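(* Let $\varphi\in\mathrm{LFM}(B_N)$ be elliptic and not an automorphism of $B_N$, and let $p=\dim L_U(\varphi,z_0)$ for its fixed point $z_0\in B_N$. Suppose $p>0$, and let $U$, $A$ be the matrices in the normal form $\psi(z',z'')=(Uz',Az'')$ of $\varphi$, with $\Lambda_\varphi=\{\lambda_1,\dots,\lambda_N\}$ the union of the spectra of $U$ and $A$. Then the spectrum of $C_\varphi$ on $H^2(B_N)$ is as follows. (i) If $U$ has an irrational unimodular eigenvalue, then $\sigma(C_\varphi)$ is a union of circles: $$\sigma(C_\varphi)=\bigcup_{\alpha\in\mathbb{N}^N}\Lambda_\varphi^\alpha\,\mathbb{T}\ \cup\{0\}.$$ (ii) If all eigenvalues of $U$ are rational, then $$\sigma(C_\varphi)=\bigcup_{\alpha\in\mathbb{N}^N}\{\Lambda_\varphi^\alpha\}\ \cup\{0\}.$$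
   Context: $B_N$ is the open Euclidean unit ball of $\mathbb{C}^N$; $H^2(B_N)$ is the classical Hardy space; $C_\varphi f=f\circ\varphi$ is the composition operator. $\mathrm{LFM}(B_N)$ is the set of linear fractional maps $\varphi(z)=\frac{Mz+B}{\langle z,C\rangle+d}$ ($M\in\mathbb{C}^{N\times N}$, $B,C\in\mathbb{C}^N$, $d\in\mathbb{C}$) that map $B_N$ into itself; $C_\varphi$ is bounded on $H^2(B_N)$ for such $\varphi$. $\varphi$ is elliptic if it has a fixed point in $B_N$. The unitary space of $\varphi$ at a fixed point $z_0\in B_N$ is $L_U(\varphi,z_0)=\bigoplus_{|\alpha|=1}\ker(d\varphi_{z_0}-\alpha I)^N$ ($\alpha\in\mathbb{C}$, $|\alpha|=1$), $d\varphi_{z_0}$ being the complex differential. Normal form: when $p>0$, $\varphi$ is conjugated (by an automorphism of $B_N$) to a map $\psi(z',z'')=(Uz',Az'')$, $(z',z'')\in(\mathbb{C}^p\times\mathbb{C}^{N-p})\cap B_N$, where $U$ is a unitary diagonal $p\times p$ matrix and $A$ is an $(N-p)\times(N-p)$ matrix with operator norm $\|A\|<1$. The eigenvalues $\lambda_1,\dots,\lambda_N$ of $U$ and $A$ are listed with multiplicity. For a multi-index $\alpha\in\mathbb{N}^N$ ($0\in\mathbb{N}$), $\Lambda_\varphi^\alpha=\lambda_1^{\alpha_1}\cdots\lambda_N^{\alpha_N}$. $\mathbb{T}$ is the unit circle. A unimodular number $e^{i\theta}$ is rational if it is a root of unity (i.e. $\theta/2\pi\in\mathbb{Q}$) and irrational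 otherwise. *)

theory Defs
  imports "HOL-Analysis.Analysis" "HOL-Computational_Algebra.Computational_Algebra"
begin

text \<open>
  The space \<open>complex ^ 'n\<close> carries the Euclidean norm, so \<open>ball 0 1\<close> is the open unit ball \<open>B\<^sub>N\<close>
  with \<open>N = CARD('n)\<close>.
\<close>

abbreviation unit_ball :: "(complex ^ 'n) set" where
  "unit_ball \<equiv> ball 0 1"

text \<open>The Hermitian product of \<open>\<complex>\<^sup>N\<close>, linear in the first argument.\<close>

definition hermitian :: "complex ^ 'n \<Rightarrow> complex ^ 'n \<Rightarrow> complex" where
  "hermitian z w = (\<Sum>i\<in>UNIV. z $ i * cnj (w $ i))"


section \<open>Holomorphic functions and maps in several variables\<close>

text \<open>
  The Frechet derivative of \<open>has_derivative\<close> is only real-linear;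
  holomorphy asks in addition that it commutes with complex scalars.
\<close>

definition holo_on :: "(complex ^ 'n) set \<Rightarrow> (complex ^ 'n \<Rightarrow> complex) \<Rightarrow> bool" where
  "holo_on S f \<longleftrightarrow>
     (\<forall>z\<in>S. \<exists>D. (f has_derivative D) (at z) \<and> (\<forall>c v. D (c *s v) = c * D v))"

definition holo_map_on :: "(complex ^ 'n) set \<Rightarrow> (complex ^ 'n \<Rightarrow> complex ^ 'm) \<Rightarrow> bool" where
  "holo_map_on S F \<longleftrightarrow> (\<forall>i. holo_on S (\<lambda>z. F z $ i))"

definition ball_automorphism :: "(complex ^ 'n \<Rightarrow> complex ^ 'n) \<Rightarrow> bool" where
  "ball_automorphism F \<longleftrightarrow>
     bij_betw F unit_ball unit_ball \<and> holo_map_on unit_ball F \<and>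
     holo_map_on unit_ball (inv_into unit_ball F)"


section \<open>Linear fractional self-maps of the ball\<close>

text \<open>Only the values on the ball matter; outside of it the total function is arbitrary.\<close>

definition LFM :: "(complex ^ 'n \<Rightarrow> complex ^ 'n) set" where
  "LFM = {\<phi>. (\<exists>(M :: complex ^ 'n ^ 'n) B C d. \<forall>z\<in>unit_ball.
                 hermitian z C + d \<noteq> 0 \<and>
                 \<phi> z = (1 / (hermitian z C + d)) *s (M *v z + B)) \<and>
             \<phi> ` unit_ball \<subseteq> unit_ball}"

definition elliptic :: "(complex ^ 'n \<Rightarrow> complex ^ 'n) \<Rightarrow> bool" where
  "elliptic \<phi> \<longleftrightarrow> (\<exists>z\<in>unit_ball. \<phi> z = z)"

text \<open>
  The sum of the generalized eigenspaces is taken as the complex span of their union;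
  its complex dimension is \<open>vec.dim\<close>.
\<close>

definition unitary_space ::
    "(complex ^ 'n \<Rightarrow> complex ^ 'n) \<Rightarrow> complex ^ 'n \<Rightarrow> (complex ^ 'n) set" where
  "unitary_space \<phi> z0 =
     vec.span (\<Union>\<alpha>\<in>{\<alpha> :: complex. norm \<alpha> = 1}.
       {v. ((\<lambda>v. frechet_derivative \<phi> (at z0) v - \<alpha> *s v) ^^ CARD('n)) v = 0})"


section \<open>Matrices and the normal form\<close>

definition adjoint_matrix :: "complex ^ 'n ^ 'm \<Rightarrow> complex ^ 'm ^ 'n" where
  "adjoint_matrix M = (\<chi> i j. cnj (M $ j $ i))"

definition unitary_matrix :: "complex ^ 'n ^ 'n \<Rightarrow> bool" where
  "unitary_matrix U \<longleftrightarrow> adjoint_matrix U ** U = mat 1 \<and> U ** adjoint_matrix U = mat 1"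

definition is_diagonal :: "complex ^ 'n ^ 'n \<Rightarrow> bool" where
  "is_diagonal M \<longleftrightarrow> (\<forall>i j. i \<noteq> j \<longrightarrow> M $ i $ j = 0)"

definition is_eigenvalue :: "complex ^ 'n ^ 'n \<Rightarrow> complex \<Rightarrow> bool" where
  "is_eigenvalue M \<mu> \<longleftrightarrow> (\<exists>v. v \<noteq> 0 \<and> M *v v = \<mu> *s v)"

definition charpoly :: "complex ^ 'n ^ 'n \<Rightarrow> complex poly" where
  "charpoly M = det (\<chi> i j. (if i = j then [:0, 1:] else 0) - [:M $ i $ j:])"

text \<open>The eigenvalues, counted with algebraic multiplicity.\<close>

definition eigenvalues_mset :: "complex ^ 'n ^ 'n \<Rightarrow> complex multiset" where
  "eigenvalues_mset M = proots (charpoly M)"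

definition root_of_unity :: "complex \<Rightarrow> bool" where
  "root_of_unity \<mu> \<longleftrightarrow> (\<exists>n>0. \<mu> ^ n = 1)"

text \<open>
  A bijection \<open>e :: 'p + 'q \<Rightarrow> 'n\<close> names the coordinates of \<open>\<complex>\<^sup>N\<close> so that
  \<open>z = (z', z'')\<close> with \<open>z' \<in> \<complex>\<^sup>p\<close> (the coordinates in the range of \<open>e \<circ> Inl\<close>) and
  \<open>z'' \<in> \<complex>\<^sup>N\<^sup>-\<^sup>p\<close>.  Then \<open>block_map e U A\<close> is \<open>(z', z'') \<mapsto> (U z', A z'')\<close>.
\<close>

definition fst_block :: "('p + 'q \<Rightarrow> 'n) \<Rightarrow> complex ^ 'n \<Rightarrow> complex ^ 'p" where
  "fst_block e z = (\<chi> i. z $ e (Inl i))"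

definition snd_block :: "('p + 'q \<Rightarrow> 'n) \<Rightarrow> complex ^ 'n \<Rightarrow> complex ^ 'q" where
  "snd_block e z = (\<chi> j. z $ e (Inr j))"

definition join_blocks ::
    "('p + 'q \<Rightarrow> 'n) \<Rightarrow> complex ^ 'p \<Rightarrow> complex ^ 'q \<Rightarrow> complex ^ 'n" where
  "join_blocks e x y = (\<chi> k. case inv e k of Inl i \<Rightarrow> x $ i | Inr j \<Rightarrow> y $ j)"

definition block_map ::
    "('p + 'q \<Rightarrow> 'n) \<Rightarrow> complex ^ 'p ^ 'p \<Rightarrow> complex ^ 'q ^ 'q \<Rightarrow> complex ^ 'n \<Rightarrow> complex ^ 'n" where
  "block_map e U A z = join_blocks e (U *v fst_block e z) (A *v snd_block e z)"

text \<open>Conjugacy \<open>\<psi> = \<tau> \<circ> \<phi> \<circ> \<tau>\<^sup>-\<^sup>1\<close> on the ball, by an automorphism \<open>\<tau>\<close> of the ball.\<close>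

definition normal_form ::
    "(complex ^ 'n \<Rightarrow> complex ^ 'n) \<Rightarrow> ('p + 'q \<Rightarrow> 'n) \<Rightarrow>
     complex ^ 'p ^ 'p \<Rightarrow> complex ^ 'q ^ 'q \<Rightarrow> bool" where
  "normal_form \<phi> e U A \<longleftrightarrow>
     bij e \<and> unitary_matrix U \<and> is_diagonal U \<and> onorm (\<lambda>v. A *v v) < 1 \<and>
     (\<exists>\<tau>. ball_automorphism \<tau> \<and> (\<forall>z\<in>unit_ball. \<tau> (\<phi> z) = block_map e U A (\<tau> z)))"


section \<open>The Hardy space\<close>

text \<open>
  The normalized surface measure of the unit sphere, as the image of the uniform
  distribution on the ball under radial projection (polar coordinates).
\<close>

definition sphere_measure :: "(complex ^ 'n) measure" where
  "sphere_measure = distr (uniform_measure lborel unit_ball) borel (\<lambda>z. z /\<^sub>R norm z)"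

definition hardy_sq :: "(complex ^ 'n \<Rightarrow> complex) \<Rightarrow> ennreal" where
  "hardy_sq f =
     (SUP r\<in>{0<..<1::real}. \<integral>\<^sup>+ \<zeta>. ennreal ((norm (f (r *\<^sub>R \<zeta>)))\<^sup>2) \<partial>sphere_measure)"

text \<open>
  A function on the ball is represented by the total function that vanishes outside the ball,
  so that equality in the space is equality on the ball.
\<close>

definition hardy_space :: "(complex ^ 'n \<Rightarrow> complex) set" where
  "hardy_space =
     {f. holo_on unit_ball f \<and> (\<forall>z. z \<notin> unit_ball \<longrightarrow> f z = 0) \<and> hardy_sq f < \<infinity>}"

definition hardy_norm :: "(complex ^ 'n \<Rightarrow> complex) \<Rightarrow> real" where
  "hardy_norm f = sqrt (enn2real (hardy_sq f))"

definition comp_op ::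
    "(complex ^ 'n \<Rightarrow> complex ^ 'n) \<Rightarrow> (complex ^ 'n \<Rightarrow> complex) \<Rightarrow> complex ^ 'n \<Rightarrow> complex" where
  "comp_op \<phi> f = (\<lambda>z. if z \<in> unit_ball then f (\<phi> z) else 0)"


section \<open>Bounded operators and spectrum\<close>

text \<open>Operators on a normed space of complex functions, given by its carrier and its norm.\<close>

definition bounded_operator ::
    "('a \<Rightarrow> complex) set \<Rightarrow> (('a \<Rightarrow> complex) \<Rightarrow> real) \<Rightarrow>
     (('a \<Rightarrow> complex) \<Rightarrow> ('a \<Rightarrow> complex)) \<Rightarrow> bool" where
  "bounded_operator X nrm T \<longleftrightarrow>
     (\<forall>f\<in>X. T f \<in> X) \<and>
     (\<forall>f\<in>X. \<forall>g\<in>X. T (\<lambda>x. f x + g x) = (\<lambda>x. T f x + T g x)) \<and>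
     (\<forall>c. \<forall>f\<in>X. T (\<lambda>x. c * f x) = (\<lambda>x. c * T f x)) \<and>
     (\<exists>K. \<forall>f\<in>X. nrm (T f) \<le> K * nrm f)"

text \<open>
  The points \<open>\<mu>\<close> for which \<open>T - \<mu> I\<close> has no bounded two-sided inverse \<open>S\<close>.
\<close>

definition op_spectrum ::
    "('a \<Rightarrow> complex) set \<Rightarrow> (('a \<Rightarrow> complex) \<Rightarrow> real) \<Rightarrow>
     (('a \<Rightarrow> complex) \<Rightarrow> ('a \<Rightarrow> complex)) \<Rightarrow> complex set" where
  "op_spectrum X nrm T =
     {\<mu>. \<not> (\<exists>S. bounded_operator X nrm S \<and>
              (\<forall>f\<in>X. S (\<lambda>x. T f x - \<mu> * f x) = f) \<and>
              (\<forall>f\<in>X. (\<lambda>x. T (S f) x - \<mu> * S f x) = f))}"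

definition hardy_spectrum :: "(complex ^ 'n \<Rightarrow> complex ^ 'n) \<Rightarrow> complex set" where
  "hardy_spectrum \<phi> = op_spectrum hardy_space hardy_norm (comp_op \<phi>)"

text \<open>\<open>\<Lambda>\<^sup>\<alpha>\<close> for a multi-index \<open>\<alpha>\<close>.\<close>

definition multi_power :: "('n \<Rightarrow> complex) \<Rightarrow> ('n :: finite \<Rightarrow> nat) \<Rightarrow> complex" where
  "multi_power lam \<alpha> = (\<Prod>i\<in>UNIV. lam i ^ \<alpha> i)"

end

theory Submission
  imports Defs "HOL-Complex_Analysis.Complex_Analysis"
begin

text \<open>
  After conjugation to the normal form, \<open>C\<^sub>\<psi> = V T = T V\<close> with \<open>T f (z', z'') = f (z', A z'')\<close> and the
  unitary operator \<open>V f (z', z'') = f (U z', z'')\<close>.  Products of linear functionals that are left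
  eigenvectors of \<open>U\<close> or \<open>A\<close> are eigenfunctions, so \<open>\<Lambda>\<^sup>\<alpha>\<close> and limits of such numbers
  belong to the spectrum.

  Conversely let \<open>\<mu> \<noteq> 0\<close>; one has to invert \<open>T - \<mu> V\<^sup>-\<^sup>1\<close>.  A finite product of factors \<open>T - c\<close>, where
  \<open>c\<close> runs through products of eigenvalues of \<open>A\<close>, annihilates all polynomials of degree less than \<open>m\<close> in \<open>z''\<close>,
  hence maps \<open>H\<^sup>2\<close> into the functions that vanish to order \<open>m\<close> at \<open>z'' = 0\<close>.  On these \<open>C\<^sub>\<psi>\<close> has norm at
  most \<open>\<parallel>A\<parallel>\<^sup>m < |\<mu>|\<close> for large \<open>m\<close>, and the Neumann series converges.  What remains are finitely many steps on which
  \<open>T\<close> acts as a scalar \<open>c\<close>; there \<open>c - \<mu> V\<^sup>-\<^sup>1\<close> is invertible, because \<open>|c| \<noteq> |\<mu>|\<close> in case (i), and because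
  \<open>V\<^sup>N = 1\<close>, \<open>c\<^sup>N \<noteq> \<mu>\<^sup>N\<close> in case (ii), where the eigenvalues of \<open>U\<close> generate the group of \<open>N\<close>-th roots of unity.
\<close>

section \<open>Hermitian algebra\<close>

text \<open>The operator is not compact: on functions of \<open>z'\<close> alone it is an invertible
  isometry, and modulo functions vanishing to order \<open>m\<close> the space stays
  infinite-dimensional, so eigenvalues need not exhaust the spectrum. What survives of
  finite-dimensional algebra is that \<open>T\<close> satisfies a polynomial equation modulo order
  \<open>m\<close>, while \<open>V\<close> is isometric and commutes with it; hence the splitting.
  The function theory rests on the Szego formula for functions holomorphic past the closed ball,
  which comes from rotation invariance and Cauchy's formula on circles. It yields point bounds,
  adjoints of linear compositions, Taylor remainders and the Poisson kernel. Members of the Hardy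
  space enter through dilates \<open>f (r z)\<close> with \<open>r < 1\<close>, as their norm is a
  supremum over \<open>r\<close>; boundary values never occur. The decay factor at order
  \<open>m\<close> carries no constant, so the Neumann series needs no estimate of iterates beyond
  its powers. Since the conjugating automorphism is arbitrary, boundedness of its composition
  operator is proved by factoring it into a Moebius involution and a unitary map.\<close>

lemma norm_sq_vec: "(norm v)\<^sup>2 = (\<Sum>i\<in>UNIV. (norm (v $ i))\<^sup>2)" for v :: "complex ^ 'n"
  by (simp add: norm_vec_def L2_set_def sum_nonneg)

lemma hermitian_self: "hermitian v v = of_real ((norm v)\<^sup>2)"
  by (simp add: hermitian_def norm_sq_vec complex_norm_square[symmetric] del: of_real_power)

lemma Re_hermitian: "Re (hermitian v w) = v \<bullet> w"
  by (simp add: hermitian_def inner_vec_def inner_complex_def)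

lemma hermitian_simps [simp]:
  "hermitian (u + v) w = hermitian u w + hermitian v w"
  "hermitian (u - v) w = hermitian u w - hermitian v w"
  "hermitian (- u) w = - hermitian u w"
  "hermitian w (u + v) = hermitian w u + hermitian w v"
  "hermitian w (u - v) = hermitian w u - hermitian w v"
  "hermitian w (- u) = - hermitian w u"
  "hermitian (c *s u) w = c * hermitian u w"
  "hermitian w (c *s u) = cnj c * hermitian w u"
  "hermitian (r *\<^sub>R u) w = r * hermitian u w"
  "hermitian w (r *\<^sub>R u) = r * hermitian w u"
  "hermitian 0 w = 0" "hermitian w 0 = 0"
  by (simp_all add: hermitian_def algebra_simps sum.distrib sum_subtractf sum_negf
      sum_distrib_left scaleR_conv_of_real[where 'a=complex])

lemma cnj_hermitian: "cnj (hermitian v w) = hermitian w v"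
  by (simp add: hermitian_def mult.commute)

lemma norm_smult_vec [simp]: "norm (c *s v) = norm c * norm v" for v :: "complex ^ 'n"
proof -
  have "(norm (c *s v))\<^sup>2 = (norm c * norm v)\<^sup>2"
    unfolding norm_sq_vec power_mult_distrib
    by (simp add: norm_mult power_mult_distrib sum_distrib_left)
  then show ?thesis by (simp add: power2_eq_iff_nonneg)
qed

lemma scaleR_smult: "r *\<^sub>R v = complex_of_real r *s v" for v :: "complex ^ 'n"
  by (simp add: vec_eq_iff scaleR_conv_of_real[where 'a=complex])

text \<open>A unimodular factor \<open>c\<close> turns the product into its modulus; the real
  Cauchy-Schwarz inequality for the real part then applies.\<close>

lemma norm_hermitian_le: "norm (hermitian v w) \<le> norm v * norm w"
proof (cases "hermitian v w = 0")
  case False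
  define c where "c = cnj (hermitian v w) / norm (hermitian v w)"
  have c: "norm c = 1" using False by (simp add: c_def norm_divide)
  have "hermitian (c *s v) w = of_real (norm (hermitian v w))"
    using False
    by (simp add: c_def complex_norm_square[symmetric] field_simps power2_eq_square)
  then have "norm (hermitian v w) = (c *s v) \<bullet> w"
    by (metis Re_complex_of_real Re_hermitian)
  also have "\<dots> \<le> norm (c *s v) * norm w" by (rule norm_cauchy_schwarz)
  finally show ?thesis by (simp add: c)
qed auto

lemma bounded_bilinear_hermitian: "bounded_bilinear hermitian"
  by (rule bounded_bilinear.intro)
     (auto simp: scaleR_conv_of_real[where 'a=complex] norm_hermitian_le intro!: exI[of _ 1])

lemma bounded_bilinear_smult: "bounded_bilinear (\<lambda>c (v :: complex ^ 'n). c *s v)"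
  by (rule bounded_bilinear.intro)
     (auto simp: vec_eq_iff algebra_simps scaleR_conv_of_real[where 'a=complex] intro!: exI[of _ 1])

lemmas continuous_on_hermitian [continuous_intros] =
  bounded_bilinear.continuous_on[OF bounded_bilinear_hermitian]
lemmas continuous_on_smult [continuous_intros] =
  bounded_bilinear.continuous_on[OF bounded_bilinear_smult]

lemma borel_measurable_hermitian [measurable (raw)]:
  fixes f g :: "'a \<Rightarrow> complex ^ 'n"
  assumes "f \<in> borel_measurable M" "g \<in> borel_measurable M"
  shows "(\<lambda>x. hermitian (f x) (g x)) \<in> borel_measurable M"
proof -
  have "(\<lambda>p. hermitian (fst p) (snd p :: complex ^ 'n)) \<in> borel_measurable borel"
    by (intro borel_measurable_continuous_onI continuous_intros)
  from measurable_compose[OF borel_measurable_Pair[OF assms] this] show ?thesis by simp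
qed

lemma bounded_linear_matrix_vector: "bounded_linear (\<lambda>v. (A :: complex ^ 'm ^ 'n) *v v)"
  by (rule linear_conv_bounded_linear[THEN iffD1], rule linearI)
     (auto simp: vec_eq_iff matrix_vector_mult_def sum_distrib_left algebra_simps sum.distrib
       scaleR_conv_of_real[where 'a=complex])

lemma smult_matrix_vector: "A *v (c *s v) = c *s (A *v v)" for A :: "complex ^ 'm ^ 'n"
  by (simp add: vec_eq_iff matrix_vector_mult_def sum_distrib_left algebra_simps)

lemma hermitian_adjoint: "hermitian (A *v v) w = hermitian v (adjoint_matrix A *v w)"
  unfolding hermitian_def matrix_vector_mult_def adjoint_matrix_def
  by (simp add: sum_distrib_left sum_distrib_right mult_ac) (rule sum.swap)

section \<open>The surface measure\<close>

text \<open>With \<open>B\<close> the unit ball, Fubini's theorem for \<open>(x, y) \<mapsto> 1\<^sub>B(Tx) 1\<^sub>S(Tx + y)\<close> evaluates to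
  \<open>|B| |S|\<close> in one order of integration and to \<open>|B| |T\<^sup>-\<^sup>1 S|\<close> in the other one.\<close>

lemma distr_lborel_orthogonal:
  fixes T :: "'a::euclidean_space \<Rightarrow> 'a"
  assumes T: "orthogonal_transformation T"
  shows "distr lborel borel T = lborel"
proof (rule measure_eqI)
  show "sets (distr lborel borel T) = sets lborel" by simp
  fix S assume "S \<in> sets (distr lborel borel T)"
  then have S[measurable]: "S \<in> sets borel" by simp
  have lin: "linear T" and nT: "\<And>x. norm (T x) = norm x"
    using T by (auto simp: orthogonal_transformation)
  have [measurable]: "T \<in> borel_measurable borel"
    using lin by (intro borel_measurable_continuous_onI linear_continuous_on)
      (simp add: linear_conv_bounded_linear)
  obtain R where R: "\<And>y. T (R y) = y"
    using orthogonal_transformation_surj[OF T] by (metis surjD)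
  let ?B = "ball (0::'a) 1"
  define b s :: "'a \<Rightarrow> ennreal" where "b = indicator ?B" and "s = indicator S"
  have [measurable]: "b \<in> borel_measurable borel" "s \<in> borel_measurable borel"
    by (simp_all add: b_def s_def borel_measurable_indicator)
  have ib: "(\<integral>\<^sup>+x. b x \<partial>lborel) = emeasure lborel ?B" and is1: "(\<integral>\<^sup>+x. s x \<partial>lborel) = emeasure lborel S"
    by (simp_all add: b_def s_def)
  have tr: "(\<integral>\<^sup>+x. f (x + t) \<partial>lborel) = (\<integral>\<^sup>+x. f x \<partial>lborel)"
    if [measurable]: "f \<in> borel_measurable borel" for f :: "'a \<Rightarrow> ennreal" and t
    by (subst (2) lborel_distr_plus[of t, symmetric]) (simp add: nn_integral_distr add.commute)
  have rf: "(\<integral>\<^sup>+x. f (t - x) \<partial>lborel) = (\<integral>\<^sup>+x. f x \<partial>lborel)"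
    if [measurable]: "f \<in> borel_measurable borel" for f :: "'a \<Rightarrow> ennreal" and t
    by (subst (2) lborel_affine[of "-1" t]) (simp_all add: nn_integral_density nn_integral_distr)
  have "emeasure lborel ?B * emeasure lborel S =
     (\<integral>\<^sup>+x. (\<integral>\<^sup>+y. b (T x) * s (y + T x) \<partial>lborel) \<partial>lborel)"
  proof -
    have "b (T x) = b x" for x
      by (simp add: b_def indicator_def nT)
    then show ?thesis
      by (simp add: nn_integral_cmult tr nn_integral_multc ib is1)
  qed
  also have "\<dots> = (\<integral>\<^sup>+y. (\<integral>\<^sup>+x. b (T x) * s (y + T x) \<partial>lborel) \<partial>lborel)"
    by (rule lborel_pair.Fubini') measurable
  also have "\<dots> = (\<integral>\<^sup>+y. (\<integral>\<^sup>+x. b (T x - y) * s (T x) \<partial>lborel) \<partial>lborel)"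
  proof (rule nn_integral_cong)
    fix y
    have "(\<integral>\<^sup>+x. b (T (x + R y) - y) * s (T (x + R y)) \<partial>lborel) =
       (\<integral>\<^sup>+x. b (T x - y) * s (T x) \<partial>lborel)"
      by (rule tr) measurable
    then show "(\<integral>\<^sup>+x. b (T x) * s (y + T x) \<partial>lborel) =
       (\<integral>\<^sup>+x. b (T x - y) * s (T x) \<partial>lborel)"
      by (simp add: linear_add[OF lin] R add.commute)
  qed
  also have "\<dots> = (\<integral>\<^sup>+x. (\<integral>\<^sup>+y. b (T x - y) * s (T x) \<partial>lborel) \<partial>lborel)"
    by (rule lborel_pair.Fubini') measurable
  also have "\<dots> = emeasure lborel ?B * (\<integral>\<^sup>+x. s (T x) \<partial>lborel)"
    by (simp add: nn_integral_multc rf nn_integral_cmult ib)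
  also have "(\<integral>\<^sup>+x. s (T x) \<partial>lborel) = emeasure (distr lborel borel T) S"
    by (subst nn_integral_indicator[symmetric]) (simp_all add: nn_integral_distr s_def[symmetric])
  finally have "emeasure lborel ?B * emeasure lborel S
    = emeasure lborel ?B * emeasure (distr lborel borel T) S" .
  moreover have "emeasure lborel ?B \<noteq> 0" "emeasure lborel ?B \<noteq> top"
    using emeasure_lborel_ball_finite[of "0::'a" 1] content_ball_pos[of 1 "0::'a"]
    by (auto simp: measure_def)
  ultimately show "emeasure (distr lborel borel T) S = emeasure lborel S"
    by (simp add: ennreal_mult_cancel_left)
qed


lemma sets_sphere_measure [simp, measurable_cong]: "sets sphere_measure = sets borel"
  by (simp add: sphere_measure_def)

lemma space_sphere_measure [simp]: "space sphere_measure = UNIV"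
  by (simp add: sphere_measure_def)

lemma unit_ball_measure:
  "emeasure lborel (unit_ball :: (complex ^ 'n) set) \<noteq> 0"
  "emeasure lborel (unit_ball :: (complex ^ 'n) set) \<noteq> \<infinity>"
  using emeasure_lborel_ball_finite[of "0 :: complex ^ 'n" 1] content_ball_pos[of 1 "0 :: complex ^ 'n"]
  by (auto simp: measure_def)

lemma emeasure_sphere_measure: "emeasure (sphere_measure :: (complex ^ 'n) measure) UNIV = 1"
  unfolding sphere_measure_def
  using unit_ball_measure[where 'n = 'n]
  by (subst emeasure_distr) (auto simp: less_top intro!: ennreal_divide_self)

text \<open>Radial projection misses the sphere only at the origin, where division by zero returns
  \<open>0\<close>, and a single point is a null set.\<close>

lemma AE_sphere_measure: "AE \<zeta> in (sphere_measure :: (complex ^ 'n) measure). norm \<zeta> = 1"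
proof -
  have "AE z in lborel. z \<noteq> (0 :: complex ^ 'n)"
    by (rule AE_lborel_singleton)
  then show ?thesis
    unfolding sphere_measure_def
    by (subst AE_distr_iff) (auto intro!: AE_uniform_measureI)
qed

text \<open>A linear isometry preserves the uniform measure of the ball and commutes with radial
  projection.\<close>

lemma distr_sphere_measure:
  fixes T :: "complex ^ 'n \<Rightarrow> complex ^ 'n"
  assumes T: "orthogonal_transformation T"
  shows "distr sphere_measure borel T = sphere_measure"
proof -
  have lin: "linear T" and nT: "\<And>x. norm (T x) = norm x"
    using T by (auto simp: orthogonal_transformation)
  have [measurable]: "T \<in> borel_measurable borel"
    using lin by (intro borel_measurable_continuous_onI linear_continuous_on)
      (simp add: linear_conv_bounded_linear)
  have unif: "distr (uniform_measure lborel unit_ball) borel T = uniform_measure lborel unit_ball"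
  proof (rule measure_eqI)
    fix S assume "S \<in> sets (distr (uniform_measure lborel unit_ball) borel T)"
    then have [measurable]: "S \<in> sets borel" by simp
    have "unit_ball \<inter> T -` S = T -` (unit_ball \<inter> S)" by (auto simp: nT)
    then have "emeasure lborel (unit_ball \<inter> T -` S) = emeasure (distr lborel borel T) (unit_ball \<inter> S)"
      by (simp add: emeasure_distr)
    then show "emeasure (distr (uniform_measure lborel unit_ball) borel T) S =
        emeasure (uniform_measure lborel unit_ball) S"
      using measurable_sets[of T borel borel S]
      by (simp add: emeasure_distr distr_lborel_orthogonal[OF T])
  qed simp
  have "distr sphere_measure borel T = distr (uniform_measure lborel unit_ball) borel (T \<circ> (\<lambda>z. z /\<^sub>R norm z))"
    unfolding sphere_measure_def by (rule distr_distr) auto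
  also have "T \<circ> (\<lambda>z. z /\<^sub>R norm z) = (\<lambda>z. z /\<^sub>R norm z) \<circ> T"
    by (auto simp: linear_scale[OF lin] nT)
  also have "distr (uniform_measure lborel unit_ball) borel \<dots> =
      distr (distr (uniform_measure lborel unit_ball) borel T) borel (\<lambda>z. z /\<^sub>R norm z)"
    by (rule distr_distr[symmetric]) auto
  finally show ?thesis by (simp add: unif sphere_measure_def)
qed

text \<open>Restricting the space to the sphere makes \<open>norm \<zeta> = 1\<close> available at
  every point instead of almost everywhere, and lets functions that are continuous only on the
  sphere or the closed ball be integrated as they stand.\<close>

definition sigma :: "(complex ^ 'n) measure" where
  "sigma = restrict_space sphere_measure (sphere 0 1)"

lemma space_sigma [simp]: "space sigma = sphere 0 1"
  by (simp add: sigma_def space_restrict_space)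

lemma sets_sigma [measurable_cong]: "sets sigma = sets (restrict_space borel (sphere 0 1))"
  unfolding sigma_def by (rule sets_restrict_space_cong) simp

lemma emeasure_sigma: "emeasure (sigma :: (complex ^ 'n) measure) (sphere 0 1) = 1"
proof -
  have "emeasure sphere_measure (sphere (0 :: complex ^ 'n) 1) = emeasure (sphere_measure :: (complex ^ 'n) measure) UNIV"
    by (rule emeasure_eq_AE) (use AE_sphere_measure in auto)
  then show ?thesis
    unfolding sigma_def by (simp add: emeasure_restrict_space emeasure_sphere_measure)
qed

interpretation sigma: finite_measure "sigma :: (complex ^ 'n) measure"
  by (rule finite_measureI) (simp add: emeasure_sigma)

lemma measure_sigma [simp]: "measure (sigma :: (complex ^ 'n) measure) (sphere 0 1) = 1"
  by (simp add: measure_def emeasure_sigma)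

lemma measurable_sigma_continuous:
  fixes g :: "complex ^ 'n \<Rightarrow> 'b::topological_space"
  shows "continuous_on (sphere 0 1) g \<Longrightarrow> g \<in> borel_measurable sigma"
  by (simp add: measurable_cong_sets[OF sets_sigma refl] borel_measurable_continuous_on_restrict)

lemma measurable_sigma_borel [measurable]: "(\<lambda>x. x) \<in> borel_measurable sigma"
  by (rule measurable_sigma_continuous) (intro continuous_intros)

lemma integrable_sigma_continuous:
  fixes g :: "complex ^ 'n \<Rightarrow> 'b::{banach,second_countable_topology}"
  assumes "continuous_on (sphere 0 1) g"
  shows "integrable sigma g"
proof -
  have "bounded (g ` sphere 0 1)"
    using assms by (intro compact_imp_bounded compact_continuous_image) auto
  then obtain C where "\<And>\<zeta>. norm \<zeta> = 1 \<Longrightarrow> norm (g \<zeta>) \<le> C"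
    unfolding bounded_iff by (metis imageI mem_sphere_0)
  then show ?thesis
    by (intro sigma.integrable_const_bound[of _ C] measurable_sigma_continuous assms)
      (auto intro!: AE_I2)
qed

lemma distr_sigma:
  fixes T :: "complex ^ 'n \<Rightarrow> complex ^ 'n"
  assumes T: "orthogonal_transformation T"
  shows "T \<in> measurable sigma sigma" "distr sigma sigma T = sigma"
proof -
  have lin: "linear T" and nT: "\<And>x. norm (T x) = norm x"
    using T by (auto simp: orthogonal_transformation)
  have cT: "continuous_on A T" for A
    using lin by (intro linear_continuous_on) (simp add: linear_conv_bounded_linear)
  have Tb[measurable]: "T \<in> borel_measurable borel"
    by (rule borel_measurable_continuous_onI[OF cT])
  show 1: "T \<in> measurable sigma sigma"
    unfolding measurable_cong_sets[OF refl sets_sigma]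
    by (rule measurable_restrict_space2) (auto simp: nT intro: measurable_sigma_continuous cT)
  show "distr sigma sigma T = sigma"
  proof (rule measure_eqI)
    fix S assume "S \<in> sets (distr sigma sigma T)"
    then have S: "S \<in> sets sigma" by simp
    then obtain S' where S': "S' \<in> sets borel" "S = sphere 0 1 \<inter> S'"
      by (auto simp: sets_sigma sets_restrict_space)
    then have [measurable]: "S \<in> sets borel" by auto
    have "T -` S \<inter> sphere 0 1 = T -` S" using S' by (auto simp: nT)
    moreover have "emeasure sphere_measure (T -` S) = emeasure (distr sphere_measure borel T) S"
      by (simp add: emeasure_distr measurable_cong_sets[OF sets_sphere_measure refl])
    moreover have "S \<subseteq> sphere 0 1" using S' by auto
    ultimately show "emeasure (distr sigma sigma T) S = emeasure sigma S"
      using S 1 emeasure_restrict_space[of "sphere 0 1" sphere_measure S]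
        emeasure_restrict_space[of "sphere 0 1" sphere_measure "T -` S"]
      by (auto simp: emeasure_distr distr_sphere_measure[OF T] nT sigma_def[symmetric])
  qed simp
qed

lemma integral_sigma_orthogonal:
  fixes T :: "complex ^ 'n \<Rightarrow> complex ^ 'n" and g :: "complex ^ 'n \<Rightarrow> 'b::{banach,second_countable_topology}"
  assumes T: "orthogonal_transformation T" and "g \<in> borel_measurable sigma"
  shows "(\<integral>\<zeta>. g (T \<zeta>) \<partial>sigma) = (\<integral>\<zeta>. g \<zeta> \<partial>sigma)"
  using integral_distr[OF distr_sigma(1)[OF T] assms(2)] by (simp add: distr_sigma(2)[OF T])

lemma hardy_sq_sigma:
  "hardy_sq f = (SUP r\<in>{0<..<1::real}. \<integral>\<^sup>+ \<zeta>. ennreal ((norm (f (r *\<^sub>R \<zeta>)))\<^sup>2) \<partial>sigma)"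
  unfolding hardy_sq_def
proof (intro SUP_cong refl)
  fix r :: real
  have "(\<integral>\<^sup>+ \<zeta>. ennreal ((norm (f (r *\<^sub>R \<zeta>)))\<^sup>2) \<partial>sigma)
     = (\<integral>\<^sup>+ \<zeta>. ennreal ((norm (f (r *\<^sub>R \<zeta>)))\<^sup>2) * indicator (sphere 0 1) \<zeta> \<partial>sphere_measure)"
    unfolding sigma_def by (subst nn_integral_restrict_space) auto
  also have "\<dots> = (\<integral>\<^sup>+ \<zeta>. ennreal ((norm (f (r *\<^sub>R \<zeta>)))\<^sup>2) \<partial>sphere_measure)"
    by (rule nn_integral_cong_AE) (use AE_sphere_measure in eventually_elim, auto)
  finally show "(\<integral>\<^sup>+ \<zeta>. ennreal ((norm (f (r *\<^sub>R \<zeta>)))\<^sup>2) \<partial>sphere_measure)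
     = (\<integral>\<^sup>+ \<zeta>. ennreal ((norm (f (r *\<^sub>R \<zeta>)))\<^sup>2) \<partial>sigma)" by simp
qed

section \<open>Holomorphic functions of several variables\<close>

text \<open>\<open>sc\<close> is the scalar multiplication of the target, so one notion covers
  scalar functions and vector-valued maps.\<close>

definition cdiff :: "(complex ^ 'm \<Rightarrow> 'b::real_normed_vector) \<Rightarrow> (complex \<Rightarrow> 'b \<Rightarrow> 'b) \<Rightarrow> complex ^ 'm \<Rightarrow> bool" where
  "cdiff F sc z \<longleftrightarrow> (\<exists>D. (F has_derivative D) (at z) \<and> (\<forall>c v. D (c *s v) = sc c (D v)))"

lemma holo_on_cdiff: "holo_on S f \<longleftrightarrow> (\<forall>z\<in>S. cdiff f (*) z)"
  by (simp add: holo_on_def cdiff_def)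

lemma holo_on_imp_continuous_on: "holo_on S f \<Longrightarrow> continuous_on S f"
  unfolding holo_on_def
  by (meson continuous_at_imp_continuous_on has_derivative_continuous)

lemma holo_on_transform:
  assumes "holo_on S f" "open S" "\<And>z. z \<in> S \<Longrightarrow> f z = g z"
  shows "holo_on S g"
  using assms unfolding holo_on_def
  by (metis has_derivative_transform_within_open)

text \<open>The gateway to one-variable theory: Cauchy's formula, the Schwarz lemma and the maximum
  principle are all applied to such restrictions to complex lines.\<close>

lemma holo_slice:
  assumes f: "holo_on S f" and sub: "\<And>x. x \<in> T \<Longrightarrow> a + x *s v \<in> S"
  shows "(\<lambda>x. f (a + x *s v)) holomorphic_on T"
  unfolding holomorphic_on_def
proof
  fix x assume "x \<in> T"
  then obtain D where D: "(f has_derivative D) (at (a + x *s v))" "\<And>c v. D (c *s v) = c * D v"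
    using f sub unfolding holo_on_def by blast
  have "((\<lambda>x. a + x *s v) has_derivative (\<lambda>h. h *s v)) (at x)"
    by (auto intro!: derivative_eq_intros bounded_bilinear.FDERIV[OF bounded_bilinear_smult])
  from has_derivative_compose[OF this D(1)]
  have "((\<lambda>x. f (a + x *s v)) has_derivative (\<lambda>h. h * D v)) (at x)"
    by (simp add: D(2))
  then have "((\<lambda>x. f (a + x *s v)) has_field_derivative D v) (at x)"
    by (simp add: has_field_derivative_def mult_commute_abs)
  then show "(\<lambda>x. f (a + x *s v)) field_differentiable at x within T"
    by (meson field_differentiable_at_within field_differentiable_def)
qed

lemma cdiff_compose:
  assumes "cdiff F ((*s)) z" "cdiff f sc (F z)"
  shows "cdiff (\<lambda>z. f (F z)) sc z"
proof -
  obtain D where D: "(F has_derivative D) (at z)" "\<And>c v. D (c *s v) = c *s (D v)"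
    using assms(1) by (auto simp: cdiff_def)
  obtain E where E: "(f has_derivative E) (at (F z))" "\<And>c v. E (c *s v) = sc c (E v)"
    using assms(2) by (auto simp: cdiff_def)
  from has_derivative_compose[OF D(1) E(1)] show ?thesis
    unfolding cdiff_def by (intro exI[of _ "\<lambda>x. E (D x)"]) (simp add: D E)
qed

lemma cdiff_const: "(\<And>c. sc c 0 = 0) \<Longrightarrow> cdiff (\<lambda>z. k) sc z"
  unfolding cdiff_def by (intro exI[of _ "\<lambda>x. 0"]) auto

lemma cdiff_vec:
  fixes F :: "complex ^ 'm \<Rightarrow> complex ^ 'n"
  assumes "\<And>i. cdiff (\<lambda>z. F z $ i) (*) z"
  shows "cdiff F ((*s)) z"
proof -
  from assms obtain D where
    D: "\<And>i. ((\<lambda>z. F z $ i) has_derivative D i) (at z)" "\<And>i c v. D i (c *s v) = c * D i v"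
    unfolding cdiff_def by metis
  have "(F has_derivative (\<lambda>v. \<chi> i. D i v)) (at z)"
    using D(1) by (subst has_derivative_componentwise_within)
      (auto simp: Basis_vec_def inner_axis intro!: has_derivative_inner_left)
  then show ?thesis
    unfolding cdiff_def by (intro exI[of _ "\<lambda>v. \<chi> i. D i v"]) (simp add: D(2) vec_eq_iff)
qed

lemma cdiff_linear:
  assumes "linear F" "\<And>c v. F (c *s v) = sc c (F v)"
  shows "cdiff (F :: complex ^ 'm \<Rightarrow> 'b::euclidean_space) sc z"
  unfolding cdiff_def using assms
  by (intro exI[of _ F]) (simp add: linear_imp_has_derivative)

lemma cdiff_add:
  fixes f g :: "complex ^ 'm \<Rightarrow> complex"
  assumes "cdiff f (*) z" "cdiff g (*) z"
  shows "cdiff (\<lambda>z. f z + g z) (*) z"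
proof -
  obtain D where D: "(f has_derivative D) (at z)" "\<And>c v. D (c *s v) = c * (D v)"
    using assms(1) by (auto simp: cdiff_def)
  obtain E where E: "(g has_derivative E) (at z)" "\<And>c v. E (c *s v) = c * (E v)"
    using assms(2) by (auto simp: cdiff_def)
  from has_derivative_add[OF D(1) E(1)] show ?thesis
    unfolding cdiff_def by (intro exI[of _ "\<lambda>h. D h + E h"]) (simp add: D E algebra_simps)
qed

lemma cdiff_mult:
  fixes f g :: "complex ^ 'm \<Rightarrow> complex"
  assumes "cdiff f (*) z" "cdiff g (*) z"
  shows "cdiff (\<lambda>z. f z * g z) (*) z"
proof -
  obtain D where D: "(f has_derivative D) (at z)" "\<And>c v. D (c *s v) = c * (D v)"
    using assms(1) by (auto simp: cdiff_def)
  obtain E where E: "(g has_derivative E) (at z)" "\<And>c v. E (c *s v) = c * (E v)"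
    using assms(2) by (auto simp: cdiff_def)
  from has_derivative_mult[OF D(1) E(1)] show ?thesis
    unfolding cdiff_def by (intro exI[of _ "\<lambda>h. f z * E h + D h * g z"]) (simp add: D E algebra_simps)
qed

lemma cdiff_field:
  fixes f :: "complex ^ 'm \<Rightarrow> complex"
  assumes "cdiff f (*) z" "(h has_field_derivative h') (at (f z))"
  shows "cdiff (\<lambda>z. h (f z)) (*) z"
proof -
  obtain D where D: "(f has_derivative D) (at z)" "\<And>c v. D (c *s v) = c * (D v)"
    using assms(1) by (auto simp: cdiff_def)
  from has_derivative_compose[OF D(1) assms(2)[unfolded has_field_derivative_def]] show ?thesis
    unfolding cdiff_def by (intro exI[of _ "\<lambda>v. h' * D v"]) (simp add: D)
qed

lemma cdiff_inverse: "cdiff f (*) z \<Longrightarrow> f z \<noteq> 0 \<Longrightarrow> cdiff (\<lambda>z. inverse (f z :: complex)) (*) z"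
  by (erule cdiff_field, rule DERIV_inverse)

lemma cdiff_power: "cdiff f (*) z \<Longrightarrow> cdiff (\<lambda>z. (f z :: complex) ^ k) (*) z"
  by (induction k) (auto intro: cdiff_mult cdiff_const)

lemma cdiff_nth:
  fixes F :: "complex ^ 'm \<Rightarrow> complex ^ 'n"
  assumes "cdiff F ((*s)) z"
  shows "cdiff (\<lambda>z. F z $ i) (*) z"
proof (rule cdiff_compose[OF assms, where f = "\<lambda>v. vec_nth v i"])
  show "cdiff (\<lambda>v. vec_nth v i) (*) (F z)"
    by (rule cdiff_linear) (auto intro: linearI)
qed

lemma cdiff_smult:
  fixes F :: "complex ^ 'm \<Rightarrow> complex ^ 'n"
  assumes "cdiff f (*) z" "cdiff F ((*s)) z"
  shows "cdiff (\<lambda>z. f z *s F z) ((*s)) z"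
proof (rule cdiff_vec)
  show "cdiff (\<lambda>z. (f z *s F z) $ i) (*) z" for i
    unfolding vector_smult_component by (rule cdiff_mult[OF assms(1) cdiff_nth[OF assms(2)]])
qed

lemma cdiff_hermitian: "cdiff (\<lambda>z. hermitian z w) (*) z"
  by (rule cdiff_linear[OF bounded_linear.linear[OF
      bounded_bilinear.bounded_linear_left[OF bounded_bilinear_hermitian]] hermitian_simps(7)])

lemma cdiff_scaleR: "cdiff (\<lambda>z. r *\<^sub>R z) ((*s)) (z :: complex ^ 'n)"
proof (rule cdiff_linear)
  show "linear (\<lambda>z :: complex ^ 'n. r *\<^sub>R z)" by (rule linear_scaleR)
  show "r *\<^sub>R (c *s v) = c *s (r *\<^sub>R v)" for c and v :: "complex ^ 'n"
    by (simp add: vec_eq_iff)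
qed

lemma cdiff_id: "cdiff (\<lambda>z. z) ((*s)) (z :: complex ^ 'n)"
  by (rule cdiff_linear[OF linear_id[unfolded id_def] refl])

lemma holo_on_compose:
  assumes "holo_on S f" "\<And>z. z \<in> T \<Longrightarrow> F z \<in> S" "\<And>z. z \<in> T \<Longrightarrow> cdiff F ((*s)) z"
  shows "holo_on T (\<lambda>z. f (F z))"
  unfolding holo_on_cdiff using assms by (metis cdiff_compose holo_on_cdiff)

section \<open>Moments\<close>

text \<open>The unitary reflection in the complex hyperplane orthogonal to \<open>u\<close>, and the
  identity for \<open>u = 0\<close>.\<close>

definition hreflect :: "complex ^ 'n \<Rightarrow> complex ^ 'n \<Rightarrow> complex ^ 'n" where
  "hreflect u x = x - (2 * hermitian x u / (norm u)\<^sup>2) *s u"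

text \<open>The map is self-adjoint and an involution, hence isometric. For carrying
  \<open>a\<close> to \<open>b\<close> the product of the two has to be real, because this makes
  \<open>2 * hermitian a (a - b)\<close> equal to the squared norm of \<open>a - b\<close>.\<close>

lemma hreflect:
  "orthogonal_transformation (hreflect u)"
  "hermitian (hreflect u x) y = hermitian x (hreflect u y)"
  "norm a = norm b \<Longrightarrow> hermitian a b \<in> \<real> \<Longrightarrow> hreflect (a - b) a = b"
proof -
  show 2: "hermitian (hreflect u x) y = hermitian x (hreflect u y)" for x y
    by (simp add: hreflect_def cnj_hermitian mult_ac)
  have inv: "hreflect u (hreflect u x) = x" for x
    by (cases "u = 0") (simp_all add: hreflect_def hermitian_self vec_eq_iff field_simps)
  have "norm (hreflect u x) = norm x" for x
  proof -
    have "hermitian (hreflect u x) (hreflect u x) = hermitian x x" by (simp only: 2 inv)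
    then have "(norm (hreflect u x))\<^sup>2 = (norm x)\<^sup>2"
      unfolding hermitian_self of_real_eq_iff .
    then show ?thesis by (simp add: power2_eq_iff_nonneg)
  qed
  moreover have "linear (hreflect u)"
    by (rule linearI) (auto simp: hreflect_def vec_eq_iff field_simps add_divide_distrib
        scaleR_conv_of_real[where 'a=complex])
  ultimately show "orthogonal_transformation (hreflect u)"
    by (simp add: orthogonal_transformation)
  show "hreflect (a - b) a = b" if "norm a = norm b" "hermitian a b \<in> \<real>" for a b
  proof (cases "a = b")
    case False
    have *: "hermitian b a = hermitian a b"
      using that(2) by (metis cnj_hermitian Reals_cnj_iff)
    have "hermitian (a - b) (a - b) = 2 * hermitian a (a - b)"
      unfolding hermitian_simps using that(1) * by (simp add: hermitian_self)
    then have "of_real ((norm (a - b))\<^sup>2) = 2 * hermitian a (a - b)"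
      by (simp only: hermitian_self)
    then have "2 * hermitian a (a - b) / (norm (a - b))\<^sup>2 = 1"
      using False by (metis divide_self_if eq_iff_diff_eq_0 norm_eq_zero of_real_eq_0_iff of_real_power power_not_zero)
    then show ?thesis by (simp add: hreflect_def)
  qed (simp add: hreflect_def)
qed

text \<open>A phase \<open>\<omega>\<close> makes the product of \<open>a\<close> and
  \<open>\<omega> *s b\<close> real, so a unitary reflection carries one to the other; the phase
  disappears under the norm. Transitivity of the unitary group on spheres is thus reduced to single
  reflections.\<close>

lemma integral_hermitian_rotate:
  fixes a b :: "complex ^ 'n" and \<Phi> :: "real \<Rightarrow> real"
  assumes ab: "norm a = norm b" and c: "continuous_on UNIV \<Phi>"
  shows "(\<integral>\<zeta>. \<Phi> (norm (hermitian \<zeta> a)) \<partial>sigma) = (\<integral>\<zeta>. \<Phi> (norm (hermitian \<zeta> b)) \<partial>sigma)"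
proof -
  define \<omega> where "\<omega> = (if hermitian a b = 0 then 1 else hermitian a b / norm (hermitian a b))"
  have \<omega>: "norm \<omega> = 1" by (simp add: \<omega>_def norm_divide)
  have "hermitian a (\<omega> *s b) = of_real (norm (hermitian a b))"
    by (auto simp: \<omega>_def complex_norm_square[symmetric] field_simps power2_eq_square)
  then have R: "hreflect (a - \<omega> *s b) a = \<omega> *s b"
    by (intro hreflect(3)) (auto simp: ab \<omega>)
  have "(\<integral>\<zeta>. \<Phi> (norm (hermitian \<zeta> a)) \<partial>sigma) =
      (\<integral>\<zeta>. \<Phi> (norm (hermitian (hreflect (a - \<omega> *s b) \<zeta>) a)) \<partial>sigma)"
    by (rule integral_sigma_orthogonal[OF hreflect(1), symmetric])
       (intro measurable_sigma_continuous continuous_intros continuous_on_compose2[OF c], auto)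
  also have "\<dots> = (\<integral>\<zeta>. \<Phi> (norm (hermitian \<zeta> b)) \<partial>sigma)"
    by (simp add: hreflect(2) R norm_mult \<omega>)
  finally show ?thesis .
qed

text \<open>The moment of order \<open>2k\<close> of one coordinate; rotation invariance makes the
  choice of the coordinate, here \<open>undefined\<close>, immaterial.\<close>

definition moment :: "'n::finite itself \<Rightarrow> nat \<Rightarrow> real" where
  "moment TYPE('n::finite) k = (\<integral>\<zeta>. norm (hermitian \<zeta> (axis undefined 1 :: complex ^ 'n)) ^ (2 * k) \<partial>sigma)"

lemma integral_hermitian_power:
  fixes w :: "complex ^ 'n"
  shows "(\<integral>\<zeta>. norm (hermitian \<zeta> w) ^ (2 * k) \<partial>sigma) = moment TYPE('n) k * norm w ^ (2 * k)"
proof -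
  let ?a = "of_real (norm w) *s axis undefined 1 :: complex ^ 'n"
  have "(\<integral>\<zeta>. norm (hermitian \<zeta> w) ^ (2 * k) \<partial>sigma) = (\<integral>\<zeta>. norm (hermitian \<zeta> ?a) ^ (2 * k) \<partial>sigma)"
    by (rule integral_hermitian_rotate) (auto simp: norm_axis_1 intro!: continuous_intros)
  also have "\<dots> = (\<integral>\<zeta>. norm (hermitian \<zeta> (axis undefined 1 :: complex ^ 'n)) ^ (2 * k) * norm w ^ (2 * k) \<partial>sigma)"
    by (simp add: norm_mult power_mult_distrib mult_ac)
  finally show ?thesis by (simp add: moment_def)
qed

lemma moment_0: "moment TYPE('n::finite) 0 = 1"
  by (simp add: moment_def)

definition phase :: "'n \<Rightarrow> complex \<Rightarrow> complex ^ 'n \<Rightarrow> complex ^ 'n" where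
  "phase j \<omega> z = (\<chi> l. if l = j then \<omega> * z $ l else z $ l)"

lemma phase_orthogonal: "norm \<omega> = 1 \<Longrightarrow> orthogonal_transformation (phase j \<omega>)"
proof -
  assume \<omega>: "norm \<omega> = 1"
  have "norm (phase j \<omega> z) = norm z" for z :: "complex ^ 'a"
    unfolding norm_vec_def L2_set_def by (auto simp: phase_def norm_mult \<omega> intro!: sum.cong)
  then show ?thesis
    by (auto simp: orthogonal_transformation phase_def vec_eq_iff algebra_simps
        scaleR_conv_of_real[where 'a=complex] intro!: linearI)
qed

text \<open>Rotating coordinate \<open>j\<close> by \<open>\<omega>\<close> multiplies the integrand
  by \<open>\<omega> ^ a * cnj \<omega> ^ b\<close>, and the angle \<open>pi / (a - b)\<close> makes
  this factor \<open>-1\<close>.\<close>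

lemma moment_mixed_zero:
  fixes i j :: "'n::finite"
  assumes "i \<noteq> j" "a \<noteq> b"
  shows "(\<integral>\<zeta>. (\<zeta> $ i) ^ p * (\<zeta> $ j) ^ a * cnj ((\<zeta> $ i) ^ q * (\<zeta> $ j) ^ b) \<partial>(sigma :: (complex ^ 'n) measure)) = 0"
proof -
  have "\<exists>\<omega>. norm \<omega> = 1 \<and> \<omega> ^ a * cnj \<omega> ^ b \<noteq> 1"
  proof (intro exI conjI)
    let ?\<omega> = "cis (pi / (real a - real b))"
    have "?\<omega> ^ a * cnj ?\<omega> ^ b = cis ((real a - real b) * (pi / (real a - real b)))"
      unfolding left_diff_distrib by (simp add: cis_cnj Complex.DeMoivre cis_mult)
    also have "\<dots> = -1" using assms by simp
    finally show "?\<omega> ^ a * cnj ?\<omega> ^ b \<noteq> 1" by simp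
  qed simp
  then obtain \<omega> where \<omega>: "norm \<omega> = 1" "\<omega> ^ a * cnj \<omega> ^ b \<noteq> 1" by blast
  let ?f = "\<lambda>\<zeta> :: complex ^ 'n. (\<zeta> $ i) ^ p * (\<zeta> $ j) ^ a * cnj ((\<zeta> $ i) ^ q * (\<zeta> $ j) ^ b)"
  have "(\<integral>\<zeta>. ?f \<zeta> \<partial>sigma) = (\<integral>\<zeta>. ?f (phase j \<omega> \<zeta>) \<partial>sigma)"
    by (rule integral_sigma_orthogonal[OF phase_orthogonal[OF \<omega>(1)], symmetric])
       (intro measurable_sigma_continuous continuous_intros)
  also have "\<dots> = (\<integral>\<zeta>. (\<omega> ^ a * cnj \<omega> ^ b) * ?f \<zeta> \<partial>sigma)"
    using assms by (simp add: phase_def power_mult_distrib mult_ac)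
  also have "\<dots> = (\<omega> ^ a * cnj \<omega> ^ b) * (\<integral>\<zeta>. ?f \<zeta> \<partial>sigma)"
    by (rule integral_mult_right_zero)
  finally show ?thesis using \<omega>(2) by simp
qed

lemma hermitian_axis: "hermitian z (axis j 1) = z $ j"
  by (simp add: hermitian_def axis_def if_distrib cong: if_cong)

lemma integral_sum_power_norm:
  fixes X :: "nat \<Rightarrow> complex ^ 'n \<Rightarrow> complex"
  assumes X: "\<And>a. continuous_on (sphere 0 1) (X a)"
    and orth: "\<And>a b. a \<le> n \<Longrightarrow> b \<le> n \<Longrightarrow> a \<noteq> b \<Longrightarrow> (\<integral>\<zeta>. X a \<zeta> * cnj (X b \<zeta>) \<partial>sigma) = 0"
  shows "(\<integral>\<zeta>. (norm (\<Sum>a\<le>n. X a \<zeta>))\<^sup>2 \<partial>sigma) = (\<Sum>a\<le>n. \<integral>\<zeta>. (norm (X a \<zeta>))\<^sup>2 \<partial>sigma)"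
proof -
  have int: "integrable sigma (\<lambda>\<zeta>. X a \<zeta> * cnj (X b \<zeta>))" for a b
    by (intro integrable_sigma_continuous continuous_intros X)
  have "complex_of_real (\<integral>\<zeta>. (norm (\<Sum>a\<le>n. X a \<zeta>))\<^sup>2 \<partial>sigma)
      = (\<integral>\<zeta>. (\<Sum>a\<le>n. \<Sum>b\<le>n. X a \<zeta> * cnj (X b \<zeta>)) \<partial>sigma)"
    unfolding integral_complex_of_real[symmetric]
    by (simp add: complex_norm_square sum_product del: of_real_power)
  also have "\<dots> = (\<Sum>a\<le>n. \<Sum>b\<le>n. \<integral>\<zeta>. X a \<zeta> * cnj (X b \<zeta>) \<partial>sigma)"
    by (simp add: Bochner_Integration.integral_sum Bochner_Integration.integrable_sum int)
  also have "\<dots> = (\<Sum>a\<le>n. \<Sum>b\<le>n. if a = b then \<integral>\<zeta>. X a \<zeta> * cnj (X a \<zeta>) \<partial>sigma else 0)"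
    by (intro sum.cong refl) (auto simp: orth)
  also have "\<dots> = (\<Sum>a\<le>n. \<integral>\<zeta>. X a \<zeta> * cnj (X a \<zeta>) \<partial>sigma)"
    by simp
  also have "\<dots> = complex_of_real (\<Sum>a\<le>n. \<integral>\<zeta>. (norm (X a \<zeta>))\<^sup>2 \<partial>sigma)"
    unfolding of_real_sum integral_complex_of_real[symmetric]
    by (simp add: complex_norm_square del: of_real_power)
  finally show ?thesis unfolding of_real_eq_iff .
qed

text \<open>Comparing the coefficients of \<open>t\<^sup>2\<close> in \<open>\<integral> |\<zeta>\<^sub>i + t \<zeta>\<^sub>j|\<^sup>2\<^sup>n = m\<^sub>n (1 + t\<^sup>2)\<^sup>n\<close>.\<close>

lemma moment_mixed:
  fixes i j :: "'n::finite"
  assumes ij: "i \<noteq> j"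
  shows "Suc k * (\<integral>\<zeta>. norm (\<zeta> $ i) ^ (2 * k) * (norm (\<zeta> $ j))\<^sup>2 \<partial>(sigma :: (complex ^ 'n) measure))
     = moment TYPE('n) (Suc k)"
proof -
  define J where "J a = (\<integral>\<zeta>. (norm ((\<zeta> $ i) ^ (Suc k - a) * (\<zeta> $ j) ^ a))\<^sup>2 \<partial>(sigma :: (complex ^ 'n) measure))" for a
  define c where "c a = real (Suc k choose a)" for a
  have key: "(\<Sum>a\<le>Suc k. ((c a)\<^sup>2 * J a - moment TYPE('n) (Suc k) * c a) * s ^ a) = 0" if "s \<ge> 0" for s
  proof -
    \<comment> \<open>With \<open>s = t\<^sup>2\<close> both sides become polynomials in
      \<open>s\<close>: orthogonality leaves only the squared moduli of the binomial terms, in which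
      \<open>t\<close> occurs to even powers.\<close>
    define t where "t = sqrt s"
    have t: "t ^ 2 = s" using that by (simp add: t_def)
    let ?X = "\<lambda>a (\<zeta> :: complex ^ 'n). of_real (c a * t ^ a) * ((\<zeta> $ i) ^ (Suc k - a) * (\<zeta> $ j) ^ a)"
    let ?w = "axis i 1 + t *\<^sub>R axis j 1 :: complex ^ 'n"
    have h: "hermitian \<zeta> ?w = \<zeta> $ i + t * \<zeta> $ j" for \<zeta> :: "complex ^ 'n"
      by (simp only: hermitian_simps hermitian_axis)
    have nw: "norm ?w ^ 2 = 1 + s"
    proof -
      have "hermitian ?w ?w = 1 + of_real s"
        using ij unfolding h by (simp add: axis_def scaleR_conv_of_real[where 'a=complex] t[symmetric] power2_eq_square)
      then show ?thesis
        unfolding hermitian_self by (metis of_real_1 of_real_add of_real_eq_iff)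
    qed
    have "(\<Sum>a\<le>Suc k. (c a)\<^sup>2 * J a * s ^ a) = (\<Sum>a\<le>Suc k. \<integral>\<zeta>. (norm (?X a \<zeta>))\<^sup>2 \<partial>sigma)"
    proof (intro sum.cong refl)
      fix a :: nat
      have sq: "\<bar>c a * t ^ a\<bar>\<^sup>2 = (c a)\<^sup>2 * s ^ a"
        unfolding t[symmetric] power2_abs power_mult_distrib
        by (simp only: power_mult[symmetric] mult.commute)
      have "(norm (?X a \<zeta>))\<^sup>2 = ((c a)\<^sup>2 * s ^ a) * (norm ((\<zeta> $ i) ^ (Suc k - a) * (\<zeta> $ j) ^ a))\<^sup>2"
        for \<zeta> :: "complex ^ 'n"
        unfolding norm_mult[of "of_real _"] norm_of_real power_mult_distrib[of "\<bar>_\<bar>"] sq ..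
      then show "(c a)\<^sup>2 * J a * s ^ a = (\<integral>\<zeta>. (norm (?X a \<zeta>))\<^sup>2 \<partial>sigma)"
        unfolding J_def by (simp only: integral_mult_right_zero mult_ac)
    qed
    also have "\<dots> = (\<integral>\<zeta>. (norm (\<Sum>a\<le>Suc k. ?X a \<zeta>))\<^sup>2 \<partial>sigma)"
    proof (rule integral_sum_power_norm[symmetric])
      fix a b :: nat assume "a \<noteq> b"
      have eq: "?X a \<zeta> * cnj (?X b \<zeta>) = of_real (c a * t ^ a * (c b * t ^ b)) *
         ((\<zeta> $ i) ^ (Suc k - a) * (\<zeta> $ j) ^ a * cnj ((\<zeta> $ i) ^ (Suc k - b) * (\<zeta> $ j) ^ b))" for \<zeta>
        by simp
      show "(\<integral>\<zeta>. ?X a \<zeta> * cnj (?X b \<zeta>) \<partial>sigma) = 0"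
        unfolding eq integral_mult_right_zero moment_mixed_zero[OF ij \<open>a \<noteq> b\<close>] by simp
    qed (intro continuous_intros)
    also have "\<dots> = (\<integral>\<zeta>. norm (hermitian \<zeta> ?w) ^ (2 * Suc k) \<partial>sigma)"
    proof (intro Bochner_Integration.integral_cong refl)
      fix \<zeta> :: "complex ^ 'n"
      have "(\<Sum>a\<le>Suc k. ?X a \<zeta>) = (t * \<zeta> $ j + \<zeta> $ i) ^ Suc k"
        unfolding binomial_ring by (intro sum.cong refl) (simp add: c_def power_mult_distrib mult_ac)
      then show "(norm (\<Sum>a\<le>Suc k. ?X a \<zeta>))\<^sup>2 = norm (hermitian \<zeta> ?w) ^ (2 * Suc k)"
        unfolding h by (simp only: norm_power power_mult[symmetric] mult.commute add.commute)
    qed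
    also have "\<dots> = moment TYPE('n) (Suc k) * (1 + s) ^ Suc k"
      by (subst integral_hermitian_power) (simp only: power_mult nw)
    also have "\<dots> = (\<Sum>a\<le>Suc k. moment TYPE('n) (Suc k) * c a * s ^ a)"
      unfolding add.commute[of 1 s] binomial_ring sum_distrib_left c_def
      by (intro sum.cong refl) simp
    finally show ?thesis
      by (simp add: left_diff_distrib sum_subtractf del: sum.atMost_Suc)
  qed
  \<comment> \<open>Infinitely many zeros force all coefficients to vanish; the one at
    \<open>a = 1\<close>, where \<open>c 1 = k + 1\<close>, is the claim multiplied by
    \<open>k + 1\<close>.\<close>
  have "((c 1)\<^sup>2 * J 1 - moment TYPE('n) (Suc k) * c 1) = 0"
  proof (rule ccontr)
    assume "\<not> ?thesis"
    then have "finite {s. (\<Sum>a\<le>Suc k. ((c a)\<^sup>2 * J a - moment TYPE('n) (Suc k) * c a) * s ^ a) = 0}"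
      by (intro polyfun_finite_roots[THEN iffD2]) (auto intro!: exI[of _ 1])
    moreover have "{0..1::real} \<subseteq> {s. (\<Sum>a\<le>Suc k. ((c a)\<^sup>2 * J a - moment TYPE('n) (Suc k) * c a) * s ^ a) = 0}"
      using key by auto
    ultimately have "finite {0..1::real}" by (rule rev_finite_subset)
    then show False by (simp add: infinite_Icc)
  qed
  then have "Suc k * J 1 = moment TYPE('n) (Suc k)"
    by (simp add: c_def power2_eq_square)
  moreover have "J 1 = (\<integral>\<zeta>. norm (\<zeta> $ i) ^ (2 * k) * (norm (\<zeta> $ j))\<^sup>2 \<partial>(sigma :: (complex ^ 'n) measure))"
    unfolding J_def by (simp add: norm_mult norm_power power_mult_distrib power_mult[symmetric] mult.commute)
  ultimately show ?thesis by simp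
qed

text \<open>Insert the squared norm of \<open>\<zeta>\<close>, which is \<open>1\<close>, as a sum
  over the coordinates: the coordinate itself contributes the next moment, and each of the other
  \<open>CARD('n) - 1\<close> contributes that moment divided by \<open>k + 1\<close>.\<close>

lemma moment_rec: "moment TYPE('n::finite) k * real (Suc k) = moment TYPE('n) (Suc k) * real (k + CARD('n))"
proof -
  let ?i = "undefined :: 'n"
  note h = hermitian_axis[where 'a = 'n]
  have int: "integrable sigma (\<lambda>\<zeta> :: complex ^ 'n. norm (\<zeta> $ i) ^ (2 * k) * (norm (\<zeta> $ j))\<^sup>2)" for i j
    by (intro integrable_sigma_continuous continuous_intros)
  have "moment TYPE('n) k = (\<integral>\<zeta>. (\<Sum>j\<in>UNIV. norm (\<zeta> $ ?i) ^ (2 * k) * (norm (\<zeta> $ j))\<^sup>2) \<partial>(sigma :: (complex ^ 'n) measure))"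
    unfolding moment_def h
    by (intro Bochner_Integration.integral_cong refl)
      (simp add: sum_distrib_left[symmetric] norm_sq_vec[symmetric])
  also have "\<dots> = (\<Sum>j\<in>UNIV. \<integral>\<zeta>. norm (\<zeta> $ ?i) ^ (2 * k) * (norm (\<zeta> $ j))\<^sup>2 \<partial>(sigma :: (complex ^ 'n) measure))"
    by (rule Bochner_Integration.integral_sum) (rule int)
  also have "\<dots> = moment TYPE('n) (Suc k) + (\<Sum>j\<in>UNIV - {?i}. \<integral>\<zeta>. norm (\<zeta> $ ?i) ^ (2 * k) * (norm (\<zeta> $ j))\<^sup>2 \<partial>(sigma :: (complex ^ 'n) measure))"
    by (subst sum.remove[of _ ?i]) (auto simp: moment_def h power2_eq_square mult_ac)
  also have "(\<Sum>j\<in>UNIV - {?i}. \<integral>\<zeta>. norm (\<zeta> $ ?i) ^ (2 * k) * (norm (\<zeta> $ j))\<^sup>2 \<partial>(sigma :: (complex ^ 'n) measure))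
     = (\<Sum>j\<in>UNIV - {?i}. moment TYPE('n) (Suc k) / Suc k)"
    using moment_mixed[where k = k and 'n = 'n]
    by (intro sum.cong refl) (simp add: field_simps)
  also have "\<dots> = (real CARD('n) - 1) * (moment TYPE('n) (Suc k) / Suc k)"
    by (simp add: card_Diff_singleton of_nat_diff Suc_leI)
  finally show ?thesis by (simp add: field_simps)
qed

section \<open>The Szego formula\<close>

definition szego :: "complex ^ 'n \<Rightarrow> complex ^ 'n \<Rightarrow> complex" where
  "szego z w = inverse ((1 - hermitian z w) ^ CARD('n))"

lemma moment_pos: "moment TYPE('n::finite) k > 0"
proof (induction k)
  case (Suc k)
  then have "moment TYPE('n) (Suc k) * real (k + CARD('n)) > 0"
    unfolding moment_rec[symmetric] by simp
  then show ?case by (simp add: zero_less_mult_iff)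
qed (simp add: moment_0)

text \<open>The negative binomial coefficients start at \<open>1\<close> and obey the recursion of
  \<open>moment_rec\<close> for the reciprocals; so the kernel is the power series whose
  coefficients cancel the moments.\<close>

lemma szego_sums:
  fixes x :: complex
  assumes "norm x < 1"
  shows "(\<lambda>k. of_real (1 / moment TYPE('n::finite) k) * x ^ k) sums inverse ((1 - x) ^ CARD('n))"
proof -
  let ?c = "\<lambda>k. (- of_nat CARD('n) gchoose k) * (- 1 :: complex) ^ k"
  have "?c k = of_real (1 / moment TYPE('n) k)" for k
  proof (induction k)
    case (Suc k)
    have "?c (Suc k) * of_nat (Suc k) = ?c k * of_nat (k + CARD('n))"
      by (simp add: gbinomial_prod_rev field_simps del: of_nat_Suc)
    then have "?c (Suc k) = ?c k * of_real (real (k + CARD('n)) / real (Suc k))"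
      by (simp add: field_simps del: of_nat_Suc)
    also have "\<dots> = of_real (1 / moment TYPE('n) k * (real (k + CARD('n)) / real (Suc k)))"
      unfolding Suc by (rule of_real_mult[symmetric])
    also have "1 / moment TYPE('n) k * (real (k + CARD('n)) / real (Suc k)) = 1 / moment TYPE('n) (Suc k)"
      using moment_rec[where 'n = 'n and k = k] moment_pos[where 'n = 'n and k = k]
        moment_pos[where 'n = 'n and k = "Suc k"]
      by (simp add: field_simps del: of_nat_Suc of_nat_add)
    finally show ?case .
  qed (simp add: moment_0)
  moreover have "(\<lambda>k. (- of_nat CARD('n) gchoose k) * (- x) ^ k) sums (1 + (- x)) powr (- of_nat CARD('n))"
    using assms by (intro gen_binomial_complex) simp
  moreover have "(1 + (- x)) powr (- of_nat CARD('n)) = inverse ((1 - x) ^ CARD('n))"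
  proof -
    have "1 - x \<noteq> 0" using assms by auto
    then show ?thesis by (simp add: powr_minus powr_nat')
  qed
  moreover have "(- x) ^ k = (- 1) ^ k * x ^ k" for k
    by (metis mult_minus1 power_mult_distrib)
  ultimately show ?thesis by (simp only: mult.assoc[symmetric])
qed

section \<open>Averages over circles and the reproducing formula\<close>

definition circ :: "real \<Rightarrow> complex" where "circ t = exp (2 * of_real pi * \<i> * of_real t)"

lemma norm_circ [simp]: "norm (circ t) = 1"
  by (simp add: circ_def)

lemma continuous_on_circ [continuous_intros]: "continuous_on A f \<Longrightarrow> continuous_on A (\<lambda>x. circ (f x))"
  unfolding circ_def by (intro continuous_intros)

definition unit_interval :: "real measure" where "unit_interval = restrict_space lborel {0..1}"

lemma unit_interval_facts:
  "sets unit_interval = sets (restrict_space borel {0..1})" "space unit_interval = {0..1}"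
  "finite_measure unit_interval"
proof -
  show "sets unit_interval = sets (restrict_space borel {0..1})"
    unfolding unit_interval_def by (rule sets_restrict_space_cong) simp
  show "space unit_interval = {0..1}" by (simp add: unit_interval_def space_restrict_space)
  show "finite_measure unit_interval"
    by (rule finite_measureI) (simp add: unit_interval_def emeasure_restrict_space)
qed

interpretation unit_interval: finite_measure unit_interval
  by (rule unit_interval_facts)

lemma measure_unit_interval: "measure unit_interval (space unit_interval) = 1"
  by (simp add: unit_interval_def measure_restrict_space space_restrict_space)

text \<open>Cauchy's formula for Taylor coefficients as a Lebesgue average over the parameter
  interval, the form in which Fubini's theorem can combine it with \<open>sigma\<close>.\<close>

lemma coefficient_integral:
  assumes G: "G holomorphic_on ball 0 R" "R > 1"
  shows "(\<integral>t. G (circ t) * cnj (circ t) ^ k \<partial>unit_interval) = (deriv ^^ k) G 0 / fact k"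
proof -
  have cont: "continuous_on (cball 0 1) G"
    using G by (intro continuous_on_subset[OF holomorphic_on_imp_continuous_on[OF G(1)]]) auto
  have hol: "G holomorphic_on ball 0 1" using G by (auto elim: holomorphic_on_subset)
  have cp: "circlepath 0 1 t = circ t" for t by (simp add: circlepath circ_def)
  have c1: "circ t * cnj (circ t) = 1" for t by (simp add: complex_norm_square[symmetric])
  have inv: "cnj (circ t) = 1 / circ t" for t
    using c1[of t] by (metis mult.commute nonzero_eq_divide_eq norm_circ norm_zero zero_neq_one)
  have "((\<lambda>u. G u / (u - 0) ^ Suc k) has_contour_integral 2 * pi * \<i> / fact k * (deriv ^^ k) G 0) (circlepath 0 1)"
    using cont hol by (intro Cauchy_has_contour_integral_higher_derivative_circlepath) auto
  then have "((\<lambda>t. G (circ t) / circ t ^ Suc k * (2 * pi * \<i> * circ t)) has_integral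
       2 * pi * \<i> / fact k * (deriv ^^ k) G 0) {0..1}"
    by (simp add: has_contour_integral vector_derivative_circlepath cp circ_def[symmetric] del: power_Suc)
  moreover have "G (circ t) / circ t ^ Suc k * (2 * pi * \<i> * circ t) =
     2 * pi * \<i> * (G (circ t) * cnj (circ t) ^ k)" for t
    unfolding inv by (simp add: field_simps circ_def)
  ultimately have "((\<lambda>t. 2 * pi * \<i> * (G (circ t) * cnj (circ t) ^ k)) has_integral
       2 * pi * \<i> / fact k * (deriv ^^ k) G 0) {0..1}"
    by (simp only:)
  then have "((\<lambda>t. (1 / (2 * pi * \<i>)) * (2 * pi * \<i> * (G (circ t) * cnj (circ t) ^ k))) has_integral
      (1 / (2 * pi * \<i>)) * (2 * pi * \<i> / fact k * (deriv ^^ k) G 0)) {0..1}"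
    by (rule has_integral_mult_right)
  then have I: "((\<lambda>t. G (circ t) * cnj (circ t) ^ k) has_integral (deriv ^^ k) G 0 / fact k) {0..1}"
    by simp
  have "continuous_on {0..1} (\<lambda>t. G (circ t) * cnj (circ t) ^ k)"
    by (intro continuous_intros continuous_on_compose2[OF cont]) auto
  then have "set_integrable lborel {0..1} (\<lambda>t. G (circ t) * cnj (circ t) ^ k)"
    by (rule borel_integrable_atLeastAtMost')
  then have "(LINT t:{0..1}|lborel. G (circ t) * cnj (circ t) ^ k) = (deriv ^^ k) G 0 / fact k"
    using I by (simp add: set_borel_integral_eq_integral(2) integral_unique)
  then show ?thesis
    by (simp add: unit_interval_def integral_restrict_space set_lebesgue_integral_def)
qed

text \<open>Each \<open>V t\<close> preserves \<open>sigma\<close>, so averaging over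
  \<open>t\<close> changes nothing; exchanging the integrals puts an average over a circle inside,
  which Cauchy's formula evaluates.\<close>

lemma integral_sigma_circle_average:
  fixes \<Psi> :: "complex ^ 'n \<Rightarrow> complex" and V :: "real \<Rightarrow> complex ^ 'n \<Rightarrow> complex ^ 'n"
  assumes \<Psi>: "continuous_on (cball 0 1) \<Psi>"
    and V: "\<And>t. orthogonal_transformation (V t)"
    and cV: "continuous_on UNIV (\<lambda>(t, \<zeta>). V t \<zeta>)"
  shows "(\<integral>\<zeta>. \<Psi> \<zeta> \<partial>sigma) = (\<integral>\<zeta>. (\<integral>t. \<Psi> (V t \<zeta>) \<partial>unit_interval) \<partial>sigma)"
proof -
  interpret P: pair_sigma_finite unit_interval "sigma :: (complex ^ 'n) measure" ..
  have fin: "finite_measure (unit_interval \<Otimes>\<^sub>M (sigma :: (complex ^ 'n) measure))"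
    by (rule finite_measure_pair_measure) unfold_locales
  \<comment> \<open>\<open>\<Psi>\<close> is continuous on the closed ball only; cutting it off
    gives a Borel function on the whole space, to which composition with \<open>V\<close> and
    Fubini's theorem apply.\<close>
  define \<Psi>' where "\<Psi>' = (\<lambda>z. indicator (cball 0 1) z *\<^sub>R \<Psi> z)"
  have [measurable]: "\<Psi>' \<in> borel_measurable borel"
    unfolding \<Psi>'_def using \<Psi>
    by (intro borel_measurable_continuous_on_indicator) auto
  have nV: "norm (V t \<zeta>) = norm \<zeta>" for t \<zeta>
    using V by (auto simp: orthogonal_transformation)
  have [measurable]: "(\<lambda>p. V (fst p) (snd p)) \<in> borel_measurable borel"
    using cV by (intro borel_measurable_continuous_onI) (simp add: case_prod_beta')
  have [measurable]: "(\<lambda>t. t) \<in> borel_measurable unit_interval"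
    by (simp add: measurable_cong_sets[OF unit_interval_facts(1) refl] measurable_restrict_space1)
  have mVp: "(\<lambda>p. V (fst p) (snd p)) \<in> borel_measurable (unit_interval \<Otimes>\<^sub>M sigma)"
  proof -
    have "(\<lambda>p. (fst p, snd p)) \<in> borel_measurable (unit_interval \<Otimes>\<^sub>M (sigma :: (complex ^ 'n) measure))"
      by (intro borel_measurable_Pair measurable_compose[OF measurable_fst] measurable_compose[OF measurable_snd]) measurable
    from measurable_compose[OF this \<open>(\<lambda>p. V (fst p) (snd p)) \<in> borel_measurable borel\<close>]
    show ?thesis by simp
  qed
  have "compact (cball (0 :: complex ^ 'n) 1)" by simp
  then have "bounded (\<Psi> ` cball 0 1)"
    by (intro compact_imp_bounded compact_continuous_image \<Psi>)
  then obtain C where C: "\<And>z. norm z \<le> 1 \<Longrightarrow> norm (\<Psi> z) \<le> C"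
    unfolding bounded_iff by (metis imageI mem_cball_0)
  have int: "integrable (unit_interval \<Otimes>\<^sub>M sigma) (\<lambda>p. \<Psi>' (V (fst p) (snd p)))"
    by (rule finite_measure.integrable_const_bound[OF fin, of _ C])
      (auto simp: \<Psi>'_def nV space_pair_measure intro!: AE_I2 C measurable_compose[OF mVp] \<open>\<Psi>' \<in> borel_measurable borel\<close>[unfolded \<Psi>'_def])
  have eq: "\<Psi>' \<zeta> = \<Psi> \<zeta>" if "norm \<zeta> = 1" for \<zeta> using that by (simp add: \<Psi>'_def)
  have "(\<integral>\<zeta>. (\<integral>t. \<Psi> (V t \<zeta>) \<partial>unit_interval) \<partial>sigma) = (\<integral>\<zeta>. (\<integral>t. \<Psi>' (V t \<zeta>) \<partial>unit_interval) \<partial>sigma)"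
    by (intro Bochner_Integration.integral_cong refl) (auto simp: eq nV)
  also have "\<dots> = (\<integral>t. (\<integral>\<zeta>. \<Psi>' (V t \<zeta>) \<partial>sigma) \<partial>unit_interval)"
    by (rule P.Fubini_integral) (use int in \<open>simp add: case_prod_beta'\<close>)
  also have "\<dots> = (\<integral>t. (\<integral>\<zeta>. \<Psi>' \<zeta> \<partial>sigma) \<partial>unit_interval)"
    by (intro Bochner_Integration.integral_cong refl integral_sigma_orthogonal V
        measurable_compose[OF measurable_sigma_borel]) measurable
  also have "\<dots> = (\<integral>\<zeta>. \<Psi>' \<zeta> \<partial>sigma)"
    by (simp add: measure_unit_interval)
  also have "\<dots> = (\<integral>\<zeta>. \<Psi> \<zeta> \<partial>sigma)"
    by (intro Bochner_Integration.integral_cong refl) (auto simp: eq)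
  finally show ?thesis ..
qed

text \<open>With \<open>z = s u\<close> and \<open>norm u = 1\<close> the kernel is a power series
  in \<open>cnj (hermitian \<zeta> u)\<close>, so only the integrals of \<open>g\<close> against its
  powers matter. Two averages over circles express them by the Taylor coefficients
  \<open>a k\<close> of \<open>g\<close> along the line of \<open>u\<close>; the moments cancel, and
  the Taylor series at \<open>s\<close> remains.\<close>

theorem szego_formula:
  fixes g :: "complex ^ 'n \<Rightarrow> complex"
  assumes g: "holo_on (ball 0 R) g" "R > 1" and z: "norm z < 1"
  shows "g z = (\<integral>\<zeta>. g \<zeta> * szego z \<zeta> \<partial>sigma)"
proof -
  define s where "s = norm z"
  obtain u :: "complex ^ 'n" where u: "norm u = 1" "z = of_real s *s u"
  proof (cases "z = 0")
    case True
    then show ?thesis using that[of "axis undefined 1"] by (simp add: s_def norm_axis_1)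
  next
    case False
    have "norm ((1 / of_real s) *s z :: complex ^ 'n) = 1" "z = of_real s *s ((1 / of_real s) *s z)"
      using False by (simp_all add: s_def norm_divide vector_smult_assoc)
    then show ?thesis using that by blast
  qed
  have s: "0 \<le> s" "s < 1" using z by (auto simp: s_def)
  have cg: "continuous_on (cball 0 1) g"
    using g by (intro continuous_on_subset[OF holo_on_imp_continuous_on[OF g(1)]]) auto
  define h where "h = (\<lambda>x. g (x *s u))"
  have hol_h: "h holomorphic_on ball 0 R"
    using holo_slice[OF g(1), of "ball 0 R" 0 u] u(1) by (auto simp: h_def)
  define a where "a k = (deriv ^^ k) h 0 / fact k" for k
  have hu: "norm (hermitian \<zeta> u) \<le> 1" if "norm \<zeta> = 1" for \<zeta>
    using norm_hermitian_le[of \<zeta> u] that u by simp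

  have pyth: "(norm (hermitian \<zeta> u *s u + x *s (\<zeta> - hermitian \<zeta> u *s u)))\<^sup>2 =
      (norm (hermitian \<zeta> u *s u))\<^sup>2 + (norm x * norm (\<zeta> - hermitian \<zeta> u *s u))\<^sup>2" for \<zeta> x
  proof -
    let ?p = "hermitian \<zeta> u *s u" and ?q = "\<zeta> - hermitian \<zeta> u *s u"
    have "hermitian ?q ?p = 0" using u(1) by (simp add: hermitian_self)
    then have "hermitian (x *s ?q) ?p = 0" using hermitian_simps(7)[of x ?q ?p] by simp
    then have "orthogonal ?p (x *s ?q)"
      unfolding orthogonal_def Re_hermitian[symmetric] by (metis cnj_hermitian complex_cnj_zero zero_complex.sel(1))
    from norm_add_Pythagorean[OF this] show ?thesis unfolding norm_smult_vec[of x ?q] .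
  qed
  \<comment> \<open>Rotating the part of \<open>\<zeta>\<close> orthogonal to \<open>u\<close> fixes
    \<open>hermitian \<zeta> u\<close>; the mean value property replaces \<open>g\<close> by its
    value at the projection of \<open>\<zeta>\<close> to the line of \<open>u\<close>.\<close>
  have step1: "(\<integral>\<zeta>. g \<zeta> * cnj (hermitian \<zeta> u) ^ k \<partial>sigma) = (\<integral>\<zeta>. h (hermitian \<zeta> u) * cnj (hermitian \<zeta> u) ^ k \<partial>sigma)" for k
  proof -
    define V where "V t \<zeta> = hermitian \<zeta> u *s u + circ t *s (\<zeta> - hermitian \<zeta> u *s u)" for t \<zeta>
    have hV: "hermitian (V t \<zeta>) u = hermitian \<zeta> u" for t \<zeta>
      using u(1) by (simp add: V_def hermitian_self)
    have nV: "norm (V t \<zeta>) = norm \<zeta>" for t \<zeta>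
    proof -
      have "(norm (V t \<zeta>))\<^sup>2 = (norm \<zeta>)\<^sup>2"
        using pyth[of \<zeta> "circ t"] pyth[of \<zeta> 1] by (simp add: V_def)
      then show ?thesis by (simp add: power2_eq_iff_nonneg)
    qed
    have "linear (V t)" for t
      by (rule linearI) (auto simp: V_def vec_eq_iff algebra_simps scaleR_conv_of_real[where 'a=complex])
    then have oV: "orthogonal_transformation (V t)" for t
      by (simp add: orthogonal_transformation nV)
    have "(\<integral>\<zeta>. g \<zeta> * cnj (hermitian \<zeta> u) ^ k \<partial>sigma) =
      (\<integral>\<zeta>. (\<integral>t. g (V t \<zeta>) * cnj (hermitian (V t \<zeta>) u) ^ k \<partial>unit_interval) \<partial>sigma)"
      by (rule integral_sigma_circle_average[OF _ oV])
         (auto simp: V_def case_prod_beta' intro!: continuous_intros cg)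
    also have "\<dots> = (\<integral>\<zeta>. h (hermitian \<zeta> u) * cnj (hermitian \<zeta> u) ^ k \<partial>sigma)"
    proof (intro Bochner_Integration.integral_cong refl)
      fix \<zeta> :: "complex ^ 'n" assume "\<zeta> \<in> space sigma"
      then have \<zeta>: "norm \<zeta> = 1" by simp
      let ?p = "hermitian \<zeta> u *s u" and ?q = "\<zeta> - hermitian \<zeta> u *s u"
      have "?p + x *s ?q \<in> ball 0 R" if "norm x < R" for x
      proof -
        have p1: "(norm ?p)\<^sup>2 + (norm ?q)\<^sup>2 = 1" using pyth[of \<zeta> 1] \<zeta> by simp
        \<comment> \<open>A convex combination of \<open>1\<close> and \<open>X\<close> with weights
          \<open>P\<close> and \<open>Q\<close> stays below \<open>S\<close>; for
          \<open>Q = 0\<close> the strictness comes from \<open>1 < S\<close>.\<close>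
        have aux: "P + X * Q < S" if "P + Q = 1" "P \<ge> 0" "Q \<ge> 0" "X < S" "1 < S" for P Q X S :: real
        proof -
          have "P + X * Q < S * P + S * Q"
          proof (cases "Q = 0")
            case False
            then have "X * Q < S * Q" using that by simp
            moreover have "P \<le> S * P" using that mult_right_mono[of 1 S P] by simp
            ultimately show ?thesis by linarith
          qed (use that in simp)
          also have "S * P + S * Q = S" using that(1) by (simp add: distrib_left[symmetric])
          finally show ?thesis .
        qed
        have "(norm ?p)\<^sup>2 + (norm x)\<^sup>2 * (norm ?q)\<^sup>2 < R\<^sup>2"
          using p1 by (rule aux) (use that g(2) in \<open>simp_all add: power_strict_mono one_less_power\<close>)
        then have "(norm ?p)\<^sup>2 + (norm x * norm ?q)\<^sup>2 < R\<^sup>2"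
          unfolding power_mult_distrib .
        then have "(norm (?p + x *s ?q))\<^sup>2 < R\<^sup>2" unfolding pyth .
        then have "norm (?p + x *s ?q) < R" by (rule power2_less_imp_less) (use g(2) in simp)
        then show ?thesis by (simp only: mem_ball_0)
      qed
      then have "(\<lambda>x. g (?p + x *s ?q)) holomorphic_on ball 0 R"
        by (intro holo_slice[OF g(1)]) auto
      from coefficient_integral[OF this g(2), of 0]
      have "(\<integral>t. g (V t \<zeta>) \<partial>unit_interval) = h (hermitian \<zeta> u)"
        by (simp add: V_def h_def)
      then show "(\<integral>t. g (V t \<zeta>) * cnj (hermitian (V t \<zeta>) u) ^ k \<partial>unit_interval) =
          h (hermitian \<zeta> u) * cnj (hermitian \<zeta> u) ^ k"
        by (simp add: hV)
    qed
    finally show ?thesis .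
  qed

  \<comment> \<open>Rotating \<open>\<zeta>\<close> as a whole multiplies
    \<open>hermitian \<zeta> u\<close> by \<open>circ t\<close>. The average over \<open>t\<close>
    picks the coefficient of order \<open>k\<close> and leaves the modulus of
    \<open>hermitian \<zeta> u\<close> to the power \<open>2 * k\<close>.\<close>
  have step2: "(\<integral>\<zeta>. h (hermitian \<zeta> u) * cnj (hermitian \<zeta> u) ^ k \<partial>sigma) = a k * of_real (moment TYPE('n) k)" for k
  proof -
    have o: "orthogonal_transformation (\<lambda>\<zeta>. circ t *s \<zeta> :: complex ^ 'n)" for t
      by (auto simp: orthogonal_transformation vec_eq_iff algebra_simps scaleR_conv_of_real[where 'a=complex] intro!: linearI)
    have hu': "norm (hermitian \<zeta> u) \<le> 1" if "norm \<zeta> \<le> 1" for \<zeta>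
      using norm_hermitian_le[of \<zeta> u] that u by simp
    have ch: "continuous_on (cball 0 1) h"
      using g(2) by (intro continuous_on_subset[OF holomorphic_on_imp_continuous_on[OF hol_h]]) auto
    have "(\<integral>\<zeta>. h (hermitian \<zeta> u) * cnj (hermitian \<zeta> u) ^ k \<partial>sigma) =
      (\<integral>\<zeta>. (\<integral>t. h (hermitian (circ t *s \<zeta>) u) * cnj (hermitian (circ t *s \<zeta>) u) ^ k \<partial>unit_interval) \<partial>sigma)"
      by (rule integral_sigma_circle_average[OF _ o])
         (auto simp: case_prod_beta' intro!: continuous_intros continuous_on_compose2[OF ch] hu')
    also have "\<dots> = (\<integral>\<zeta>. a k * of_real (norm (hermitian \<zeta> u) ^ (2 * k)) \<partial>sigma)"
    proof (intro Bochner_Integration.integral_cong refl)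
      fix \<zeta> :: "complex ^ 'n" assume "\<zeta> \<in> space sigma"
      then have \<zeta>: "norm (hermitian \<zeta> u) \<le> 1" by (simp add: hu)
      let ?x = "hermitian \<zeta> u"
      have "norm (?x * x) < R" if "norm x < R" for x
      proof -
        have "norm x * norm ?x \<le> norm x * 1" using \<zeta> by (intro mult_left_mono) auto
        then show ?thesis using that by (simp add: norm_mult mult.commute)
      qed
      then have bx: "\<And>x. norm x < R \<Longrightarrow> norm (?x * x) < R" .
      then have "(\<lambda>x. h (?x * x)) holomorphic_on ball 0 R"
        by (intro holomorphic_on_compose_gen[OF _ hol_h, unfolded o_def] holomorphic_intros) auto
      then have "(\<integral>t. h (?x * circ t) * cnj (circ t) ^ k \<partial>unit_interval) = (deriv ^^ k) (\<lambda>x. h (?x * x)) 0 / fact k"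
        using g(2) by (rule coefficient_integral)
      also have "(deriv ^^ k) (\<lambda>x. h (?x * x)) 0 = ?x ^ k * (deriv ^^ k) h 0"
        using higher_deriv_compose_linear[OF hol_h, of "ball 0 R" 0 ?x k] bx g(2) by simp
      finally have c: "(\<integral>t. h (?x * circ t) * cnj (circ t) ^ k \<partial>unit_interval) = ?x ^ k * a k"
        by (simp add: a_def)
      have "(\<integral>t. h (hermitian (circ t *s \<zeta>) u) * cnj (hermitian (circ t *s \<zeta>) u) ^ k \<partial>unit_interval)
        = (\<integral>t. (h (?x * circ t) * cnj (circ t) ^ k) * cnj ?x ^ k \<partial>unit_interval)"
        by (intro Bochner_Integration.integral_cong refl) (simp add: power_mult_distrib mult_ac)
      also have "\<dots> = a k * (?x * cnj ?x) ^ k"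
        unfolding integral_mult_left_zero c by (simp add: power_mult_distrib mult_ac)
      also have "(?x * cnj ?x) ^ k = of_real (norm ?x ^ (2 * k))"
        by (simp only: complex_norm_square[symmetric] power_mult of_real_power)
      finally show "(\<integral>t. h (hermitian (circ t *s \<zeta>) u) * cnj (hermitian (circ t *s \<zeta>) u) ^ k \<partial>unit_interval)
        = a k * of_real (norm ?x ^ (2 * k))" .
    qed
    also have "\<dots> = a k * of_real (\<integral>\<zeta>. norm (hermitian \<zeta> u) ^ (2 * k) \<partial>sigma)"
      by (simp only: integral_mult_right_zero integral_complex_of_real)
    finally show ?thesis unfolding integral_hermitian_power u by simp
  qed

  \<comment> \<open>Termwise integration is dominated by a multiple of the kernel series at the real
    point \<open>s < 1\<close>.\<close>
  have "(\<lambda>k. of_real (s ^ k / moment TYPE('n) k) * (\<integral>\<zeta>. g \<zeta> * cnj (hermitian \<zeta> u) ^ k \<partial>sigma)) sums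
     (\<integral>\<zeta>. g \<zeta> * szego z \<zeta> \<partial>sigma)"
  proof -
    obtain C where C: "\<And>z. norm z \<le> 1 \<Longrightarrow> norm (g z) \<le> C"
      using compact_imp_bounded[OF compact_continuous_image[OF cg compact_cball]]
      unfolding bounded_iff by (metis imageI mem_cball_0)
    have C0: "0 \<le> C" using C[of 0] norm_ge_zero[of "g 0"] by (simp del: norm_ge_zero)
    define F where "F k \<zeta> = of_real (s ^ k / moment TYPE('n) k) * (g \<zeta> * cnj (hermitian \<zeta> u) ^ k)" for k \<zeta>
    have cF: "continuous_on (sphere 0 1) (F k)" for k
      unfolding F_def by (intro continuous_intros continuous_on_subset[OF cg]) auto
    define b where "b k = C * (s ^ k / moment TYPE('n) k)" for k
        have F_le: "norm (F k \<zeta>) \<le> b k" if "norm \<zeta> = 1" for k \<zeta>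
    proof -
      have "norm (g \<zeta>) * norm (hermitian \<zeta> u) ^ k \<le> C * 1"
        using that by (intro mult_mono C power_le_one hu) (use C0 in auto)
      then have "(s ^ k / moment TYPE('n) k) * (norm (g \<zeta>) * norm (hermitian \<zeta> u) ^ k) \<le> (s ^ k / moment TYPE('n) k) * (C * 1)"
        using s moment_pos[where 'n = 'n and k = k] by (intro mult_left_mono) auto
      then show ?thesis
        using s moment_pos[where 'n = 'n and k = k]
        by (simp add: F_def b_def norm_mult norm_power norm_divide mult.commute)
    qed
    have summ: "summable (\<lambda>k. b k)"
    proof -
      have "summable (\<lambda>k. complex_of_real (1 / moment TYPE('n) k) * (of_real s) ^ k)"
        using szego_sums[where 'n = 'n, of "of_real s"] s by (simp add: sums_iff)
      then have "summable (\<lambda>k. complex_of_real (1 / moment TYPE('n) k * s ^ k))" by simp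
      then have "summable (\<lambda>k. 1 / moment TYPE('n) k * s ^ k)"
        unfolding summable_complex_of_real .
      then show ?thesis unfolding b_def by (intro summable_mult) simp
    qed
    have "(\<lambda>k. \<integral>\<zeta>. F k \<zeta> \<partial>sigma) sums (\<integral>\<zeta>. (\<Sum>k. F k \<zeta>) \<partial>sigma)"
    proof (rule sums_integral)
      show "integrable sigma (F k)" for k by (rule integrable_sigma_continuous[OF cF])
      show "AE \<zeta> in sigma. summable (\<lambda>k. norm (F k \<zeta>))"
        by (intro AE_I2 summable_comparison_test[OF _ summ] exI[of _ 0] allI impI) (simp add: F_le)
      show "summable (\<lambda>k. \<integral>\<zeta>. norm (F k \<zeta>) \<partial>sigma)"
      proof (intro summable_comparison_test[OF _ summ] exI[of _ 0] allI impI)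
        fix k
        have "(\<integral>\<zeta>. norm (F k \<zeta>) \<partial>sigma) \<le> (\<integral>\<zeta>. b k \<partial>(sigma :: (complex ^ 'n) measure))"
          by (intro integral_mono integrable_sigma_continuous continuous_intros cF) (auto intro: F_le)
        then show "norm (\<integral>\<zeta>. norm (F k \<zeta>) \<partial>sigma) \<le> b k"
          by simp
      qed
    qed
    moreover have "(\<Sum>k. F k \<zeta>) = g \<zeta> * szego z \<zeta>" if "norm \<zeta> = 1" for \<zeta>
    proof -
      have hz: "hermitian z \<zeta> = of_real s * cnj (hermitian \<zeta> u)"
        by (simp add: u(2) cnj_hermitian)
      have "norm (hermitian z \<zeta>) \<le> s"
        using norm_hermitian_le[of z \<zeta>] that by (simp add: s_def)
      then have "norm (hermitian z \<zeta>) < 1" using s by simp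
      from sums_mult[OF szego_sums[where 'n = 'n, OF this], of "g \<zeta>"]
      have "(\<lambda>k. g \<zeta> * (of_real (1 / moment TYPE('n) k) * hermitian z \<zeta> ^ k)) sums (g \<zeta> * szego z \<zeta>)"
        unfolding szego_def .
      moreover have "g \<zeta> * (of_real (1 / moment TYPE('n) k) * hermitian z \<zeta> ^ k) = F k \<zeta>" for k
        unfolding hz F_def power_mult_distrib by simp
      ultimately show ?thesis by (simp add: sums_iff)
    qed
    then have "(\<integral>\<zeta>. (\<Sum>k. F k \<zeta>) \<partial>sigma) = (\<integral>\<zeta>. g \<zeta> * szego z \<zeta> \<partial>sigma)"
      by (intro Bochner_Integration.integral_cong refl) simp
    ultimately have "(\<lambda>k. \<integral>\<zeta>. F k \<zeta> \<partial>sigma) sums (\<integral>\<zeta>. g \<zeta> * szego z \<zeta> \<partial>sigma)" by (simp only:)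
    then show ?thesis unfolding F_def integral_mult_right_zero .
  qed
  moreover have "of_real (s ^ k / moment TYPE('n) k) * (\<integral>\<zeta>. g \<zeta> * cnj (hermitian \<zeta> u) ^ k \<partial>sigma) = a k * of_real s ^ k" for k
    using moment_pos[where 'n = 'n and k = k] by (simp add: step1 step2)
  ultimately have "(\<lambda>k. a k * of_real s ^ k) sums (\<integral>\<zeta>. g \<zeta> * szego z \<zeta> \<partial>sigma)" by (simp only:)
  moreover have "(\<lambda>k. a k * of_real s ^ k) sums h s"
    using holomorphic_power_series[OF hol_h, of "of_real s"] s g(2) by (simp add: a_def)
  ultimately have "h s = (\<integral>\<zeta>. g \<zeta> * szego z \<zeta> \<partial>sigma)"
    by (rule sums_unique2[rotated])
  then show ?thesis by (simp add: h_def u(2)[symmetric])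
qed

section \<open>Norm of the kernel, point evaluation and the Poisson inequality\<close>

lemma Cauchy_Schwarz_sigma:
  fixes F G :: "complex ^ 'n \<Rightarrow> complex"
  assumes F: "continuous_on (sphere 0 1) F" and G: "continuous_on (sphere 0 1) G"
  shows "(\<integral>\<zeta>. norm (F \<zeta>) * norm (G \<zeta>) \<partial>sigma)\<^sup>2 \<le> (\<integral>\<zeta>. (norm (F \<zeta>))\<^sup>2 \<partial>sigma) * (\<integral>\<zeta>. (norm (G \<zeta>))\<^sup>2 \<partial>sigma)"
    "(norm (\<integral>\<zeta>. F \<zeta> * G \<zeta> \<partial>sigma))\<^sup>2 \<le> (\<integral>\<zeta>. (norm (F \<zeta>))\<^sup>2 \<partial>sigma) * (\<integral>\<zeta>. (norm (G \<zeta>))\<^sup>2 \<partial>sigma)"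
proof -
  have cont: "continuous_on (sphere 0 1) (\<lambda>\<zeta>. norm (F \<zeta>) * norm (G \<zeta>))"
    "continuous_on (sphere 0 1) (\<lambda>\<zeta>. (norm (F \<zeta>))\<^sup>2)" "continuous_on (sphere 0 1) (\<lambda>\<zeta>. (norm (G \<zeta>))\<^sup>2)"
    by (intro continuous_intros F G)+
  have conv: "(\<integral>\<^sup>+\<zeta>. ennreal (h \<zeta>) \<partial>sigma) = ennreal (\<integral>\<zeta>. h \<zeta> \<partial>sigma)"
    if "continuous_on (sphere 0 1) h" "\<And>\<zeta>. h \<zeta> \<ge> 0" for h :: "complex ^ 'n \<Rightarrow> real"
    using that by (intro nn_integral_eq_integral integrable_sigma_continuous) auto
  have "(\<integral>\<^sup>+\<zeta>. ennreal (norm (F \<zeta>)) * ennreal (norm (G \<zeta>)) \<partial>sigma)\<^sup>2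
      \<le> (\<integral>\<^sup>+\<zeta>. (ennreal (norm (F \<zeta>)))\<^sup>2 \<partial>sigma) * (\<integral>\<^sup>+\<zeta>. (ennreal (norm (G \<zeta>)))\<^sup>2 \<partial>sigma)"
    by (intro Cauchy_Schwarz_nn_integral measurable_compose[OF _ measurable_ennreal]
        measurable_sigma_continuous continuous_intros F G)
  then have "ennreal ((\<integral>\<zeta>. norm (F \<zeta>) * norm (G \<zeta>) \<partial>sigma)\<^sup>2)
      \<le> ennreal ((\<integral>\<zeta>. (norm (F \<zeta>))\<^sup>2 \<partial>sigma) * (\<integral>\<zeta>. (norm (G \<zeta>))\<^sup>2 \<partial>sigma))"
    by (simp add: ennreal_mult[symmetric] ennreal_power conv[OF cont(1)] conv[OF cont(2)] conv[OF cont(3)])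
  then show 1: "(\<integral>\<zeta>. norm (F \<zeta>) * norm (G \<zeta>) \<partial>sigma)\<^sup>2 \<le> (\<integral>\<zeta>. (norm (F \<zeta>))\<^sup>2 \<partial>sigma) * (\<integral>\<zeta>. (norm (G \<zeta>))\<^sup>2 \<partial>sigma)"
    by (simp add: ennreal_le_iff)
  have "norm (\<integral>\<zeta>. F \<zeta> * G \<zeta> \<partial>sigma) \<le> (\<integral>\<zeta>. norm (F \<zeta>) * norm (G \<zeta>) \<partial>sigma)"
    using integral_norm_bound[of sigma "\<lambda>\<zeta>. F \<zeta> * G \<zeta>"] by (simp add: norm_mult)
  then show "(norm (\<integral>\<zeta>. F \<zeta> * G \<zeta> \<partial>sigma))\<^sup>2 \<le> (\<integral>\<zeta>. (norm (F \<zeta>))\<^sup>2 \<partial>sigma) * (\<integral>\<zeta>. (norm (G \<zeta>))\<^sup>2 \<partial>sigma)"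
    using 1 by (meson norm_ge_zero order_trans power_mono)
qed

lemma norm_hermitian_lt_1: "norm z < 1 \<Longrightarrow> norm w \<le> 1 \<Longrightarrow> norm (hermitian z w) < 1"
proof -
  assume *: "norm z < 1" "norm w \<le> 1"
  have "norm z * norm w \<le> norm z * 1" using * by (intro mult_left_mono) auto
  then show ?thesis using norm_hermitian_le[of z w] * by linarith
qed

lemma one_minus_hermitian_nonzero: "norm (hermitian z w) < 1 \<Longrightarrow> 1 - hermitian z w \<noteq> 0"
  by auto

lemma cnj_szego: "cnj (szego z w) = szego w z"
  by (simp add: szego_def cnj_hermitian)

lemma szego_self: "norm z < 1 \<Longrightarrow> szego z z = of_real (1 / (1 - (norm z)\<^sup>2) ^ CARD('n))" for z :: "complex ^ 'n"
  by (simp add: szego_def hermitian_self inverse_eq_divide)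

lemma holo_szego:
  assumes "norm x < 1"
  shows "\<exists>R>1. holo_on (ball 0 R) (\<lambda>z. szego z x)"
proof (intro exI conjI)
  \<comment> \<open>For nonzero \<open>x\<close> any radius strictly between \<open>1\<close> and
    \<open>1 / norm x\<close> would serve; this choice also makes sense for
    \<open>x = 0\<close>.\<close>
  let ?R = "2 / (1 + norm x)"
  show "1 < ?R" using assms by (simp add: field_simps add_pos_nonneg)
  have "1 - hermitian z x \<noteq> 0" if "norm z < ?R" for z
  proof (rule one_minus_hermitian_nonzero)
    have "norm (hermitian z x) \<le> norm z * norm x" by (rule norm_hermitian_le)
    also have "\<dots> \<le> ?R * norm x" using that by (intro mult_right_mono) auto
    also have "\<dots> < 1" using assms by (simp add: field_simps add_pos_nonneg)
    finally show "norm (hermitian z x) < 1" .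
  qed
  then have nz: "(1 - hermitian z x) ^ k \<noteq> 0" if "z \<in> ball 0 ?R" for z k
    using that by simp
  have d: "cdiff (\<lambda>z. 1 - hermitian z x) (*) z" for z
    using cdiff_add[OF cdiff_const[of "(*)" 1] cdiff_mult[OF cdiff_const[of "(*)" "-1"] cdiff_hermitian]]
    by simp
  show "holo_on (ball 0 ?R) (\<lambda>z. szego z x)"
    unfolding holo_on_cdiff szego_def by (intro ballI) (rule cdiff_inverse[OF cdiff_power[OF d] nz])
qed

lemma continuous_on_sphere: "continuous_on (cball 0 1) g \<Longrightarrow> continuous_on (sphere 0 1) g"
  by (rule continuous_on_subset[OF _ sphere_cball])

lemma continuous_on_sphere_holo: "holo_on (ball 0 R) g \<Longrightarrow> R > 1 \<Longrightarrow> continuous_on (cball 0 1) g"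
  by (rule continuous_on_subset[OF holo_on_imp_continuous_on]) auto

lemma continuous_on_szego:
  assumes "norm x < 1"
  shows "continuous_on (cball 0 1) (\<lambda>z. szego z x)"
proof -
  obtain R where "R > 1" "holo_on (ball 0 R) (\<lambda>z. szego z x)" using holo_szego assms by blast
  then show ?thesis using continuous_on_sphere_holo by blast
qed

lemma continuous_on_szego': "norm x < 1 \<Longrightarrow> continuous_on (cball 0 1) (szego x)"
  using continuous_on_cnj[OF continuous_on_szego[of x]] by (simp add: cnj_szego)

text \<open>The reproducing formula applied to the kernel at its own point, where the integrand
  becomes the squared modulus of the kernel.\<close>

lemma integral_szego:
  fixes x :: "complex ^ 'n"
  assumes "norm x < 1"
  shows "(\<integral>\<zeta>. (norm (szego x \<zeta>))\<^sup>2 \<partial>sigma) = 1 / (1 - (norm x)\<^sup>2) ^ CARD('n)"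
proof -
  obtain R where "R > 1" "holo_on (ball 0 R) (\<lambda>z. szego z x)" using holo_szego assms by blast
  from szego_formula[OF this(2,1) assms]
  have *: "szego x x = (\<integral>\<zeta>. szego \<zeta> x * szego x \<zeta> \<partial>sigma)" .
  have "szego \<zeta> x * szego x \<zeta> = of_real ((norm (szego x \<zeta>))\<^sup>2)" for \<zeta>
    by (simp only: complex_norm_square cnj_szego mult.commute)
  with * have "szego x x = (\<integral>\<zeta>. of_real ((norm (szego x \<zeta>))\<^sup>2) \<partial>sigma)" by (simp only:)
  then have "of_real (1 / (1 - (norm x)\<^sup>2) ^ CARD('n)) = complex_of_real (\<integral>\<zeta>. (norm (szego x \<zeta>))\<^sup>2 \<partial>sigma)"
    unfolding szego_self[OF assms] integral_complex_of_real .
  then show ?thesis unfolding of_real_eq_iff by simp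
qed

text \<open>The reproducing formula and the Cauchy-Schwarz inequality; the denominator is the
  squared norm of the kernel.\<close>

lemma point_evaluation_closed:
  fixes g :: "complex ^ 'n \<Rightarrow> complex"
  assumes g: "holo_on (ball 0 R) g" "R > 1" and z: "norm z < 1"
  shows "(norm (g z))\<^sup>2 \<le> (\<integral>\<zeta>. (norm (g \<zeta>))\<^sup>2 \<partial>sigma) / (1 - (norm z)\<^sup>2) ^ CARD('n)"
proof -
  have "(norm (\<integral>\<zeta>. g \<zeta> * szego z \<zeta> \<partial>sigma))\<^sup>2 \<le> (\<integral>\<zeta>. (norm (g \<zeta>))\<^sup>2 \<partial>sigma) * (\<integral>\<zeta>. (norm (szego z \<zeta>))\<^sup>2 \<partial>sigma)"
    by (rule Cauchy_Schwarz_sigma(2)[OF continuous_on_sphere[OF continuous_on_sphere_holo[OF g]]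
        continuous_on_sphere[OF continuous_on_szego'[OF z]]])
  then show ?thesis
    unfolding szego_formula[OF g z, symmetric] integral_szego[OF z] by (simp only: times_divide_eq_right mult_1_right)
qed

text \<open>The Szego formula for \<open>g\<close> times the kernel at \<open>z\<close> represents \<open>g(z)\<close> by the positive Poisson--Szego kernel.\<close>

lemma poisson_inequality:
  fixes g :: "complex ^ 'n \<Rightarrow> complex"
  assumes g: "holo_on (ball 0 R) g" "R > 1" and z: "norm z < 1"
  shows "(norm (g z))\<^sup>2 \<le> (1 - (norm z)\<^sup>2) ^ CARD('n) * (\<integral>\<zeta>. (norm (g \<zeta>))\<^sup>2 * (norm (szego z \<zeta>))\<^sup>2 \<partial>sigma)"
proof -
  define S where "S = 1 / (1 - (norm z)\<^sup>2) ^ CARD('n)"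
  have S: "S > 0" using z by (simp add: S_def abs_square_less_1)
  obtain R' where R': "R' > 1" "holo_on (ball 0 R') (\<lambda>w. szego w z)" using holo_szego z by blast
  have "holo_on (ball 0 (min R R')) (\<lambda>w. g w * szego w z)"
    using g R' by (auto simp: holo_on_cdiff intro!: cdiff_mult)
  from szego_formula[OF this _ z] g R'
  have e1: "g z * of_real S = (\<integral>\<zeta>. (g \<zeta> * szego z \<zeta>) * szego \<zeta> z \<partial>sigma)"
    by (simp add: szego_self[OF z] S_def mult_ac)
  have e2: "(norm (\<integral>\<zeta>. (g \<zeta> * szego z \<zeta>) * szego \<zeta> z \<partial>sigma))\<^sup>2
      \<le> (\<integral>\<zeta>. (norm (g \<zeta> * szego z \<zeta>))\<^sup>2 \<partial>sigma) * (\<integral>\<zeta>. (norm (szego \<zeta> z))\<^sup>2 \<partial>sigma)"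
    by (rule Cauchy_Schwarz_sigma(2)[OF continuous_on_mult[OF
          continuous_on_sphere[OF continuous_on_sphere_holo[OF g]] continuous_on_sphere[OF continuous_on_szego'[OF z]]]
        continuous_on_sphere[OF continuous_on_szego[OF z]]])
  have "norm (szego \<zeta> z) = norm (szego z \<zeta>)" for \<zeta>
    by (metis cnj_szego complex_mod_cnj)
  then have e3: "(\<integral>\<zeta>. (norm (szego \<zeta> z))\<^sup>2 \<partial>sigma) = S"
    unfolding S_def integral_szego[OF z, symmetric] by simp
  have "norm (g z * of_real S) = norm (g z) * S" using S by (simp add: norm_mult)
  then have "(norm (g z))\<^sup>2 * S * S \<le> (\<integral>\<zeta>. (norm (g \<zeta> * szego z \<zeta>))\<^sup>2 \<partial>sigma) * S"
    using e2 unfolding e1[symmetric] e3 by (simp only: power_mult_distrib power2_eq_square mult_ac)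
  then have "(norm (g z))\<^sup>2 * S \<le> (\<integral>\<zeta>. (norm (g \<zeta> * szego z \<zeta>))\<^sup>2 \<partial>sigma)"
    by (rule mult_right_le_imp_le[OF _ S])
  then have "(norm (g z))\<^sup>2 \<le> (\<integral>\<zeta>. (norm (g \<zeta> * szego z \<zeta>))\<^sup>2 \<partial>sigma) / S"
    by (simp only: pos_le_divide_eq[OF S])
  then show ?thesis
    unfolding S_def norm_mult power_mult_distrib divide_divide_eq_right by (simp only: div_by_1 mult.commute)
qed

section \<open>The Hardy space\<close>

definition hmean :: "(complex ^ 'n \<Rightarrow> complex) \<Rightarrow> real \<Rightarrow> real" where
  "hmean f r = (\<integral>\<zeta>. (norm (f (r *\<^sub>R \<zeta>)))\<^sup>2 \<partial>sigma)"

lemma hmean_nonneg: "hmean f r \<ge> 0"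
  by (simp add: hmean_def)

lemma continuous_on_dilate:
  assumes f: "continuous_on unit_ball f" and r: "0 < r" "r < 1"
  shows "continuous_on (cball 0 1) (\<lambda>\<zeta> :: complex ^ 'n. f (r *\<^sub>R \<zeta>))"
proof (rule continuous_on_compose2[OF f])
  show "continuous_on (cball 0 1) (\<lambda>\<zeta> :: complex ^ 'n. r *\<^sub>R \<zeta>)" by (intro continuous_intros)
  have "norm (r *\<^sub>R \<zeta>) < 1" if "norm \<zeta> \<le> 1" for \<zeta> :: "complex ^ 'n"
  proof -
    have "r * norm \<zeta> \<le> r * 1" using r that by (intro mult_left_mono) auto
    then have "r * norm \<zeta> < 1" using r by linarith
    then show ?thesis using r by simp
  qed
  then show "(*\<^sub>R) r ` cball 0 1 \<subseteq> (unit_ball :: (complex ^ 'n) set)" by (auto simp del: norm_scaleR)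
qed

lemma holo_dilate:
  assumes f: "holo_on unit_ball f" and r: "0 < r"
  shows "holo_on (ball 0 (1 / r)) (\<lambda>\<zeta> :: complex ^ 'n. f (r *\<^sub>R \<zeta>))"
  by (rule holo_on_compose[OF f]) (use r in \<open>auto simp: field_simps intro: cdiff_scaleR\<close>)

lemma nn_integral_hmean:
  assumes f: "continuous_on unit_ball f" and r: "0 < r" "r < 1"
  shows "(\<integral>\<^sup>+ \<zeta>. ennreal ((norm (f (r *\<^sub>R \<zeta>)))\<^sup>2) \<partial>sigma) = ennreal (hmean f r)"
  unfolding hmean_def using continuous_on_dilate[OF f r]
  by (intro nn_integral_eq_integral integrable_sigma_continuous continuous_intros)
    (auto elim: continuous_on_subset)

lemma hardy_sq_hmean:
  "continuous_on unit_ball f \<Longrightarrow> hardy_sq f = (SUP r\<in>{0<..<1}. ennreal (hmean f r))"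
  unfolding hardy_sq_sigma by (intro SUP_cong refl nn_integral_hmean) auto

lemma hardy_space_holo: "f \<in> hardy_space \<Longrightarrow> holo_on unit_ball f"
  by (simp add: hardy_space_def)

lemma hardy_space_continuous: "f \<in> hardy_space \<Longrightarrow> continuous_on unit_ball f"
  by (simp add: hardy_space_holo holo_on_imp_continuous_on)

lemma hardy_space_outside: "f \<in> hardy_space \<Longrightarrow> norm z \<ge> 1 \<Longrightarrow> f z = 0"
  by (simp add: hardy_space_def)

lemma hardy_norm_nonneg: "hardy_norm f \<ge> 0"
  by (simp add: hardy_norm_def)

lemma hmean_le:
  assumes "f \<in> hardy_space" "0 < r" "r < 1"
  shows "hmean f r \<le> (hardy_norm f)\<^sup>2"
proof -
  have "ennreal (hmean f r) \<le> hardy_sq f"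
    unfolding hardy_sq_hmean[OF hardy_space_continuous[OF assms(1)]]
    using assms by (intro SUP_upper) auto
  also have "hardy_sq f = ennreal ((hardy_norm f)\<^sup>2)"
    using assms(1) by (simp add: hardy_norm_def hardy_space_def)
  finally show ?thesis by (simp add: ennreal_le_iff)
qed

text \<open>Membership is always obtained from bounds of the means at each fixed
  \<open>r < 1\<close>; the passage to the supremum happens only here.\<close>

lemma hardy_spaceI:
  assumes f: "holo_on unit_ball f" "\<And>z. norm z \<ge> 1 \<Longrightarrow> f z = 0"
    and K: "K \<ge> 0" "\<And>r. 0 < r \<Longrightarrow> r < 1 \<Longrightarrow> hmean f r \<le> K\<^sup>2"
  shows "f \<in> hardy_space" "hardy_norm f \<le> K"
proof -
  have le: "hardy_sq f \<le> ennreal (K\<^sup>2)"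
    unfolding hardy_sq_hmean[OF holo_on_imp_continuous_on[OF f(1)]]
    by (intro SUP_least ennreal_leI K(2)) auto
  then have "hardy_sq f < \<infinity>"
    by (metis ennreal_less_top infinity_ennreal_def order_le_less_trans)
  then show "f \<in> hardy_space" using f by (simp add: hardy_space_def)
  have "enn2real (hardy_sq f) \<le> K\<^sup>2" using le by (intro enn2real_leI) auto
  then show "hardy_norm f \<le> K"
    unfolding hardy_norm_def using K(1) by (simp add: real_le_lsqrt)
qed

text \<open>The dilate of \<open>f\<close> by a radius \<open>r\<close> halfway between
  \<open>\<rho>\<close> and \<open>1\<close> is holomorphic past the closed ball, and
  \<open>z / r\<close> stays in the ball of radius \<open>\<rho> / r < 1\<close>, where the squared
  norm of the kernel is bounded by \<open>S\<close>.\<close>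

lemma hardy_point_evaluation:
  assumes \<rho>: "\<rho> < 1"
  shows "\<exists>C\<ge>0. \<forall>f\<in>hardy_space. \<forall>z :: complex ^ 'n. norm z \<le> \<rho> \<longrightarrow> norm (f z) \<le> C * hardy_norm f"
proof (cases "\<rho> \<ge> 0")
  case True
  define r where "r = (1 + \<rho>) / 2"
  have r: "\<rho> < r" "0 < r" "r < 1" using \<rho> True by (auto simp: r_def)
  define S where "S = 1 / (1 - (\<rho> / r)\<^sup>2) ^ CARD('n)"
  have q: "0 \<le> \<rho> / r" "\<rho> / r < 1" using r True by auto
  then have pos: "1 - (\<rho> / r)\<^sup>2 > 0" by (simp add: abs_square_less_1)
  have "norm (f z) \<le> sqrt S * hardy_norm f" if f: "f \<in> hardy_space" and z: "norm z \<le> \<rho>"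
    for f and z :: "complex ^ 'n"
  proof -
    have nz: "norm (z /\<^sub>R r) \<le> \<rho> / r" using z r by (simp add: field_simps)
    have "(norm (f (r *\<^sub>R (z /\<^sub>R r))))\<^sup>2 \<le> hmean f r / (1 - (norm (z /\<^sub>R r))\<^sup>2) ^ CARD('n)"
      unfolding hmean_def
      using r order_le_less_trans[OF nz q(2)]
      by (intro point_evaluation_closed[OF holo_dilate[OF hardy_space_holo[OF f] r(2)]]) simp_all
    also have "\<dots> \<le> (hardy_norm f)\<^sup>2 / (1 - (\<rho> / r)\<^sup>2) ^ CARD('n)"
      using hmean_le[OF f r(2,3)] nz pos power_mono[OF nz, of 2]
      by (intro frac_le power_mono) auto
    finally have "(norm (f z))\<^sup>2 \<le> S * (hardy_norm f)\<^sup>2" using r by (simp add: S_def)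
    also have "\<dots> = (sqrt S * hardy_norm f)\<^sup>2"
      using pos by (simp add: power_mult_distrib S_def)
    finally show ?thesis
      by (rule power2_le_imp_le) (use pos in \<open>auto simp: S_def hardy_norm_nonneg\<close>)
  qed
  moreover have "sqrt S \<ge> 0" using pos by (simp add: S_def)
  ultimately show ?thesis by blast
next
  case False
  then have "\<not> norm z \<le> \<rho>" for z :: "complex ^ 'n" using norm_ge_zero[of z] by linarith
  then show ?thesis by blast
qed

lemma hardy_norm_pos: "f \<in> hardy_space \<Longrightarrow> norm z < 1 \<Longrightarrow> f z \<noteq> 0 \<Longrightarrow> hardy_norm f > 0"
proof (rule ccontr)
  assume f: "f \<in> hardy_space" and z: "norm z < 1" "f z \<noteq> 0" and "\<not> hardy_norm f > 0"
  then have "hardy_norm f = 0" using hardy_norm_nonneg[of f] by simp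
  moreover obtain C where "norm (f z) \<le> C * hardy_norm f"
    using hardy_point_evaluation[OF z(1)] f by blast
  ultimately show False using z(2) by simp
qed

lemma hardy_space_add:
  assumes f: "f \<in> hardy_space" and g: "g \<in> hardy_space"
  shows "(\<lambda>z. f z + g z) \<in> hardy_space" "hardy_norm (\<lambda>z. f z + g z) \<le> hardy_norm f + hardy_norm g"
proof -
  have h: "holo_on unit_ball (\<lambda>z. f z + g z)"
    using hardy_space_holo[OF f] hardy_space_holo[OF g] by (auto simp: holo_on_cdiff intro!: cdiff_add)
  have out: "norm z \<ge> 1 \<Longrightarrow> f z + g z = 0" for z by (simp add: hardy_space_outside[OF f] hardy_space_outside[OF g])
  have "hmean (\<lambda>z. f z + g z) r \<le> (hardy_norm f + hardy_norm g)\<^sup>2" if r: "0 < r" "r < 1" for r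
  proof -
    let ?F = "\<lambda>\<zeta>. f (r *\<^sub>R \<zeta>)" and ?G = "\<lambda>\<zeta>. g (r *\<^sub>R \<zeta>)"
    have cF: "continuous_on (sphere 0 1) ?F" and cG: "continuous_on (sphere 0 1) ?G"
      using continuous_on_dilate[OF hardy_space_continuous[OF f] r]
        continuous_on_dilate[OF hardy_space_continuous[OF g] r] by (auto elim: continuous_on_subset)
    have "hmean (\<lambda>z. f z + g z) r \<le> (\<integral>\<zeta>. (norm (?F \<zeta>))\<^sup>2 + 2 * (norm (?F \<zeta>) * norm (?G \<zeta>)) + (norm (?G \<zeta>))\<^sup>2 \<partial>sigma)"
      unfolding hmean_def
    proof (rule integral_mono)
      fix \<zeta>
      have "(norm (?F \<zeta> + ?G \<zeta>))\<^sup>2 \<le> (norm (?F \<zeta>) + norm (?G \<zeta>))\<^sup>2"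
        by (intro power_mono norm_triangle_ineq) auto
      then show "(norm (?F \<zeta> + ?G \<zeta>))\<^sup>2 \<le> (norm (?F \<zeta>))\<^sup>2 + 2 * (norm (?F \<zeta>) * norm (?G \<zeta>)) + (norm (?G \<zeta>))\<^sup>2"
        by (simp add: power2_sum)
    qed (intro integrable_sigma_continuous continuous_intros cF cG)+
    also have "\<dots> = hmean f r + 2 * (\<integral>\<zeta>. norm (?F \<zeta>) * norm (?G \<zeta>) \<partial>sigma) + hmean g r"
    proof -
      have i: "integrable sigma (\<lambda>\<zeta>. (norm (?F \<zeta>))\<^sup>2)" "integrable sigma (\<lambda>\<zeta>. 2 * (norm (?F \<zeta>) * norm (?G \<zeta>)))"
        "integrable sigma (\<lambda>\<zeta>. (norm (?G \<zeta>))\<^sup>2)"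
        by (intro integrable_sigma_continuous continuous_intros cF cG)+
      show ?thesis
        unfolding hmean_def Bochner_Integration.integral_add[OF Bochner_Integration.integrable_add[OF i(1,2)] i(3)]
          Bochner_Integration.integral_add[OF i(1,2)] integral_mult_right_zero ..
    qed
    also have "(\<integral>\<zeta>. norm (?F \<zeta>) * norm (?G \<zeta>) \<partial>sigma) \<le> hardy_norm f * hardy_norm g"
    proof (rule power2_le_imp_le)
      have "(\<integral>\<zeta>. norm (?F \<zeta>) * norm (?G \<zeta>) \<partial>sigma)\<^sup>2 \<le> hmean f r * hmean g r"
        unfolding hmean_def by (rule Cauchy_Schwarz_sigma[OF cF cG])
      also have "\<dots> \<le> (hardy_norm f)\<^sup>2 * (hardy_norm g)\<^sup>2"
        by (intro mult_mono hmean_le f g r hmean_nonneg) auto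
      finally show "(\<integral>\<zeta>. norm (?F \<zeta>) * norm (?G \<zeta>) \<partial>sigma)\<^sup>2 \<le> (hardy_norm f * hardy_norm g)\<^sup>2"
        by (simp add: power_mult_distrib)
    qed (simp add: hardy_norm_nonneg)
    finally show ?thesis
      using hmean_le[OF f r] hmean_le[OF g r] by (simp add: power2_sum)
  qed
  from this have *: "\<And>r. 0 < r \<Longrightarrow> r < 1 \<Longrightarrow> hmean (\<lambda>z. f z + g z) r \<le> (hardy_norm f + hardy_norm g)\<^sup>2" .
  have K: "hardy_norm f + hardy_norm g \<ge> 0" by (simp add: hardy_norm_nonneg)
  show "(\<lambda>z. f z + g z) \<in> hardy_space" "hardy_norm (\<lambda>z. f z + g z) \<le> hardy_norm f + hardy_norm g"
    using hardy_spaceI[OF h out K *] by blast+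
qed

lemma hardy_space_scale:
  assumes f: "f \<in> hardy_space"
  shows "(\<lambda>z. c * f z) \<in> hardy_space" "hardy_norm (\<lambda>z. c * f z) \<le> norm c * hardy_norm f"
proof -
  have h: "holo_on unit_ball (\<lambda>z. c * f z)"
    using hardy_space_holo[OF f] by (auto simp: holo_on_cdiff intro!: cdiff_mult cdiff_const)
  have out: "norm z \<ge> 1 \<Longrightarrow> c * f z = 0" for z by (simp add: hardy_space_outside[OF f])
  have "hmean (\<lambda>z. c * f z) r \<le> (norm c * hardy_norm f)\<^sup>2" if r: "0 < r" "r < 1" for r
    using mult_left_mono[OF hmean_le[OF f r], of "(norm c)\<^sup>2"]
    by (simp add: hmean_def norm_mult power_mult_distrib)
  from this have *: "\<And>r. 0 < r \<Longrightarrow> r < 1 \<Longrightarrow> hmean (\<lambda>z. c * f z) r \<le> (norm c * hardy_norm f)\<^sup>2" .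
  have K: "norm c * hardy_norm f \<ge> 0" by (simp add: hardy_norm_nonneg)
  show "(\<lambda>z. c * f z) \<in> hardy_space" "hardy_norm (\<lambda>z. c * f z) \<le> norm c * hardy_norm f"
    using hardy_spaceI[OF h out K *] by blast+
qed

section \<open>Composition with linear maps\<close>

text \<open>Adjointness is stated for functions because block maps, their compositions and their
  powers occur as functions and not as matrices.\<close>

definition adjoint_pair :: "(complex ^ 'n \<Rightarrow> complex ^ 'n) \<Rightarrow> (complex ^ 'n \<Rightarrow> complex ^ 'n) \<Rightarrow> bool" where
  "adjoint_pair L L' \<longleftrightarrow> linear L \<and> linear L' \<and> (\<forall>c v. L (c *s v) = c *s L v) \<and>
     (\<forall>c v. L' (c *s v) = c *s L' v) \<and> (\<forall>v w. hermitian (L v) w = hermitian v (L' w))"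

lemma adjoint_pairD:
  assumes "adjoint_pair L L'"
  shows "linear L" "linear L'" "L (c *s v) = c *s L v" "L' (c *s v) = c *s L' v"
    "hermitian (L v) w = hermitian v (L' w)" "cdiff L ((*s)) z" "cdiff L' ((*s)) z"
    "continuous_on A L" "continuous_on A L'"
  using assms by (auto simp: adjoint_pair_def intro: cdiff_linear linear_continuous_on
      simp flip: linear_conv_bounded_linear)

lemma adjoint_pair_sym: "adjoint_pair L L' \<Longrightarrow> adjoint_pair L' L"
  unfolding adjoint_pair_def by (metis cnj_hermitian)

lemma adjoint_pair_comp: "adjoint_pair L L' \<Longrightarrow> adjoint_pair M M' \<Longrightarrow> adjoint_pair (L \<circ> M) (M' \<circ> L')"
  unfolding adjoint_pair_def by (auto intro: linear_compose)

lemma adjoint_pair_funpow: "adjoint_pair P P \<Longrightarrow> adjoint_pair (P ^^ k) (P ^^ k)"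
proof (induction k)
  case 0
  then show ?case by (simp add: adjoint_pair_def linear_id[unfolded id_def] id_def)
next
  case (Suc k)
  from adjoint_pair_comp[OF Suc.prems Suc.IH[OF Suc.prems]] show ?case
    by (simp add: funpow_Suc_right[symmetric] flip: funpow.simps(2))
qed

lemma adjoint_pair_scale:
  assumes "adjoint_pair L L'"
  shows "adjoint_pair (\<lambda>v. s *\<^sub>R L v) (\<lambda>v. s *\<^sub>R L' v)"
  using assms unfolding adjoint_pair_def
  by (auto intro!: linear_compose_scale_right simp: vec_eq_iff)

lemma adjoint_pair_norm:
  assumes L: "adjoint_pair L L'" and s: "s \<ge> 0" "\<And>v. norm (L v) \<le> s * norm v"
  shows "norm (L' w) \<le> s * norm w"
proof (cases "L' w = 0")
  case False
  have "(norm (L' w))\<^sup>2 = norm (hermitian (L' w) (L' w))"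
    by (simp add: hermitian_self norm_power)
  also have "\<dots> = norm (hermitian (L (L' w)) w)" by (simp only: adjoint_pairD(5)[OF L])
  also have "\<dots> \<le> norm (L (L' w)) * norm w" by (rule norm_hermitian_le)
  also have "\<dots> \<le> s * norm (L' w) * norm w" by (intro mult_right_mono s) auto
  finally have "norm (L' w) * norm (L' w) \<le> norm (L' w) * (s * norm w)"
    by (simp add: power2_eq_square mult_ac)
  then show ?thesis using False by simp
qed (use s in simp)

lemma norm_szego_le:
  fixes z w :: "complex ^ 'n"
  assumes "norm (hermitian z w) \<le> s" "s < 1"
  shows "norm (szego z w) \<le> 1 / (1 - s) ^ CARD('n)"
proof -
  have "1 - s \<le> 1 - norm (hermitian z w)" using assms by simp
  also have "\<dots> \<le> norm (1 - hermitian z w)" using norm_triangle_ineq2[of 1 "hermitian z w"] by simp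
  finally have "(1 - s) ^ CARD('n) \<le> norm (1 - hermitian z w) ^ CARD('n)"
    using assms by (intro power_mono) auto
  moreover have "norm (szego z w) = 1 / norm (1 - hermitian z w) ^ CARD('n)"
    unfolding szego_def norm_inverse norm_power by (rule inverse_eq_divide)
  ultimately show ?thesis using assms by (simp add: frac_le)
qed

lemma Fubini_sigma:
  fixes k :: "complex ^ 'n \<Rightarrow> complex ^ 'm \<Rightarrow> complex"
  assumes k: "(\<lambda>p. k (fst p) (snd p)) \<in> borel_measurable (sigma \<Otimes>\<^sub>M sigma)"
    and C: "\<And>\<zeta> \<eta>. norm \<zeta> = 1 \<Longrightarrow> norm \<eta> = 1 \<Longrightarrow> norm (k \<zeta> \<eta>) \<le> C"
  shows "(\<integral>\<eta>. (\<integral>\<zeta>. k \<zeta> \<eta> \<partial>sigma) \<partial>sigma) = (\<integral>\<zeta>. (\<integral>\<eta>. k \<zeta> \<eta> \<partial>sigma) \<partial>sigma)"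
    "integrable sigma (\<lambda>\<eta>. \<integral>\<zeta>. k \<zeta> \<eta> \<partial>sigma)"
proof -
  interpret P: pair_sigma_finite "sigma :: (complex ^ 'n) measure" "sigma :: (complex ^ 'm) measure" ..
  have fin: "finite_measure ((sigma :: (complex ^ 'n) measure) \<Otimes>\<^sub>M (sigma :: (complex ^ 'm) measure))"
    by (rule finite_measure_pair_measure) unfold_locales
  have int: "integrable (sigma \<Otimes>\<^sub>M sigma) (\<lambda>p. k (fst p) (snd p))"
    by (rule finite_measure.integrable_const_bound[OF fin, of _ C])
      (auto intro!: AE_I2 C k simp: space_pair_measure)
  then show "(\<integral>\<eta>. (\<integral>\<zeta>. k \<zeta> \<eta> \<partial>sigma) \<partial>sigma) = (\<integral>\<zeta>. (\<integral>\<eta>. k \<zeta> \<eta> \<partial>sigma) \<partial>sigma)"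
    by (intro P.Fubini_integral) (simp add: case_prod_beta')
  from int show "integrable sigma (\<lambda>\<eta>. \<integral>\<zeta>. k \<zeta> \<eta> \<partial>sigma)"
    by (intro P.integrable_snd) (simp add: case_prod_beta')
qed

lemma bounded_on_cball:
  fixes g :: "complex ^ 'n \<Rightarrow> complex"
  assumes "continuous_on (cball 0 1) g"
  obtains C where "C \<ge> 0" "\<And>z. norm z \<le> 1 \<Longrightarrow> norm (g z) \<le> C"
proof -
  obtain C where C: "\<And>z. norm z \<le> 1 \<Longrightarrow> norm (g z) \<le> C"
    using compact_imp_bounded[OF compact_continuous_image[OF assms compact_cball]]
    unfolding bounded_iff by (metis imageI mem_cball_0)
  moreover have "C \<ge> 0" using C[of 0] norm_ge_zero[of "g 0"] by (simp del: norm_ge_zero)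
  ultimately show ?thesis using that by blast
qed

text \<open>The kernel satisfies
  \<open>szego (L \<eta>) \<zeta> = szego \<eta> (L' \<zeta>)\<close>. Writing
  \<open>F (L \<eta>)\<close> by the reproducing formula, exchanging the integrals and reading the
  inner one as the reproducing formula for \<open>G\<close> moves \<open>L\<close> to the other
  factor. The strict contraction \<open>s < 1\<close> keeps the kernel bounded for Fubini's
  theorem.\<close>

lemma adjoint_composition:
  fixes F G :: "complex ^ 'n \<Rightarrow> complex"
  assumes L: "adjoint_pair L L'" and s: "0 \<le> s" "s < 1" "\<And>v. norm (L v) \<le> s * norm v"
    and F: "holo_on (ball 0 R) F" "R > 1" and G: "holo_on (ball 0 R') G" "R' > 1"
  shows "(\<integral>\<eta>. F (L \<eta>) * cnj (G \<eta>) \<partial>sigma) = (\<integral>\<zeta>. F \<zeta> * cnj (G (L' \<zeta>)) \<partial>sigma)"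
proof -
  note cF = continuous_on_sphere_holo[OF F] and cG = continuous_on_sphere_holo[OF G]
  obtain CF where CF: "CF \<ge> 0" "\<And>z. norm z \<le> 1 \<Longrightarrow> norm (F z) \<le> CF" using bounded_on_cball[OF cF] by blast
  obtain CG where CG: "CG \<ge> 0" "\<And>z. norm z \<le> 1 \<Longrightarrow> norm (G z) \<le> CG" using bounded_on_cball[OF cG] by blast
  have sL': "norm (L' v) \<le> s * norm v" for v using adjoint_pair_norm[OF L s(1,3)] .
  have mF: "F \<in> borel_measurable sigma" and mG: "G \<in> borel_measurable sigma"
    using cF cG by (auto intro!: measurable_sigma_continuous continuous_on_sphere)
  have mL: "L \<in> borel_measurable borel"
    by (intro borel_measurable_continuous_onI adjoint_pairD(8)[OF L])
  define k where "k \<zeta> \<eta> = F \<zeta> * szego (L \<eta>) \<zeta> * cnj (G \<eta>)" for \<zeta> \<eta>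
  have "(\<integral>\<eta>. F (L \<eta>) * cnj (G \<eta>) \<partial>sigma) = (\<integral>\<eta>. (\<integral>\<zeta>. k \<zeta> \<eta> \<partial>sigma) \<partial>sigma)"
  proof (intro Bochner_Integration.integral_cong refl)
    fix \<eta> :: "complex ^ 'n" assume "\<eta> \<in> space sigma"
    then have "norm (L \<eta>) < 1" using s(3)[of \<eta>] s(2) by simp
    from szego_formula[OF F this] show "F (L \<eta>) * cnj (G \<eta>) = (\<integral>\<zeta>. k \<zeta> \<eta> \<partial>sigma)"
      by (simp add: k_def)
  qed
  also have "\<dots> = (\<integral>\<zeta>. (\<integral>\<eta>. k \<zeta> \<eta> \<partial>sigma) \<partial>sigma)"
  proof (rule Fubini_sigma(1))
    let ?S = "sigma :: (complex ^ 'n) measure"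
    have m1: "(\<lambda>p. fst p) \<in> borel_measurable (?S \<Otimes>\<^sub>M ?S)"
      by (rule measurable_compose[OF measurable_fst measurable_sigma_borel])
    have m2: "(\<lambda>p. L (snd p)) \<in> borel_measurable (?S \<Otimes>\<^sub>M ?S)"
      by (rule measurable_compose[OF measurable_compose[OF measurable_snd measurable_sigma_borel] mL])
    have m3: "(\<lambda>p. F (fst p)) \<in> borel_measurable (?S \<Otimes>\<^sub>M ?S)"
      by (rule measurable_compose[OF measurable_fst mF])
    have mc: "cnj \<in> borel_measurable borel"
      by (intro borel_measurable_continuous_onI continuous_intros)
    have m4: "(\<lambda>p. cnj (G (snd p))) \<in> borel_measurable (?S \<Otimes>\<^sub>M ?S)"
      by (rule measurable_compose[OF measurable_compose[OF measurable_snd mG] mc])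
    show "(\<lambda>p. k (fst p) (snd p)) \<in> borel_measurable (?S \<Otimes>\<^sub>M ?S)"
      unfolding k_def szego_def
      by (intro borel_measurable_times m3 m4 borel_measurable_inverse borel_measurable_power
          borel_measurable_diff borel_measurable_const borel_measurable_hermitian m1 m2)
    fix \<zeta> \<eta> :: "complex ^ 'n" assume *: "norm \<zeta> = 1" "norm \<eta> = 1"
    have "norm (hermitian (L \<eta>) \<zeta>) \<le> s"
      using norm_hermitian_le[of "L \<eta>" \<zeta>] s(3)[of \<eta>] * by simp
    then have "norm (szego (L \<eta>) \<zeta>) \<le> 1 / (1 - s) ^ CARD('n)" using s(2) by (rule norm_szego_le)
    then show "norm (k \<zeta> \<eta>) \<le> CF * (1 / (1 - s) ^ CARD('n)) * CG"
      unfolding k_def norm_mult using CF CG s * by (intro mult_mono) auto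
  qed
  also have "\<dots> = (\<integral>\<zeta>. F \<zeta> * cnj (G (L' \<zeta>)) \<partial>sigma)"
  proof (intro Bochner_Integration.integral_cong refl)
    fix \<zeta> :: "complex ^ 'n" assume "\<zeta> \<in> space sigma"
    then have "norm (L' \<zeta>) < 1" using sL'[of \<zeta>] s(2) by simp
    from szego_formula[OF G this]
    have "cnj (G (L' \<zeta>)) = (\<integral>\<eta>. cnj (G \<eta> * szego (L' \<zeta>) \<eta>) \<partial>sigma)"
      by (simp add: integral_cnj[symmetric] del: complex_cnj_mult)
    moreover have "F \<zeta> * cnj (G \<eta> * szego (L' \<zeta>) \<eta>) = k \<zeta> \<eta>" for \<eta>
    proof -
      have "cnj (szego (L' \<zeta>) \<eta>) = szego (L \<eta>) \<zeta>"
        unfolding cnj_szego by (simp only: szego_def adjoint_pairD(5)[OF L])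
      then show ?thesis by (simp add: k_def)
    qed
    ultimately show "(\<integral>\<eta>. k \<zeta> \<eta> \<partial>sigma) = F \<zeta> * cnj (G (L' \<zeta>))"
      by (simp only: integral_mult_right_zero[symmetric])
  qed
  finally show ?thesis .
qed

text \<open>With \<open>P = L L'\<close> and \<open>y\<^sub>k = \<parallel>F \<circ> P\<^sup>k\<parallel>\<^sup>2\<close> the Cauchy-Schwarz inequality gives
  \<open>y\<^sub>k\<^sup>2 \<le> y\<^sub>0 y\<^sub>2\<^sub>k\<close>, so the geometric decay rate of \<open>y\<close> already holds at the first step, without constant.\<close>

lemma composition_decay:
  fixes F :: "complex ^ 'n \<Rightarrow> complex"
  assumes L: "adjoint_pair L L'" and s: "0 \<le> s" "s < 1" "\<And>v. norm (L v) \<le> s * norm v"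
    and F: "holo_on (ball 0 R) F" "R > 1" and b: "b > 0"
    and C: "\<And>k \<zeta>. norm \<zeta> = 1 \<Longrightarrow> norm (F (((L \<circ> L') ^^ k) \<zeta>)) \<le> C * b ^ k"
  shows "(\<integral>\<eta>. (norm (F (L \<eta>)))\<^sup>2 \<partial>sigma) \<le> b * (\<integral>\<eta>. (norm (F \<eta>))\<^sup>2 \<partial>sigma)"
proof -
  have sL': "norm (L' v) \<le> s * norm v" for v using adjoint_pair_norm[OF L s(1,3)] .
  define P where "P = L \<circ> L'"
  have P: "adjoint_pair P P"
    unfolding P_def by (rule adjoint_pair_comp[OF L adjoint_pair_sym[OF L]])
  have sP: "norm (P v) \<le> s * norm v" for v
  proof -
    have "norm (P v) \<le> s * norm (L' v)" unfolding P_def o_def by (rule s(3))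
    also have "\<dots> \<le> s * (s * norm v)" by (intro mult_left_mono sL' s)
    also have "\<dots> \<le> s * (1 * norm v)" using s by (intro mult_left_mono mult_right_mono) auto
    finally show ?thesis by simp
  qed
  have sPk: "norm ((P ^^ k) v) \<le> norm v" for k v
  proof (induction k)
    case (Suc k)
    have "norm (P ((P ^^ k) v)) \<le> s * norm ((P ^^ k) v)" by (rule sP)
    also have "\<dots> \<le> 1 * norm ((P ^^ k) v)" using s by (intro mult_right_mono) auto
    finally show ?case using Suc by simp
  qed simp
  have sPSk: "norm ((P ^^ Suc k) v) \<le> s * norm v" for k v
  proof -
    have "norm (P ((P ^^ k) v)) \<le> s * norm ((P ^^ k) v)" by (rule sP)
    also have "\<dots> \<le> s * norm v" by (intro mult_left_mono sPk s)
    finally show ?thesis by simp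
  qed
  have hol: "holo_on (ball 0 R) (\<lambda>z. F (M z))" if "adjoint_pair M M'" "\<And>v. norm (M v) \<le> norm v" for M M'
    by (rule holo_on_compose[OF F(1) _ adjoint_pairD(6)[OF that(1)]])
      (simp add: order_le_less_trans[OF that(2)])
  have holP: "holo_on (ball 0 R) (\<lambda>z. F ((P ^^ k) z))" for k
    by (rule hol[OF adjoint_pair_funpow[OF P] sPk])
  have cP: "continuous_on (sphere 0 1) (\<lambda>z. F ((P ^^ k) z))" for k
    by (rule continuous_on_sphere[OF continuous_on_sphere_holo[OF holP F(2)]])
  have cF: "continuous_on (sphere 0 1) F" by (rule continuous_on_sphere[OF continuous_on_sphere_holo[OF F]])
  define y where "y k = (\<integral>\<eta>. (norm (F ((P ^^ k) \<eta>)))\<^sup>2 \<partial>sigma)" for k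
  have y_nonneg: "y k \<ge> 0" for k by (simp add: y_def)
  have sq: "complex_of_real (\<integral>\<eta>. (norm (H \<eta>))\<^sup>2 \<partial>sigma) = (\<integral>\<eta>. H \<eta> * cnj (H \<eta>) \<partial>sigma)"
    for H :: "complex ^ 'n \<Rightarrow> complex"
    unfolding integral_complex_of_real[symmetric] by (simp only: complex_norm_square)
  have CS: "x\<^sup>2 \<le> y 0 * y k" if "complex_of_real x = (\<integral>\<zeta>. F \<zeta> * cnj (F ((P ^^ k) \<zeta>)) \<partial>sigma)" for x k
  proof -
    have "x\<^sup>2 = (norm (complex_of_real x))\<^sup>2" by simp
    also have "\<dots> \<le> (\<integral>\<zeta>. (norm (F \<zeta>))\<^sup>2 \<partial>sigma) * (\<integral>\<zeta>. (norm (cnj (F ((P ^^ k) \<zeta>))))\<^sup>2 \<partial>sigma)"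
      unfolding that by (rule Cauchy_Schwarz_sigma(2)[OF cF continuous_on_cnj[OF cP]])
    finally show ?thesis by (simp add: y_def)
  qed
  have double: "(y (Suc k))\<^sup>2 \<le> y 0 * y (2 * Suc k)" for k
  proof (rule CS)
    have "complex_of_real (y (Suc k)) = (\<integral>\<eta>. F ((P ^^ Suc k) \<eta>) * cnj (F ((P ^^ Suc k) \<eta>)) \<partial>sigma)"
      unfolding y_def by (rule sq)
    also have "\<dots> = (\<integral>\<zeta>. F \<zeta> * cnj (F ((P ^^ Suc k) ((P ^^ Suc k) \<zeta>))) \<partial>sigma)"
      by (rule adjoint_composition[OF adjoint_pair_funpow[OF P] s(1,2) sPSk F holP F(2)])
    finally show "complex_of_real (y (Suc k)) = (\<integral>\<zeta>. F \<zeta> * cnj (F ((P ^^ (2 * Suc k)) \<zeta>)) \<partial>sigma)"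
      by (simp only: mult_2 funpow_add o_apply)
  qed
  \<comment> \<open>The adjoint moves \<open>L\<close> to the other side: the squared norm of
    \<open>F \<circ> L\<close> is the pairing of \<open>F\<close> with \<open>F \<circ> P\<close>,
    which ties it to \<open>y 1\<close>.\<close>
  have first: "(\<integral>\<eta>. (norm (F (L \<eta>)))\<^sup>2 \<partial>sigma)\<^sup>2 \<le> y 0 * y 1"
  proof (rule CS)
    have nL: "norm (L v) \<le> norm v" for v
      by (rule order_trans[OF s(3)]) (use mult_right_mono[of s 1 "norm v"] s in simp)
    have "complex_of_real (\<integral>\<eta>. (norm (F (L \<eta>)))\<^sup>2 \<partial>sigma) = (\<integral>\<eta>. F (L \<eta>) * cnj (F (L \<eta>)) \<partial>sigma)"
      by (rule sq)
    also have "\<dots> = (\<integral>\<zeta>. F \<zeta> * cnj (F (L (L' \<zeta>))) \<partial>sigma)"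
      by (rule adjoint_composition[OF L s F hol[OF L nL] F(2)])
    finally show "complex_of_real (\<integral>\<eta>. (norm (F (L \<eta>)))\<^sup>2 \<partial>sigma) = (\<integral>\<zeta>. F \<zeta> * cnj (F ((P ^^ 1) \<zeta>)) \<partial>sigma)"
      by (simp add: P_def)
  qed
  have iter: "y 1 ^ 2 ^ j \<le> y 0 ^ (2 ^ j - 1) * y (2 ^ j)" for j
  proof (induction j)
    case (Suc j)
    have "y 1 ^ 2 ^ Suc j = (y 1 ^ 2 ^ j)\<^sup>2" by (simp add: power_mult[symmetric] mult.commute)
    also have "\<dots> \<le> (y 0 ^ (2 ^ j - 1) * y (2 ^ j))\<^sup>2"
      by (intro power_mono Suc zero_le_power y_nonneg)
    also have "\<dots> = y 0 ^ (2 * (2 ^ j - 1)) * (y (2 ^ j))\<^sup>2"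
      by (simp add: power_mult_distrib power_mult[symmetric] mult.commute)
    also have "\<dots> \<le> y 0 ^ (2 * (2 ^ j - 1)) * (y 0 * y (2 ^ Suc j))"
    proof (intro mult_left_mono zero_le_power y_nonneg)
      have "Suc (2 ^ j - 1) = 2 ^ j" by simp
      then show "(y (2 ^ j))\<^sup>2 \<le> y 0 * y (2 ^ Suc j)" using double[of "2 ^ j - 1"] by (simp only: power_Suc)
    qed
    also have "\<dots> = y 0 ^ (Suc (2 * (2 ^ j - 1))) * y (2 ^ Suc j)" by simp
    also have "Suc (2 * (2 ^ j - 1)) = 2 ^ Suc j - 1"
    proof -
      have "1 \<le> (2 :: nat) ^ j" by simp
      then show ?thesis unfolding power_Suc by linarith
    qed
    finally show ?case .
  qed simp
  have y_le: "y k \<le> C\<^sup>2 * (b\<^sup>2) ^ k" for k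
  proof -
    have "y k \<le> (\<integral>\<eta>. (C * b ^ k)\<^sup>2 \<partial>(sigma :: (complex ^ 'n) measure))"
      unfolding y_def
      by (intro integral_mono integrable_sigma_continuous continuous_intros cP power_mono)
        (simp_all add: C P_def)
    also have "\<dots> = C\<^sup>2 * (b\<^sup>2) ^ k"
      by (simp add: power_mult_distrib power_mult[symmetric] mult.commute)
    finally show ?thesis .
  qed
  have "y 1 \<le> b\<^sup>2 * y 0"
  proof (cases "y 0 = 0")
    case True
    then have "y 1 ^ 2 ^ 1 \<le> 0" using iter[of 1] by simp
    then show ?thesis using True by simp
  next
    case False
    then have y0: "y 0 > 0" using y_nonneg[of 0] by simp
    \<comment> \<open>The factor by which \<open>y 1\<close> exceeds the desired bound. Its powers
      of exponent \<open>2 ^ j\<close> stay below a fixed number, so it is at most \<open>1\<close>;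
      this is where the constant \<open>C\<close> disappears.\<close>
    define q where "q = y 1 / (b\<^sup>2 * y 0)"
    have q0: "q \<ge> 0" using y0 b y_nonneg by (simp add: q_def)
    have "q ^ 2 ^ j \<le> C\<^sup>2 / y 0" for j
    proof -
      have "y 1 ^ 2 ^ j \<le> y 0 ^ (2 ^ j - 1) * (C\<^sup>2 * (b\<^sup>2) ^ 2 ^ j)"
        by (rule order_trans[OF iter[of j] mult_left_mono[OF y_le]]) (use y0 in simp)
      then have "y 1 ^ 2 ^ j * y 0 \<le> (y 0 ^ (2 ^ j - 1) * y 0) * (C\<^sup>2 * (b\<^sup>2) ^ 2 ^ j)"
        using mult_right_mono[of "y 1 ^ 2 ^ j" _ "y 0"] y0 by (simp add: mult_ac)
      also have "y 0 ^ (2 ^ j - 1) * y 0 = y 0 ^ 2 ^ j"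
        by (metis One_nat_def Suc_pred pos2 power_Suc2 zero_less_power)
      finally show ?thesis
        using y0 b by (simp add: q_def power_divide power_mult_distrib field_simps)
    qed
    then have bdd: "q ^ 2 ^ j \<le> C\<^sup>2 / y 0" for j .
    have "q \<le> 1"
    proof (rule ccontr)
      assume "\<not> q \<le> 1"
      then obtain n where n: "C\<^sup>2 / y 0 < q ^ n" using real_arch_pow[of q "C\<^sup>2 / y 0"] by auto
      have "q ^ n \<le> q ^ 2 ^ n" using \<open>\<not> q \<le> 1\<close> by (intro power_increasing) (auto intro: less_imp_le)
      then show False using n bdd[of n] by simp
    qed
    then show ?thesis using y0 b by (simp add: q_def field_simps)
  qed
  then have "(\<integral>\<eta>. (norm (F (L \<eta>)))\<^sup>2 \<partial>sigma)\<^sup>2 \<le> (b * y 0)\<^sup>2"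
    using first mult_left_mono[of "y 1" "b\<^sup>2 * y 0" "y 0"] y_nonneg[of 0]
    by (simp add: power2_eq_square mult_ac)
  then have "(\<integral>\<eta>. (norm (F (L \<eta>)))\<^sup>2 \<partial>sigma) \<le> b * y 0"
    by (rule power2_le_imp_le) (use b y_nonneg in simp)
  then show ?thesis by (simp add: y_def)
qed

lemma comp_op_holo:
  assumes f: "f \<in> hardy_space" and L: "\<And>z. norm z < 1 \<Longrightarrow> norm (L z) < 1" "\<And>z. norm z < 1 \<Longrightarrow> cdiff L ((*s)) z"
  shows "holo_on unit_ball (comp_op L f)" "norm z \<ge> 1 \<Longrightarrow> comp_op L f z = 0"
proof -
  have "holo_on unit_ball (\<lambda>z. f (L z))"
    by (rule holo_on_compose[OF hardy_space_holo[OF f]]) (use L in auto)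
  then show "holo_on unit_ball (comp_op L f)"
    by (rule holo_on_transform) (auto simp: comp_op_def)
qed (simp add: comp_op_def)

text \<open>Write \<open>r = r' * s\<close> with both factors below \<open>1\<close>: the dilate of
  \<open>f\<close> by \<open>r'\<close> is holomorphic past the closed ball, and \<open>L\<close>
  scaled by \<open>s\<close> is a strict contraction. The powers of \<open>s\<close> that arise in
  the iterates are absorbed by the parameter \<open>t\<close> of the hypothesis.\<close>

lemma comp_op_linear_decay:
  assumes f: "f \<in> hardy_space" and L: "adjoint_pair L L'" "\<And>v. norm (L v) \<le> norm v" and b: "b > 0"
    and C: "\<And>r. 0 < r \<Longrightarrow> r < 1 \<Longrightarrow>
      \<exists>C. \<forall>k \<zeta> t. norm \<zeta> = 1 \<longrightarrow> 0 \<le> t \<longrightarrow> t \<le> 1 \<longrightarrow> norm (f ((r * t) *\<^sub>R ((L \<circ> L') ^^ k) \<zeta>)) \<le> C * b ^ k"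
  shows "comp_op L f \<in> hardy_space" "hardy_norm (comp_op L f) \<le> sqrt b * hardy_norm f"
proof -
  have L': "\<And>v. norm (L' v) \<le> norm v" using adjoint_pair_norm[OF L(1), of 1] L(2) by simp
  have "hmean (comp_op L f) r \<le> (sqrt b * hardy_norm f)\<^sup>2" if r: "0 < r" "r < 1" for r
  proof -
    define s where "s = (1 + r) / 2"
    have s: "0 < s" "s < 1" "r < s" using r by (auto simp: s_def)
    define r' where "r' = r / s"
    have r': "0 < r'" "r' < 1" "r' * s = r" using s r by (auto simp: r'_def)
    obtain C where C: "\<And>k \<zeta> t. norm \<zeta> = 1 \<Longrightarrow> 0 \<le> t \<Longrightarrow> t \<le> 1 \<Longrightarrow> norm (f ((r' * t) *\<^sub>R ((L \<circ> L') ^^ k) \<zeta>)) \<le> C * b ^ k"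
      using C[OF r'(1,2)] by blast
    define F where "F = (\<lambda>z. f (r' *\<^sub>R z))"
    let ?L = "\<lambda>v. s *\<^sub>R L v" and ?L' = "\<lambda>v. s *\<^sub>R L' v"
    have P: "((?L \<circ> ?L') ^^ k) v = (s\<^sup>2 ^ k) *\<^sub>R ((L \<circ> L') ^^ k) v" for k v
    proof (induction k)
      case (Suc k)
      show ?case
        unfolding funpow.simps(2) o_apply Suc[unfolded o_def]
        using Suc by (simp add: linear_scale[OF adjoint_pairD(1)[OF L(1)]] linear_scale[OF adjoint_pairD(2)[OF L(1)]]
            power2_eq_square mult_ac o_def)
    qed simp
    have "(\<integral>\<eta>. (norm (F (?L \<eta>)))\<^sup>2 \<partial>sigma) \<le> b * (\<integral>\<eta>. (norm (F \<eta>))\<^sup>2 \<partial>sigma)"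
    proof (rule composition_decay[OF adjoint_pair_scale[OF L(1)] _ s(2) _ _ _ b])
      show "holo_on (ball 0 (1 / r')) F"
        unfolding F_def by (rule holo_dilate[OF hardy_space_holo[OF f] r'(1)])
      show "1 < 1 / r'" using r' by simp
      show "norm (s *\<^sub>R L v) \<le> s * norm v" for v using L(2)[of v] s by (simp add: mult_left_mono)
      show "norm (F (((?L \<circ> ?L') ^^ k) \<zeta>)) \<le> C * b ^ k" if "norm \<zeta> = 1" for k \<zeta>
        using C[OF that, of "(s\<^sup>2) ^ k" k] s unfolding P F_def
        by (simp add: power_le_one power2_eq_square mult_le_one)
    qed (use s in auto)
    also have "(\<integral>\<eta>. (norm (F (?L \<eta>)))\<^sup>2 \<partial>sigma) = hmean (comp_op L f) r"
      unfolding hmean_def F_def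
      using r r' by (intro Bochner_Integration.integral_cong refl)
        (simp add: comp_op_def linear_scale[OF adjoint_pairD(1)[OF L(1)]])
    also have "(\<integral>\<eta>. (norm (F \<eta>))\<^sup>2 \<partial>sigma) = hmean f r'" by (simp add: hmean_def F_def)
    also have "b * hmean f r' \<le> b * (hardy_norm f)\<^sup>2"
      using hmean_le[OF f r'(1,2)] b by simp
    finally show ?thesis using b by (simp add: power_mult_distrib)
  qed
  note * = this
  have nL: "norm (L z) < 1" if "norm z < 1" for z using L(2)[of z] that by simp
  note hol = comp_op_holo[OF f nL adjoint_pairD(6)[OF L(1)]]
  have K: "0 \<le> sqrt b * hardy_norm f" using b by (simp add: hardy_norm_nonneg)
  show "comp_op L f \<in> hardy_space" by (rule hardy_spaceI(1)[OF hol K *])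
  show "hardy_norm (comp_op L f) \<le> sqrt b * hardy_norm f" by (rule hardy_spaceI(2)[OF hol K *])
qed

text \<open>The case \<open>b = 1\<close> of the decay estimate: the iterates of
  \<open>L \<circ> L'\<close> stay in the closed ball, where the dilate of \<open>f\<close> is
  bounded.\<close>

theorem comp_op_contraction:
  assumes f: "f \<in> hardy_space" and L: "adjoint_pair L L'" "\<And>v. norm (L v) \<le> norm v"
  shows "comp_op L f \<in> hardy_space" "hardy_norm (comp_op L f) \<le> hardy_norm f"
proof -
  have L': "\<And>v. norm (L' v) \<le> norm v" using adjoint_pair_norm[OF L(1), of 1] L(2) by simp
  have Pk: "norm (((L \<circ> L') ^^ k) v) \<le> norm v" for k v
    by (induction k) (auto intro: order_trans[OF L(2)] order_trans[OF L'])
  have *: "\<exists>C. \<forall>k \<zeta> t. norm \<zeta> = 1 \<longrightarrow> 0 \<le> t \<longrightarrow> t \<le> 1 \<longrightarrow> norm (f ((r * t) *\<^sub>R ((L \<circ> L') ^^ k) \<zeta>)) \<le> C * 1 ^ k"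
    if r: "0 < r" "r < 1" for r
  proof -
    obtain C where C: "\<And>z. norm z \<le> 1 \<Longrightarrow> norm (f (r *\<^sub>R z)) \<le> C"
      using bounded_on_cball[OF continuous_on_dilate[OF hardy_space_continuous[OF f] r]] by blast
    have "norm (f ((r * t) *\<^sub>R ((L \<circ> L') ^^ k) \<zeta>)) \<le> C * 1 ^ k" if "norm \<zeta> = 1" "0 \<le> t" "t \<le> 1" for k \<zeta> t
    proof -
      have "norm (t *\<^sub>R ((L \<circ> L') ^^ k) \<zeta>) \<le> 1"
        using Pk[of k \<zeta>] that by (simp add: mult_le_one)
      from C[OF this] show ?thesis by simp
    qed
    then show ?thesis by blast
  qed
  show "comp_op L f \<in> hardy_space" "hardy_norm (comp_op L f) \<le> hardy_norm f"
    using comp_op_linear_decay[OF f L zero_less_one *] by simp_all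
qed

section \<open>Series in the Hardy space\<close>

lemma slice_derivative:
  fixes f :: "complex ^ 'n \<Rightarrow> complex"
  assumes "(f has_derivative D) (at z)" "\<And>c v. D (c *s v) = c * D v"
  shows "((\<lambda>x. f (z + x *s v)) has_field_derivative D v) (at 0)"
proof -
  have "((\<lambda>x :: complex. x *s v) has_derivative (\<lambda>h. h *s v)) (at 0)"
    by (rule bounded_linear.has_derivative[OF bounded_bilinear.bounded_linear_left[OF bounded_bilinear_smult]
          has_derivative_ident])
  from has_derivative_add[OF has_derivative_const this, of z]
  have "((\<lambda>x. z + x *s v) has_derivative (\<lambda>h. h *s v)) (at 0)" by simp
  moreover have "(f has_derivative D) (at (z + 0 *s v))" using assms(1) by simp
  ultimately have "((\<lambda>x. f (z + x *s v)) has_derivative (\<lambda>h. D (h *s v))) (at 0)"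
    by (rule has_derivative_compose)
  then show ?thesis by (simp add: has_field_derivative_def assms(2) mult_commute_abs)
qed

text \<open>The one-variable Cauchy inequality, on the complex line through \<open>z\<close> in the
  direction of \<open>h\<close> with the direction vector scaled to length
  \<open>\<delta>\<close>.\<close>

lemma cauchy_estimate:
  assumes f: "holo_on unit_ball f" and D: "(f has_derivative D) (at z)" "\<And>c v. D (c *s v) = c * D v"
    and \<delta>: "\<delta> > 0" "norm z + \<delta> \<le> \<rho>" "\<rho> < 1" and B: "\<And>w. norm w \<le> \<rho> \<Longrightarrow> norm (f w) \<le> B"
  shows "norm (D h) \<le> B / \<delta> * norm h"
proof (cases "h = 0")
  case True
  then show ?thesis using D(2)[of 0 0] by simp
next
  case False
  define v where "v = (of_real (\<delta> / norm h) :: complex) *s h"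
  have nv: "norm v = \<delta>" using False \<delta> by (simp add: v_def norm_divide)
  let ?\<phi> = "\<lambda>x. f (z + x *s v)"
  have nz: "norm (z + x *s v) \<le> \<rho>" if "norm x \<le> 1" for x
  proof -
    have "norm (z + x *s v) \<le> norm z + norm x * \<delta>"
      using norm_triangle_ineq[of z "x *s v"] by (simp add: nv)
    also have "norm x * \<delta> \<le> 1 * \<delta>" using that \<delta> by (intro mult_right_mono) auto
    finally show ?thesis using \<delta> by simp
  qed
  then have "?\<phi> holomorphic_on cball 0 1"
    using \<delta>(3) by (intro holo_slice[OF f]) (auto intro: order_le_less_trans)
  then have "norm ((deriv ^^ 1) ?\<phi> 0) \<le> fact 1 * B / 1 ^ 1"
    by (intro Cauchy_inequality) (auto intro!: B nz holomorphic_on_imp_continuous_on elim: holomorphic_on_subset)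
  moreover have "deriv ?\<phi> 0 = D v" by (rule DERIV_imp_deriv[OF slice_derivative[OF D]])
  ultimately have "norm (D v) \<le> B" by simp
  moreover have "D v = of_real (\<delta> / norm h) * D h" unfolding v_def by (rule D(2))
  ultimately have "\<delta> / norm h * norm (D h) \<le> B" using \<delta> by (simp add: norm_mult norm_divide)
  then show ?thesis using False \<delta> by (simp add: field_simps)
qed

text \<open>Cauchy's estimate turns the geometric bound for the terms on a larger ball into one for
  their derivatives near \<open>z0\<close>, so the derivatives converge uniformly and the series may
  be differentiated term by term.\<close>

lemma holo_series:
  fixes f :: "nat \<Rightarrow> complex ^ 'n \<Rightarrow> complex"
  assumes f: "\<And>j. holo_on unit_ball (f j)" and q: "0 \<le> q" "q < 1"
    and M: "\<And>\<rho>. \<rho> < 1 \<Longrightarrow> \<exists>M. \<forall>j z. norm z \<le> \<rho> \<longrightarrow> norm (f j z) \<le> M * q ^ j"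
  shows "holo_on unit_ball (\<lambda>z. \<Sum>j. f j z)"
  unfolding holo_on_def
proof
  fix z0 :: "complex ^ 'n" assume "z0 \<in> unit_ball"
  then have z0: "norm z0 < 1" by simp
  define \<rho> where "\<rho> = (1 + norm z0) / 2"
  define \<delta> where "\<delta> = (1 - norm z0) / 4"
  have \<rho>: "\<rho> < 1" "\<delta> > 0" "norm z0 + 2 * \<delta> \<le> \<rho>" using z0 by (auto simp: \<rho>_def \<delta>_def field_simps)
  obtain M where M: "\<And>j z. norm z \<le> \<rho> \<Longrightarrow> norm (f j z) \<le> M * q ^ j" using M[OF \<rho>(1)] by blast
  let ?S = "ball z0 \<delta>"
  have S: "norm z + \<delta> \<le> \<rho>" if "z \<in> ?S" for z
    using that \<rho> norm_triangle_ineq2[of z z0] by (simp add: dist_norm norm_minus_commute)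
  have sub: "norm z < 1" if "z \<in> ?S" for z using S[OF that] \<rho> by simp
  have "\<forall>j z. \<exists>D. z \<in> ?S \<longrightarrow> (f j has_derivative D) (at z) \<and> (\<forall>c v. D (c *s v) = c * D v)"
    using f sub unfolding holo_on_def by (metis mem_ball_0)
  then obtain D where D: "\<And>j z. z \<in> ?S \<Longrightarrow> (f j has_derivative D j z) (at z)"
    "\<And>j z c v. z \<in> ?S \<Longrightarrow> D j z (c *s v) = c * D j z v" by metis
  have D_le: "norm (D j z h) \<le> M / \<delta> * norm h * q ^ j" if "z \<in> ?S" for j z h
    using cauchy_estimate[OF f D(1)[OF that] D(2)[OF that] \<rho>(2) S[OF that] \<rho>(1) M, where h = h] by (simp add: mult_ac)
  have geo: "summable (\<lambda>j. K * q ^ j)" for K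
    using q by (intro summable_mult summable_geometric) auto
  have sD: "summable (\<lambda>j. D j z h)" if "z \<in> ?S" for z h
    by (rule summable_comparison_test'[OF geo D_le[OF that]])
  have M0: "M \<ge> 0"
    using order_trans[OF norm_ge_zero M[of z0 0]] \<rho> by simp
  define D' where "D' z h = (\<Sum>j. D j z h)" for z h
  have "\<exists>g. \<forall>x\<in>?S. (\<lambda>n. f n x) sums g x \<and> (g has_derivative D' x) (at x within ?S)"
  proof (rule has_derivative_series)
    show "(f n has_derivative D n x) (at x within ?S)" if "x \<in> ?S" for n x
      using D(1)[OF that] by (rule has_derivative_at_withinI)
    show "\<forall>\<^sub>F n in sequentially. \<forall>x\<in>?S. \<forall>h. norm ((\<Sum>i<n. D i x h) - D' x h) \<le> e * norm h" if e: "e > 0" for e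
    proof -
      have "(\<lambda>n. M / \<delta> * (1 / (1 - q)) * q ^ n) \<longlonglongrightarrow> M / \<delta> * (1 / (1 - q)) * 0"
        using q by (intro tendsto_intros) auto
      then have "\<forall>\<^sub>F n in sequentially. M / \<delta> * (1 / (1 - q)) * q ^ n < e"
        by (rule order_tendstoD) (use e in simp)
      then show ?thesis
      proof eventually_elim
        case (elim n)
        show ?case
        proof (intro ballI allI)
          fix x h assume x: "x \<in> ?S"
          have sh: "summable (\<lambda>j. D (j + n) x h)" using sD[OF x] by (rule summable_ignore_initial_segment)
          have "D' x h = (\<Sum>j. D (j + n) x h) + (\<Sum>i<n. D i x h)"
            unfolding D'_def by (rule suminf_split_initial_segment[OF sD[OF x]])
          then have "norm ((\<Sum>i<n. D i x h) - D' x h) = norm (\<Sum>j. D (j + n) x h)" by simp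
          also have "\<dots> \<le> (\<Sum>j. M / \<delta> * norm h * q ^ n * q ^ j)"
          proof (rule norm_suminf_le[OF _ geo])
            show "norm (D (j + n) x h) \<le> M / \<delta> * norm h * q ^ n * q ^ j" for j
              using D_le[OF x, of "j + n" h] by (simp add: power_add mult_ac)
          qed
          also have "\<dots> = (M / \<delta> * (1 / (1 - q)) * q ^ n) * norm h"
            using q by (subst suminf_mult) (auto simp: suminf_geometric mult_ac intro!: summable_geometric)
          also have "\<dots> \<le> e * norm h" using elim by (intro mult_right_mono) auto
          finally show "norm ((\<Sum>i<n. D i x h) - D' x h) \<le> e * norm h" .
        qed
      qed
    qed
    show "z0 \<in> ?S" using \<rho> by simp
    show "(\<lambda>n. f n z0) sums (\<Sum>j. f j z0)"
      by (intro summable_sums summable_comparison_test'[OF geo M]) (use \<rho> in simp)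
  qed simp
  then obtain g where g: "\<And>x. x \<in> ?S \<Longrightarrow> (\<lambda>n. f n x) sums g x"
    "\<And>x. x \<in> ?S \<Longrightarrow> (g has_derivative D' x) (at x within ?S)" by blast
  have z0S: "z0 \<in> ?S" using \<rho> by simp
  have "(g has_derivative D' z0) (at z0)" using g(2)[OF z0S] unfolding at_within_open[OF z0S open_ball] .
  then have "((\<lambda>z. \<Sum>j. f j z) has_derivative D' z0) (at z0)"
    by (rule has_derivative_transform_within_open[OF _ open_ball z0S]) (rule sums_unique[OF g(1)])
  moreover have "D' z0 (c *s v) = c * D' z0 v" for c v
    unfolding D'_def D(2)[OF z0S] by (rule suminf_mult[OF sD[OF z0S]])
  ultimately show "\<exists>D. ((\<lambda>z. \<Sum>j. f j z) has_derivative D) (at z0) \<and> (\<forall>c v. D (c *s v) = c * D v)"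
    by blast
qed

text \<open>The form in which completeness of the space enters. Point evaluation gives locally
  uniform geometric bounds, hence a holomorphic sum; the partial sums obey the norm bound, which
  dominated convergence carries over to the mean at each \<open>r\<close>.\<close>

theorem hardy_series:
  fixes f :: "nat \<Rightarrow> complex ^ 'n \<Rightarrow> complex"
  assumes f: "\<And>j. f j \<in> hardy_space" and q: "0 \<le> q" "q < 1" and C: "\<And>j. hardy_norm (f j) \<le> C * q ^ j"
  shows "(\<lambda>z. \<Sum>j. f j z) \<in> hardy_space" "hardy_norm (\<lambda>z. \<Sum>j. f j z) \<le> C / (1 - q)"
    "summable (\<lambda>j. f j z)"
proof -
  let ?g = "\<lambda>z. \<Sum>j. f j z"
  have C0: "C \<ge> 0" using order_trans[OF hardy_norm_nonneg C[of 0]] by simp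
  have geo: "summable (\<lambda>j. K * q ^ j)" for K
    using q by (intro summable_mult summable_geometric) auto
  have M: "\<exists>M\<ge>0. \<forall>j z. norm z \<le> \<rho> \<longrightarrow> norm (f j z) \<le> M * q ^ j" if \<rho>: "\<rho> < 1" for \<rho>
  proof -
    obtain K where K: "K \<ge> 0" "\<And>f z. f \<in> hardy_space \<Longrightarrow> norm (z :: complex ^ 'n) \<le> \<rho> \<Longrightarrow> norm (f z) \<le> K * hardy_norm f"
      using hardy_point_evaluation[OF \<rho>] by blast
    have "norm (f j z) \<le> K * C * q ^ j" if "norm z \<le> \<rho>" for j z
      using K(2)[OF f that, of j] mult_left_mono[OF C[of j] K(1)] by (simp add: mult.assoc)
    moreover have "K * C \<ge> 0" using K(1) C0 by simp
    ultimately show ?thesis by blast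
  qed
  show summ: "summable (\<lambda>j. f j z)" for z
  proof (cases "norm z < 1")
    case True
    then obtain M where "\<And>j. norm (f j z) \<le> M * q ^ j" using M[OF True] by blast
    then show ?thesis by (rule summable_comparison_test'[OF geo])
  next
    case False
    then show ?thesis using hardy_space_outside[OF f] by simp
  qed
  have hol: "holo_on unit_ball ?g"
    by (rule holo_series[OF hardy_space_holo[OF f] q]) (use M in blast)
  have out: "?g z = 0" if "norm z \<ge> 1" for z using hardy_space_outside[OF f that] by simp
  have partial: "(\<lambda>z. \<Sum>j<n. f j z) \<in> hardy_space \<and> hardy_norm (\<lambda>z. \<Sum>j<n. f j z) \<le> (\<Sum>j<n. C * q ^ j)" for n
  proof (induction n)
    case 0
    show ?case using hardy_space_scale[OF f[of 0], of 0] by simp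
  next
    case (Suc n)
    then show ?case
      using hardy_space_add[OF conjunct1[OF Suc] f[of n]] C[of n] by simp
  qed
  have sum_le: "(\<Sum>j<n. C * q ^ j) \<le> C / (1 - q)" for n
  proof -
    have "(\<Sum>j<n. C * q ^ j) \<le> (\<Sum>j. C * q ^ j)"
      by (rule sum_le_suminf[OF geo]) (use C0 q in auto)
    also have "\<dots> = C / (1 - q)"
      using q by (subst suminf_mult) (auto simp: suminf_geometric intro!: summable_geometric)
    finally show ?thesis .
  qed
  have K: "0 \<le> C / (1 - q)" using C0 q by simp
  have "hmean ?g r \<le> (C / (1 - q))\<^sup>2" if r: "0 < r" "r < 1" for r
  proof -
    obtain M where M0: "M \<ge> 0" and M: "\<And>j z. norm z \<le> r \<Longrightarrow> norm (f j z) \<le> M * q ^ j"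
      using M[OF r(2)] by blast
    have nr: "norm (r *\<^sub>R \<zeta>) \<le> r" if "norm \<zeta> = 1" for \<zeta> :: "complex ^ 'n" using that r by simp
    let ?S = "\<lambda>n z. \<Sum>j<n. f j z"
    have cont: "continuous_on (sphere 0 1) (\<lambda>\<zeta>. h (r *\<^sub>R \<zeta>))" if "holo_on unit_ball h" for h :: "complex ^ 'n \<Rightarrow> complex"
      by (rule continuous_on_sphere[OF continuous_on_dilate[OF holo_on_imp_continuous_on[OF that] r]])
    have "(\<lambda>n. hmean (?S n) r) \<longlonglongrightarrow> hmean ?g r"
      unfolding hmean_def
    proof (rule integral_dominated_convergence)
      show "integrable sigma (\<lambda>\<zeta> :: complex ^ 'n. (M / (1 - q))\<^sup>2)" by simp
      show "(\<lambda>\<zeta>. (norm (?g (r *\<^sub>R \<zeta>)))\<^sup>2) \<in> borel_measurable sigma"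
        by (intro measurable_sigma_continuous continuous_intros cont[OF hol])
      show "(\<lambda>\<zeta>. (norm (?S n (r *\<^sub>R \<zeta>)))\<^sup>2) \<in> borel_measurable sigma" for n
        using cont[OF hardy_space_holo[OF conjunct1[OF partial[of n]]]]
        by (intro measurable_sigma_continuous continuous_on_power continuous_on_norm)
      show "AE \<zeta> in sigma. (\<lambda>n. (norm (?S n (r *\<^sub>R \<zeta>)))\<^sup>2) \<longlonglongrightarrow> (norm (?g (r *\<^sub>R \<zeta>)))\<^sup>2"
        by (intro AE_I2 tendsto_power tendsto_norm summable_LIMSEQ summ)
      show "AE \<zeta> in sigma. norm ((norm (?S n (r *\<^sub>R \<zeta>)))\<^sup>2) \<le> (M / (1 - q))\<^sup>2" for n
      proof (rule AE_I2)
        fix \<zeta> :: "complex ^ 'n" assume "\<zeta> \<in> space sigma"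
        then have \<zeta>: "norm \<zeta> = 1" by simp
        have "norm (?S n (r *\<^sub>R \<zeta>)) \<le> (\<Sum>j<n. M * q ^ j)"
          by (rule order_trans[OF norm_sum sum_mono]) (rule M[OF nr[OF \<zeta>]])
        also have "\<dots> \<le> (\<Sum>j. M * q ^ j)"
          by (rule sum_le_suminf[OF geo]) (use M0 q in auto)
        also have "\<dots> = M / (1 - q)"
          using q by (subst suminf_mult) (auto simp: suminf_geometric intro!: summable_geometric)
        finally show "norm ((norm (?S n (r *\<^sub>R \<zeta>)))\<^sup>2) \<le> (M / (1 - q))\<^sup>2"
          using power_mono[OF _ norm_ge_zero, of _ _ 2] by fastforce
      qed
    qed
    moreover have "hmean (?S n) r \<le> (C / (1 - q))\<^sup>2" for n
    proof -
      have "hmean (?S n) r \<le> (hardy_norm (?S n))\<^sup>2"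
        by (rule hmean_le[OF conjunct1[OF partial] r])
      also have "\<dots> \<le> (C / (1 - q))\<^sup>2"
        using partial[of n] sum_le[of n] by (intro power_mono hardy_norm_nonneg) auto
      finally show ?thesis .
    qed
    ultimately show ?thesis by (intro LIMSEQ_le_const2) auto
  qed
  note * = this
  show "?g \<in> hardy_space" by (rule hardy_spaceI(1)[OF hol out K *])
  show "hardy_norm ?g \<le> C / (1 - q)" by (rule hardy_spaceI(2)[OF hol out K *])
qed

section \<open>Automorphisms of the ball\<close>

text \<open>\<open>p\<close> is the orthogonal projection of \<open>z\<close> to the line of
  \<open>a\<close>; the complement is shrunk by \<open>sqrt (1 - |a|\<^sup>2)\<close>, the factor
  that makes \<open>mobius a\<close> an involution. For \<open>a = 0\<close> the map is the
  identity.\<close>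

definition mob_lin :: "complex ^ 'n \<Rightarrow> complex ^ 'n \<Rightarrow> complex ^ 'n" where
  "mob_lin a z = (let p = (hermitian z a / of_real ((norm a)\<^sup>2)) *s a in p + of_real (sqrt (1 - (norm a)\<^sup>2)) *s (z - p))"

text \<open>The involutive automorphism of the ball that exchanges \<open>0\<close> and \<open>a\<close>.\<close>

definition mobius :: "complex ^ 'n \<Rightarrow> complex ^ 'n \<Rightarrow> complex ^ 'n" where
  "mobius a z = (1 / (1 - hermitian z a)) *s (a - mob_lin a z)"

lemma mob_lin_adjoint: "hermitian (mob_lin a z) w = hermitian z (mob_lin a w)"
proof -
  have *: "cnj (hermitian x y) = hermitian y x" for x y :: "complex ^ 'a" by (rule cnj_hermitian)
  show ?thesis by (simp add: mob_lin_def Let_def * algebra_simps)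
qed

text \<open>On the line of \<open>a\<close> the map is the identity and on the orthogonal complement
  a scalar, so its square is a scalar plus a map of rank at most one.\<close>

lemma mob_lin_sq:
  assumes "norm a < 1"
  shows "mob_lin a (mob_lin a z) = of_real (1 - (norm a)\<^sup>2) *s z + hermitian z a *s a" "mob_lin a a = a"
proof -
  define s where "s = complex_of_real (sqrt (1 - (norm a)\<^sup>2))"
  have s2: "s * s = of_real (1 - (norm a)\<^sup>2)"
    using assms by (simp add: s_def abs_square_le_1 flip: of_real_mult)
  define P where "P z = (hermitian z a / of_real ((norm a)\<^sup>2)) *s a" for z
  have m: "mob_lin a z = P z + s *s (z - P z)" for z
    by (simp add: mob_lin_def P_def s_def Let_def)
  have Padd: "P (x + y) = P x + P y" "P (x - y) = P x - P y" "P (c *s x) = c *s P x" for x y c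
    by (simp_all add: P_def add_divide_distrib diff_divide_distrib vec_eq_iff algebra_simps)
  have PP: "P (P x) = P x" for x
    by (cases "a = 0") (simp_all add: P_def hermitian_self vec_eq_iff)
  have aP: "of_real ((norm a)\<^sup>2) *s P z = hermitian z a *s a" for z
    by (cases "a = 0") (simp_all add: P_def vec_eq_iff)
  have "mob_lin a (mob_lin a z) = P z + (s * s) *s (z - P z)"
    unfolding m Padd PP by (simp add: vec_eq_iff algebra_simps)
  also have "\<dots> = of_real (1 - (norm a)\<^sup>2) *s z + of_real ((norm a)\<^sup>2) *s P z"
    unfolding s2 by (simp add: vec_eq_iff algebra_simps)
  finally show "mob_lin a (mob_lin a z) = of_real (1 - (norm a)\<^sup>2) *s z + hermitian z a *s a"
    unfolding aP .
  have "P a = a" by (cases "a = 0") (simp_all add: P_def hermitian_self)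
  then show "mob_lin a a = a" by (simp add: m)
qed

lemma mob_lin_linear: "mob_lin a (x + y) = mob_lin a x + mob_lin a y"
  "mob_lin a (x - y) = mob_lin a x - mob_lin a y" "mob_lin a (c *s x) = c *s mob_lin a x"
  by (simp_all add: mob_lin_def Let_def vec_eq_iff field_simps add_divide_distrib diff_divide_distrib)

lemma linear_mob_lin: "linear (mob_lin a)"
  by (rule linearI) (simp_all add: mob_lin_linear scaleR_smult)

lemma mobius_denominator: "norm a < 1 \<Longrightarrow> norm z \<le> 1 \<Longrightarrow> 1 - hermitian z a \<noteq> 0"
  using norm_hermitian_lt_1[of a z] by (metis cnj_hermitian complex_mod_cnj eq_iff_diff_eq_0 less_irrefl norm_one)

lemma hermitian_divide:
  assumes "d \<noteq> 0"
  shows "hermitian ((1 / d) *s u) w * d = hermitian u w" "cnj d * hermitian w ((1 / d) *s u) = hermitian w u"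
  using assms by simp_all

text \<open>Self-adjointness and the square of \<open>mob_lin\<close> evaluate the Hermitian product
  of the two numerators. The identity is kept free of divisions by multiplying with the
  denominators.\<close>

lemma mobius_identity:
  assumes a: "norm a < 1" and z: "norm z \<le> 1" and w: "norm w \<le> 1"
  shows "(1 - hermitian (mobius a z) (mobius a w)) * ((1 - hermitian z a) * (1 - hermitian a w))
    = of_real (1 - (norm a)\<^sup>2) * (1 - hermitian z w)"
proof -
  have nz: "1 - hermitian z a \<noteq> 0" "1 - hermitian a w \<noteq> 0"
    using mobius_denominator[OF a z] mobius_denominator[OF a w]
    by (auto simp: cnj_hermitian[of w a, symmetric] complex_eq_iff)
  have "hermitian (mobius a z) (mobius a w) * ((1 - hermitian z a) * (1 - hermitian a w))
      = (cnj (1 - hermitian w a) * hermitian (mobius a z) (mobius a w)) * (1 - hermitian z a)"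
    by (simp add: cnj_hermitian)
  also have "\<dots> = hermitian (a - mob_lin a z) (a - mob_lin a w)"
    unfolding mobius_def hermitian_divide(2)[OF mobius_denominator[OF a w]] hermitian_divide(1)[OF nz(1)] ..
  also have "\<dots> = hermitian a a - hermitian z a - hermitian a w + hermitian (mob_lin a (mob_lin a z)) w"
  proof -
    have f: "hermitian a (mob_lin a w) = hermitian a w" "hermitian (mob_lin a z) a = hermitian z a"
      "hermitian (mob_lin a z) (mob_lin a w) = hermitian (mob_lin a (mob_lin a z)) w"
      using mob_lin_adjoint[of a a w] mob_lin_adjoint[of a z a] mob_lin_adjoint[of a "mob_lin a z" w]
      by (simp_all only: mob_lin_sq(2)[OF a])
    show ?thesis unfolding hermitian_simps f by simp
  qed
  also have "\<dots> = of_real ((norm a)\<^sup>2) - hermitian z a - hermitian a w +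
      (of_real (1 - (norm a)\<^sup>2) * hermitian z w + hermitian z a * hermitian a w)"
    unfolding mob_lin_sq(1)[OF a] hermitian_simps hermitian_self ..
  finally show ?thesis by (simp add: left_diff_distrib algebra_simps)
qed

text \<open>Up to explicit factors \<open>mobius a\<close> passes from one argument of the Hermitian
  product to the other. This substitutes for a change of variables on the sphere.\<close>

lemma mobius_kernel:
  assumes a: "norm a < 1" and w: "norm w < 1" and z: "norm z \<le> 1"
  shows "(1 - hermitian (mobius a w) z) * (1 - hermitian w a) = (1 - hermitian a z) * (1 - hermitian w (mobius a z))"
proof -
  have nz: "1 - hermitian w a \<noteq> 0" "1 - hermitian a z \<noteq> 0"
    using mobius_denominator[OF a, of w] mobius_denominator[OF a z] w
    by (auto simp: cnj_hermitian[of z a, symmetric] complex_eq_iff)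
  have "hermitian (mobius a w) z * (1 - hermitian w a) = hermitian (a - mob_lin a w) z"
    unfolding mobius_def hermitian_divide(1)[OF nz(1)] ..
  moreover have "(1 - hermitian a z) * hermitian w (mobius a z) = hermitian w (a - mob_lin a z)"
    unfolding mobius_def using hermitian_divide(2)[OF mobius_denominator[OF a z], of w "a - mob_lin a z"]
    by (simp only: complex_cnj_diff complex_cnj_one cnj_hermitian)
  moreover have "(1 - hermitian (mobius a w) z) * (1 - hermitian w a) = (1 - hermitian w a) - hermitian (mobius a w) z * (1 - hermitian w a)"
    "(1 - hermitian a z) * (1 - hermitian w (mobius a z)) = (1 - hermitian a z) - (1 - hermitian a z) * hermitian w (mobius a z)"
    by (simp_all add: algebra_simps)
  ultimately show ?thesis
    by (simp only: hermitian_simps mob_lin_adjoint) simp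
qed

lemma mobius_norm:
  assumes a: "norm a < 1" and z: "norm z \<le> 1"
  shows "(1 - (norm (mobius a z))\<^sup>2) * (norm (1 - hermitian z a))\<^sup>2 = (1 - (norm a)\<^sup>2) * (1 - (norm z)\<^sup>2)"
proof -
  have c: "1 - hermitian a z = cnj (1 - hermitian z a)" by (simp add: cnj_hermitian)
  have "complex_of_real ((1 - (norm (mobius a z))\<^sup>2) * (norm (1 - hermitian z a))\<^sup>2)
     = of_real ((1 - (norm a)\<^sup>2) * (1 - (norm z)\<^sup>2))"
    using mobius_identity[OF a z z] unfolding c complex_norm_square[symmetric] hermitian_self by simp
  then show ?thesis unfolding of_real_eq_iff .
qed

lemma norm_mobius_le: "norm a < 1 \<Longrightarrow> norm z \<le> 1 \<Longrightarrow> norm (mobius a z) \<le> 1"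
  and norm_mobius_lt: "norm a < 1 \<Longrightarrow> norm z < 1 \<Longrightarrow> norm (mobius a z) < 1"
proof -
  assume a: "norm a < 1"
  have pos: "1 - (norm a)\<^sup>2 > 0" using a by (simp add: abs_square_less_1)
  { assume z: "norm z \<le> 1"
    have "0 \<le> 1 - (norm z)\<^sup>2" using z by (simp add: abs_square_le_1)
    with pos have "0 \<le> (1 - (norm (mobius a z))\<^sup>2) * (norm (1 - hermitian z a))\<^sup>2"
      unfolding mobius_norm[OF a z] by (intro mult_nonneg_nonneg) auto
    then have "0 \<le> 1 - (norm (mobius a z))\<^sup>2"
      using mobius_denominator[OF a z] by (simp add: zero_le_mult_iff)
    then show "norm (mobius a z) \<le> 1" by (simp add: abs_square_le_1) }
  { assume z: "norm z < 1"
    have "0 < (1 - (norm (mobius a z))\<^sup>2) * (norm (1 - hermitian z a))\<^sup>2"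
      using mobius_norm[OF a, of z] pos z by (simp add: abs_square_less_1)
    then have "0 < 1 - (norm (mobius a z))\<^sup>2"
      by (simp add: zero_less_mult_iff)
    then show "norm (mobius a z) < 1" by (simp add: abs_square_less_1) }
qed

text \<open>Numerator and denominator of the second application both carry the factor
  \<open>(1 - |a|\<^sup>2) / (1 - hermitian z a)\<close>, which cancels and leaves
  \<open>z\<close>.\<close>

lemma mobius_involution:
  assumes a: "norm a < 1" and z: "norm z < 1"
  shows "mobius a (mobius a z) = z"
proof -
  let ?d = "1 - hermitian z a"
  have nz: "?d \<noteq> 0" using mobius_denominator[OF a] z by simp
  have pos: "complex_of_real (1 - (norm a)\<^sup>2) \<noteq> 0" using a by (simp add: abs_square_eq_1 flip: of_real_power)
  have d': "1 - hermitian (mobius a z) a = of_real (1 - (norm a)\<^sup>2) / ?d"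
  proof -
    have "hermitian (mobius a z) a * ?d = hermitian (a - mob_lin a z) a"
      unfolding mobius_def by (rule hermitian_divide(1)[OF nz])
    also have "\<dots> = of_real ((norm a)\<^sup>2) - hermitian z a"
      unfolding hermitian_simps mob_lin_adjoint[of a z] mob_lin_sq(2)[OF a] hermitian_self ..
    finally have "(1 - hermitian (mobius a z) a) * ?d = of_real (1 - (norm a)\<^sup>2)"
      by (simp add: left_diff_distrib)
    then show ?thesis using nz by (simp only: eq_divide_eq) simp
  qed
  have n: "a - mob_lin a (mobius a z) = (of_real (1 - (norm a)\<^sup>2) / ?d) *s z"
  proof -
    obtain d where d: "hermitian z a = 1 - d" "d \<noteq> 0" using nz by (metis diff_diff_eq2 add_diff_cancel_left' diff_self)
    have e: "x - (1 / d) * (x - (c * y + (1 - d) * x)) = c / d * y" for x y c using d(2) by (simp add: field_simps)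
    have e': "1 - (1 - d) = d" by simp
    show ?thesis
      unfolding mobius_def mob_lin_linear mob_lin_sq[OF a] d(1) e'
      by (simp only: vec_eq_iff vector_minus_component vector_smult_component vector_add_component e simp_thms)
  qed
  show ?thesis unfolding mobius_def[of a "mobius a z"] d' n vector_smult_assoc using nz pos by simp
qed

lemma mobius_zero: "mobius a 0 = a"
  by (simp add: mobius_def mob_lin_def Let_def)

lemma cdiff_mobius:
  assumes a: "norm a < 1" and z: "norm z \<le> 1"
  shows "cdiff (mobius a) ((*s)) z"
proof -
  have d: "cdiff (\<lambda>z. 1 - hermitian z a) (*) z" for z
    using cdiff_add[OF cdiff_const[of "(*)" 1] cdiff_mult[OF cdiff_const[of "(*)" "-1"] cdiff_hermitian]] by simp
  have l: "cdiff (mob_lin a) ((*s)) z" by (rule cdiff_linear[OF linear_mob_lin mob_lin_linear(3)])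
  have "cdiff (\<lambda>z. (a - mob_lin a z) $ i) (*) z" for i
    using cdiff_add[OF cdiff_const[of "(*)" "a $ i"] cdiff_mult[OF cdiff_const[of "(*)" "-1"] cdiff_nth[OF l]]] by simp
  then have n: "cdiff (\<lambda>z. a - mob_lin a z) ((*s)) z" by (rule cdiff_vec)
  have "cdiff (\<lambda>z. inverse (1 - hermitian z a) *s (a - mob_lin a z)) ((*s)) z"
    by (rule cdiff_smult[OF cdiff_inverse[OF d mobius_denominator[OF a z]] n])
  then show ?thesis by (simp add: mobius_def[abs_def] inverse_eq_divide)
qed

lemma continuous_on_mobius: "norm a < 1 \<Longrightarrow> continuous_on (cball 0 1) (mobius a)"
  using cdiff_mobius by (meson cdiff_def continuous_at_imp_continuous_on has_derivative_continuous mem_cball_0)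

text \<open>By \<open>mobius_kernel\<close> and \<open>mobius_norm\<close> the two Poisson kernels
  differ by the factor \<open>(1 - |a|\<^sup>2) / |1 - hermitian a z|\<^sup>2\<close>, to the power
  \<open>CARD('n)\<close>; its denominator is at least \<open>(1 - |a|)\<^sup>2\<close>.\<close>

lemma poisson_mobius:
  fixes a :: "complex ^ 'n"
  assumes a: "norm a < 1" and w: "norm w < 1" and z: "norm z = 1"
  shows "(1 - (norm (mobius a w))\<^sup>2) ^ CARD('n) * (norm (szego (mobius a w) z))\<^sup>2
     \<le> ((1 - (norm a)\<^sup>2) / (1 - norm a)\<^sup>2) ^ CARD('n) * ((1 - (norm w)\<^sup>2) ^ CARD('n) * (norm (szego w (mobius a z)))\<^sup>2)"
proof -
  let ?N = "CARD('n)"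
  define p q s t u where "p = norm (1 - hermitian (mobius a w) z)" and "q = norm (1 - hermitian w a)"
    and "s = norm (1 - hermitian a z)" and "t = norm (1 - hermitian w (mobius a z))" and "u = 1 - (norm (mobius a w))\<^sup>2"
  have z': "norm z \<le> 1" using z by simp
  have w': "norm w \<le> 1" using w by simp
  have pq: "p * q = s * t"
    using arg_cong[OF mobius_kernel[OF a w z'], of norm] by (simp only: norm_mult p_def q_def s_def t_def)
  have uq: "u * q\<^sup>2 = (1 - (norm a)\<^sup>2) * (1 - (norm w)\<^sup>2)"
    using mobius_norm[OF a w'] by (simp add: u_def q_def)
  have q: "q > 0" using mobius_denominator[OF a w'] by (simp add: q_def)
  have t: "t > 0" using one_minus_hermitian_nonzero[OF norm_hermitian_lt_1[OF w norm_mobius_le[OF a z']]] by (simp add: t_def)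
  have s_ge: "1 - norm a \<le> s"
    using norm_triangle_ineq2[of 1 "hermitian a z"] norm_hermitian_le[of a z] z by (simp add: s_def)
  have s: "s > 0" using s_ge a by simp
  have p: "p > 0" using pq q s t by (metis mult_pos_pos zero_less_mult_pos2)
  have a1: "1 - (norm a)\<^sup>2 > 0" "1 - (norm w)\<^sup>2 > 0" using a w by (simp_all add: abs_square_less_1)
  have "u / p\<^sup>2 = (u * q\<^sup>2) / (p * q)\<^sup>2" using q by (simp add: power_mult_distrib)
  also have "\<dots> = (1 - (norm a)\<^sup>2) / s\<^sup>2 * ((1 - (norm w)\<^sup>2) / t\<^sup>2)"
    unfolding uq pq by (simp add: power_mult_distrib)
  also have "\<dots> \<le> (1 - (norm a)\<^sup>2) / (1 - norm a)\<^sup>2 * ((1 - (norm w)\<^sup>2) / t\<^sup>2)"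
    using a1 a s_ge by (intro mult_right_mono divide_left_mono power_mono) auto
  finally have le: "u / p\<^sup>2 \<le> (1 - (norm a)\<^sup>2) / (1 - norm a)\<^sup>2 * ((1 - (norm w)\<^sup>2) / t\<^sup>2)" .
  have "u > 0" using norm_mobius_lt[OF a w] by (simp add: u_def abs_square_less_1)
  then have "(u / p\<^sup>2) ^ ?N \<le> ((1 - (norm a)\<^sup>2) / (1 - norm a)\<^sup>2 * ((1 - (norm w)\<^sup>2) / t\<^sup>2)) ^ ?N"
    by (intro power_mono le) auto
  moreover have "(norm (szego x y))\<^sup>2 = 1 / ((norm (1 - hermitian x y))\<^sup>2) ^ ?N" for x y :: "complex ^ 'n"
    unfolding szego_def norm_inverse norm_power power_inverse
    by (simp add: inverse_eq_divide power_mult[symmetric] mult.commute)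
  ultimately show ?thesis
    by (simp add: power_mult_distrib power_divide p_def t_def u_def)
qed

text \<open>The Poisson inequality bounds the value at \<open>mobius a (r \<eta>)\<close>. Then
  \<open>poisson_mobius\<close> moves the automorphism to the integration variable at the cost of
  \<open>K\<close>, and integrating over \<open>\<eta>\<close> first leaves a mean of
  \<open>f\<close>.\<close>

theorem comp_op_mobius:
  fixes a :: "complex ^ 'n"
  assumes a: "norm a < 1"
  shows "\<exists>K\<ge>0. \<forall>f\<in>hardy_space. comp_op (mobius a) f \<in> hardy_space \<and> hardy_norm (comp_op (mobius a) f) \<le> K * hardy_norm f"
proof -
  let ?N = "CARD('n)"
  define K where "K = ((1 - (norm a)\<^sup>2) / (1 - norm a)\<^sup>2) ^ ?N"
  have a1: "1 - (norm a)\<^sup>2 > 0" using a by (simp add: abs_square_less_1)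
  have K: "K \<ge> 0" using a1 by (simp add: K_def)
  have main: "comp_op (mobius a) f \<in> hardy_space \<and> hardy_norm (comp_op (mobius a) f) \<le> sqrt K * hardy_norm f"
    if f: "f \<in> hardy_space" for f
  proof -
    \<comment> \<open>The extra dilation by \<open>\<rho>\<close> makes \<open>f\<close> holomorphic
      past the closed ball, as the Poisson inequality demands; it is removed below by dominated
      convergence as \<open>\<rho>\<close> tends to \<open>1\<close>.\<close>
    have step: "(\<integral>\<eta>. (norm (f (\<rho> *\<^sub>R mobius a (r *\<^sub>R \<eta>))))\<^sup>2 \<partial>sigma) \<le> K * (hardy_norm f)\<^sup>2"
      if r: "0 < r" "r < 1" and \<rho>: "0 < \<rho>" "\<rho> < 1" for r \<rho>
    proof -
      define F where "F = (\<lambda>z. f (\<rho> *\<^sub>R z))"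
      have F: "holo_on (ball 0 (1 / \<rho>)) F" "1 / \<rho> > 1"
        unfolding F_def using holo_dilate[OF hardy_space_holo[OF f] \<rho>(1)] \<rho> by auto
      note cF = continuous_on_sphere_holo[OF F]
      obtain CF where CF: "CF \<ge> 0" "\<And>z. norm z \<le> 1 \<Longrightarrow> norm (F z) \<le> CF" using bounded_on_cball[OF cF] by blast
      have nr: "norm (r *\<^sub>R \<eta>) = r" if "norm \<eta> = 1" for \<eta> :: "complex ^ 'n" using that r by simp
      have nr1: "norm (r *\<^sub>R \<eta>) < 1" if "norm \<eta> = 1" for \<eta> :: "complex ^ 'n" using nr[OF that] r by simp
      have r1: "1 - r\<^sup>2 > 0" using r by (simp add: abs_square_less_1)
      define k where "k \<zeta> \<eta> = complex_of_real (K * (1 - r\<^sup>2) ^ ?N * ((norm (F \<zeta>))\<^sup>2 * (norm (szego (r *\<^sub>R \<eta>) (mobius a \<zeta>)))\<^sup>2))" for \<zeta> \<eta>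
      have cm: "continuous_on (sphere 0 1) (mobius a)"
        by (rule continuous_on_subset[OF continuous_on_mobius[OF a] sphere_cball])
      have szr: "szego (r *\<^sub>R \<eta>) x = szego \<eta> (r *\<^sub>R x)" for \<eta> x :: "complex ^ 'n" by (simp add: szego_def)
      have nrm: "norm (r *\<^sub>R mobius a \<zeta>) < 1" "norm (r *\<^sub>R mobius a \<zeta>) \<le> r" if "norm \<zeta> = 1" for \<zeta>
      proof -
        have "r * norm (mobius a \<zeta>) \<le> r * 1" using norm_mobius_le[OF a, of \<zeta>] that r by (intro mult_left_mono) auto
        then show "norm (r *\<^sub>R mobius a \<zeta>) \<le> r" using r by simp
        then show "norm (r *\<^sub>R mobius a \<zeta>) < 1" using r by linarith
      qed
      have ck: "continuous_on (sphere 0 1) (\<lambda>\<zeta>. (norm (szego x \<zeta>))\<^sup>2)" if "norm x < 1" for x :: "complex ^ 'n"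
        by (intro continuous_on_power continuous_on_norm continuous_on_sphere continuous_on_szego' that)
      have ckm: "continuous_on (sphere 0 1) (\<lambda>\<zeta>. (norm (szego x (mobius a \<zeta>)))\<^sup>2)" if "norm x < 1" for x :: "complex ^ 'n"
        by (intro continuous_on_power continuous_on_norm continuous_on_compose2[OF continuous_on_szego'[OF that] cm])
          (auto intro!: norm_mobius_le[OF a])
      have pt: "(norm (F (mobius a (r *\<^sub>R \<eta>))))\<^sup>2 \<le> Re (\<integral>\<zeta>. k \<zeta> \<eta> \<partial>sigma)" if \<eta>: "norm \<eta> = 1" for \<eta>
      proof -
        let ?w = "r *\<^sub>R \<eta>"
        have "(norm (F (mobius a ?w)))\<^sup>2 \<le> (1 - (norm (mobius a ?w))\<^sup>2) ^ ?N * (\<integral>\<zeta>. (norm (F \<zeta>))\<^sup>2 * (norm (szego (mobius a ?w) \<zeta>))\<^sup>2 \<partial>sigma)"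
          by (rule poisson_inequality[OF F norm_mobius_lt[OF a nr1[OF \<eta>]]])
        also have "\<dots> = (\<integral>\<zeta>. (norm (F \<zeta>))\<^sup>2 * ((1 - (norm (mobius a ?w))\<^sup>2) ^ ?N * (norm (szego (mobius a ?w) \<zeta>))\<^sup>2) \<partial>sigma)"
          unfolding integral_mult_right_zero[symmetric] by (simp only: mult_ac)
        also have "\<dots> \<le> (\<integral>\<zeta>. (norm (F \<zeta>))\<^sup>2 * (K * ((1 - r\<^sup>2) ^ ?N * (norm (szego ?w (mobius a \<zeta>)))\<^sup>2)) \<partial>sigma)"
        proof (rule integral_mono)
          show "integrable sigma (\<lambda>\<zeta>. (norm (F \<zeta>))\<^sup>2 * ((1 - (norm (mobius a ?w))\<^sup>2) ^ ?N * (norm (szego (mobius a ?w) \<zeta>))\<^sup>2))"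
            by (intro integrable_sigma_continuous continuous_on_mult continuous_on_const ck norm_mobius_lt[OF a nr1[OF \<eta>]]
                continuous_on_power continuous_on_norm continuous_on_sphere[OF cF])
          show "integrable sigma (\<lambda>\<zeta>. (norm (F \<zeta>))\<^sup>2 * (K * ((1 - r\<^sup>2) ^ ?N * (norm (szego ?w (mobius a \<zeta>)))\<^sup>2)))"
            by (intro integrable_sigma_continuous continuous_on_mult continuous_on_const ckm nr1[OF \<eta>]
                continuous_on_power continuous_on_norm continuous_on_sphere[OF cF])
          fix \<zeta> :: "complex ^ 'n" assume "\<zeta> \<in> space sigma"
          then have "norm \<zeta> = 1" by simp
          from poisson_mobius[OF a nr1[OF \<eta>] this]
          show "(norm (F \<zeta>))\<^sup>2 * ((1 - (norm (mobius a ?w))\<^sup>2) ^ ?N * (norm (szego (mobius a ?w) \<zeta>))\<^sup>2)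
            \<le> (norm (F \<zeta>))\<^sup>2 * (K * ((1 - r\<^sup>2) ^ ?N * (norm (szego ?w (mobius a \<zeta>)))\<^sup>2))"
            unfolding K_def nr[OF \<eta>] by (intro mult_left_mono) auto
        qed
        also have "\<dots> = Re (\<integral>\<zeta>. k \<zeta> \<eta> \<partial>sigma)"
          unfolding k_def integral_complex_of_real Re_complex_of_real by (simp only: mult_ac)
        finally show ?thesis .
      qed
      have fub: "integrable sigma (\<lambda>\<eta>. \<integral>\<zeta>. k \<zeta> \<eta> \<partial>sigma)" "(\<integral>\<eta>. (\<integral>\<zeta>. k \<zeta> \<eta> \<partial>sigma) \<partial>sigma) = (\<integral>\<zeta>. (\<integral>\<eta>. k \<zeta> \<eta> \<partial>sigma) \<partial>sigma)"
      proof -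
        let ?S = "sigma :: (complex ^ 'n) measure"
        have m1: "(\<lambda>p. r *\<^sub>R snd p) \<in> borel_measurable (?S \<Otimes>\<^sub>M ?S)"
          by (intro borel_measurable_scaleR borel_measurable_const measurable_compose[OF measurable_snd measurable_sigma_borel])
        have m2: "(\<lambda>p. mobius a (fst p)) \<in> borel_measurable (?S \<Otimes>\<^sub>M ?S)"
          by (rule measurable_compose[OF measurable_fst measurable_sigma_continuous[OF cm]])
        have m3: "(\<lambda>p. F (fst p)) \<in> borel_measurable (?S \<Otimes>\<^sub>M ?S)"
          by (rule measurable_compose[OF measurable_fst measurable_sigma_continuous[OF continuous_on_sphere[OF cF]]])
        have mk: "(\<lambda>p. k (fst p) (snd p)) \<in> borel_measurable (?S \<Otimes>\<^sub>M ?S)"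
          unfolding k_def szego_def
          by (rule measurable_compose[OF _ borel_measurable_continuous_onI[OF continuous_on_of_real[OF continuous_on_id]]])
            (intro borel_measurable_times m3 borel_measurable_inverse borel_measurable_power
              borel_measurable_diff borel_measurable_const borel_measurable_hermitian m1 m2
                measurable_compose[OF _ borel_measurable_continuous_onI[OF continuous_on_norm_id]])
        have bd: "norm (k \<zeta> \<eta>) \<le> K * (1 - r\<^sup>2) ^ ?N * (CF\<^sup>2 * (1 / (1 - r) ^ ?N)\<^sup>2)"
          if *: "norm \<zeta> = 1" "norm \<eta> = 1" for \<zeta> \<eta>
        proof -
        have "norm (hermitian (r *\<^sub>R \<eta>) (mobius a \<zeta>)) \<le> r * 1"
          using * r norm_mobius_le[OF a, of \<zeta>]
          by (intro order_trans[OF norm_hermitian_le] mult_mono) auto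
        then have "norm (szego (r *\<^sub>R \<eta>) (mobius a \<zeta>)) \<le> 1 / (1 - r) ^ ?N"
          using r by (intro norm_szego_le) auto
        moreover have "norm (k \<zeta> \<eta>) = K * (1 - r\<^sup>2) ^ ?N * ((norm (F \<zeta>))\<^sup>2 * (norm (szego (r *\<^sub>R \<eta>) (mobius a \<zeta>)))\<^sup>2)"
          unfolding k_def norm_of_real using K r1 by (intro abs_of_nonneg) simp
        ultimately show ?thesis
          using K r1 CF * by (simp only:) (intro mult_left_mono mult_mono power_mono; simp)
        qed
        show "integrable sigma (\<lambda>\<eta>. \<integral>\<zeta>. k \<zeta> \<eta> \<partial>sigma)"
          "(\<integral>\<eta>. (\<integral>\<zeta>. k \<zeta> \<eta> \<partial>sigma) \<partial>sigma) = (\<integral>\<zeta>. (\<integral>\<eta>. k \<zeta> \<eta> \<partial>sigma) \<partial>sigma)"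
          using Fubini_sigma[OF mk bd] by blast+
      qed
      \<comment> \<open>The factor \<open>r\<close> moves to the other argument of the kernel, so
        the integral is the squared norm of the kernel at
        \<open>r *\<^sub>R mobius a \<zeta>\<close>. Against the factor
        \<open>(1 - r\<^sup>2) ^ ?N\<close> it is at most \<open>1\<close>.\<close>
      have inner: "(\<integral>\<eta>. k \<zeta> \<eta> \<partial>sigma) = of_real (K * (1 - r\<^sup>2) ^ ?N * ((norm (F \<zeta>))\<^sup>2 * (1 / (1 - (norm (r *\<^sub>R mobius a \<zeta>))\<^sup>2) ^ ?N)))"
        if \<zeta>: "norm \<zeta> = 1" for \<zeta>
      proof -
        have "norm (szego \<eta> x) = norm (szego x \<eta>)" for \<eta> x :: "complex ^ 'n" by (metis cnj_szego complex_mod_cnj)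
        then have "(\<integral>\<eta>. (norm (szego (r *\<^sub>R \<eta>) (mobius a \<zeta>)))\<^sup>2 \<partial>sigma) = 1 / (1 - (norm (r *\<^sub>R mobius a \<zeta>))\<^sup>2) ^ ?N"
          unfolding szr using integral_szego[OF nrm(1)[OF \<zeta>]] by simp
        then show ?thesis
          unfolding k_def integral_complex_of_real integral_mult_right_zero by simp
      qed
      have "(\<integral>\<eta>. (norm (F (mobius a (r *\<^sub>R \<eta>))))\<^sup>2 \<partial>sigma) \<le> (\<integral>\<eta>. Re (\<integral>\<zeta>. k \<zeta> \<eta> \<partial>sigma) \<partial>sigma)"
      proof (rule integral_mono)
        have "continuous_on (sphere 0 1) (\<lambda>\<eta> :: complex ^ 'n. mobius a (r *\<^sub>R \<eta>))"
          by (rule continuous_on_compose2[OF continuous_on_mobius[OF a] continuous_on_scaleR[OF continuous_on_const continuous_on_id]])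
            (use r in auto)
        then have "continuous_on (sphere 0 1) (\<lambda>\<eta> :: complex ^ 'n. F (mobius a (r *\<^sub>R \<eta>)))"
          by (rule continuous_on_compose2[OF cF]) (auto simp del: norm_scaleR intro!: norm_mobius_le[OF a] less_imp_le[OF nr1])
        then show "integrable sigma (\<lambda>\<eta> :: complex ^ 'n. (norm (F (mobius a (r *\<^sub>R \<eta>))))\<^sup>2)"
          by (intro integrable_sigma_continuous continuous_on_power continuous_on_norm)
        show "integrable sigma (\<lambda>\<eta> :: complex ^ 'n. Re (\<integral>\<zeta>. k \<zeta> \<eta> \<partial>sigma))"
          by (rule integrable_Re[OF fub(1)])
      qed (use pt in simp)
      also have "\<dots> = Re (\<integral>\<eta>. (\<integral>\<zeta>. k \<zeta> \<eta> \<partial>sigma) \<partial>sigma)"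
        by (rule integral_Re[OF fub(1)])
      also have "\<dots> = (\<integral>\<zeta>. K * (1 - r\<^sup>2) ^ ?N * ((norm (F \<zeta>))\<^sup>2 * (1 / (1 - (norm (r *\<^sub>R mobius a \<zeta>))\<^sup>2) ^ ?N)) \<partial>sigma)"
      proof -
        have "(\<integral>\<zeta>. (\<integral>\<eta>. k \<zeta> \<eta> \<partial>sigma) \<partial>sigma) =
          (\<integral>\<zeta>. complex_of_real (K * (1 - r\<^sup>2) ^ ?N * ((norm (F \<zeta>))\<^sup>2 * (1 / (1 - (norm (r *\<^sub>R mobius a \<zeta>))\<^sup>2) ^ ?N))) \<partial>sigma)"
          by (intro Bochner_Integration.integral_cong refl inner) simp
        then show ?thesis unfolding fub(2) by (simp only: integral_complex_of_real Re_complex_of_real)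
      qed
      also have "\<dots> \<le> (\<integral>\<zeta>. K * (norm (F \<zeta>))\<^sup>2 \<partial>sigma)"
      proof (rule integral_mono)
        have d: "1 - r\<^sup>2 \<le> 1 - (norm (r *\<^sub>R mobius a \<zeta>))\<^sup>2" if "norm \<zeta> = 1" for \<zeta>
          using power_mono[OF nrm(2)[OF that], of 2] by (simp del: norm_scaleR)
        show "integrable sigma (\<lambda>\<zeta>. K * (1 - r\<^sup>2) ^ ?N * ((norm (F \<zeta>))\<^sup>2 * (1 / (1 - (norm (r *\<^sub>R mobius a \<zeta>))\<^sup>2) ^ ?N)))"
        proof (intro integrable_sigma_continuous continuous_on_mult continuous_on_const continuous_on_power
            continuous_on_norm continuous_on_divide continuous_on_diff continuous_on_scaleR cm continuous_on_sphere[OF cF] ballI)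
          fix \<zeta> :: "complex ^ 'n" assume "\<zeta> \<in> sphere 0 1"
          then have "0 < 1 - (norm (r *\<^sub>R mobius a \<zeta>))\<^sup>2" using d[of \<zeta>] r1 by (simp del: norm_scaleR)
          then show "(1 - (norm (r *\<^sub>R mobius a \<zeta>))\<^sup>2) ^ ?N \<noteq> 0" by simp
        qed
        show "integrable sigma (\<lambda>\<zeta>. K * (norm (F \<zeta>))\<^sup>2)"
          by (intro integrable_sigma_continuous continuous_on_mult continuous_on_const continuous_on_power
            continuous_on_norm continuous_on_sphere[OF cF])
        fix \<zeta> :: "complex ^ 'n" assume "\<zeta> \<in> space sigma"
        then have \<zeta>: "norm \<zeta> = 1" by simp
        define x where "x = 1 - (norm (r *\<^sub>R mobius a \<zeta>))\<^sup>2"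
        have x: "0 < x" "(1 - r\<^sup>2) ^ ?N \<le> x ^ ?N"
          using d[OF \<zeta>] r1 unfolding x_def by (simp_all add: power_mono del: norm_scaleR)
        have "(1 - r\<^sup>2) ^ ?N * (1 / x ^ ?N) \<le> 1" using x by simp
        then have "(K * (norm (F \<zeta>))\<^sup>2) * ((1 - r\<^sup>2) ^ ?N * (1 / x ^ ?N)) \<le> (K * (norm (F \<zeta>))\<^sup>2) * 1"
          using K by (intro mult_left_mono) auto
        then show "K * (1 - r\<^sup>2) ^ ?N * ((norm (F \<zeta>))\<^sup>2 * (1 / (1 - (norm (r *\<^sub>R mobius a \<zeta>))\<^sup>2) ^ ?N)) \<le> K * (norm (F \<zeta>))\<^sup>2"
          unfolding x_def by (simp only: mult_ac mult_1_right)
      qed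
      also have "\<dots> = K * hmean f \<rho>" by (simp add: hmean_def F_def)
      also have "\<dots> \<le> K * (hardy_norm f)\<^sup>2" using hmean_le[OF f \<rho>] K by (rule mult_left_mono)
      finally show ?thesis by (simp add: F_def)
    qed
    have "hmean (comp_op (mobius a) f) r \<le> (sqrt K * hardy_norm f)\<^sup>2" if r: "0 < r" "r < 1" for r
    proof -
      have nr1: "norm (r *\<^sub>R \<eta>) < 1" if "norm \<eta> = 1" for \<eta> :: "complex ^ 'n" using that r by simp
      \<comment> \<open>The denominator in \<open>mobius_norm\<close> is at most
        \<open>2\<^sup>2\<close>; so the image of the sphere of radius \<open>r\<close> lies in a
        ball of radius \<open>sqrt (1 - \<epsilon>) < 1\<close>, on which \<open>f\<close> is
        bounded.\<close>
      define \<epsilon> where "\<epsilon> = (1 - (norm a)\<^sup>2) * (1 - r\<^sup>2) / 4"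
      have \<epsilon>: "\<epsilon> > 0" using a1 r by (simp add: \<epsilon>_def abs_square_less_1)
      have t: "norm (mobius a (r *\<^sub>R \<eta>)) \<le> sqrt (1 - \<epsilon>)" if \<eta>: "norm \<eta> = 1" for \<eta> :: "complex ^ 'n"
      proof (rule real_le_rsqrt)
        let ?p = "mobius a (r *\<^sub>R \<eta>)" and ?q = "norm (1 - hermitian (r *\<^sub>R \<eta>) a)"
        have "?q \<le> 1 + norm (hermitian (r *\<^sub>R \<eta>) a)" using norm_triangle_ineq4[of 1 "hermitian (r *\<^sub>R \<eta>) a"] by (simp del: hermitian_simps)
        also have "norm (hermitian (r *\<^sub>R \<eta>) a) < 1" by (rule norm_hermitian_lt_1[OF nr1[OF \<eta>]]) (use a in simp)
        finally have "?q\<^sup>2 \<le> 2\<^sup>2" by (intro power_mono) auto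
        moreover have "0 \<le> 1 - (norm ?p)\<^sup>2" using norm_mobius_lt[OF a nr1[OF \<eta>]] by (simp add: abs_square_le_1)
        ultimately have "(1 - (norm ?p)\<^sup>2) * ?q\<^sup>2 \<le> (1 - (norm ?p)\<^sup>2) * 2\<^sup>2"
          by (intro mult_left_mono)
        moreover have "(1 - (norm ?p)\<^sup>2) * ?q\<^sup>2 = (1 - (norm a)\<^sup>2) * (1 - r\<^sup>2)"
          using mobius_norm[OF a less_imp_le[OF nr1[OF \<eta>]]] \<eta> r by (simp del: hermitian_simps)
        ultimately show "(norm ?p)\<^sup>2 \<le> 1 - \<epsilon>" by (simp add: \<epsilon>_def field_simps)
      qed
      have "sqrt (1 - \<epsilon>) < 1" using \<epsilon> by simp
      then obtain M where M: "\<And>z. norm z \<le> sqrt (1 - \<epsilon>) \<Longrightarrow> norm (f z) \<le> M"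
        using hardy_point_evaluation[of "sqrt (1 - \<epsilon>)", where 'n = 'n] f by blast
      define \<rho> where "\<rho> n = 1 - inverse (real (Suc (Suc n)))" for n
      have \<rho>: "0 < \<rho> n" "\<rho> n < 1" for n by (simp_all add: \<rho>_def field_simps)
      have \<rho>_lim: "\<rho> \<longlonglongrightarrow> 1"
        using tendsto_diff[OF tendsto_const[of 1] LIMSEQ_Suc[OF LIMSEQ_inverse_real_of_nat]] by (simp add: \<rho>_def[abs_def])
      have cm: "continuous_on (sphere 0 1) (\<lambda>\<eta> :: complex ^ 'n. mobius a (r *\<^sub>R \<eta>))"
        by (rule continuous_on_compose2[OF continuous_on_mobius[OF a] continuous_on_scaleR[OF continuous_on_const continuous_on_id]])
          (use r in auto)
      have cf: "continuous_on (sphere 0 1) (\<lambda>\<eta> :: complex ^ 'n. f (c *\<^sub>R mobius a (r *\<^sub>R \<eta>)))" if c: "0 < c" "c \<le> 1" for c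
      proof (rule continuous_on_compose2[OF hardy_space_continuous[OF f] continuous_on_scaleR[OF continuous_on_const cm]])
        have "c * norm (mobius a (r *\<^sub>R \<eta>)) < 1" if "norm \<eta> = 1" for \<eta> :: "complex ^ 'n"
          using norm_mobius_lt[OF a nr1[OF that]] mult_right_mono[OF c(2), of "norm (mobius a (r *\<^sub>R \<eta>))"] by (simp del: norm_scaleR)
        then show "(\<lambda>\<eta>. c *\<^sub>R mobius a (r *\<^sub>R \<eta>)) ` sphere 0 1 \<subseteq> unit_ball" using c by auto
      qed
      have "(\<lambda>n. \<integral>\<eta>. (norm (f (\<rho> n *\<^sub>R mobius a (r *\<^sub>R \<eta>))))\<^sup>2 \<partial>(sigma :: (complex ^ 'n) measure)) \<longlonglongrightarrow>
          (\<integral>\<eta>. (norm (f (mobius a (r *\<^sub>R \<eta>))))\<^sup>2 \<partial>sigma)"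
      proof (rule integral_dominated_convergence)
        show "integrable sigma (\<lambda>\<eta> :: complex ^ 'n. M\<^sup>2)" by simp
        show "(\<lambda>\<eta>. (norm (f (mobius a (r *\<^sub>R \<eta>))))\<^sup>2) \<in> borel_measurable sigma"
          using cf[of 1] by (intro measurable_sigma_continuous continuous_on_power continuous_on_norm) simp
        show "(\<lambda>\<eta>. (norm (f (\<rho> n *\<^sub>R mobius a (r *\<^sub>R \<eta>))))\<^sup>2) \<in> borel_measurable sigma" for n
          by (intro measurable_sigma_continuous continuous_on_power continuous_on_norm cf \<rho> less_imp_le)
        show "AE \<eta> in sigma. (\<lambda>n. (norm (f (\<rho> n *\<^sub>R mobius a (r *\<^sub>R \<eta>))))\<^sup>2) \<longlonglongrightarrow> (norm (f (mobius a (r *\<^sub>R \<eta>))))\<^sup>2"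
        proof (intro AE_I2 tendsto_power tendsto_norm)
          fix \<eta> :: "complex ^ 'n" assume "\<eta> \<in> space sigma"
          then have p: "mobius a (r *\<^sub>R \<eta>) \<in> unit_ball" using norm_mobius_lt[OF a nr1[of \<eta>]] by simp
          have c: "isCont f (mobius a (r *\<^sub>R \<eta>))"
            using continuous_on_interior[OF hardy_space_continuous[OF f]] p by (simp add: interior_open)
          have "(\<lambda>n. \<rho> n *\<^sub>R mobius a (r *\<^sub>R \<eta>)) \<longlonglongrightarrow> 1 *\<^sub>R mobius a (r *\<^sub>R \<eta>)"
            by (intro tendsto_intros \<rho>_lim)
          then have l: "(\<lambda>n. \<rho> n *\<^sub>R mobius a (r *\<^sub>R \<eta>)) \<longlonglongrightarrow> mobius a (r *\<^sub>R \<eta>)" by simp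
          show "(\<lambda>n. f (\<rho> n *\<^sub>R mobius a (r *\<^sub>R \<eta>))) \<longlonglongrightarrow> f (mobius a (r *\<^sub>R \<eta>))"
            by (rule isCont_tendsto_compose[OF c l])
        qed
        show "AE \<eta> in sigma. norm ((norm (f (\<rho> n *\<^sub>R mobius a (r *\<^sub>R \<eta>))))\<^sup>2) \<le> M\<^sup>2" for n
        proof (rule AE_I2)
          fix \<eta> :: "complex ^ 'n" assume "\<eta> \<in> space sigma"
          then have "norm (mobius a (r *\<^sub>R \<eta>)) \<le> sqrt (1 - \<epsilon>)" using t by simp
          moreover have "norm (\<rho> n *\<^sub>R mobius a (r *\<^sub>R \<eta>)) \<le> 1 * norm (mobius a (r *\<^sub>R \<eta>))"
            unfolding norm_scaleR using \<rho>[of n] by (intro mult_right_mono) auto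
          ultimately have "norm (f (\<rho> n *\<^sub>R mobius a (r *\<^sub>R \<eta>))) \<le> M" by (intro M) simp
          then show "norm ((norm (f (\<rho> n *\<^sub>R mobius a (r *\<^sub>R \<eta>))))\<^sup>2) \<le> M\<^sup>2"
            by (simp add: power_mono)
        qed
      qed
      then have "(\<integral>\<eta>. (norm (f (mobius a (r *\<^sub>R \<eta>))))\<^sup>2 \<partial>sigma) \<le> K * (hardy_norm f)\<^sup>2"
        by (rule LIMSEQ_le_const2) (use step[OF r \<rho>] in blast)
      moreover have "hmean (comp_op (mobius a) f) r = (\<integral>\<eta>. (norm (f (mobius a (r *\<^sub>R \<eta>))))\<^sup>2 \<partial>sigma)"
        unfolding hmean_def comp_op_def
        by (intro Bochner_Integration.integral_cong refl) (use nr1 in simp)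
      ultimately show ?thesis using K by (simp add: power_mult_distrib)
    qed
    note * = this
    have K': "0 \<le> sqrt K * hardy_norm f" using K by (simp add: hardy_norm_nonneg)
    note hol = comp_op_holo[OF f norm_mobius_lt[OF a] cdiff_mobius[OF a less_imp_le]]
    show ?thesis using hardy_spaceI[OF hol K' *] by blast
  qed
  then show ?thesis using K by (intro exI[of _ "sqrt K"]) auto
qed

section \<open>The Schwarz lemma in the ball and the structure of automorphisms\<close>

lemma holo_map_cdiff: "holo_map_on S F \<Longrightarrow> z \<in> S \<Longrightarrow> cdiff F ((*s)) z"
  unfolding holo_map_on_def holo_on_cdiff by (intro cdiff_vec) blast

text \<open>The one-variable Schwarz lemma is applied to
  \<open>g x = hermitian (F (x *s u)) v\<close> with unit vectors \<open>u\<close> and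
  \<open>v\<close> along \<open>z\<close> and \<open>F z\<close>. Equality at the point
  \<open>norm z\<close> makes \<open>g\<close> the identity of the disc, which is the second
  claim.\<close>

lemma schwarz_ball:
  fixes F :: "complex ^ 'n \<Rightarrow> complex ^ 'n" and c :: complex
  assumes F: "holo_map_on unit_ball F" "\<And>z. norm z < 1 \<Longrightarrow> norm (F z) < 1" "F 0 = 0" and z: "norm z < 1"
  shows "norm (F z) \<le> norm z"
    "norm (F z) = norm z \<Longrightarrow> z \<noteq> 0 \<Longrightarrow> norm c < 1 \<Longrightarrow>
      hermitian (F ((c / norm z) *s z)) (F z) = c * norm z"
proof -
  have *: "norm (F z) \<le> norm z \<and> (norm (F z) = norm z \<longrightarrow> norm c < 1 \<longrightarrow>
      hermitian (F ((c / norm z) *s z)) (F z) = c * norm z)" if nz: "z \<noteq> 0" "F z \<noteq> 0" for c :: complex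
  proof -
    define u where "u = (1 / complex_of_real (norm z)) *s z"
    define v where "v = (1 / complex_of_real (norm (F z))) *s F z"
    have u: "norm u = 1" "z = of_real (norm z) *s u" using nz by (simp_all add: u_def norm_divide vector_smult_assoc)
    have v: "norm v = 1" using nz by (simp add: v_def norm_divide)
    define g where "g x = hermitian (F (x *s u)) v" for x
    have cu: "(x / norm z) *s z = x *s u" for x :: complex by (simp add: u_def vector_smult_assoc)
    have hol: "holo_on unit_ball (\<lambda>w. hermitian (F w) v)"
      unfolding holo_on_cdiff using cdiff_compose[OF holo_map_cdiff[OF F(1)] cdiff_hermitian] by blast
    have g: "g holomorphic_on ball 0 1"
      using holo_slice[OF hol, of "ball 0 1" 0 u] u(1) by (simp add: g_def[abs_def])
    have g0: "g 0 = 0" by (simp add: g_def F(3))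
    have g1: "norm (g x) < 1" if "norm x < 1" for x
      unfolding g_def by (rule norm_hermitian_lt_1) (use F(2)[of "x *s u"] that u v in auto)
    have gz: "g (of_real (norm z)) = of_real (norm (F z))"
      using nz by (simp add: g_def u(2)[symmetric] v_def hermitian_self power2_eq_square)
    have z1: "norm (complex_of_real (norm z)) < 1" using z by simp
    have le: "norm (F z) \<le> norm z" using Schwarz_Lemma(1)[OF g g0 g1 z1] by (simp add: gz)
    show ?thesis
    proof (intro conjI impI le)
      assume eq: "norm (F z) = norm z" and c: "norm c < 1"
      have "\<exists>w. norm w < 1 \<and> w \<noteq> 0 \<and> norm (g w) = norm w"
        using z1 nz eq gz by (intro exI[of _ "of_real (norm z)"]) simp
      then obtain \<alpha> where \<alpha>: "\<And>w. norm w < 1 \<Longrightarrow> g w = \<alpha> * w"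
        using Schwarz_Lemma(3)[OF g g0 g1 z1] by blast
      have "\<alpha> = 1" using \<alpha>[OF z1] nz gz eq by simp
      then have "g c = c" using \<alpha>[OF c] by simp
      then have "hermitian (F (c *s u)) (of_real (norm (F z)) *s v) = c * norm z" by (simp add: g_def eq)
      then show "hermitian (F ((c / norm z) *s z)) (F z) = c * norm z"
        using nz by (simp add: cu v_def vector_smult_assoc)
    qed
  qed
  show "norm (F z) \<le> norm z" using *[of 0] F(3) by (cases "z = 0"; cases "F z = 0") auto
  show "hermitian (F ((c / norm z) *s z)) (F z) = c * norm z"
    if "norm (F z) = norm z" "z \<noteq> 0" "norm c < 1"
    using *[of c] that by (cases "F z = 0") auto
qed

text \<open>Cartan's theorem: by the Schwarz lemma in both directions \<open>F\<close> preserves the norm, and the equality case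
  makes \<open>F\<close> homogeneous, so \<open>F\<close> agrees with its derivative at \<open>0\<close>.\<close>

lemma cartan:
  fixes F :: "complex ^ 'n \<Rightarrow> complex ^ 'n"
  assumes F: "holo_map_on unit_ball F" "\<And>z. norm z < 1 \<Longrightarrow> norm (F z) < 1" "F 0 = 0"
    and G: "holo_map_on unit_ball G" "\<And>z. norm z < 1 \<Longrightarrow> norm (G z) < 1"
    and GF: "\<And>z. norm z < 1 \<Longrightarrow> G (F z) = z"
  obtains D where "orthogonal_transformation D" "\<And>z. cdiff D ((*s)) z" "\<And>z. norm z < 1 \<Longrightarrow> F z = D z"
proof -
  have G0: "G 0 = 0" using GF[of 0] F(3) by simp
  have nF: "norm (F z) = norm z" if "norm z < 1" for z
    using schwarz_ball(1)[OF F that] schwarz_ball(1)[OF G G0 F(2)[OF that]] by (simp add: GF[OF that])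
  \<comment> \<open>The equality case determines the product of \<open>F (c *s z)\<close> and
    \<open>F z\<close>; as norms are preserved, the squared norm of
    \<open>F (c *s z) - c *s F z\<close> expands to zero.\<close>
  have hom: "F (c *s z) = c *s F z" if z: "norm z < 1" and c: "norm (c *s z) < 1" for c z
  proof (cases "z = 0")
    case False
    let ?x = "c * of_real (norm z)"
    have x: "norm ?x < 1" using c by (simp add: norm_mult)
    have e: "(?x / norm z) *s z = c *s z" using False by simp
    have h: "hermitian (F (c *s z)) (F z) = c * of_real ((norm z)\<^sup>2)"
      using schwarz_ball(2)[OF F z nF[OF z] False x] unfolding e by (simp add: power2_eq_square mult.assoc)
    have h': "hermitian (F z) (F (c *s z)) = cnj c * of_real ((norm z)\<^sup>2)"
      using arg_cong[OF h, of cnj] by (simp add: cnj_hermitian)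
    have s: "hermitian (F (c *s z)) (F (c *s z)) = c * cnj c * of_real ((norm z)\<^sup>2)"
      unfolding hermitian_self nF[OF c] by (simp add: power_mult_distrib flip: complex_norm_square)
    have s': "hermitian (F z) (F z) = of_real ((norm z)\<^sup>2)" unfolding hermitian_self nF[OF z] ..
    have "hermitian (F (c *s z) - c *s F z) (F (c *s z) - c *s F z) = 0"
      unfolding hermitian_simps h h' s s' by (simp add: algebra_simps)
    then show ?thesis unfolding hermitian_self by simp
  qed (simp add: F(3))
  obtain D where D: "(F has_derivative D) (at 0)" "\<And>c v. D (c *s v) = c *s D v"
    using holo_map_cdiff[OF F(1), of 0] by (auto simp: cdiff_def)
  have lin: "linear D" using has_derivative_linear[OF D(1)] .
  have FD: "F z = D z" if z: "norm z < 1" for z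
  proof -
    have "((\<lambda>t. t *\<^sub>R z) has_derivative (\<lambda>t. t *\<^sub>R z)) (at 0)"
      by (rule bounded_linear_imp_has_derivative[OF bounded_linear_scaleR_left])
    then have 1: "((\<lambda>t. F (t *\<^sub>R z)) has_derivative (\<lambda>t. D (t *\<^sub>R z))) (at 0)"
      by (rule has_derivative_compose) (use D(1) in simp)
    have "((\<lambda>t. t *\<^sub>R F z) has_derivative (\<lambda>t. t *\<^sub>R F z)) (at 0)"
      by (rule bounded_linear_imp_has_derivative[OF bounded_linear_scaleR_left])
    then have 2: "((\<lambda>t. F (t *\<^sub>R z)) has_derivative (\<lambda>t. t *\<^sub>R F z)) (at 0)"
    proof (rule has_derivative_transform_within_open)
      show "open (ball 0 1 :: real set)" "0 \<in> (ball 0 1 :: real set)" by auto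
      fix t :: real assume "t \<in> ball 0 1"
      then have "norm (of_real t *s z) < 1"
        using z mult_right_mono[of "\<bar>t\<bar>" 1 "norm z"] by simp
      from hom[OF z this] show "t *\<^sub>R F z = F (t *\<^sub>R z)" by (simp add: scaleR_smult)
    qed
    from has_derivative_unique[OF 1 2] have "D (1 *\<^sub>R z) = 1 *\<^sub>R F z" by meson
    then show ?thesis by simp
  qed
  have nD: "norm (D v) = norm v" for v
  proof (cases "v = 0")
    case False
    let ?c = "1 / (2 * norm v)"
    have "norm (?c *\<^sub>R v) < 1" using False by simp
    then have "norm (D (?c *\<^sub>R v)) = norm (?c *\<^sub>R v)" using FD nF by metis
    then show ?thesis using False by (simp add: linear_scale[OF lin])
  qed (simp add: linear_0[OF lin])
  show ?thesis
    by (rule that[of D]) (use lin nD D(2) FD in \<open>auto simp: orthogonal_transformation intro: cdiff_linear\<close>)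
qed

lemma comp_op_orthogonal:
  assumes f: "f \<in> hardy_space" and D: "orthogonal_transformation D" "\<And>z. cdiff D ((*s)) z"
  shows "comp_op D f \<in> hardy_space" "hardy_norm (comp_op D f) \<le> hardy_norm f"
proof -
  have lin: "linear D" and nD: "\<And>v. norm (D v) = norm v" using D(1) by (auto simp: orthogonal_transformation)
  have h: "hmean (comp_op D f) r \<le> (hardy_norm f)\<^sup>2" if r: "0 < r" "r < 1" for r
  proof -
    have "hmean (comp_op D f) r = (\<integral>\<zeta>. (norm (f (r *\<^sub>R D \<zeta>)))\<^sup>2 \<partial>sigma)"
      unfolding hmean_def comp_op_def
      by (intro Bochner_Integration.integral_cong refl) (use r in \<open>simp add: linear_scale[OF lin]\<close>)
    also have "\<dots> = hmean f r"
      unfolding hmean_def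
      by (rule integral_sigma_orthogonal[OF D(1), where g = "\<lambda>\<zeta>. (norm (f (r *\<^sub>R \<zeta>)))\<^sup>2"])
        (intro measurable_sigma_continuous continuous_on_power continuous_on_norm
          continuous_on_sphere[OF continuous_on_dilate[OF hardy_space_continuous[OF f] r]])
    also have "\<dots> \<le> (hardy_norm f)\<^sup>2" by (rule hmean_le[OF f r])
    finally show ?thesis .
  qed
  have nD': "norm z < 1 \<Longrightarrow> norm (D z) < 1" for z by (simp add: nD)
  note hol = comp_op_holo[OF f nD' D(2)]
  show "comp_op D f \<in> hardy_space" "hardy_norm (comp_op D f) \<le> hardy_norm f"
    using hardy_spaceI[OF hol hardy_norm_nonneg h] by blast+
qed

lemma ball_automorphism_inverse:
  assumes "ball_automorphism \<tau>"
  shows "ball_automorphism (inv_into unit_ball \<tau>)"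
proof -
  have bij: "bij_betw \<tau> unit_ball unit_ball" and h: "holo_map_on unit_ball \<tau>" "holo_map_on unit_ball (inv_into unit_ball \<tau>)"
    using assms by (auto simp: ball_automorphism_def)
  have "holo_map_on unit_ball (inv_into unit_ball (inv_into unit_ball \<tau>))"
    unfolding holo_map_on_def
  proof
    fix i
    have "holo_on unit_ball (\<lambda>z. \<tau> z $ i)" using h(1) by (simp add: holo_map_on_def)
    then show "holo_on unit_ball (\<lambda>z. inv_into unit_ball (inv_into unit_ball \<tau>) z $ i)"
      by (rule holo_on_transform) (simp_all add: inv_into_inv_into_eq[OF bij])
  qed
  then show ?thesis
    using h(2) bij_betw_inv_into[OF bij] by (simp add: ball_automorphism_def)
qed

text \<open>With \<open>b\<close> the preimage of \<open>0\<close>, the map \<open>\<tau>\<close>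
  after \<open>mobius b\<close> fixes the origin, so Cartan's theorem makes it a unitary map
  \<open>D\<close>. Hence \<open>\<tau>\<close> is \<open>D\<close> after \<open>mobius b\<close>,
  and both factors induce bounded operators.\<close>

theorem comp_op_automorphism:
  fixes \<tau> :: "complex ^ 'n \<Rightarrow> complex ^ 'n"
  assumes \<tau>: "ball_automorphism \<tau>"
  shows "\<exists>K\<ge>0. \<forall>f\<in>hardy_space. comp_op \<tau> f \<in> hardy_space \<and> hardy_norm (comp_op \<tau> f) \<le> K * hardy_norm f"
proof -
  let ?\<tau>' = "inv_into unit_ball \<tau>"
  have bij: "bij_betw \<tau> unit_ball unit_ball" and h: "holo_map_on unit_ball \<tau>" "holo_map_on unit_ball ?\<tau>'"
    using \<tau> by (auto simp: ball_automorphism_def)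
  have t1: "norm (\<tau> z) < 1" "?\<tau>' (\<tau> z) = z" if "norm z < 1" for z
    using bij that bij_betw_inv_into_left[OF bij, of z] by (auto simp: bij_betw_def)
  have t2: "norm (?\<tau>' z) < 1" "\<tau> (?\<tau>' z) = z" if "norm z < 1" for z
    using bij_betw_inv_into[OF bij] that bij_betw_inv_into_right[OF bij, of z] by (auto simp: bij_betw_def)
  define b where "b = ?\<tau>' 0"
  have b: "norm b < 1" "\<tau> b = 0" using t2[of 0] by (auto simp: b_def)
  have cF: "cdiff (\<lambda>z. \<tau> (mobius b z)) ((*s)) z" if "norm z < 1" for z
    by (rule cdiff_compose[OF cdiff_mobius[OF b(1)] holo_map_cdiff[OF h(1)]]) (use that norm_mobius_lt[OF b(1)] in auto)
  have cG: "cdiff (\<lambda>z. mobius b (?\<tau>' z)) ((*s)) z" if "norm z < 1" for z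
    by (rule cdiff_compose[OF holo_map_cdiff[OF h(2)] cdiff_mobius[OF b(1)]]) (use that t2 less_imp_le in auto)
  have hF: "holo_map_on unit_ball (\<lambda>z. \<tau> (mobius b z))" and hG: "holo_map_on unit_ball (\<lambda>z. mobius b (?\<tau>' z))"
    unfolding holo_map_on_def holo_on_cdiff using cdiff_nth[OF cF] cdiff_nth[OF cG] by auto
  obtain D where D: "orthogonal_transformation D" "\<And>z. cdiff D ((*s)) z" "\<And>z. norm z < 1 \<Longrightarrow> \<tau> (mobius b z) = D z"
  proof (rule cartan[OF hF _ _ hG])
    show "norm (\<tau> (mobius b z)) < 1" if "norm z < 1" for z using t1(1) norm_mobius_lt[OF b(1) that] by blast
    show "\<tau> (mobius b 0) = 0" by (simp add: mobius_zero b)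
    show "norm (mobius b (?\<tau>' z)) < 1" if "norm z < 1" for z using norm_mobius_lt[OF b(1) t2(1)[OF that]] .
    show "mobius b (?\<tau>' (\<tau> (mobius b z))) = z" if "norm z < 1" for z
      using t1(2)[OF norm_mobius_lt[OF b(1) that]] mobius_involution[OF b(1) that] by simp
  qed blast
  have \<tau>D: "\<tau> z = D (mobius b z)" if "norm z < 1" for z
    using D(3)[OF norm_mobius_lt[OF b(1) that]] mobius_involution[OF b(1) that] by simp
  have eq: "comp_op \<tau> f = comp_op (mobius b) (comp_op D f)" for f :: "complex ^ 'n \<Rightarrow> complex"
    using \<tau>D norm_mobius_lt[OF b(1)] by (auto simp: comp_op_def fun_eq_iff)
  obtain K where K: "K \<ge> 0" "\<And>f. f \<in> hardy_space \<Longrightarrow> comp_op (mobius b) f \<in> hardy_space"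
    "\<And>f. f \<in> hardy_space \<Longrightarrow> hardy_norm (comp_op (mobius b) f) \<le> K * hardy_norm f"
    using comp_op_mobius[OF b(1)] by blast
  show ?thesis
  proof (intro exI[of _ K] conjI ballI K(1))
    fix f :: "complex ^ 'n \<Rightarrow> complex" assume f: "f \<in> hardy_space"
    note Df = comp_op_orthogonal[OF f D(1,2)]
    show "comp_op \<tau> f \<in> hardy_space" unfolding eq by (rule K(2)[OF Df(1)])
    have "hardy_norm (comp_op \<tau> f) \<le> K * hardy_norm (comp_op D f)" unfolding eq by (rule K(3)[OF Df(1)])
    also have "\<dots> \<le> K * hardy_norm f" by (rule mult_left_mono[OF Df(2) K(1)])
    finally show "hardy_norm (comp_op \<tau> f) \<le> K * hardy_norm f" .
  qed
qed

section \<open>Linear operators\<close>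

locale function_space =
  fixes X :: "('a \<Rightarrow> complex) set" and nrm :: "('a \<Rightarrow> complex) \<Rightarrow> real"
  assumes add: "f \<in> X \<Longrightarrow> g \<in> X \<Longrightarrow> (\<lambda>x. f x + g x) \<in> X"
    and norm_add: "f \<in> X \<Longrightarrow> g \<in> X \<Longrightarrow> nrm (\<lambda>x. f x + g x) \<le> nrm f + nrm g"
    and scale: "f \<in> X \<Longrightarrow> (\<lambda>x. c * f x) \<in> X"
    and norm_scale: "f \<in> X \<Longrightarrow> nrm (\<lambda>x. c * f x) \<le> norm c * nrm f"
    and norm_nonneg: "nrm f \<ge> 0"
    and nonempty: "X \<noteq> {}"
begin

abbreviation bop where "bop \<equiv> bounded_operator X nrm"

lemma zero_mem: "(\<lambda>x. 0) \<in> X"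
  using nonempty scale[of _ 0] by auto

lemma norm_zero: "nrm (\<lambda>x. 0) = 0"
  using norm_scale[OF zero_mem, of 0] norm_nonneg[of "\<lambda>x. 0"] by simp

lemma diff: "f \<in> X \<Longrightarrow> g \<in> X \<Longrightarrow> (\<lambda>x. f x - c * g x) \<in> X"
  using add[of f "\<lambda>x. - c * g x"] scale[of g "- c"] by simp

lemma norm_diff: "f \<in> X \<Longrightarrow> g \<in> X \<Longrightarrow> nrm (\<lambda>x. f x - c * g x) \<le> nrm f + norm c * nrm g"
  using norm_add[of f "\<lambda>x. - c * g x"] scale[of g "- c"] norm_scale[of g "- c"] by simp

lemma bopD:
  assumes "bop T"
  shows "f \<in> X \<Longrightarrow> T f \<in> X"
    and "f \<in> X \<Longrightarrow> g \<in> X \<Longrightarrow> T (\<lambda>x. f x + g x) = (\<lambda>x. T f x + T g x)"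
    and "f \<in> X \<Longrightarrow> T (\<lambda>x. c * f x) = (\<lambda>x. c * T f x)"
    and "f \<in> X \<Longrightarrow> g \<in> X \<Longrightarrow> T (\<lambda>x. f x - c * g x) = (\<lambda>x. T f x - c * T g x)"
    and "\<exists>K\<ge>0. \<forall>f\<in>X. nrm (T f) \<le> K * nrm f"
proof -
  show 1: "f \<in> X \<Longrightarrow> T f \<in> X" and 2: "f \<in> X \<Longrightarrow> g \<in> X \<Longrightarrow> T (\<lambda>x. f x + g x) = (\<lambda>x. T f x + T g x)"
    and 3: "f \<in> X \<Longrightarrow> T (\<lambda>x. c * f x) = (\<lambda>x. c * T f x)" for f g c
    using assms by (auto simp: bounded_operator_def)
  show "f \<in> X \<Longrightarrow> g \<in> X \<Longrightarrow> T (\<lambda>x. f x - c * g x) = (\<lambda>x. T f x - c * T g x)"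
    using 2[of f "\<lambda>x. - c * g x"] 3[of g "- c"] scale[of g "- c"] by simp
  obtain K where "\<forall>f\<in>X. nrm (T f) \<le> K * nrm f" using assms by (auto simp: bounded_operator_def)
  then have "\<forall>f\<in>X. nrm (T f) \<le> \<bar>K\<bar> * nrm f"
    by (meson abs_ge_self mult_right_mono norm_nonneg order_trans)
  then show "\<exists>K\<ge>0. \<forall>f\<in>X. nrm (T f) \<le> K * nrm f" by (intro exI[of _ "\<bar>K\<bar>"]) auto
qed

lemma bopI:
  assumes "\<And>f. f \<in> X \<Longrightarrow> T f \<in> X"
    and "\<And>f g. f \<in> X \<Longrightarrow> g \<in> X \<Longrightarrow> T (\<lambda>x. f x + g x) = (\<lambda>x. T f x + T g x)"
    and "\<And>c f. f \<in> X \<Longrightarrow> T (\<lambda>x. c * f x) = (\<lambda>x. c * T f x)"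
    and "\<And>f. f \<in> X \<Longrightarrow> nrm (T f) \<le> K * nrm f"
  shows "bop T"
  using assms unfolding bounded_operator_def by blast

lemma bop_compose: assumes "bop S" "bop T" shows "bop (\<lambda>f. S (T f))"
proof -
  obtain K L where K: "K \<ge> 0" "\<And>f. f \<in> X \<Longrightarrow> nrm (S f) \<le> K * nrm f" and L: "\<And>f. f \<in> X \<Longrightarrow> nrm (T f) \<le> L * nrm f"
    using bopD(5)[OF assms(1)] bopD(5)[OF assms(2)] by blast
  have "nrm (S (T f)) \<le> (K * L) * nrm f" if "f \<in> X" for f
    using K(2)[OF bopD(1)[OF assms(2) that]] mult_left_mono[OF L[OF that] K(1)] by (simp add: mult.assoc)
  then show ?thesis
    by (intro bopI[where K = "K * L"]) (simp_all add: bopD(1-3)[OF assms(1)] bopD(1-3)[OF assms(2)])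
qed

lemma bop_scale: assumes "bop T" shows "bop (\<lambda>f x. k * T f x)"
proof -
  obtain K where K: "K \<ge> 0" "\<And>f. f \<in> X \<Longrightarrow> nrm (T f) \<le> K * nrm f" using bopD(5)[OF assms] by blast
  have "nrm (\<lambda>x. k * T f x) \<le> (norm k * K) * nrm f" if "f \<in> X" for f
    using norm_scale[OF bopD(1)[OF assms that], of k] mult_left_mono[OF K(2)[OF that], of "norm k"]
    by (simp add: mult.assoc)
  then show ?thesis
    by (intro bopI[where K = "norm k * K"]) (simp_all add: bopD(1-3)[OF assms] scale distrib_left mult.left_commute)
qed

text \<open>Invertibility relative to a set \<open>Y\<close> of right-hand sides. Solutions are
  allowed in all of \<open>X\<close>, so that nothing has to be known about the range of an inverse
  when \<open>Y\<close> grows along a chain of subsets.\<close>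

definition solvable :: "(('a \<Rightarrow> complex) \<Rightarrow> ('a \<Rightarrow> complex)) \<Rightarrow> ('a \<Rightarrow> complex) set \<Rightarrow> bool" where
  "solvable T Y \<longleftrightarrow> (\<exists>K. \<forall>f\<in>Y. \<exists>g\<in>X. T g = f \<and> nrm g \<le> K * nrm f) \<and> (\<forall>f\<in>Y. T f = (\<lambda>x. 0) \<longrightarrow> f = (\<lambda>x. 0))"

text \<open>Injectivity makes the chosen solutions unique, hence linear in the right-hand side; the
  uniform estimate makes the resulting inverse bounded.\<close>

lemma solvable_inverse:
  assumes add: "\<And>f g. f \<in> X \<Longrightarrow> g \<in> X \<Longrightarrow> T (\<lambda>x. f x + g x) = (\<lambda>x. T f x + T g x)"
    and sc: "\<And>c f. f \<in> X \<Longrightarrow> T (\<lambda>x. c * f x) = (\<lambda>x. c * T f x)"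
    and mem: "\<And>f. f \<in> X \<Longrightarrow> T f \<in> X" and solv: "solvable T X"
  shows "\<exists>S. bop S \<and> (\<forall>f\<in>X. S (T f) = f) \<and> (\<forall>f\<in>X. T (S f) = f)"
proof -
  obtain K where K: "\<forall>f\<in>X. \<exists>g\<in>X. T g = f \<and> nrm g \<le> K * nrm f" using solv by (auto simp: solvable_def)
  then obtain S where S: "\<And>f. f \<in> X \<Longrightarrow> S f \<in> X" "\<And>f. f \<in> X \<Longrightarrow> T (S f) = f" "\<And>f. f \<in> X \<Longrightarrow> nrm (S f) \<le> K * nrm f"
    by metis
  have inj: "f = g" if "f \<in> X" "g \<in> X" "T f = T g" for f g
  proof -
    have g: "(\<lambda>x. - 1 * g x) \<in> X" using that by (intro scale)
    have "T (\<lambda>x. f x + - 1 * g x) = (\<lambda>x. T f x + - 1 * T g x)"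
      unfolding add[OF that(1) g] sc[OF that(2), of "- 1"] ..
    then have "T (\<lambda>x. f x + - 1 * g x) = (\<lambda>x. 0)" using that(3) by simp
    then have "(\<lambda>x. f x + - 1 * g x) = (\<lambda>x. 0)"
      using solv that(1) g function_space.add[OF function_space_axioms that(1) g] by (auto simp: solvable_def)
    then show ?thesis by (auto simp: fun_eq_iff)
  qed
  have "bop S"
  proof (rule bopI[where K = K])
    fix f g c assume f: "f \<in> X" and g: "g \<in> X"
    note fg = function_space.add[OF function_space_axioms]
    show "S (\<lambda>x. f x + g x) = (\<lambda>x. S f x + S g x)"
      by (rule inj) (simp_all add: fg S f g add)
    show "S (\<lambda>x. c * f x) = (\<lambda>x. c * S f x)" for c
      by (rule inj) (simp_all add: scale S f sc)
  qed (simp_all add: S)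
  moreover have "S (T f) = f" if "f \<in> X" for f
    by (rule inj) (simp_all add: S mem that)
  ultimately show ?thesis using S by blast
qed

abbreviation dop :: "(('a \<Rightarrow> complex) \<Rightarrow> ('a \<Rightarrow> complex)) \<Rightarrow> complex \<Rightarrow> ('a \<Rightarrow> complex) \<Rightarrow> ('a \<Rightarrow> complex)" where
  "dop T c f \<equiv> (\<lambda>x. T f x - c * f x)"

lemma dop_linear:
  assumes T: "bop T" and f: "f \<in> X" and g: "g \<in> X"
  shows "dop T c (\<lambda>x. f x + g x) = (\<lambda>x. dop T c f x + dop T c g x)"
    "dop T c (\<lambda>x. k * f x) = (\<lambda>x. k * dop T c f x)" "dop T c f \<in> X"
proof -
  show "dop T c (\<lambda>x. f x + g x) = (\<lambda>x. dop T c f x + dop T c g x)"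
    unfolding bopD(2)[OF T f g] by (simp add: algebra_simps)
  show "dop T c (\<lambda>x. k * f x) = (\<lambda>x. k * dop T c f x)"
    unfolding bopD(3)[OF T f] by (simp add: algebra_simps)
  show "dop T c f \<in> X" by (rule diff[OF bopD(1)[OF T f] f])
qed

lemma not_in_spectrum:
  assumes T: "bop T" and "solvable (dop T \<mu>) X"
  shows "\<mu> \<notin> op_spectrum X nrm T"
proof -
  have "\<exists>S. bop S \<and> (\<forall>f\<in>X. S (dop T \<mu> f) = f) \<and> (\<forall>f\<in>X. dop T \<mu> (S f) = f)"
    by (rule solvable_inverse[where T = "dop T \<mu>", OF _ _ _ assms(2)]) (rule dop_linear[OF T]; assumption)+
  then show ?thesis unfolding op_spectrum_def by blast
qed

text \<open>A bounded inverse with constant \<open>K\<close> would force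
  \<open>1 \<le> K * norm (c n - \<mu>)\<close> for every \<open>n\<close>.\<close>

lemma approximate_eigenvalue:
  assumes T: "bop T" and f: "\<And>n. f n \<in> X" "\<And>n. nrm (f n) > 0" "\<And>n. T (f n) = (\<lambda>x. c n * f n x)" and c: "c \<longlonglongrightarrow> \<mu>"
  shows "\<mu> \<in> op_spectrum X nrm T"
proof (rule ccontr)
  assume "\<mu> \<notin> op_spectrum X nrm T"
  then obtain S where S: "bop S" "\<And>f. f \<in> X \<Longrightarrow> S (dop T \<mu> f) = f" by (auto simp: op_spectrum_def)
  obtain K where K: "K \<ge> 0" "\<And>f. f \<in> X \<Longrightarrow> nrm (S f) \<le> K * nrm f" using bopD(5)[OF S(1)] by blast
  have le: "1 \<le> K * norm (c n - \<mu>)" for n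
  proof -
    have e: "dop T \<mu> (f n) = (\<lambda>x. (c n - \<mu>) * f n x)" by (simp add: f(3) left_diff_distrib)
    have "nrm (f n) = nrm (S (\<lambda>x. (c n - \<mu>) * f n x))" using S(2)[OF f(1), of n] e by simp
    also have "\<dots> \<le> K * nrm (\<lambda>x. (c n - \<mu>) * f n x)" by (rule K(2)[OF scale[OF f(1)]])
    also have "\<dots> \<le> K * (norm (c n - \<mu>) * nrm (f n))" by (rule mult_left_mono[OF norm_scale[OF f(1)] K(1)])
    finally have "1 * nrm (f n) \<le> (K * norm (c n - \<mu>)) * nrm (f n)" by simp
    then show ?thesis using f(2)[of n] by (rule mult_right_le_imp_le)
  qed
  have "(\<lambda>n. K * norm (c n - \<mu>)) \<longlonglongrightarrow> K * norm (\<mu> - \<mu>)" by (intro tendsto_intros c)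
  from LIMSEQ_le_const[OF this, of 1] le show False by simp
qed

text \<open>Conjugating an inverse of \<open>T' - \<mu>\<close> by \<open>J\<close> gives one of
  \<open>T - \<mu>\<close>. Equality of the spectra comes from using this in both
  directions.\<close>

lemma spectrum_similar_subset:
  assumes J: "bop J" "bop J'" "\<And>f. f \<in> X \<Longrightarrow> J (J' f) = f" "\<And>f. f \<in> X \<Longrightarrow> J' (J f) = f"
    and T: "bop T'" "\<And>f. f \<in> X \<Longrightarrow> T (J f) = J (T' f)"
  shows "op_spectrum X nrm T \<subseteq> op_spectrum X nrm T'"
proof
  fix \<mu> assume \<mu>: "\<mu> \<in> op_spectrum X nrm T"
  show "\<mu> \<in> op_spectrum X nrm T'"
  proof (rule ccontr)
    assume "\<mu> \<notin> op_spectrum X nrm T'"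
    then obtain S where S: "bop S" "\<And>f. f \<in> X \<Longrightarrow> S (dop T' \<mu> f) = f" "\<And>f. f \<in> X \<Longrightarrow> dop T' \<mu> (S f) = f"
      unfolding op_spectrum_def by blast
    note m = bopD(1)[OF J(1)] bopD(1)[OF J(2)] bopD(1)[OF S(1)] bopD(1)[OF T(1)]
    have TX: "T f = J (T' (J' f))" if "f \<in> X" for f using T(2)[OF m(2)[OF that]] J(3)[OF that] by simp
    have 1: "J (S (J' (dop T \<mu> f))) = f" if f: "f \<in> X" for f
    proof -
      have "J' (dop T \<mu> f) = dop T' \<mu> (J' f)"
        unfolding TX[OF f] bopD(4)[OF J(2) m(1)[OF m(4)[OF m(2)[OF f]]] f] J(4)[OF m(4)[OF m(2)[OF f]]] ..
      then show ?thesis by (simp add: S(2)[OF m(2)[OF f]] J(3)[OF f])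
    qed
    have 2: "dop T \<mu> (J (S (J' f))) = f" if f: "f \<in> X" for f
    proof -
      let ?g = "S (J' f)"
      have g: "?g \<in> X" using f by (intro m)
      have "dop T \<mu> (J ?g) = (\<lambda>x. J (T' ?g) x - \<mu> * J ?g x)" by (simp only: T(2)[OF g])
      also have "\<dots> = J (dop T' \<mu> ?g)" by (simp only: bopD(4)[OF J(1) m(4)[OF g] g])
      finally show ?thesis by (simp only: S(3)[OF m(2)[OF f]] J(3)[OF f])
    qed
    have "bop (\<lambda>f. J (S (J' f)))" by (rule bop_compose[OF J(1) bop_compose[OF S(1) J(2)]])
    with 1 2 have "\<exists>S. bop S \<and> (\<forall>f\<in>X. S (dop T \<mu> f) = f) \<and> (\<forall>f\<in>X. dop T \<mu> (S f) = f)"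
      by (intro exI[of _ "\<lambda>f. J (S (J' f))"] conjI ballI) auto
    then show False using \<mu> unfolding op_spectrum_def by blast
  qed
qed

end

text \<open>The composition of the factors \<open>T - c\<close>, with the head of the list acting
  first; a list lets inductions split off a single factor.\<close>

fun opl :: "(('a \<Rightarrow> complex) \<Rightarrow> ('a \<Rightarrow> complex)) \<Rightarrow> complex list \<Rightarrow> ('a \<Rightarrow> complex) \<Rightarrow> ('a \<Rightarrow> complex)" where
  "opl T [] f = f"
| "opl T (c # cs) f = opl T cs (\<lambda>x. T f x - c * f x)"

context function_space
begin

lemma opl_mem: "bop T \<Longrightarrow> f \<in> X \<Longrightarrow> opl T cs f \<in> X"
  by (induction cs arbitrary: f) (auto intro: diff bopD(1))

lemma opl_commute:
  assumes T: "bop T" and S: "bop S" and c: "\<And>f. f \<in> X \<Longrightarrow> S (T f) = T (S f)"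
  shows "f \<in> X \<Longrightarrow> opl T cs (S f) = S (opl T cs f)"
proof (induction cs arbitrary: f)
  case (Cons a cs)
  have "(\<lambda>x. T (S f) x - a * S f x) = S (\<lambda>x. T f x - a * f x)"
    by (simp add: bopD(4)[OF S bopD(1)[OF T Cons.prems] Cons.prems] c[OF Cons.prems])
  then show ?case
    using Cons.IH[OF diff[OF bopD(1)[OF T Cons.prems] Cons.prems], of a] by simp
qed simp

lemma opl_Cons_commute:
  assumes T: "bop T" and f: "f \<in> X"
  shows "opl T (c # cs) f = (\<lambda>x. T (opl T cs f) x - c * opl T cs f x)"
proof -
  have S: "bop (dop T c)"
  proof -
    obtain K where K: "K \<ge> 0" "\<And>f. f \<in> X \<Longrightarrow> nrm (T f) \<le> K * nrm f" using bopD(5)[OF T] by blast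
    show ?thesis
    proof (rule bopI[where K = "K + norm c"])
      fix f assume f: "f \<in> X"
      show "nrm (dop T c f) \<le> (K + norm c) * nrm f"
        using norm_diff[OF bopD(1)[OF T f] f, of c] K(2)[OF f] by (simp add: distrib_right)
    qed (simp_all add: dop_linear[OF T] zero_mem)
  qed
  have com: "dop T c (T f) = T (dop T c f)" if "f \<in> X" for f
    by (rule bopD(4)[OF T bopD(1)[OF T that] that, symmetric])
  have "opl T cs (dop T c f) = dop T c (opl T cs f)"
    by (rule opl_commute[where S = "dop T c", OF T S _ f]) (rule com)
  then show ?thesis by (simp only: opl.simps)
qed

text \<open>The step of the induction solves \<open>(T - W) g = f\<close> by \<open>g = g' - (W - c)\<^sup>-\<^sup>1 f\<close>, where \<open>g'\<close> solves the equation
  with right-hand side \<open>(T - c) (W - c)\<^sup>-\<^sup>1 f\<close>.\<close>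

lemma solvable_chain:
  assumes T: "bop T" and W: "bop W" and com: "\<And>f. f \<in> X \<Longrightarrow> T (W f) = W (T f)"
  shows "(\<And>c. c \<in> set cs \<Longrightarrow> solvable (dop W c) X) \<Longrightarrow> solvable (\<lambda>f x. T f x - W f x) (opl T cs ` X) \<Longrightarrow>
    solvable (\<lambda>f x. T f x - W f x) X"
proof (induction cs)
  case (Cons c cs)
  let ?D = "\<lambda>f x. T f x - W f x"
  obtain S where S: "bop S" "\<And>f. f \<in> X \<Longrightarrow> S (dop W c f) = f" "\<And>f. f \<in> X \<Longrightarrow> dop W c (S f) = f"
  proof -
    have "\<exists>S. bop S \<and> (\<forall>f\<in>X. S (dop W c f) = f) \<and> (\<forall>f\<in>X. dop W c (S f) = f)"
    proof (rule solvable_inverse[where T = "dop W c"])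
      show "solvable (dop W c) X" by (rule Cons.prems(1)) simp
    qed (rule dop_linear[OF W]; assumption)+
    then show ?thesis using that by blast
  qed
  note m = bopD(1)[OF T] bopD(1)[OF W] bopD(1)[OF S(1)]
  have ST: "S (T f) = T (S f)" if f: "f \<in> X" for f
  proof -
    have "dop W c (T (S f)) = T (dop W c (S f))"
      by (simp add: bopD(4)[OF T m(2)[OF m(3)[OF f]] m(3)[OF f]] com[OF m(3)[OF f]])
    then have "dop W c (T (S f)) = T f" by (simp only: S(3)[OF f])
    then show ?thesis using S(2)[OF m(1)[OF m(3)[OF f]]] by simp
  qed
  \<comment> \<open>\<open>S\<close> commutes with \<open>T\<close> and so preserves the range of a
    product of factors; the extra factor \<open>T - c\<close> then lands in the range of the longer
    product.\<close>
  have step: "dop T c (S f) \<in> opl T (c # cs) ` X" if f: "f \<in> opl T cs ` X" for f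
  proof -
    obtain x where x: "x \<in> X" "f = opl T cs x" using f by blast
    have "S f = opl T cs (S x)" using opl_commute[OF T S(1) ST x(1)] x(2) by simp
    then have "dop T c (S f) = opl T (c # cs) (S x)"
      using opl_Cons_commute[OF T m(3)[OF x(1)]] by simp
    then show ?thesis using m(3)[OF x(1)] by blast
  qed
  have X: "f \<in> X" if "f \<in> opl T cs ` X" for f using that opl_mem[OF T] by blast
  obtain K where K: "\<And>f. f \<in> opl T (c # cs) ` X \<Longrightarrow> \<exists>g\<in>X. ?D g = f \<and> nrm g \<le> K * nrm f"
    using Cons.prems(2) unfolding solvable_def by blast
  have inj: "f = (\<lambda>x. 0)" if "f \<in> opl T (c # cs) ` X" "?D f = (\<lambda>x. 0)" for f
    using Cons.prems(2) that unfolding solvable_def by blast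
  obtain KS where KS: "KS \<ge> 0" "\<And>f. f \<in> X \<Longrightarrow> nrm (S f) \<le> KS * nrm f" using bopD(5)[OF S(1)] by blast
  obtain KT where KT: "KT \<ge> 0" "\<And>f. f \<in> X \<Longrightarrow> nrm (T f) \<le> KT * nrm f" using bopD(5)[OF T] by blast
  have "solvable ?D (opl T cs ` X)"
    unfolding solvable_def
  proof (intro conjI exI ballI impI)
    fix f assume f: "f \<in> opl T cs ` X"
    have fX: "f \<in> X" by (rule X[OF f])
    note Sf = m(3)[OF fX]
    obtain g where g: "g \<in> X" "?D g = dop T c (S f)" "nrm g \<le> K * nrm (dop T c (S f))"
      using K[OF step[OF f]] by blast
    have "?D (\<lambda>x. g x - 1 * S f x) = (\<lambda>x. ?D g x - ?D (S f) x)"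
      unfolding bopD(4)[OF T g(1) Sf] bopD(4)[OF W g(1) Sf] by (simp add: algebra_simps)
    also have "\<dots> = dop W c (S f)" unfolding fun_cong[OF g(2)] by (simp add: algebra_simps)
    finally have 1: "?D (\<lambda>x. g x - 1 * S f x) = f" by (simp only: S(3)[OF fX])
    have n: "nrm (dop T c (S f)) \<le> (KT + norm c) * (KS * nrm f)"
    proof -
      have "nrm (dop T c (S f)) \<le> nrm (T (S f)) + norm c * nrm (S f)" by (rule norm_diff[OF m(1)[OF Sf] Sf])
      also have "\<dots> \<le> (KT + norm c) * nrm (S f)" using KT(2)[OF Sf] by (simp add: distrib_right)
      also have "\<dots> \<le> (KT + norm c) * (KS * nrm f)" using KT(1) by (intro mult_left_mono KS(2)[OF fX]) auto
      finally show ?thesis .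
    qed
    have "nrm (\<lambda>x. g x - 1 * S f x) \<le> nrm g + nrm (S f)" using norm_diff[OF g(1) Sf, of 1] by simp
    also have "nrm g \<le> \<bar>K\<bar> * nrm (dop T c (S f))"
      using g(3) mult_right_mono[OF abs_ge_self[of K] norm_nonneg] order_trans by blast
    also have "\<bar>K\<bar> * nrm (dop T c (S f)) \<le> \<bar>K\<bar> * ((KT + norm c) * (KS * nrm f))" by (rule mult_left_mono[OF n]) simp
    also have "nrm (S f) \<le> KS * nrm f" by (rule KS(2)[OF fX])
    finally have 2: "nrm (\<lambda>x. g x - 1 * S f x) \<le> (\<bar>K\<bar> * (KT + norm c) * KS + KS) * nrm f"
      by (simp add: algebra_simps)
    from 1 2 diff[OF g(1) Sf, of 1] show "\<exists>g\<in>X. ?D g = f \<and> nrm g \<le> (\<bar>K\<bar> * (KT + norm c) * KS + KS) * nrm f" by blast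
  next
    fix f assume f: "f \<in> opl T cs ` X" and 0: "?D f = (\<lambda>x. 0)"
    have fX: "f \<in> X" by (rule X[OF f])
    \<comment> \<open>On the kernel of \<open>T - W\<close> the operators \<open>T - c\<close> and
      \<open>W - c\<close> agree, so \<open>f = S (T - c) f\<close>; a kernel element therefore
      already lies in the smaller range, where injectivity is known.\<close>
    have "dop T c f = dop W c f" using fun_cong[OF 0] by (auto simp: fun_eq_iff)
    then have "f = S (dop T c f)" using S(2)[OF fX] by simp
    also have "\<dots> = dop T c (S f)" by (simp only: bopD(4)[OF S(1) m(1)[OF fX] fX] ST[OF fX])
    finally have "f \<in> opl T (c # cs) ` X" using step[OF f] by simp
    then show "f = (\<lambda>x. 0)" using 0 by (rule inj)
  qed
  note base = this
  show ?case
  proof (rule Cons.IH[OF _ base])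
    fix d assume "d \<in> set cs"
    then have "d \<in> set (c # cs)" by simp
    then show "solvable (dop W d) X" by (rule Cons.prems(1))
  qed
next
  case Nil
  have "opl T [] ` X = X" by (simp add: image_def)
  then show ?case using Nil.prems(2) by (simp only:)
qed

end

section \<open>The Hardy space as an instance of the operator theory\<close>

lemma hardy_space_zero: "(\<lambda>z. 0) \<in> (hardy_space :: (complex ^ 'n \<Rightarrow> complex) set)"
proof (rule hardy_spaceI(1)[where K = 0])
  show "holo_on unit_ball (\<lambda>z :: complex ^ 'n. 0)" unfolding holo_on_cdiff by (intro ballI cdiff_const) simp
qed (simp_all add: hmean_def)

interpretation hardy: function_space "hardy_space :: (complex ^ 'n \<Rightarrow> complex) set" hardy_norm
proof
  fix f g :: "complex ^ 'n \<Rightarrow> complex" and c :: complex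
  show "(\<lambda>x. f x + g x) \<in> hardy_space" if "f \<in> hardy_space" "g \<in> hardy_space" by (rule hardy_space_add(1)[OF that])
  show "hardy_norm (\<lambda>x. f x + g x) \<le> hardy_norm f + hardy_norm g" if "f \<in> hardy_space" "g \<in> hardy_space"
    by (rule hardy_space_add(2)[OF that])
  show "(\<lambda>x. c * f x) \<in> hardy_space" if "f \<in> hardy_space" by (rule hardy_space_scale(1)[OF that])
  show "hardy_norm (\<lambda>x. c * f x) \<le> norm c * hardy_norm f" if "f \<in> hardy_space" by (rule hardy_space_scale(2)[OF that])
  show "hardy_norm f \<ge> 0" by (rule hardy_norm_nonneg)
  show "(hardy_space :: (complex ^ 'n \<Rightarrow> complex) set) \<noteq> {}" using hardy_space_zero by blast
qed

section \<open>Annihilating products of linear forms\<close>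

text \<open>Composition without the cut-off outside the ball that \<open>comp_op\<close> performs,
  so that polynomial identities hold on the whole space.\<close>

abbreviation pull :: "('a \<Rightarrow> 'a) \<Rightarrow> ('a \<Rightarrow> complex) \<Rightarrow> ('a \<Rightarrow> complex)" where
  "pull S f \<equiv> (\<lambda>x. f (S x))"

lemma opl_pull_linear:
  "opl (pull S) cs (\<lambda>x. f x + g x) = (\<lambda>x. opl (pull S) cs f x + opl (pull S) cs g x)"
  "opl (pull S) cs (\<lambda>x. k * f x) = (\<lambda>x. k * opl (pull S) cs f x)"
  "opl (pull S) cs (\<lambda>x. 0) = (\<lambda>x. 0)"
proof (induction cs arbitrary: f g)
  case (Cons c cs)
  { case 1
    have e: "(\<lambda>x. f (S x) + g (S x) - c * (f x + g x)) = (\<lambda>x. (f (S x) - c * f x) + (g (S x) - c * g x))"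
      by (simp add: algebra_simps)
    show ?case by (simp only: opl.simps e Cons.IH)
  next
    case 2
    have e: "(\<lambda>x. k * f (S x) - c * (k * f x)) = (\<lambda>x. k * (f (S x) - c * f x))"
      by (simp add: algebra_simps)
    show ?case by (simp only: opl.simps e Cons.IH)
  next
    case 3
    show ?case using Cons.IH(3) by simp }
qed simp_all

lemma opl_pull_pull: "opl (pull S) cs (pull S f) = pull S (opl (pull S) cs f)"
  by (induction cs arbitrary: f) (use opl_pull_linear in simp_all)

lemma opl_append: "opl T (cs @ ds) f = opl T ds (opl T cs f)"
  by (induction cs arbitrary: f) auto

lemma opl_pull_Cons: "opl (pull S) (c # cs) f = (\<lambda>x. opl (pull S) cs f (S x) - c * opl (pull S) cs f x)"
proof -
  have "opl (pull S) (c # cs) f = opl (pull S) cs (\<lambda>x. f (S x) + - c * f x)" by simp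
  also have "\<dots> = (\<lambda>x. opl (pull S) cs (pull S f) x + - c * opl (pull S) cs f x)"
    unfolding opl_pull_linear ..
  finally show ?thesis unfolding opl_pull_pull by simp
qed

lemma opl_pull_zero_append:
  assumes "opl (pull S) cs f = (\<lambda>x. 0)"
  shows "opl (pull S) (cs @ ds) f = (\<lambda>x. 0)" "opl (pull S) (ds @ cs) f = (\<lambda>x. 0)"
proof -
  show "opl (pull S) (cs @ ds) f = (\<lambda>x. 0)" by (simp add: opl_append assms opl_pull_linear)
  show "opl (pull S) (ds @ cs) f = (\<lambda>x. 0)"
    using assms by (induction ds) (auto simp: opl_pull_Cons simp del: opl.simps(2))
qed

text \<open>Composition with \<open>S\<close> is multiplicative: the factor with scalar
  \<open>a * b\<close> applied to \<open>f g\<close> equals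
  \<open>(f \<circ> S - a f) (g \<circ> S) + a f (g \<circ> S - b g)\<close>. In each summand one of
  the two lists has become shorter, which gives the induction on the total length.\<close>

lemma opl_pull_mult:
  "\<exists>cs. set cs \<subseteq> {a * b | a b. a \<in> set as \<and> b \<in> set bs} \<and>
    (\<forall>f g. opl (pull S) as f = (\<lambda>x. 0) \<longrightarrow> opl (pull S) bs g = (\<lambda>x. 0) \<longrightarrow>
       opl (pull S) cs (\<lambda>x. f x * g x) = (\<lambda>x. 0))"
proof (induction "length as + length bs" arbitrary: as bs rule: less_induct)
  case less
  show ?case
  proof (cases as)
    case Nil
    then show ?thesis by (intro exI[of _ "[]"]) (auto simp: fun_eq_iff)
  next
    case as: (Cons a as')
    show ?thesis
    proof (cases bs)
      case Nil
      then show ?thesis by (intro exI[of _ "[]"]) (auto simp: fun_eq_iff)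
    next
      case bs: (Cons b bs')
      obtain c1 where c1: "set c1 \<subseteq> {a * b | a b. a \<in> set as' \<and> b \<in> set bs}"
        "\<And>f g. opl (pull S) as' f = (\<lambda>x. 0) \<Longrightarrow> opl (pull S) bs g = (\<lambda>x. 0) \<Longrightarrow> opl (pull S) c1 (\<lambda>x. f x * g x) = (\<lambda>x. 0)"
        using less[of as' bs] as by auto
      obtain c2 where c2: "set c2 \<subseteq> {a * b | a b. a \<in> set as \<and> b \<in> set bs'}"
        "\<And>f g. opl (pull S) as f = (\<lambda>x. 0) \<Longrightarrow> opl (pull S) bs' g = (\<lambda>x. 0) \<Longrightarrow> opl (pull S) c2 (\<lambda>x. f x * g x) = (\<lambda>x. 0)"
        using less[of as bs'] bs by auto
      show ?thesis
      proof (intro exI[of _ "(a * b) # c1 @ c2"] conjI allI impI)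
        show "set ((a * b) # c1 @ c2) \<subseteq> {a * b | a b. a \<in> set as \<and> b \<in> set bs}"
        proof -
          have "set as' \<subseteq> set as" "set bs' \<subseteq> set bs" "a \<in> set as" "b \<in> set bs" by (auto simp: as bs)
          then show ?thesis using c1(1) c2(1) by auto blast+
        qed
        fix f g assume f: "opl (pull S) as f = (\<lambda>x. 0)" and g: "opl (pull S) bs g = (\<lambda>x. 0)"
        have e: "(\<lambda>x. f (S x) * g (S x) - a * b * (f x * g x)) =
           (\<lambda>x. (f (S x) - a * f x) * g (S x) + a * (f x * (g (S x) - b * g x)))"
          by (simp add: algebra_simps)
        have 1: "opl (pull S) (c1 @ c2) (\<lambda>x. (f (S x) - a * f x) * g (S x)) = (\<lambda>x. 0)"
        proof (rule opl_pull_zero_append(1), rule c1(2))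
          show "opl (pull S) as' (\<lambda>x. f (S x) - a * f x) = (\<lambda>x. 0)" using f by (simp add: as)
          show "opl (pull S) bs (\<lambda>x. g (S x)) = (\<lambda>x. 0)" by (simp add: opl_pull_pull g)
        qed
        have 2: "opl (pull S) (c1 @ c2) (\<lambda>x. f x * (g (S x) - b * g x)) = (\<lambda>x. 0)"
        proof (rule opl_pull_zero_append(2), rule c2(2)[OF f])
          show "opl (pull S) bs' (\<lambda>x. g (S x) - b * g x) = (\<lambda>x. 0)" using g by (simp add: bs)
        qed
        show "opl (pull S) ((a * b) # c1 @ c2) (\<lambda>x. f x * g x) = (\<lambda>x. 0)"
          unfolding opl.simps e opl_pull_linear 1 2 by simp
      qed
    qed
  qed
qed

text \<open>Lists of generators instead of exponents free the definition from an index type; for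
  \<open>range lam\<close> it is the set of all \<open>multi_power lam \<alpha>\<close>.\<close>

definition monoid_of :: "complex set \<Rightarrow> complex set" where
  "monoid_of E = {prod_list xs | xs. set xs \<subseteq> E}"

lemma monoid_of_1: "1 \<in> monoid_of E"
  unfolding monoid_of_def by (auto intro!: exI[of _ "[]"])

lemma monoid_of_mult:
  assumes "a \<in> monoid_of E" "b \<in> monoid_of E"
  shows "a * b \<in> monoid_of E"
proof -
  obtain xs ys where "set xs \<subseteq> E" "a = prod_list xs" "set ys \<subseteq> E" "b = prod_list ys"
    using assms by (auto simp: monoid_of_def)
  then have "set (xs @ ys) \<subseteq> E" "a * b = prod_list (xs @ ys)" by auto
  then show ?thesis unfolding monoid_of_def by blast
qed

lemma monoid_of_incl: "a \<in> E \<Longrightarrow> a \<in> monoid_of E"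
  unfolding monoid_of_def by (auto intro!: exI[of _ "[a]"])

lemma monoid_of_power: "a \<in> monoid_of E \<Longrightarrow> a ^ n \<in> monoid_of E"
  by (induction n) (auto intro: monoid_of_1 monoid_of_mult)

lemma monoid_of_mono: "E \<subseteq> F \<Longrightarrow> monoid_of E \<subseteq> monoid_of F"
  unfolding monoid_of_def by blast

text \<open>\<open>opl_pull_mult\<close> supplies a list for each single exponent by induction, and
  concatenation covers all exponents below \<open>m\<close>. The list is chosen before
  \<open>f\<close>.\<close>

lemma opl_pull_powers:
  assumes "set as \<subseteq> monoid_of E"
  shows "\<exists>cs. set cs \<subseteq> monoid_of E \<and> (\<forall>f. opl (pull S) as f = (\<lambda>x. 0) \<longrightarrow> (\<forall>k<m. opl (pull S) cs (\<lambda>x. f x ^ k) = (\<lambda>x. 0)))"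
proof -
  have pow: "\<exists>cs. set cs \<subseteq> monoid_of E \<and> (\<forall>f. opl (pull S) as f = (\<lambda>x. 0) \<longrightarrow> opl (pull S) cs (\<lambda>x. f x ^ k) = (\<lambda>x. 0))" for k
  proof (induction k)
    case 0
    show ?case by (intro exI[of _ "[1]"]) (auto simp: monoid_of_1)
  next
    case (Suc k)
    then obtain cs where cs: "set cs \<subseteq> monoid_of E" "\<And>f. opl (pull S) as f = (\<lambda>x. 0) \<Longrightarrow> opl (pull S) cs (\<lambda>x. f x ^ k) = (\<lambda>x. 0)"
      by blast
    obtain ds where ds: "set ds \<subseteq> {a * b | a b. a \<in> set as \<and> b \<in> set cs}"
      "\<And>f g. opl (pull S) as f = (\<lambda>x. 0) \<Longrightarrow> opl (pull S) cs g = (\<lambda>x. 0) \<Longrightarrow> opl (pull S) ds (\<lambda>x. f x * g x) = (\<lambda>x. 0)"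
      using opl_pull_mult[of as cs S] by blast
    have "set ds \<subseteq> monoid_of E" using ds(1) cs(1) assms by (auto intro: monoid_of_mult)
    moreover have "opl (pull S) ds (\<lambda>x. f x ^ Suc k) = (\<lambda>x. 0)" if "opl (pull S) as f = (\<lambda>x. 0)" for f
      using ds(2)[OF that cs(2)[OF that]] by simp
    ultimately show ?case by blast
  qed
  show ?thesis
  proof (induction m)
    case 0
    show ?case by (intro exI[of _ "[]"]) simp
  next
    case (Suc m)
    obtain cs where cs: "set cs \<subseteq> monoid_of E"
      "\<And>f k. opl (pull S) as f = (\<lambda>x. 0) \<Longrightarrow> k < m \<Longrightarrow> opl (pull S) cs (\<lambda>x. f x ^ k) = (\<lambda>x. 0)" using Suc by blast
    obtain ds where ds: "set ds \<subseteq> monoid_of E"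
      "\<And>f. opl (pull S) as f = (\<lambda>x. 0) \<Longrightarrow> opl (pull S) ds (\<lambda>x. f x ^ m) = (\<lambda>x. 0)" using pow by blast
    have "opl (pull S) (cs @ ds) (\<lambda>x. f x ^ k) = (\<lambda>x. 0)" if f: "opl (pull S) as f = (\<lambda>x. 0)" "k < Suc m" for f k
    proof (cases "k = m")
      case True
      then show ?thesis using opl_pull_zero_append(2)[OF ds(2)[OF f(1)]] by simp
    next
      case False
      then show ?thesis using opl_pull_zero_append(1)[OF cs(2)[OF f(1)]] f(2) by simp
    qed
    moreover have "set (cs @ ds) \<subseteq> monoid_of E" using cs(1) ds(1) by simp
    ultimately show ?case by blast
  qed
qed

section \<open>An annihilating product for a matrix\<close>

fun vopl :: "complex ^ 'm ^ 'm \<Rightarrow> complex list \<Rightarrow> complex ^ 'm \<Rightarrow> complex ^ 'm" where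
  "vopl B [] v = v"
| "vopl B (r # rs) v = vopl B rs (B *v v - r *s v)"

lemma matrix_vector_add: "(A :: complex ^ 'm ^ 'n) *v (x + y) = A *v x + A *v y"
  by (rule matrix_vector_right_distrib)

lemma vopl_linear: "vopl B rs (x + y) = vopl B rs x + vopl B rs y" "vopl B rs (c *s x) = c *s vopl B rs x"
proof (induction rs arbitrary: x y)
  case (Cons r rs)
  { case 1
    have e: "B *v (x + y) - r *s (x + y) = (B *v x - r *s x) + (B *v y - r *s y)"
      by (simp add: matrix_vector_add vec_eq_iff algebra_simps)
    show ?case unfolding vopl.simps e by (rule Cons.IH(1))
  next
    case 2
    have e: "B *v (c *s x) - r *s (c *s x) = c *s (B *v x - r *s x)"
      by (simp add: smult_matrix_vector vec_eq_iff algebra_simps)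
    show ?case unfolding vopl.simps e by (rule Cons.IH(2)) }
qed simp_all

lemma vopl_zero: "vopl B rs 0 = 0"
  using vopl_linear(2)[of B rs 0 0] by simp

lemma vopl_commute: "vopl B rs (B *v v) = B *v vopl B rs v"
proof (induction rs arbitrary: v)
  case (Cons r rs)
  have e: "B *v (B *v v) - r *s (B *v v) = B *v (B *v v - r *s v)"
    by (simp add: matrix_vector_mult_diff_distrib smult_matrix_vector)
  show ?case unfolding vopl.simps e by (rule Cons.IH)
qed simp

lemma vopl_Cons: "vopl B (r # rs) v = B *v vopl B rs v - r *s vopl B rs v"
proof -
  have e: "x - r *s y = x + (- r) *s y" for x y :: "complex ^ 'a" by (simp add: vec_eq_iff)
  show ?thesis unfolding vopl.simps e vopl_linear vopl_commute ..
qed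

lemma vopl_append: "vopl B (rs @ ss) v = vopl B ss (vopl B rs v)"
  by (induction rs arbitrary: v) auto

text \<open>A factor \<open>B - r\<close> with \<open>r\<close> not an eigenvalue is injective, and
  it can be made to act last, so it may be dropped.\<close>

lemma vopl_filter: "vopl B rs v = 0 \<Longrightarrow> vopl B (filter (is_eigenvalue B) rs) v = 0"
proof (induction rs arbitrary: v)
  case (Cons r rs)
  show ?case
  proof (cases "is_eigenvalue B r")
    case True
    then show ?thesis using Cons by simp
  next
    case False
    have "B *v vopl B rs v = r *s vopl B rs v" using Cons.prems unfolding vopl_Cons by simp
    then have "vopl B rs v = 0" using False by (auto simp: is_eigenvalue_def)
    then show ?thesis using False Cons.IH by simp
  qed
qed simp

text \<open>The fundamental theorem of algebra splits off one root of \<open>g\<close> at a time.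
  The summation bound \<open>N\<close> merely dominates the degree, which lets both drop by one
  together.\<close>

lemma vopl_factor:
  fixes B :: "complex ^ 'm ^ 'm"
  assumes "g \<noteq> 0" "degree g \<le> N" "(\<Sum>i\<le>N. coeff g i *s (((*v) B ^^ i) v)) = 0"
  shows "\<exists>rs. vopl B rs v = 0"
  using assms
proof (induction "degree g" arbitrary: g v N)
  case 0
  then obtain c where c: "g = [:c:]" "c \<noteq> 0" by (metis degree_eq_zeroE pCons_eq_0_iff)
  have "(\<Sum>i\<le>N. coeff g i *s (((*v) B ^^ i) v)) = (\<Sum>i\<le>N. if i = 0 then c *s v else 0)"
    by (intro sum.cong refl) (auto simp: c coeff_pCons split: nat.split)
  then have "v = 0" using 0 c by simp
  then show ?case by (intro exI[of _ "[]"]) simp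
next
  case (Suc d)
  then have nc: "\<not> constant (poly g)" by (simp add: constant_degree)
  obtain r where r: "poly g r = 0" using Fundamental_Theorem_Algebra.fundamental_theorem_of_algebra[OF nc] by blast
  then obtain h where h: "g = [:- r, 1:] * h" by (metis poly_eq_0_iff_dvd dvdE)
  have h0: "h \<noteq> 0" using Suc.prems(1) h by auto
  have dg: "degree g = Suc (degree h)"
  proof -
    have "degree ([:- r, 1:] * h) = degree [:- r, 1:] + degree h" by (rule degree_mult_eq) (use h0 in auto)
    then show ?thesis by (simp add: h)
  qed
  obtain M where M: "N = Suc M" using Suc.prems(2) dg by (cases N) auto
  define f where "f i = ((*v) B ^^ i) v" for i
  have cg: "coeff g i = coeff (pCons 0 h) i - r * coeff h i" for i by (simp add: h)
  have lin: "((*v) B ^^ i) (x - r *s y) = ((*v) B ^^ i) x - r *s (((*v) B ^^ i) y)" for i x y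
    by (induction i) (simp_all add: matrix_vector_mult_diff_distrib smult_matrix_vector)
  have step: "((*v) B ^^ i) (B *v v - r *s v) = f (Suc i) - r *s f i" for i
    unfolding lin f_def by (simp add: funpow_swap1)
  have "0 = (\<Sum>i\<le>Suc M. coeff g i *s f i)" using Suc.prems(3) by (simp add: M f_def)
  also have "\<dots> = (\<Sum>i\<le>Suc M. coeff (pCons 0 h) i *s f i) - (\<Sum>i\<le>Suc M. (r * coeff h i) *s f i)"
    unfolding sum_subtractf[symmetric] by (intro sum.cong refl) (simp add: cg vector_sub_rdistrib)
  also have "(\<Sum>i\<le>Suc M. coeff (pCons 0 h) i *s f i) = (\<Sum>i\<le>M. coeff h i *s f (Suc i))"
    by (subst sum.atMost_Suc_shift) simp
  also have "(\<Sum>i\<le>Suc M. (r * coeff h i) *s f i) = (\<Sum>i\<le>M. (r * coeff h i) *s f i)"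
  proof -
    have "coeff h (Suc M) = 0" using Suc.prems(2) dg M by (intro coeff_eq_0) simp
    then show ?thesis by simp
  qed
  also have "(\<Sum>i\<le>M. coeff h i *s f (Suc i)) - (\<Sum>i\<le>M. (r * coeff h i) *s f i) = (\<Sum>i\<le>M. coeff h i *s (((*v) B ^^ i) (B *v v - r *s v)))"
    unfolding sum_subtractf[symmetric] step
    by (intro sum.cong refl) (simp add: vec_eq_iff algebra_simps)
  finally have "(\<Sum>i\<le>M. coeff h i *s (((*v) B ^^ i) (B *v v - r *s v))) = 0" by simp
  moreover have "d = degree h" using Suc.hyps(2) dg by simp
  moreover have "degree h \<le> M" using Suc.prems(2) dg M by simp
  ultimately obtain rs where "vopl B rs (B *v v - r *s v) = 0" using Suc.hyps(1)[OF _ h0] by blast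
  then show ?case by (intro exI[of _ "r # rs"]) simp
qed

text \<open>There are more vectors than the dimension. If two of them coincide, the set of their
  values may be too small for the dependence argument, and their difference is the relation
  instead.\<close>

lemma krylov_relation:
  fixes f :: "nat \<Rightarrow> complex ^ 'm"
  shows "\<exists>a. (\<exists>i\<le>CARD('m). a i \<noteq> 0) \<and> (\<Sum>i\<le>CARD('m). a i *s f i) = 0"
proof (cases "inj_on f {..CARD('m)}")
  case True
  have "vec.dependent (f ` {..CARD('m)})"
  proof (rule ccontr)
    assume "\<not> ?thesis"
    then have "card (f ` {..CARD('m)}) \<le> vec.dim (UNIV :: (complex ^ 'm) set)"
      by (intro vec.independent_card_le_dim) auto
    then show False using card_image[OF True] unfolding vec_dim_card by simp
  qed
  then obtain u where u: "\<exists>v\<in>f ` {..CARD('m)}. u v \<noteq> 0" "(\<Sum>v\<in>f ` {..CARD('m)}. u v *s v) = 0"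
    using vec.dependent_finite[of "f ` {..CARD('m)}"] by auto
  then have "(\<Sum>i\<le>CARD('m). u (f i) *s f i) = 0" by (simp add: sum.reindex[OF True])
  then show ?thesis using u(1) by (intro exI[of _ "\<lambda>i. u (f i)"]) auto
next
  case False
  then obtain i j where ij: "i \<le> CARD('m)" "j \<le> CARD('m)" "i \<noteq> j" "f i = f j" by (auto simp: inj_on_def)
  let ?a = "\<lambda>k. if k = i then 1 else if k = j then - 1 else (0 :: complex)"
  have "(\<Sum>k\<le>CARD('m). ?a k *s f k) = (\<Sum>k\<in>{i, j}. ?a k *s f k)"
    using ij by (intro sum.mono_neutral_right) auto
  also have "\<dots> = 0" using ij by (simp add: vec_eq_iff)
  finally show ?thesis using ij by (intro exI[of _ ?a]) auto
qed

text \<open>Takes the place of the Cayley-Hamilton theorem: a Krylov relation annihilates one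
  vector, factors that do not belong to eigenvalues are dropped, and the lists for the basis vectors
  are concatenated.\<close>

lemma vopl_eigenvalues:
  fixes B :: "complex ^ 'm ^ 'm"
  shows "\<exists>rs. set rs \<subseteq> {\<mu>. is_eigenvalue B \<mu>} \<and> (\<forall>v. vopl B rs v = 0)"
proof -
  have single: "\<exists>rs. set rs \<subseteq> {\<mu>. is_eigenvalue B \<mu>} \<and> vopl B rs v = 0" for v
  proof -
    obtain a where a: "\<exists>i\<le>CARD('m). a i \<noteq> 0" "(\<Sum>i\<le>CARD('m). a i *s (((*v) B ^^ i) v)) = 0"
      using krylov_relation[of "\<lambda>i. ((*v) B ^^ i) v"] by blast
    define g where "g = (\<Sum>i\<le>CARD('m). monom (a i) i)"
    have cg: "coeff g j = (if j \<le> CARD('m) then a j else 0)" for j by (simp add: g_def coeff_sum)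
    have "g \<noteq> 0" using a(1) cg by (metis coeff_0)
    moreover have "degree g \<le> CARD('m)" by (intro degree_le) (simp add: cg)
    moreover have "(\<Sum>i\<le>CARD('m). coeff g i *s (((*v) B ^^ i) v)) = 0" using a(2) by (simp add: cg)
    ultimately obtain rs where "vopl B rs v = 0" using vopl_factor by blast
    then have "vopl B (filter (is_eigenvalue B) rs) v = 0" by (rule vopl_filter)
    then show ?thesis by (intro exI[of _ "filter (is_eigenvalue B) rs"]) auto
  qed
  have all: "\<exists>rs. set rs \<subseteq> {\<mu>. is_eigenvalue B \<mu>} \<and> (\<forall>j\<in>J. vopl B rs (axis j 1) = 0)" if "finite J" for J :: "'m set"
    using that
  proof induction
    case (insert j J)
    obtain rs where rs: "set rs \<subseteq> {\<mu>. is_eigenvalue B \<mu>}" "\<forall>j\<in>J. vopl B rs (axis j 1) = 0" using insert.IH by blast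
    obtain ss where ss: "set ss \<subseteq> {\<mu>. is_eigenvalue B \<mu>}" "vopl B ss (vopl B rs (axis j 1)) = 0"
      using single[of "vopl B rs (axis j 1)"] by blast
    have "\<forall>i\<in>insert j J. vopl B (rs @ ss) (axis i 1) = 0"
      using rs(2) ss(2) by (simp add: vopl_append vopl_zero)
    moreover have "set (rs @ ss) \<subseteq> {\<mu>. is_eigenvalue B \<mu>}" using rs(1) ss(1) by simp
    ultimately show ?case by blast
  qed (auto intro: exI[of _ "[]"])
  obtain rs where rs: "set rs \<subseteq> {\<mu>. is_eigenvalue B \<mu>}" "\<And>j. vopl B rs (axis j 1) = 0"
    using all[OF finite[of "UNIV :: 'm set"]] by blast
  have sum: "vopl B rs (\<Sum>j\<in>J. v $ j *s axis j 1) = 0" if "finite J" for v and J :: "'m set"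
    using that by induction (simp_all add: vopl_linear vopl_zero rs(2))
  have "vopl B rs v = 0" for v
    using sum[of UNIV v] by (simp add: basis_expansion)
  then show ?thesis using rs(1) by blast
qed

lemma opl_pull_hermitian: "opl (pull ((*v) A)) rs (\<lambda>w. hermitian w \<eta>) = (\<lambda>w. hermitian (vopl A rs w) \<eta>)"
proof (induction rs)
  case (Cons r rs)
  show ?case unfolding opl_pull_Cons Cons.IH vopl_Cons vopl_commute by simp
qed simp

text \<open>The list must not depend on \<open>\<eta>\<close>: the Taylor polynomial below is an
  integral over \<open>\<eta>\<close> of such powers, and one list has to annihilate the whole
  integrand.\<close>

lemma annihilate_powers:
  fixes A :: "complex ^ 'm ^ 'm"
  shows "\<exists>cs. set cs \<subseteq> monoid_of {\<mu>. is_eigenvalue A \<mu>} \<and>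
    (\<forall>\<eta>. \<forall>k<m. opl (pull ((*v) A)) cs (\<lambda>w. hermitian w \<eta> ^ k) = (\<lambda>w. 0))"
proof -
  obtain rs where rs: "set rs \<subseteq> {\<mu>. is_eigenvalue A \<mu>}" "\<And>v. vopl A rs v = 0" using vopl_eigenvalues by blast
  have "set rs \<subseteq> monoid_of {\<mu>. is_eigenvalue A \<mu>}" using rs(1) monoid_of_incl by blast
  from opl_pull_powers[OF this] obtain cs where cs: "set cs \<subseteq> monoid_of {\<mu>. is_eigenvalue A \<mu>}"
    "\<And>f. opl (pull ((*v) A)) rs f = (\<lambda>x. 0) \<Longrightarrow> (\<forall>k<m. opl (pull ((*v) A)) cs (\<lambda>x. f x ^ k) = (\<lambda>x. 0))"
    by blast
  have "opl (pull ((*v) A)) rs (\<lambda>w. hermitian w \<eta>) = (\<lambda>x. 0)" for \<eta>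
    unfolding opl_pull_hermitian rs(2) by simp
  from cs(2)[OF this] cs(1) show ?thesis by blast
qed

section \<open>Taylor expansion\<close>

lemma opl_pull_integral:
  fixes h :: "complex ^ 'm \<Rightarrow> 'a \<Rightarrow> complex"
  assumes "\<And>w. integrable sigma (\<lambda>\<eta>. h \<eta> w)"
  shows "opl (pull S) cs (\<lambda>w. \<integral>\<eta>. h \<eta> w \<partial>sigma) = (\<lambda>w. \<integral>\<eta>. opl (pull S) cs (h \<eta>) w \<partial>sigma)"
  using assms
proof (induction cs arbitrary: h)
  case (Cons c cs)
  have int: "integrable sigma (\<lambda>\<eta>. h \<eta> (S w) - c * h \<eta> w)" for w
    by (intro Bochner_Integration.integrable_diff integrable_mult_right Cons.prems)
  have "(\<integral>\<eta>. h \<eta> (S w) \<partial>sigma) - c * (\<integral>\<eta>. h \<eta> w \<partial>sigma) = (\<integral>\<eta>. h \<eta> (S w) - c * h \<eta> w \<partial>sigma)" for w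
    by (subst Bochner_Integration.integral_diff) (simp_all add: Cons.prems)
  then show ?case using Cons.IH[OF int] by simp
qed simp

lemma opl_pull_sum:
  "opl (pull S) cs (\<lambda>x. \<Sum>k<(m::nat). c k * f k x) = (\<lambda>x. \<Sum>k<m. c k * opl (pull S) cs (f k) x)"
proof (induction m)
  case (Suc m)
  then show ?case by (simp add: opl_pull_linear)
qed (simp add: opl_pull_linear)

lemma opl_pull_bound:
  fixes h :: "complex ^ 'm \<Rightarrow> complex"
  assumes "\<And>w. norm (S w) \<le> norm w" and "\<exists>C. \<forall>w. norm w \<le> \<delta> \<longrightarrow> norm (h w) \<le> C * norm w ^ m"
  shows "\<exists>C. \<forall>w. norm w \<le> \<delta> \<longrightarrow> norm (opl (pull S) cs h w) \<le> C * norm w ^ m"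
  using assms(2)
proof (induction cs arbitrary: h)
  case (Cons c cs)
  obtain C where C: "\<And>w. norm w \<le> \<delta> \<Longrightarrow> norm (h w) \<le> C * norm w ^ m" using Cons.prems by blast
  have "norm (h (S w) - c * h w) \<le> (\<bar>C\<bar> + norm c * \<bar>C\<bar>) * norm w ^ m" if w: "norm w \<le> \<delta>" for w
  proof -
    have Sw: "norm (S w) \<le> \<delta>" using assms(1)[of w] w by simp
    have "norm (h (S w)) \<le> C * norm (S w) ^ m" by (rule C[OF Sw])
    also have "\<dots> \<le> \<bar>C\<bar> * norm w ^ m" by (intro mult_mono power_mono assms(1)) auto
    finally have 1: "norm (h (S w)) \<le> \<bar>C\<bar> * norm w ^ m" .
    have "norm (h w) \<le> \<bar>C\<bar> * norm w ^ m"
      using C[OF w] mult_right_mono[OF abs_ge_self[of C], of "norm w ^ m"] by simp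
    then have 2: "norm c * norm (h w) \<le> norm c * (\<bar>C\<bar> * norm w ^ m)" by (rule mult_left_mono) simp
    have "norm (h (S w) - c * h w) \<le> norm (h (S w)) + norm c * norm (h w)"
      using norm_triangle_ineq4[of "h (S w)" "c * h w"] by (simp add: norm_mult)
    with 1 2 show ?thesis by (simp add: distrib_right)
  qed
  then have "\<exists>C. \<forall>w. norm w \<le> \<delta> \<longrightarrow> norm (h (S w) - c * h w) \<le> C * norm w ^ m" by blast
  from Cons.IH[OF this] show ?case by simp
qed simp

lemma szego_remainder:
  "\<exists>C. \<forall>x. norm x \<le> 1 / 2 \<longrightarrow>
    norm (inverse ((1 - x) ^ CARD('m::finite)) - (\<Sum>k<m. of_real (1 / moment TYPE('m) k) * x ^ k)) \<le> C * norm (x :: complex) ^ m"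
proof -
  define c where "c k = 1 / moment TYPE('m) k" for k
  have c: "c k > 0" for k using moment_pos[where 'n = 'm and k = k] by (simp add: c_def)
  have "summable (\<lambda>k. complex_of_real (c k) * (1 / 2) ^ k)"
    using szego_sums[where 'n = 'm, of "1 / 2"] by (simp add: c_def sums_iff)
  then have "summable (\<lambda>k. complex_of_real (c k * (1 / 2) ^ k))" by simp
  then have s: "summable (\<lambda>k. c k * (1 / 2) ^ k)" unfolding summable_complex_of_real .
  have s': "summable (\<lambda>k. c (k + m) * (1 / 2) ^ (k + m))" by (rule summable_ignore_initial_segment[OF s])
  \<comment> \<open>The tail of the series at \<open>1 / 2\<close>, rescaled by
    \<open>2 ^ m\<close>: after \<open>norm x ^ m\<close> is split off, the remaining powers are
    bounded by those of \<open>1 / 2\<close>.\<close>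
  let ?C = "2 ^ m * (\<Sum>k. c (k + m) * (1 / 2) ^ (k + m))"
  have "norm (inverse ((1 - x) ^ CARD('m)) - (\<Sum>k<m. of_real (c k) * x ^ k)) \<le> ?C * norm x ^ m" if x: "norm x \<le> 1 / 2" for x :: complex
  proof -
    have sx: "(\<lambda>k. of_real (c k) * x ^ k) sums inverse ((1 - x) ^ CARD('m))"
      unfolding c_def by (rule szego_sums) (use x in simp)
    have "inverse ((1 - x) ^ CARD('m)) = (\<Sum>k. of_real (c (k + m)) * x ^ (k + m)) + (\<Sum>k<m. of_real (c k) * x ^ k)"
      unfolding sums_unique[OF sx] by (rule suminf_split_initial_segment[OF sums_summable[OF sx]])
    then have "norm (inverse ((1 - x) ^ CARD('m)) - (\<Sum>k<m. of_real (c k) * x ^ k)) = norm (\<Sum>k. of_real (c (k + m)) * x ^ (k + m))"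
      by simp
    also have "\<dots> \<le> (\<Sum>k. (2 ^ m * norm x ^ m) * (c (k + m) * (1 / 2) ^ (k + m)))"
    proof (rule norm_suminf_le[OF _ summable_mult[OF s']])
      fix k
      have "norm x ^ k \<le> (1 / 2) ^ k" using x by (intro power_mono) auto
      then have "c (k + m) * norm x ^ m * norm x ^ k \<le> c (k + m) * norm x ^ m * (1 / 2) ^ k"
        using c[of "k + m"] by (intro mult_left_mono) auto
      then show "norm (of_real (c (k + m)) * x ^ (k + m)) \<le> (2 ^ m * norm x ^ m) * (c (k + m) * (1 / 2) ^ (k + m))"
        using c[of "k + m"] by (simp add: norm_mult norm_power power_add power_divide mult_ac)
    qed
    also have "\<dots> = ?C * norm x ^ m" by (subst suminf_mult[OF s']) (simp only: mult_ac)
    finally show ?thesis .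
  qed
  then show ?thesis unfolding c_def by blast
qed

text \<open>\<open>P\<close> is a Taylor polynomial of \<open>G\<close> in integral form: truncating
  the Szego kernel turns the reproducing formula into an integral of powers
  \<open>hermitian w \<eta> ^ k\<close> with \<open>k < m\<close>, which \<open>cs\<close>
  annihilates. The remainder is of order \<open>m\<close>, and the factors \<open>T - c\<close>
  preserve this order. No multi-index expansion occurs.\<close>

lemma taylor_annihilate:
  fixes G :: "complex ^ 'm \<Rightarrow> complex"
  assumes G: "holo_on (ball 0 R) G" "R > 1" and A: "\<And>v. norm (A *v v) \<le> norm v"
    and cs: "\<And>\<eta> k. k < m \<Longrightarrow> opl (pull ((*v) A)) cs (\<lambda>w. hermitian w \<eta> ^ k) = (\<lambda>w. 0)"
  shows "\<exists>C. \<forall>w. norm w \<le> 1 / 2 \<longrightarrow> norm (opl (pull ((*v) A)) cs G w) \<le> C * norm w ^ m"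
proof -
  define c where "c k = complex_of_real (1 / moment TYPE('m) k)" for k
  define T where "T x = (\<Sum>k<m. c k * x ^ k)" for x :: complex
  obtain C where C: "\<And>x. norm x \<le> 1 / 2 \<Longrightarrow> norm (inverse ((1 - x) ^ CARD('m)) - T x) \<le> C * norm (x :: complex) ^ m"
    using szego_remainder[where 'm = 'm and m = m] unfolding T_def c_def by blast
  note cG = continuous_on_sphere_holo[OF G]
  obtain D where D: "D \<ge> 0" "\<And>z. norm z \<le> 1 \<Longrightarrow> norm (G z) \<le> D" using bounded_on_cball[OF cG] by blast
  have cGs: "continuous_on (sphere 0 1) G" by (rule continuous_on_sphere[OF cG])
  define P where "P w = (\<integral>\<eta>. G \<eta> * T (hermitian w \<eta>) \<partial>sigma)" for w
  have cT: "continuous_on (sphere 0 1) (\<lambda>\<eta>. G \<eta> * T (hermitian w \<eta>))" for w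
    unfolding T_def by (intro continuous_on_mult cGs continuous_intros)
  have int: "integrable sigma (\<lambda>\<eta>. G \<eta> * T (hermitian w \<eta>))" for w
    by (rule integrable_sigma_continuous[OF cT])
  have P0: "opl (pull ((*v) A)) cs P = (\<lambda>w. 0)"
  proof -
    have "opl (pull ((*v) A)) cs (\<lambda>w. G \<eta> * T (hermitian w \<eta>)) = (\<lambda>w. 0)" for \<eta>
      unfolding T_def opl_pull_linear(2) opl_pull_sum by (simp add: cs)
    then show ?thesis unfolding P_def opl_pull_integral[OF int] by simp
  qed
  have "norm (G w - P w) \<le> (D * \<bar>C\<bar>) * norm w ^ m" if w: "norm w \<le> 1 / 2" for w
  proof -
    have w1: "norm w < 1" using w by simp
    have i1: "integrable sigma (\<lambda>\<eta>. G \<eta> * szego w \<eta>)"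
      by (intro integrable_sigma_continuous continuous_on_mult cGs continuous_on_sphere[OF continuous_on_szego'[OF w1]])
    have "G w - P w = (\<integral>\<eta>. G \<eta> * szego w \<eta> - G \<eta> * T (hermitian w \<eta>) \<partial>sigma)"
      unfolding P_def szego_formula[OF G w1] by (rule Bochner_Integration.integral_diff[OF i1 int, symmetric])
    also have "norm \<dots> \<le> (\<integral>\<eta>. norm (G \<eta> * szego w \<eta> - G \<eta> * T (hermitian w \<eta>)) \<partial>sigma)"
      by (rule integral_norm_bound)
    also have "\<dots> \<le> (\<integral>\<eta>. (D * \<bar>C\<bar>) * norm w ^ m \<partial>(sigma :: (complex ^ 'm) measure))"
    proof (rule integral_mono)
      show "integrable sigma (\<lambda>\<eta>. norm (G \<eta> * szego w \<eta> - G \<eta> * T (hermitian w \<eta>)))"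
        by (intro integrable_norm Bochner_Integration.integrable_diff i1 int)
      show "integrable sigma (\<lambda>\<eta> :: complex ^ 'm. (D * \<bar>C\<bar>) * norm w ^ m)" by simp
      fix \<eta> :: "complex ^ 'm" assume "\<eta> \<in> space sigma"
      then have \<eta>: "norm \<eta> = 1" by simp
      have hw: "norm (hermitian w \<eta>) \<le> norm w" using norm_hermitian_le[of w \<eta>] \<eta> by simp
      have "norm (szego w \<eta> - T (hermitian w \<eta>)) \<le> C * norm (hermitian w \<eta>) ^ m"
        unfolding szego_def by (rule C) (use hw w in simp)
      also have "\<dots> \<le> \<bar>C\<bar> * norm w ^ m" by (intro mult_mono power_mono hw) auto
      finally have "norm (G \<eta>) * norm (szego w \<eta> - T (hermitian w \<eta>)) \<le> D * (\<bar>C\<bar> * norm w ^ m)"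
        using D \<eta> by (intro mult_mono) auto
      then show "norm (G \<eta> * szego w \<eta> - G \<eta> * T (hermitian w \<eta>)) \<le> (D * \<bar>C\<bar>) * norm w ^ m"
        by (simp only: right_diff_distrib[symmetric] norm_mult mult.assoc)
    qed
    finally show ?thesis by simp
  qed
  then have "\<exists>C. \<forall>w. norm w \<le> 1 / 2 \<longrightarrow> norm (G w - P w) \<le> C * norm w ^ m" by blast
  from opl_pull_bound[OF A this] obtain C' where C': "\<And>w. norm w \<le> 1 / 2 \<Longrightarrow> norm (opl (pull ((*v) A)) cs (\<lambda>w. G w - P w) w) \<le> C' * norm w ^ m"
    by blast
  have "opl (pull ((*v) A)) cs G = opl (pull ((*v) A)) cs (\<lambda>w. (G w - P w) + P w)" by simp
  also have "\<dots> = (\<lambda>w. opl (pull ((*v) A)) cs (\<lambda>w. G w - P w) w + opl (pull ((*v) A)) cs P w)"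
    by (rule opl_pull_linear(1))
  also have "\<dots> = opl (pull ((*v) A)) cs (\<lambda>w. G w - P w)" unfolding P0 by simp
  finally show ?thesis using C' by auto
qed

lemma opl_pull_cong:
  assumes "\<And>w. w \<in> W \<Longrightarrow> S w \<in> W"
  shows "(\<And>w. w \<in> W \<Longrightarrow> g w = h w) \<Longrightarrow> w \<in> W \<Longrightarrow> opl (pull S) cs g w = opl (pull S) cs h w"
proof (induction cs arbitrary: g h w)
  case (Cons c cs)
  show ?case unfolding opl.simps
    by (rule Cons.IH) (simp_all only: Cons.prems assms)
qed simp

text \<open>Passes from an operator product on functions of the ball to plain composition in a
  parameter \<open>w\<close>, provided that \<open>T\<close> acts along \<open>j\<close> as
  composition with \<open>S\<close>.\<close>

lemma opl_subst:
  assumes T: "\<And>f w. w \<in> W \<Longrightarrow> T f (j w) = f (j (S w))" and S: "\<And>w. w \<in> W \<Longrightarrow> S w \<in> W"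
  shows "w \<in> W \<Longrightarrow> opl T cs f (j w) = opl (pull S) cs (\<lambda>w. f (j w)) w"
proof (induction cs arbitrary: f w)
  case (Cons c cs)
  have "opl T (c # cs) f (j w) = opl (pull S) cs (\<lambda>w. T f (j w) - c * f (j w)) w"
    unfolding opl.simps by (rule Cons.IH[OF Cons.prems])
  also have "\<dots> = opl (pull S) cs (\<lambda>w. f (j (S w)) - c * f (j w)) w"
  proof (rule opl_pull_cong[where W = W])
    show "T f (j w) - c * f (j w) = f (j (S w)) - c * f (j w)" if "w \<in> W" for w using T[OF that] by simp
  qed (use S Cons.prems in simp_all)
  finally show ?case by simp
qed simp

text \<open>The Schwarz lemma iterated \<open>m\<close> times, one zero being divided out at each
  step. The unspecified \<open>K\<close> only certifies the order of the zero and is replaced by the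
  bound \<open>C\<close> on the circle; the origin is excluded because after a division nothing is
  known there beforehand.\<close>

lemma schwarz_order:
  assumes "g holomorphic_on ball 0 R" "R > 1" "\<exists>K. \<forall>x. norm x \<le> 1 \<longrightarrow> x \<noteq> 0 \<longrightarrow> norm (g x) \<le> K * norm x ^ m"
    and "\<And>x. norm x = 1 \<Longrightarrow> norm (g x) \<le> C" and "norm x \<le> 1"
  shows "norm (g x) \<le> C * norm (x :: complex) ^ m"
  using assms
proof (induction m arbitrary: g x)
  case 0
  have cont: "continuous_on (cball 0 1) g"
    using 0 by (intro continuous_on_subset[OF holomorphic_on_imp_continuous_on[OF 0(1)]]) auto
  have "norm (g x) \<le> C"
  proof (rule maximum_modulus_frontier[where S = "cball 0 1" and f = g and \<xi> = x])
    show "g holomorphic_on interior (cball 0 1)" using 0(1,2) by (auto elim: holomorphic_on_subset)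
    show "continuous_on (closure (cball 0 1)) g" using cont by simp
    show "norm (g z) \<le> C" if "z \<in> frontier (cball 0 1)" for z using that 0(4) by simp
  qed (use 0(5) in auto)
  then show ?case by simp
next
  case (Suc m)
  obtain K where K: "\<And>x. norm x \<le> 1 \<Longrightarrow> x \<noteq> 0 \<Longrightarrow> norm (g x) \<le> K * norm x ^ Suc m" using Suc.prems(3) by blast
  have g0: "g 0 = 0"
  proof -
    have "isCont g 0"
      using holomorphic_on_imp_continuous_on[OF Suc.prems(1)] Suc.prems(2) by (simp add: continuous_on_eq_continuous_at)
    then have "g \<midarrow>0\<rightarrow> g 0" by (simp add: isCont_def)
    moreover have "g \<midarrow>0\<rightarrow> 0"
    proof (rule tendsto_norm_zero_cancel, rule tendsto_sandwich[of "\<lambda>x. 0" _ _ "\<lambda>x. K * norm x ^ Suc m"])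
      show "\<forall>\<^sub>F x in at 0. norm (g x) \<le> K * norm x ^ Suc m"
        unfolding eventually_at power_Suc by (rule exI[of _ 1]) (simp add: K[unfolded power_Suc])
      have "((\<lambda>x :: complex. K * norm x ^ Suc m) \<longlongrightarrow> K * norm (0::complex) ^ Suc m) (at 0)"
        by (intro tendsto_mult tendsto_power tendsto_const tendsto_norm[OF tendsto_ident_at])
      then show "((\<lambda>x. K * norm x ^ Suc m) \<longlongrightarrow> 0) (at (0::complex))" by simp
    qed auto
    ultimately show ?thesis by (rule LIM_unique)
  qed
  obtain h where h: "h holomorphic_on ball 0 R" "\<And>z. norm z < R \<Longrightarrow> g z = z * h z"
    using Schwarz3[OF Suc.prems(1) g0] by blast
  have hK: "norm (h z) \<le> K * norm z ^ m" if "norm z \<le> 1" "z \<noteq> 0" for z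
  proof -
    have "norm z * norm (h z) \<le> norm z * (K * norm z ^ m)"
      using K[OF that] h(2)[of z] that Suc.prems(2) by (simp add: norm_mult mult_ac)
    then show ?thesis using that by simp
  qed
  have "norm (h x) \<le> C * norm x ^ m"
  proof (rule Suc.IH[OF h(1) Suc.prems(2) _ _ Suc.prems(5)])
    show "\<exists>K. \<forall>x. norm x \<le> 1 \<longrightarrow> x \<noteq> 0 \<longrightarrow> norm (h x) \<le> K * norm x ^ m" using hK by blast
    show "norm (h z) \<le> C" if "norm z = 1" for z
      using Suc.prems(4)[OF that] h(2)[of z] that Suc.prems(2) by (simp add: norm_mult)
  qed
  then have "norm x * norm (h x) \<le> norm x * (C * norm x ^ m)" by (rule mult_left_mono) simp
  then show ?case using h(2)[of x] Suc.prems(2,5) by (simp add: norm_mult mult_ac)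
qed

section \<open>Block maps\<close>

lemma sum_block:
  fixes e :: "'p::finite + 'q::finite \<Rightarrow> 'n::finite"
  assumes "bij e"
  shows "(\<Sum>k\<in>UNIV. f k) = (\<Sum>i\<in>UNIV. f (e (Inl i))) + (\<Sum>j\<in>UNIV. f (e (Inr j)))"
proof -
  have "(\<Sum>k\<in>UNIV. f k) = (\<Sum>s\<in>UNIV. f (e s))"
    by (rule sum.reindex_bij_betw[OF assms, symmetric])
  also have "\<dots> = (\<Sum>s\<in>UNIV <+> UNIV. f (e s))" by (simp add: UNIV_Plus_UNIV)
  also have "\<dots> = (\<Sum>i\<in>UNIV. f (e (Inl i))) + (\<Sum>j\<in>UNIV. f (e (Inr j)))"
    by (subst sum.Plus) simp_all
  finally show ?thesis .
qed

context
  fixes e :: "'p::finite + 'q::finite \<Rightarrow> 'n::finite"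
  assumes e: "bij e"
begin

lemma join_nth: "join_blocks e x y $ e (Inl i) = x $ i" "join_blocks e x y $ e (Inr j) = y $ j"
  using e by (simp_all add: join_blocks_def inv_f_f bij_is_inj)

lemma block_eqI: "fst_block e z = fst_block e w \<Longrightarrow> snd_block e z = snd_block e w \<Longrightarrow> z = w"
proof -
  assume "fst_block e z = fst_block e w" "snd_block e z = snd_block e w"
  then have "z $ e s = w $ e s" for s
    by (cases s) (simp_all add: fst_block_def snd_block_def vec_eq_iff)
  then show "z = w" using e by (simp add: vec_eq_iff) (metis bij_pointE)
qed

lemma block_join [simp]: "fst_block e (join_blocks e x y) = x" "snd_block e (join_blocks e x y) = y"
  by (simp_all add: fst_block_def snd_block_def join_nth vec_eq_iff)

lemma join_block [simp]: "join_blocks e (fst_block e z) (snd_block e z) = z"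
  by (rule block_eqI) simp_all

lemma block_linear:
  "fst_block e (z + w) = fst_block e z + fst_block e w" "snd_block e (z + w) = snd_block e z + snd_block e w"
  "fst_block e (c *s z) = c *s fst_block e z" "snd_block e (c *s z) = c *s snd_block e z"
  "fst_block e (r *\<^sub>R z) = r *\<^sub>R fst_block e z" "snd_block e (r *\<^sub>R z) = r *\<^sub>R snd_block e z"
  by (simp_all add: fst_block_def snd_block_def vec_eq_iff)

lemma join_linear:
  "join_blocks e x y + join_blocks e x' y' = join_blocks e (x + x') (y + y')"
  "c *s join_blocks e x y = join_blocks e (c *s x) (c *s y)"
  "r *\<^sub>R join_blocks e x y = join_blocks e (r *\<^sub>R x) (r *\<^sub>R y)"
  by (rule block_eqI; simp add: block_linear)+

lemma hermitian_block:
  "hermitian z w = hermitian (fst_block e z) (fst_block e w) + hermitian (snd_block e z) (snd_block e w)"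
  unfolding hermitian_def by (simp add: sum_block[OF e] fst_block_def snd_block_def)

lemma norm_block: "(norm z)\<^sup>2 = (norm (fst_block e z))\<^sup>2 + (norm (snd_block e z))\<^sup>2"
  unfolding norm_sq_vec by (simp add: sum_block[OF e] fst_block_def snd_block_def)

lemma norm_join: "(norm (join_blocks e x y))\<^sup>2 = (norm x)\<^sup>2 + (norm y)\<^sup>2"
  by (simp add: norm_block)

lemma norm_join_mono:
  assumes "norm x \<le> norm x'" "norm y \<le> norm y'"
  shows "norm (join_blocks e x y) \<le> norm (join_blocks e x' y')"
proof (rule power2_le_imp_le)
  show "(norm (join_blocks e x y))\<^sup>2 \<le> (norm (join_blocks e x' y'))\<^sup>2"
    unfolding norm_join using assms by (intro add_mono power_mono) auto
qed simp

lemma fst_block_le: "norm (fst_block e z) \<le> norm z"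
  by (rule power2_le_imp_le) (simp_all add: norm_block[of z])

lemma block_map_join: "block_map e U A (join_blocks e x y) = join_blocks e (U *v x) (A *v y)"
  by (simp add: block_map_def)

lemma block_map_compose: "block_map e U A (block_map e U' A' z) = block_map e (U ** U') (A ** A') z"
  by (simp add: block_map_def matrix_vector_mul_assoc)

lemma block_map_one: "block_map e (mat 1) (mat 1) z = z"
  by (simp add: block_map_def)

lemma adjoint_pair_block: "adjoint_pair (block_map e U A) (block_map e (adjoint_matrix U) (adjoint_matrix A))"
proof -
  have "linear (block_map e M N)" "block_map e M N (c *s v) = c *s block_map e M N v" for M N c v
    by (auto intro!: linearI simp: block_map_def join_linear block_linear matrix_vector_add smult_matrix_vector scaleR_smult)
  then show ?thesis
    unfolding adjoint_pair_def by (simp add: hermitian_block block_map_def hermitian_adjoint)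
qed

lemma norm_block_map_le:
  assumes "\<And>x. norm (U *v x) \<le> norm x" "\<And>y. norm (A *v y) \<le> norm y"
  shows "norm (block_map e U A z) \<le> norm z"
proof -
  have "norm (block_map e U A z) \<le> norm (join_blocks e (fst_block e z) (snd_block e z))"
    unfolding block_map_def by (intro norm_join_mono assms)
  then show ?thesis by simp
qed

lemma cdiff_join_snd: "cdiff (\<lambda>w. join_blocks e x (c *s w)) ((*s)) w"
proof (rule cdiff_vec)
  fix k
  obtain s where s: "k = e s" using e by (metis bij_pointE)
  show "cdiff (\<lambda>w. join_blocks e x (c *s w) $ k) (*) w"
  proof (cases s)
    case (Inl i)
    then show ?thesis by (simp add: s join_nth cdiff_const)
  next
    case (Inr j)
    have "cdiff (\<lambda>w. c * w $ j) (*) w" by (rule cdiff_mult[OF cdiff_const cdiff_nth[OF cdiff_id]]) simp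
    then show ?thesis by (simp add: s Inr join_nth)
  qed
qed

end

section \<open>Composition operators on the Hardy space and the Neumann series\<close>

lemma comp_op_compose:
  assumes "\<And>z. norm z < 1 \<Longrightarrow> norm (L z) < 1"
  shows "comp_op L (comp_op M f) = comp_op (\<lambda>z. M (L z)) f"
  using assms by (auto simp: comp_op_def fun_eq_iff)

lemma comp_op_id:
  assumes "f \<in> hardy_space"
  shows "comp_op (\<lambda>z. z) f = f"
proof
  show "comp_op (\<lambda>z. z) f z = f z" for z
    using hardy_space_outside[OF assms, of z] by (simp add: comp_op_def)
qed

lemma bop_comp_op:
  assumes K: "\<And>f. f \<in> hardy_space \<Longrightarrow> comp_op L f \<in> hardy_space \<and> hardy_norm (comp_op L f) \<le> K * hardy_norm f"
  shows "bounded_operator hardy_space hardy_norm (comp_op L)"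
proof (rule hardy.bopI)
  fix f g :: "complex ^ 'a \<Rightarrow> complex" and c :: complex
  show "comp_op L (\<lambda>x. f x + g x) = (\<lambda>x. comp_op L f x + comp_op L g x)"
    "comp_op L (\<lambda>x. c * f x) = (\<lambda>x. c * comp_op L f x)" by (auto simp: comp_op_def fun_eq_iff)
  show "comp_op L f \<in> hardy_space" "hardy_norm (comp_op L f) \<le> K * hardy_norm f" if "f \<in> hardy_space"
    using K[OF that] by auto
qed

lemma hardy_norm_eq_0:
  assumes "f \<in> hardy_space" "hardy_norm f \<le> 0"
  shows "f = (\<lambda>x. 0)"
proof
  fix z show "f z = 0"
  proof (cases "norm z < 1")
    case True
    then show ?thesis using hardy_norm_pos[OF assms(1), of z] assms(2) by force
  next
    case False
    then show ?thesis using hardy_space_outside[OF assms(1), of z] by simp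
  qed
qed

text \<open>The solution is the sum of \<open>k ^ j\<close> times \<open>f\<close> composed with
  \<open>L ^^ j\<close>. Bounds are asked along the orbit of this one \<open>f\<close> only, because
  the decay used later holds only on functions of a given vanishing order.\<close>

lemma neumann:
  fixes L :: "complex ^ 'n \<Rightarrow> complex ^ 'n"
  assumes f: "f \<in> hardy_space" and L: "\<And>z. norm z < 1 \<Longrightarrow> norm (L z) < 1"
    and B: "\<And>j. comp_op (L ^^ j) f \<in> hardy_space" "\<And>j. hardy_norm (comp_op (L ^^ j) f) \<le> B ^ j * hardy_norm f"
    and k: "B \<ge> 0" "norm k * B < 1"
  shows "\<exists>g\<in>hardy_space. (\<lambda>z. g z - k * comp_op L g z) = f \<and> hardy_norm g \<le> 1 / (1 - norm k * B) * hardy_norm f"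
proof -
  define h where "h j = (\<lambda>z. k ^ j * comp_op (L ^^ j) f z)" for j
  have h: "h j \<in> hardy_space" for j unfolding h_def by (rule hardy_space_scale(1)[OF B(1)])
  have hn: "hardy_norm (h j) \<le> hardy_norm f * (norm k * B) ^ j" for j
  proof -
    have "hardy_norm (h j) \<le> norm (k ^ j) * hardy_norm (comp_op (L ^^ j) f)"
      unfolding h_def by (rule hardy_space_scale(2)[OF B(1)])
    also have "\<dots> \<le> norm (k ^ j) * (B ^ j * hardy_norm f)" by (intro mult_left_mono B) simp
    finally show ?thesis by (simp add: norm_power power_mult_distrib mult_ac)
  qed
  have q: "0 \<le> norm k * B" using k by simp
  define g where "g = (\<lambda>z. \<Sum>j. h j z)"
  have g: "g \<in> hardy_space" "hardy_norm g \<le> hardy_norm f / (1 - norm k * B)" "summable (\<lambda>j. h j z)" for z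
    using hardy_series[OF h q k(2) hn] unfolding g_def by blast+
  have "g z - k * comp_op L g z = f z" for z
  proof (cases "norm z < 1")
    case True
    have Lj: "norm ((L ^^ j) z) < 1" for j by (induction j) (simp_all add: True L)
    have s: "k * h j (L z) = h (Suc j) z" for j
      using True L[OF True] by (simp add: h_def comp_op_def funpow_swap1)
    have "g z = (\<Sum>j. h (Suc j) z) + h 0 z"
      unfolding g_def using suminf_split_head[OF g(3)[of z]] by simp
    also have "(\<Sum>j. h (Suc j) z) = k * g (L z)"
      unfolding g_def s[symmetric] by (rule suminf_mult[OF g(3)])
    finally show ?thesis using True by (simp add: comp_op_def h_def)
  next
    case False
    then show ?thesis using hardy_space_outside[OF g(1), of z] hardy_space_outside[OF f, of z] by (simp add: comp_op_def)
  qed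
  then show ?thesis using g(1,2) by (intro bexI[of _ g]) (auto simp: fun_eq_iff)
qed

section \<open>The normal form\<close>

text \<open>\<open>a\<close> is a strictly positive bound below \<open>1\<close> rather than the
  norm of \<open>A\<close> itself, so that powers of \<open>a\<close> can serve as decay rates and
  divisors even for \<open>A = 0\<close>.\<close>

locale normal_map =
  fixes e :: "'p::finite + 'q::finite \<Rightarrow> 'n::finite" and U :: "complex ^ 'p ^ 'p" and A :: "complex ^ 'q ^ 'q" and a :: real
  assumes e: "bij e" and U: "adjoint_matrix U ** U = mat 1" "U ** adjoint_matrix U = mat 1"
    and A: "\<And>y. norm (A *v y) \<le> a * norm y" and a: "0 < a" "a < 1"
begin

abbreviation "join \<equiv> join_blocks e"
abbreviation "Us \<equiv> adjoint_matrix U"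
abbreviation "As \<equiv> adjoint_matrix A"

lemma norm_U: "norm (U *v x) = norm x" "norm (Us *v x) = norm x"
proof -
  have 1: "Us *v (U *v x) = x" "U *v (Us *v x) = x" for x by (simp_all add: matrix_vector_mul_assoc U)
  have "hermitian (U *v x) (U *v x) = hermitian x x" for x by (simp add: hermitian_adjoint 1)
  then have "complex_of_real ((norm (U *v x))\<^sup>2) = of_real ((norm x)\<^sup>2)" for x by (simp only: hermitian_self)
  then have n: "norm (U *v x) = norm x" for x unfolding of_real_eq_iff by (simp add: power2_eq_iff_nonneg)
  show "norm (U *v x) = norm x" by (rule n)
  show "norm (Us *v x) = norm x" using n[of "Us *v x"] by (simp add: 1)
qed

lemma norm_A: "norm (A *v y) \<le> norm y"
  by (rule order_trans[OF A]) (use a in \<open>simp add: mult_left_le_one_le\<close>)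

lemma norm_As: "norm (As *v y) \<le> a * norm y"
proof -
  have "adjoint_pair ((*v) A) ((*v) As)"
    unfolding adjoint_pair_def
    by (simp add: hermitian_adjoint smult_matrix_vector bounded_linear.linear[OF bounded_linear_matrix_vector])
  from adjoint_pair_norm[OF this] A a show ?thesis by simp
qed

text \<open>\<open>comp_op \<psi>A\<close> and \<open>comp_op \<psi>U\<close> are the operators
  \<open>T\<close> and \<open>V\<close> of the overview; \<open>\<psi>V\<close> inverts
  \<open>\<psi>U\<close>, so \<open>comp_op \<psi>V\<close> is the inverse of
  \<open>V\<close>.\<close>

definition "\<psi> = block_map e U A"
definition "\<psi>A = block_map e (mat 1) A"
definition "\<psi>U = block_map e U (mat 1)"
definition "\<psi>V = block_map e Us (mat 1)"

lemmas psi_defs = \<psi>_def \<psi>A_def \<psi>U_def \<psi>V_def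

lemma psi_norm: "norm (\<psi> z) \<le> norm z" "norm (\<psi>A z) \<le> norm z" "norm (\<psi>U z) \<le> norm z" "norm (\<psi>V z) \<le> norm z"
  unfolding psi_defs by (intro norm_block_map_le[OF e]; simp add: norm_U norm_A)+

lemma psi_ball: "norm z < 1 \<Longrightarrow> norm (\<psi> z) < 1" "norm z < 1 \<Longrightarrow> norm (\<psi>A z) < 1"
  "norm z < 1 \<Longrightarrow> norm (\<psi>U z) < 1" "norm z < 1 \<Longrightarrow> norm (\<psi>V z) < 1"
  using psi_norm[of z] by linarith+

lemma psi_compose:
  "\<psi>A (\<psi>U z) = \<psi> z" "\<psi>U (\<psi>A z) = \<psi> z" "\<psi>U (\<psi>V z) = z" "\<psi>V (\<psi>U z) = z" "\<psi>V (\<psi>A z) = \<psi>A (\<psi>V z)"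
  by (simp_all add: psi_defs block_map_compose[OF e] block_map_one[OF e] U)

lemma contraction:
  assumes "f \<in> hardy_space"
  shows "comp_op \<psi> f \<in> hardy_space \<and> hardy_norm (comp_op \<psi> f) \<le> 1 * hardy_norm f"
    "comp_op \<psi>A f \<in> hardy_space \<and> hardy_norm (comp_op \<psi>A f) \<le> 1 * hardy_norm f"
    "comp_op \<psi>U f \<in> hardy_space \<and> hardy_norm (comp_op \<psi>U f) \<le> 1 * hardy_norm f"
    "comp_op \<psi>V f \<in> hardy_space \<and> hardy_norm (comp_op \<psi>V f) \<le> 1 * hardy_norm f"
  using comp_op_contraction[OF assms adjoint_pair_block[OF e] psi_norm(1)[unfolded psi_defs]]
    comp_op_contraction[OF assms adjoint_pair_block[OF e] psi_norm(2)[unfolded psi_defs]]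
    comp_op_contraction[OF assms adjoint_pair_block[OF e] psi_norm(3)[unfolded psi_defs]]
    comp_op_contraction[OF assms adjoint_pair_block[OF e] psi_norm(4)[unfolded psi_defs]]
  unfolding psi_defs mult_1 by blast+

lemma bops: "hardy.bop (comp_op \<psi>)" "hardy.bop (comp_op \<psi>A)" "hardy.bop (comp_op \<psi>U)" "hardy.bop (comp_op \<psi>V)"
  by (rule bop_comp_op[OF contraction(1)] bop_comp_op[OF contraction(2)] bop_comp_op[OF contraction(3)] bop_comp_op[OF contraction(4)]; assumption)+

lemma ops_compose:
  assumes "f \<in> hardy_space"
  shows "comp_op \<psi>U (comp_op \<psi>A f) = comp_op \<psi> f" "comp_op \<psi>A (comp_op \<psi>U f) = comp_op \<psi> f"
    "comp_op \<psi>U (comp_op \<psi>V f) = f" "comp_op \<psi>V (comp_op \<psi>U f) = f"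
    "comp_op \<psi>A (comp_op \<psi>V f) = comp_op \<psi>V (comp_op \<psi>A f)"
proof -
  note c = comp_op_compose[OF psi_ball(2)] comp_op_compose[OF psi_ball(3)] comp_op_compose[OF psi_ball(4)]
  show "comp_op \<psi>U (comp_op \<psi>A f) = comp_op \<psi> f" by (subst c(2)) (simp_all only: psi_compose psi_ball)
  show "comp_op \<psi>A (comp_op \<psi>U f) = comp_op \<psi> f" by (subst c(1)) (simp_all only: psi_compose psi_ball)
  show "comp_op \<psi>U (comp_op \<psi>V f) = f" by (subst c(2)) (simp_all only: psi_compose psi_ball comp_op_id[OF assms])
  show "comp_op \<psi>V (comp_op \<psi>U f) = f" by (subst c(3)) (simp_all only: psi_compose psi_ball comp_op_id[OF assms])
  show "comp_op \<psi>A (comp_op \<psi>V f) = comp_op \<psi>V (comp_op \<psi>A f)"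
    by (subst c(1), assumption, subst c(3), assumption) (simp only: psi_compose)
qed

text \<open>Vanishing to order \<open>m\<close> along \<open>z'' = 0\<close>, tested on complex lines, where the one-variable Schwarz lemma applies.\<close>

definition vanishing :: "nat \<Rightarrow> (complex ^ 'n \<Rightarrow> complex) \<Rightarrow> bool" where
  "vanishing m f \<longleftrightarrow> (\<forall>z. norm z < 1 \<longrightarrow>
     (\<exists>C. \<forall>l. norm l \<le> 1 \<longrightarrow> norm (f (join (fst_block e z) (l *s snd_block e z))) \<le> C * norm l ^ m))"

lemma norm_join_scale: "norm l \<le> 1 \<Longrightarrow> norm (join (fst_block e z) (l *s snd_block e z)) \<le> norm z"
  using norm_join_mono[OF e, of "fst_block e z" "fst_block e z" "l *s snd_block e z" "snd_block e z"]
  by (simp add: mult_left_le_one_le join_block[OF e])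

lemma vanishing_comp:
  assumes f: "vanishing m f"
  shows "vanishing m (comp_op \<psi> f)" "vanishing m (comp_op \<psi>U f)"
proof -
  have *: "vanishing m (comp_op (block_map e M N) f)" if "\<And>z. norm (block_map e M N z) \<le> norm z" for M N
    unfolding vanishing_def
  proof (intro allI impI)
    fix z :: "complex ^ 'n" assume z: "norm z < 1"
    then have zb: "norm (block_map e M N z) < 1" using that[of z] by simp
    have fb: "fst_block e (block_map e M N z) = M *v fst_block e z" "snd_block e (block_map e M N z) = N *v snd_block e z"
      by (simp_all add: block_map_def block_join[OF e])
    obtain C where C: "\<And>l. norm l \<le> 1 \<Longrightarrow> norm (f (join (M *v fst_block e z) (l *s (N *v snd_block e z)))) \<le> C * norm l ^ m"
      using f[unfolded vanishing_def, THEN spec, THEN mp, OF zb] unfolding fb by blast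
    have "norm (comp_op (block_map e M N) f (join (fst_block e z) (l *s snd_block e z))) \<le> C * norm l ^ m" if "norm l \<le> 1" for l
      using C[OF that] norm_join_scale[OF that, of z] z
      by (simp add: comp_op_def block_map_join[OF e] smult_matrix_vector)
    then show "\<exists>C. \<forall>l. norm l \<le> 1 \<longrightarrow> norm (comp_op (block_map e M N) f (join (fst_block e z) (l *s snd_block e z))) \<le> C * norm l ^ m"
      by blast
  qed
  show "vanishing m (comp_op \<psi> f)" "vanishing m (comp_op \<psi>U f)"
    unfolding psi_defs by (rule *[OF psi_norm(1)[unfolded psi_defs]], rule *[OF psi_norm(3)[unfolded psi_defs]])
qed

text \<open>The constants in \<open>vanishing\<close> may depend on \<open>z\<close>. On each line
  they only certify the order of the zero, and \<open>schwarz_order\<close> replaces them by the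
  maximum of \<open>f\<close> on a closed ball. The dilation by \<open>r\<close> makes the slice
  holomorphic beyond the unit disc.\<close>

lemma vanishing_bound:
  assumes f: "f \<in> hardy_space" "vanishing m f" and r: "0 < r" "r < 1"
  shows "\<exists>C. \<forall>z l. norm z \<le> 1 \<longrightarrow> norm l \<le> 1 \<longrightarrow> norm (f (r *\<^sub>R join (fst_block e z) (l *s snd_block e z))) \<le> C * norm l ^ m"
proof -
  obtain C where C: "\<And>z. norm z \<le> 1 \<Longrightarrow> norm (f (r *\<^sub>R z)) \<le> C"
    using bounded_on_cball[OF continuous_on_dilate[OF hardy_space_continuous[OF f(1)] r]] by blast
  have "norm (f (r *\<^sub>R join (fst_block e z) (l *s snd_block e z))) \<le> C * norm l ^ m"
    if z: "norm z \<le> 1" and l: "norm l \<le> 1" for z l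
  proof -
    let ?x = "fst_block e z" and ?y = "snd_block e z"
    let ?g = "\<lambda>l. f (r *\<^sub>R join ?x (l *s ?y))"
    have rj: "r *\<^sub>R join ?x (l *s ?y) = join (r *\<^sub>R ?x) (l *s (r *\<^sub>R ?y))" for l
      by (simp add: join_linear[OF e] scaleR_smult vector_smult_assoc mult.commute)
    have rj': "r *\<^sub>R join ?x (l *s ?y) = r *\<^sub>R join ?x 0 + l *s (r *\<^sub>R join 0 ?y)" for l
      by (simp add: join_linear[OF e] scaleR_smult vector_smult_assoc mult.commute)
    have "norm (r *\<^sub>R join ?x (l *s ?y)) < 1" if "norm l < 1 / r" for l
    proof -
      have "(norm (join ?x (l *s ?y)))\<^sup>2 = (norm ?x)\<^sup>2 + (norm l)\<^sup>2 * (norm ?y)\<^sup>2"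
        by (simp add: norm_join[OF e] power_mult_distrib)
      also have "\<dots> \<le> (max 1 (norm l))\<^sup>2 * (norm ?x)\<^sup>2 + (max 1 (norm l))\<^sup>2 * (norm ?y)\<^sup>2"
      proof (rule add_mono)
        show "(norm ?x)\<^sup>2 \<le> (max 1 (norm l))\<^sup>2 * (norm ?x)\<^sup>2"
          using mult_right_mono[of 1 "(max 1 (norm l))\<^sup>2" "(norm ?x)\<^sup>2"] by (simp add: one_le_power)
        show "(norm l)\<^sup>2 * (norm ?y)\<^sup>2 \<le> (max 1 (norm l))\<^sup>2 * (norm ?y)\<^sup>2"
          by (intro mult_right_mono power_mono) auto
      qed
      also have "\<dots> = (max 1 (norm l) * norm z)\<^sup>2"
        unfolding power_mult_distrib norm_block[OF e, of z] by (simp add: distrib_left)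
      finally have "norm (join ?x (l *s ?y)) \<le> max 1 (norm l) * norm z"
        by (rule power2_le_imp_le) simp
      also have "\<dots> \<le> max 1 (norm l) * 1" using z by (intro mult_left_mono) auto
      finally have "r * norm (join ?x (l *s ?y)) \<le> r * max 1 (norm l)" using r by (intro mult_left_mono) auto
      also have "\<dots> < 1" using that r by (simp add: max_def field_simps)
      finally show ?thesis using r by simp
    qed
    then have hol: "?g holomorphic_on ball 0 (1 / r)"
      unfolding rj' by (intro holo_slice[OF hardy_space_holo[OF f(1)]]) simp
    show ?thesis
    proof (rule schwarz_order[OF hol _ _ _ l])
      show "1 < 1 / r" using r by simp
      have "r * norm z \<le> r * 1" using r z by (intro mult_left_mono) auto
      then have "r * norm z < 1" using r(2) by linarith
      then have "norm (r *\<^sub>R z) < 1" using r(1) by simp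
      then obtain K where "\<forall>l. norm l \<le> 1 \<longrightarrow> norm (f (join (fst_block e (r *\<^sub>R z)) (l *s snd_block e (r *\<^sub>R z)))) \<le> K * norm l ^ m"
        using f(2)[unfolded vanishing_def, THEN spec, THEN mp] by blast
      then show "\<exists>K. \<forall>x. norm x \<le> 1 \<longrightarrow> x \<noteq> 0 \<longrightarrow> norm (?g x) \<le> K * norm x ^ m"
        unfolding rj block_linear[OF e] by (intro exI[of _ K]) simp
      show "norm (?g x) \<le> C" if "norm x = 1" for x
        by (rule C) (use norm_join_scale[of x z] that z in simp)
    qed
  qed
  then show ?thesis by blast
qed

text \<open>\<open>\<psi>\<close> composed with its adjoint fixes \<open>z'\<close> and acts on
  \<open>z''\<close> as \<open>A ** As\<close>, whose power \<open>k\<close> contracts by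
  \<open>(a\<^sup>2) ^ k\<close>. Order \<open>m\<close> turns this into decay at the rate
  \<open>b = (a ^ m)\<^sup>2\<close>, and \<open>comp_op_linear_decay\<close> gives the square root
  of \<open>b\<close> as operator bound.\<close>

lemma vanishing_decay:
  assumes f: "f \<in> hardy_space" "vanishing m f"
  shows "comp_op \<psi> f \<in> hardy_space" "hardy_norm (comp_op \<psi> f) \<le> a ^ m * hardy_norm f"
proof -
  let ?L' = "block_map e Us As"
  have P: "((\<psi> \<circ> ?L') ^^ k) z = join (fst_block e z) (((*v) (A ** As) ^^ k) (snd_block e z))" for k z
  proof (induction k)
    case (Suc k)
    have stepeq: "(\<psi> \<circ> ?L') w = join (fst_block e w) ((A ** As) *v snd_block e w)" for w
      by (simp add: \<psi>_def block_map_compose[OF e] U) (simp add: block_map_def)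
    have "((\<psi> \<circ> ?L') ^^ Suc k) z = (\<psi> \<circ> ?L') (((\<psi> \<circ> ?L') ^^ k) z)" by simp
    also have "\<dots> = join (fst_block e z) ((A ** As) *v (((*v) (A ** As) ^^ k) (snd_block e z)))"
      unfolding stepeq Suc block_join[OF e] ..
    moreover have "((*v) (A ** As) ^^ Suc k) (snd_block e z) = (A ** As) *v (((*v) (A ** As) ^^ k) (snd_block e z))"
      by simp
    ultimately show ?case by (simp only:)
  qed (simp add: join_block[OF e])
  have nP: "norm (((*v) (A ** As) ^^ k) y) \<le> (a\<^sup>2) ^ k * norm y" for k y
  proof (induction k)
    case (Suc k)
    let ?y = "((*v) (A ** As) ^^ k) y"
    have "norm (A *v (As *v ?y)) \<le> a * (a * norm ?y)"
      by (rule order_trans[OF A mult_left_mono[OF norm_As]]) (use a in simp)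
    also have "\<dots> \<le> a * (a * ((a\<^sup>2) ^ k * norm y))" using Suc a by (intro mult_left_mono) auto
    finally show ?case by (simp add: matrix_vector_mul_assoc power2_eq_square mult_ac)
  qed simp
  have b: "(a ^ m)\<^sup>2 > 0" using a by simp
  have *: "\<exists>C. \<forall>k \<zeta> t. norm \<zeta> = 1 \<longrightarrow> 0 \<le> t \<longrightarrow> t \<le> 1 \<longrightarrow> norm (f ((r * t) *\<^sub>R ((\<psi> \<circ> ?L') ^^ k) \<zeta>)) \<le> C * ((a ^ m)\<^sup>2) ^ k"
    if r: "0 < r" "r < 1" for r
  proof -
    obtain C where C: "\<And>z l. norm z \<le> 1 \<Longrightarrow> norm l \<le> 1 \<Longrightarrow> norm (f (r *\<^sub>R join (fst_block e z) (l *s snd_block e z))) \<le> C * norm l ^ m"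
      using vanishing_bound[OF f r] by blast
    have "norm (f ((r * t) *\<^sub>R ((\<psi> \<circ> ?L') ^^ k) \<zeta>)) \<le> C * ((a ^ m)\<^sup>2) ^ k"
      if \<zeta>: "norm \<zeta> = 1" and t: "0 \<le> t" "t \<le> 1" for k \<zeta> t
    proof -
      define l where "l = complex_of_real ((a\<^sup>2) ^ k)"
      have l: "l \<noteq> 0" "norm l = (a\<^sup>2) ^ k" using a by (simp_all add: l_def norm_power)
      have l1: "norm l \<le> 1" unfolding l(2) using a by (intro power_le_one) (auto simp: abs_square_le_1)
      \<comment> \<open>The second block of the iterate is written as \<open>l *s y\<close> with
        \<open>y\<close> no longer than the original block, so that \<open>l\<close> alone carries
        the decay.\<close>
      define y where "y = (1 / l) *s ((*v) (A ** As) ^^ k) (snd_block e \<zeta>)"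
      have ly: "l *s y = ((*v) (A ** As) ^^ k) (snd_block e \<zeta>)" using l by (simp add: y_def vector_smult_assoc)
      have "norm y \<le> norm (snd_block e \<zeta>)"
        using nP[of k "snd_block e \<zeta>"] a by (simp add: y_def norm_divide l(2) field_simps)
      then have n: "norm (join (fst_block e \<zeta>) y) \<le> 1"
        using norm_join_mono[OF e, of "fst_block e \<zeta>" "fst_block e \<zeta>" y "snd_block e \<zeta>"] \<zeta> by (simp add: join_block[OF e])
      define z where "z = t *\<^sub>R join (fst_block e \<zeta>) y"
      have nz: "norm z \<le> 1" unfolding z_def norm_scaleR using n t by (simp add: mult_le_one)
      have "(r * t) *\<^sub>R ((\<psi> \<circ> ?L') ^^ k) \<zeta> = r *\<^sub>R join (fst_block e z) (l *s snd_block e z)"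
        unfolding P z_def ly[symmetric]
        by (simp add: block_linear[OF e] block_join[OF e] join_linear[OF e] scaleR_smult vector_smult_assoc mult_ac)
      then show ?thesis using C[OF nz l1] by (simp add: l(2) power_mult[symmetric] mult_ac)
    qed
    then show ?thesis by blast
  qed
  have L: "adjoint_pair \<psi> ?L'" unfolding \<psi>_def by (rule adjoint_pair_block[OF e])
  show "comp_op \<psi> f \<in> hardy_space" by (rule comp_op_linear_decay(1)[OF f(1) L psi_norm(1) b *])
  show "hardy_norm (comp_op \<psi> f) \<le> a ^ m * hardy_norm f"
    using comp_op_linear_decay(2)[OF f(1) L psi_norm(1) b *] a by (simp add: real_sqrt_abs)
qed

text \<open>On the slice through \<open>z\<close> in the second variable the factors
  \<open>T - c\<close> act by composition with \<open>A\<close>. For small \<open>w\<close> the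
  Taylor estimate applies there, since \<open>cs\<close> annihilates the Taylor polynomial;
  elsewhere boundedness is enough.\<close>

lemma vanishing_annihilated:
  assumes cs: "\<And>\<eta> k. k < m \<Longrightarrow> opl (pull ((*v) A)) cs (\<lambda>w. hermitian w \<eta> ^ k) = (\<lambda>w. 0)" and f: "f \<in> hardy_space"
  shows "vanishing m (opl (comp_op \<psi>A) cs f)"
  unfolding vanishing_def
proof (intro allI impI)
  let ?h = "opl (comp_op \<psi>A) cs f"
  fix z :: "complex ^ 'n" assume z: "norm z < 1"
  let ?x = "fst_block e z" and ?y = "snd_block e z"
  \<comment> \<open>The scale of the slice: as \<open>(5 / 4)\<^sup>2 / 2 < 1\<close>, the ball of
    radius \<open>5 / 4\<close> is mapped into the unit ball, so \<open>G\<close> is holomorphic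
    past the closed ball as the Szego formula demands.\<close>
  define \<rho> where "\<rho> = sqrt ((1 - (norm ?x)\<^sup>2) / 2)"
  have x1: "(norm ?x)\<^sup>2 < 1" using fst_block_le[OF e, of z] z by (simp add: abs_square_less_1)
  have \<rho>: "\<rho> > 0" "\<rho>\<^sup>2 = (1 - (norm ?x)\<^sup>2) / 2" using x1 by (simp_all add: \<rho>_def)
  define j where "j w = join ?x (complex_of_real \<rho> *s w)" for w
  let ?W = "ball (0 :: complex ^ 'q) (5 / 4)"
  have jW: "norm (j w) < 1" if "w \<in> ?W" for w
  proof -
    have "(norm w)\<^sup>2 \<le> (5 / 4)\<^sup>2" using that by (intro power_mono) auto
    then have "\<rho>\<^sup>2 * (norm w)\<^sup>2 \<le> \<rho>\<^sup>2 * (5 / 4)\<^sup>2" by (intro mult_left_mono) auto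
    also have "\<dots> < 1 - (norm ?x)\<^sup>2" unfolding \<rho>(2) using x1 by (simp add: power2_eq_square)
    finally have "(norm (j w))\<^sup>2 < 1"
      using \<rho>(1) by (simp add: j_def norm_join[OF e] power_mult_distrib)
    then show ?thesis by (simp add: abs_square_less_1)
  qed
  have AW: "A *v w \<in> ?W" if "w \<in> ?W" for w using that norm_A[of w] by simp
  define G where "G w = f (j w)" for w
  have G: "holo_on ?W G"
    unfolding G_def
  proof (rule holo_on_compose[OF hardy_space_holo[OF f]])
    show "cdiff j ((*s)) w" for w unfolding j_def by (rule cdiff_join_snd[OF e])
  qed (use jW in auto)
  obtain C where C: "\<And>w. norm w \<le> 1 / 2 \<Longrightarrow> norm (opl (pull ((*v) A)) cs G w) \<le> C * norm w ^ m"
    using taylor_annihilate[OF G _ norm_A cs] by auto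
  have sub: "?h (j w) = opl (pull ((*v) A)) cs G w" if "w \<in> ?W" for w
    unfolding G_def
  proof (rule opl_subst[where W = ?W, OF _ AW that])
    fix f :: "complex ^ 'n \<Rightarrow> complex" and w assume "w \<in> ?W"
    then show "comp_op \<psi>A f (j w) = f (j (A *v w))"
      using jW[of w] by (simp add: comp_op_def j_def \<psi>A_def block_map_join[OF e] smult_matrix_vector)
  qed
  have h: "?h \<in> hardy_space" by (rule hardy.opl_mem[OF bops(2) f])
  obtain M where M: "M \<ge> 0" "\<And>w. norm w \<le> norm z \<Longrightarrow> norm (?h w) \<le> M"
  proof -
    obtain K where K: "K \<ge> 0" "\<forall>f\<in>hardy_space. \<forall>w :: complex ^ 'n. norm w \<le> norm z \<longrightarrow> norm (f w) \<le> K * hardy_norm f"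
      using hardy_point_evaluation[OF z] by blast
    show ?thesis by (rule that[of "K * hardy_norm ?h"]) (use K h hardy_norm_nonneg[of ?h] in auto)
  qed
  show "\<exists>C. \<forall>l. norm l \<le> 1 \<longrightarrow> norm (?h (join ?x (l *s ?y))) \<le> C * norm l ^ m"
  proof (intro exI allI impI)
    fix l :: complex assume l: "norm l \<le> 1"
    let ?w = "(l / complex_of_real \<rho>) *s ?y"
    have jw: "join ?x (l *s ?y) = j ?w" using \<rho>(1) by (simp add: j_def vector_smult_assoc)
    have nw: "norm ?w = norm l * (norm ?y / \<rho>)" using \<rho>(1) by (simp add: norm_divide)
    have "norm (?h (join ?x (l *s ?y))) \<le> (\<bar>C\<bar> + M * 2 ^ m) * norm ?w ^ m"
    proof (cases "norm ?w \<le> 1 / 2")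
      case True
      then have "norm (?h (j ?w)) \<le> C * norm ?w ^ m" using sub[of ?w] C[OF True] by simp
      also have "\<dots> \<le> (\<bar>C\<bar> + M * 2 ^ m) * norm ?w ^ m" using M(1) by (intro mult_right_mono) (auto intro: add_increasing2)
      finally show ?thesis unfolding jw .
    next
      \<comment> \<open>Away from \<open>w = 0\<close> the uniform bound \<open>M\<close> suffices,
        because \<open>2 * norm ?w\<close> is at least \<open>1\<close> and may be raised to the
        power \<open>m\<close>.\<close>
      case False
      then have "1 \<le> (2 * norm ?w) ^ m" by (intro one_le_power) simp
      then have "M * 1 \<le> M * (2 * norm ?w) ^ m" using M(1) by (rule mult_left_mono)
      moreover have "norm (?h (join ?x (l *s ?y))) \<le> M" by (rule M(2)[OF norm_join_scale[OF l]])
      ultimately have "norm (?h (join ?x (l *s ?y))) \<le> M * 2 ^ m * norm ?w ^ m" by (simp add: power_mult_distrib mult.assoc)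
      also have "\<dots> \<le> (\<bar>C\<bar> + M * 2 ^ m) * norm ?w ^ m" by (intro mult_right_mono) auto
      finally show ?thesis .
    qed
    then show "norm (?h (join ?x (l *s ?y))) \<le> ((\<bar>C\<bar> + M * 2 ^ m) * (norm ?y / \<rho>) ^ m) * norm l ^ m"
      unfolding nw by (simp only: power_mult_distrib mult_ac)
  qed
qed

end

section \<open>The Neumann series on invariant classes of functions\<close>

context function_space
begin

lemma sum_mem:
  assumes "\<And>i. i < (n::nat) \<Longrightarrow> f i \<in> X"
  shows "(\<lambda>x. \<Sum>i<n. f i x) \<in> X \<and> nrm (\<lambda>x. \<Sum>i<n. f i x) \<le> (\<Sum>i<n. nrm (f i))"
  using assms
proof (induction n)
  case 0
  then show ?case by (simp add: zero_mem norm_zero)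
next
  case (Suc n)
  have IH: "(\<lambda>x. \<Sum>i<n. f i x) \<in> X" "nrm (\<lambda>x. \<Sum>i<n. f i x) \<le> (\<Sum>i<n. nrm (f i))" using Suc by simp_all
  have n: "f n \<in> X" using Suc.prems by simp
  show ?case using add[OF IH(1) n] norm_add[OF IH(1) n] IH(2) by simp
qed

end

lemma comp_op_scale: "comp_op L (\<lambda>x. c * f x) = (\<lambda>x. c * comp_op L f x)"
  by (simp add: comp_op_def fun_eq_iff)

lemma comp_op_diff: "comp_op L (\<lambda>x. f x - c * g x) = (\<lambda>x. comp_op L f x - c * comp_op L g x)"
  by (simp add: comp_op_def fun_eq_iff)

text \<open>\<open>P\<close> marks a class that composition with \<open>L\<close> preserves and on
  which the one-step factor \<open>B\<close> holds; invariance turns it into \<open>B ^ j\<close>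
  along the orbit.\<close>

lemma neumann_invariant:
  fixes L :: "complex ^ 'n \<Rightarrow> complex ^ 'n"
  assumes P: "\<And>f. P f \<Longrightarrow> f \<in> hardy_space" "\<And>f. P f \<Longrightarrow> P (comp_op L f)" "\<And>f. P f \<Longrightarrow> hardy_norm (comp_op L f) \<le> B * hardy_norm f"
    and L: "\<And>z. norm z < 1 \<Longrightarrow> norm (L z) < 1" and k: "B \<ge> 0" "norm k * B < 1" and f: "P f"
  shows "\<exists>g\<in>hardy_space. (\<lambda>z. g z - k * comp_op L g z) = f \<and> hardy_norm g \<le> 1 / (1 - norm k * B) * hardy_norm f"
proof (rule neumann[where B = B])
  have "P (comp_op (L ^^ j) f) \<and> hardy_norm (comp_op (L ^^ j) f) \<le> B ^ j * hardy_norm f" for j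
  proof (induction j)
    case 0
    have e: "comp_op (L ^^ 0) f = f" using comp_op_id[OF P(1)[OF f]] by (simp add: id_def)
    show ?case unfolding e using f by simp
  next
    case (Suc j)
    have "comp_op (L ^^ Suc j) f = comp_op (\<lambda>z. (L ^^ j) (L z)) f" by (simp add: o_def funpow_swap1)
    also have "\<dots> = comp_op L (comp_op (L ^^ j) f)" by (rule comp_op_compose[OF L, symmetric])
    finally have e: "comp_op (L ^^ Suc j) f = comp_op L (comp_op (L ^^ j) f)" .
    have "hardy_norm (comp_op L (comp_op (L ^^ j) f)) \<le> B * hardy_norm (comp_op (L ^^ j) f)" using P(3) Suc by blast
    also have "\<dots> \<le> B * (B ^ j * hardy_norm f)" using Suc k(1) by (intro mult_left_mono) auto
    finally show ?case unfolding e using P(2) Suc by (simp add: mult.assoc)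
  qed
  then show "comp_op (L ^^ j) f \<in> hardy_space" "hardy_norm (comp_op (L ^^ j) f) \<le> B ^ j * hardy_norm f" for j
    using P(1) by blast+
qed (use L k P(1)[OF f] in auto)

lemma clear_denominator:
  fixes c :: complex
  assumes "g - (m / c) * v = (- 1 / c) * f" "c \<noteq> 0"
  shows "m * v - c * g = f"
proof -
  have "m * v - c * g = - (c * (g - (m / c) * v))" using assms(2) by (simp add: right_diff_distrib)
  then show ?thesis unfolding assms(1) using assms(2) by simp
qed

section \<open>Inverting \<open>c - \<mu> V\<^sup>-\<^sup>1\<close>, and the resolvent of the normal
  form\<close>

context normal_map
begin

abbreviation "H \<equiv> (hardy_space :: (complex ^ 'n \<Rightarrow> complex) set)"
abbreviation "W \<mu> \<equiv> (\<lambda>f x. \<mu> * comp_op \<psi>V f x)"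

text \<open>Two mutually inverse contractions are isometries.\<close>

lemma isometry:
  assumes "f \<in> H"
  shows "hardy_norm (comp_op \<psi>U f) = hardy_norm f" "hardy_norm (comp_op \<psi>V f) = hardy_norm f"
proof -
  note V = contraction(4)[OF assms] and U = contraction(3)[OF assms]
  show "hardy_norm (comp_op \<psi>U f) = hardy_norm f"
    using U contraction(4)[OF conjunct1[OF U]] ops_compose(4)[OF assms] by simp
  show "hardy_norm (comp_op \<psi>V f) = hardy_norm f"
    using V contraction(3)[OF conjunct1[OF V]] ops_compose(3)[OF assms] by simp
qed

lemma isometry_eigenfunction:
  assumes f: "f \<in> H" "comp_op \<psi>V f = (\<lambda>x. k * f x)" and k: "norm k \<noteq> 1"
  shows "f = (\<lambda>x. 0)"
proof (rule hardy_norm_eq_0[OF f(1)])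
  have 1: "hardy_norm f \<le> norm k * hardy_norm f"
    using isometry(2)[OF f(1)] hardy_space_scale(2)[OF f(1), of k] unfolding f(2) by simp
  show "hardy_norm f \<le> 0"
  proof (cases "norm k < 1")
    case True
    show ?thesis
    proof (rule ccontr)
      assume "\<not> hardy_norm f \<le> 0"
      then show False using 1 mult_strict_right_mono[OF True, of "hardy_norm f"] by simp
    qed
  next
    case False
    then have k1: "norm k > 1" "k \<noteq> 0" using k by auto
    have "f = (\<lambda>x. (1 / k) * comp_op \<psi>V f x)" unfolding f(2) using k1 by simp
    then have "hardy_norm f \<le> norm (1 / k) * hardy_norm f"
      using hardy_space_scale(2)[OF conjunct1[OF contraction(4)[OF f(1)]], of "1 / k"] isometry(2)[OF f(1)] by simp
    then have "norm k * hardy_norm f \<le> norm k * (norm (1 / k) * hardy_norm f)" by (intro mult_left_mono) auto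
    then have "norm k * hardy_norm f \<le> hardy_norm f" using k1 by (simp add: norm_divide)
    show ?thesis
    proof (rule ccontr)
      assume "\<not> hardy_norm f \<le> 0"
      then show False using \<open>norm k * hardy_norm f \<le> hardy_norm f\<close> mult_strict_right_mono[OF k1(1), of "hardy_norm f"] by simp
    qed
  qed
qed

text \<open>An isometry with isometric inverse admits a Neumann series on either side of its circle:
  for \<open>norm c < norm \<mu>\<close> the equation is first multiplied by \<open>V\<close> and
  expanded in \<open>c / \<mu>\<close>, otherwise it is expanded in
  \<open>\<mu> / c\<close>.\<close>

lemma solvable_modulus:
  assumes \<mu>: "\<mu> \<noteq> 0" and c: "norm c \<noteq> norm \<mu>"
  shows "hardy.solvable (\<lambda>f x. W \<mu> f x - c * f x) H"
  unfolding hardy.solvable_def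
proof (intro conjI ballI impI)
  fix f assume f: "f \<in> H" "(\<lambda>x. W \<mu> f x - c * f x) = (\<lambda>x. 0)"
  have "comp_op \<psi>V f = (\<lambda>x. (c / \<mu>) * f x)"
  proof
    show "comp_op \<psi>V f x = (c / \<mu>) * f x" for x using fun_cong[OF f(2), of x] \<mu> by (simp add: field_simps)
  qed
  then show "f = (\<lambda>x. 0)" by (rule isometry_eigenfunction[OF f(1)]) (use \<mu> c in \<open>simp add: norm_divide field_simps\<close>)
next
  show "\<exists>K. \<forall>f\<in>H. \<exists>g\<in>H. (\<lambda>x. W \<mu> g x - c * g x) = f \<and> hardy_norm g \<le> K * hardy_norm f"
  proof (cases "norm c < norm \<mu>")
    case True
    have *: "\<exists>g\<in>H. (\<lambda>x. W \<mu> g x - c * g x) = f \<and> hardy_norm g \<le> (1 / (1 - norm (c / \<mu>) * 1) * norm (1 / \<mu>)) * hardy_norm f"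
      if f: "f \<in> H" for f
    proof -
      let ?f = "\<lambda>x. (1 / \<mu>) * comp_op \<psi>U f x"
      have Uf: "comp_op \<psi>U f \<in> H" by (rule conjunct1[OF contraction(3)[OF f]])
      have f': "?f \<in> H" by (rule hardy_space_scale(1)[OF Uf])
      have k: "norm (c / \<mu>) * 1 < 1" using True \<mu> by (simp add: norm_divide)
      obtain g where g: "g \<in> H" "(\<lambda>x. g x - (c / \<mu>) * comp_op \<psi>U g x) = ?f"
        "hardy_norm g \<le> 1 / (1 - norm (c / \<mu>) * 1) * hardy_norm ?f"
        using neumann_invariant[where P = "\<lambda>f. f \<in> H" and L = \<psi>U and B = 1 and k = "c / \<mu>" and f = ?f] contraction(3) psi_ball(3) k f'
        by auto
      have "comp_op \<psi>V (\<lambda>x. g x - (c / \<mu>) * comp_op \<psi>U g x) = (\<lambda>x. (1 / \<mu>) * f x)"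
        unfolding g(2) comp_op_scale ops_compose(4)[OF f] ..
      then have e: "comp_op \<psi>V g x - (c / \<mu>) * g x = (1 / \<mu>) * f x" for x
        unfolding comp_op_diff ops_compose(4)[OF g(1)] by (rule fun_cong)
      have "(\<lambda>x. W \<mu> g x - c * g x) = f"
      proof
        show "W \<mu> g x - c * g x = f x" for x using e[of x] \<mu> by (simp add: field_simps)
      qed
      moreover have "hardy_norm g \<le> (1 / (1 - norm (c / \<mu>) * 1) * norm (1 / \<mu>)) * hardy_norm f"
      proof -
        have "hardy_norm ?f \<le> norm (1 / \<mu>) * hardy_norm f"
          using hardy_space_scale(2)[OF Uf, of "1 / \<mu>"] isometry(1)[OF f] by simp
        then have "1 / (1 - norm (c / \<mu>) * 1) * hardy_norm ?f \<le> 1 / (1 - norm (c / \<mu>) * 1) * (norm (1 / \<mu>) * hardy_norm f)"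
          using k by (intro mult_left_mono) auto
        then show ?thesis using g(3) unfolding mult.assoc by (rule order_trans[rotated])
      qed
      ultimately show ?thesis using g(1) by blast
    qed
    then show ?thesis by (intro exI ballI)
  next
    case False
    then have c': "norm \<mu> < norm c" "c \<noteq> 0" using c \<mu> by auto
    have *: "\<exists>g\<in>H. (\<lambda>x. W \<mu> g x - c * g x) = f \<and> hardy_norm g \<le> (1 / (1 - norm (\<mu> / c) * 1) * norm (- 1 / c)) * hardy_norm f"
      if f: "f \<in> H" for f
    proof -
      let ?f = "\<lambda>x. (- 1 / c) * f x"
      have f': "?f \<in> H" by (rule hardy_space_scale(1)[OF f])
      have k: "norm (\<mu> / c) * 1 < 1" using c' by (simp add: norm_divide)
      obtain g where g: "g \<in> H" "(\<lambda>x. g x - (\<mu> / c) * comp_op \<psi>V g x) = ?f"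
        "hardy_norm g \<le> 1 / (1 - norm (\<mu> / c) * 1) * hardy_norm ?f"
        using neumann_invariant[where P = "\<lambda>f. f \<in> H" and L = \<psi>V and B = 1 and k = "\<mu> / c" and f = ?f] contraction(4) psi_ball(4) k f'
        by auto
      have "(\<lambda>x. W \<mu> g x - c * g x) = f"
      proof
        show "W \<mu> g x - c * g x = f x" for x by (rule clear_denominator[OF fun_cong[OF g(2)] c'(2)])
      qed
      moreover have "hardy_norm g \<le> (1 / (1 - norm (\<mu> / c) * 1) * norm (- 1 / c)) * hardy_norm f"
      proof -
        have "1 / (1 - norm (\<mu> / c) * 1) * hardy_norm ?f \<le> 1 / (1 - norm (\<mu> / c) * 1) * (norm (- 1 / c) * hardy_norm f)"
          using k by (intro mult_left_mono hardy_space_scale(2)[OF f]) auto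
        then show ?thesis using g(3) unfolding mult.assoc by (rule order_trans[rotated])
      qed
      ultimately show ?thesis using g(1) by blast
    qed
    then show ?thesis by (intro exI ballI)
  qed
qed

text \<open>If \<open>V\<^sup>N = 1\<close> then \<open>(\<mu>V - c) \<Sum>\<^sub>j \<mu>\<^sup>j c\<^sup>N\<^sup>-\<^sup>1\<^sup>-\<^sup>j V\<^sup>j = \<mu>\<^sup>N - c\<^sup>N\<close>.\<close>

lemma solvable_periodic:
  assumes N: "N > 0" "\<And>z. (\<psi>V ^^ N) z = z" and c: "\<mu> ^ N \<noteq> c ^ N" and \<mu>: "\<mu> \<noteq> 0"
  shows "hardy.solvable (\<lambda>f x. W \<mu> f x - c * f x) H"
  unfolding hardy.solvable_def
proof (intro conjI ballI impI)
  fix f assume f: "f \<in> H" "(\<lambda>x. W \<mu> f x - c * f x) = (\<lambda>x. 0)"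
  show "f = (\<lambda>x. 0)"
  proof
    fix z show "f z = 0"
    proof (cases "norm z < 1")
      case True
      have b: "norm ((\<psi>V ^^ j) z) < 1" for j by (induction j) (simp_all add: True psi_ball(4))
      \<comment> \<open>The kernel equation is followed along the orbit of \<open>z\<close>, which
        returns to \<open>z\<close> after \<open>N\<close> steps.\<close>
      have "\<mu> ^ j * f ((\<psi>V ^^ j) z) = c ^ j * f z" for j
      proof (induction j)
        case (Suc j)
        have "\<mu> * f ((\<psi>V ^^ Suc j) z) = c * f ((\<psi>V ^^ j) z)"
          using fun_cong[OF f(2), of "(\<psi>V ^^ j) z"] b[of j] by (simp add: comp_op_def)
        then have "\<mu> ^ Suc j * f ((\<psi>V ^^ Suc j) z) = c * (\<mu> ^ j * f ((\<psi>V ^^ j) z))" by (simp add: mult_ac)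
        then show ?case unfolding Suc by (simp add: mult_ac)
      qed simp
      from this[of N] have "(\<mu> ^ N - c ^ N) * f z = 0" by (simp add: N(2) left_diff_distrib)
      then show ?thesis using c by simp
    next
      case False
      then show ?thesis using hardy_space_outside[OF f(1), of z] by simp
    qed
  qed
next
  define d where "d = 1 / (\<mu> ^ N - c ^ N)"
  define b where "b j = d * \<mu> ^ j * c ^ (N - 1 - j)" for j
  have *: "\<exists>g\<in>H. (\<lambda>x. W \<mu> g x - c * g x) = f \<and> hardy_norm g \<le> (\<Sum>j<N. norm (b j)) * hardy_norm f" if f: "f \<in> H" for f
  proof -
    define F where "F j = comp_op (\<psi>V ^^ j) f" for j
    have F: "F j \<in> H \<and> hardy_norm (F j) \<le> hardy_norm f" for j
    proof (induction j)
      case 0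
      have "F 0 = f" using comp_op_id[OF f] by (simp add: F_def id_def)
      then show ?case using f by simp
    next
      case (Suc j)
      have "F (Suc j) = comp_op (\<lambda>z. (\<psi>V ^^ j) (\<psi>V z)) f" by (simp add: F_def o_def funpow_swap1)
      also have "\<dots> = comp_op \<psi>V (F j)" unfolding F_def by (rule comp_op_compose[OF psi_ball(4), symmetric])
      finally show ?case using contraction(4)[OF conjunct1[OF Suc]] Suc by simp
    qed
    let ?g = "\<lambda>x. \<Sum>j<N. b j * F j x"
    have bF: "(\<lambda>x. b j * F j x) \<in> H" "hardy_norm (\<lambda>x. b j * F j x) \<le> norm (b j) * hardy_norm f" for j
      using hardy_space_scale[OF conjunct1[OF F], of "b j" j] mult_left_mono[OF conjunct2[OF F[of j]], of "norm (b j)"] by auto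
    have g: "?g \<in> H" "hardy_norm ?g \<le> (\<Sum>j<N. hardy_norm (\<lambda>x. b j * F j x))"
      using hardy.sum_mem[of N "\<lambda>j x. b j * F j x"] bF(1) by auto
    have "hardy_norm ?g \<le> (\<Sum>j<N. norm (b j)) * hardy_norm f"
      unfolding sum_distrib_right by (rule order_trans[OF g(2) sum_mono[OF bF(2)]])
    moreover have "(\<lambda>x. W \<mu> ?g x - c * ?g x) = f"
    proof
      fix z
      show "W \<mu> ?g z - c * ?g z = f z"
      proof (cases "norm z < 1")
        case True
        have s: "F j (\<psi>V z) = F (Suc j) z" for j
          using True psi_ball(4)[OF True] by (simp add: F_def comp_op_def funpow_swap1)
        define a where "a j = d * \<mu> ^ j * c ^ (N - j) * F j z" for j
        have "W \<mu> ?g z - c * ?g z = (\<Sum>j<N. a (Suc j) - a j)"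
        proof -
          have "\<mu> * (b j * F (Suc j) z) - c * (b j * F j z) = a (Suc j) - a j" if "j < N" for j
          proof -
            have 1: "c * c ^ (N - Suc j) = c ^ (N - j)" using that by (metis Suc_diff_Suc power_Suc)
            have 2: "a (Suc j) = \<mu> * (b j * F (Suc j) z)" by (simp add: a_def b_def mult_ac)
            have "c * (b j * F j z) = d * \<mu> ^ j * (c * c ^ (N - Suc j)) * F j z" by (simp add: b_def mult_ac)
            then have "c * (b j * F j z) = a j" unfolding 1 a_def .
            then show ?thesis unfolding 2 by simp
          qed
          then have "(\<Sum>j<N. a (Suc j) - a j) = (\<Sum>j<N. \<mu> * (b j * F (Suc j) z) - c * (b j * F j z))"
            by (intro sum.cong) auto
          then show ?thesis using True by (simp add: comp_op_def s sum_subtractf sum_distrib_left)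
        qed
        also have "\<dots> = a N - a 0" by (rule sum_lessThan_telescope)
        also have "\<dots> = d * (\<mu> ^ N - c ^ N) * f z" using True by (simp add: a_def F_def comp_op_def N(2) algebra_simps)
        also have "\<dots> = f z" using c by (simp add: d_def)
        finally show ?thesis .
      next
        case False
        then show ?thesis using hardy_space_outside[OF f, of z] hardy_space_outside[OF g(1), of z] by (simp add: comp_op_def)
      qed
    qed
    ultimately show ?thesis using g(1) by blast
  qed
  then show "\<exists>K. \<forall>f\<in>H. \<exists>g\<in>H. (\<lambda>x. W \<mu> g x - c * g x) = f \<and> hardy_norm g \<le> K * hardy_norm f" by blast
qed

lemma resolvent:
  assumes \<mu>: "\<mu> \<noteq> 0"
    and c: "\<And>c. c \<in> monoid_of {\<mu>. is_eigenvalue A \<mu>} \<Longrightarrow> hardy.solvable (\<lambda>f x. W \<mu> f x - c * f x) H"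
  shows "\<mu> \<notin> op_spectrum H hardy_norm (comp_op \<psi>)"
proof -
  obtain m where m: "a ^ m < norm \<mu>" using real_arch_pow_inv[of "norm \<mu>" a] \<mu> a by auto
  obtain cs where cs: "set cs \<subseteq> monoid_of {\<mu>. is_eigenvalue A \<mu>}"
    "\<And>\<eta> k. k < m \<Longrightarrow> opl (pull ((*v) A)) cs (\<lambda>w. hermitian w \<eta> ^ k) = (\<lambda>w. 0)"
    using annihilate_powers[of A m] by blast
  let ?T = "comp_op \<psi>A" and ?V = "comp_op \<psi>U" and ?V' = "comp_op \<psi>V" and ?C = "comp_op \<psi>"
  let ?D = "\<lambda>f x. ?T f x - W \<mu> f x"
  have W: "hardy.bop (W \<mu>)" by (rule hardy.bop_scale[OF bops(4)])
  note mem = hardy.bopD(1)[OF bops(1)] hardy.bopD(1)[OF bops(2)] hardy.bopD(1)[OF bops(3)] hardy.bopD(1)[OF bops(4)]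
  \<comment> \<open>Multiplication by \<open>V\<close> turns
    \<open>T - \<mu> V\<^sup>-\<^sup>1\<close> into \<open>C\<^sub>\<psi> - \<mu>\<close>. As
    \<open>V\<close> is an isometry, solvability and bounds pass between the two.\<close>
  have VD: "?V (?D g) = (\<lambda>x. ?C g x - \<mu> * g x)" if "g \<in> H" for g
    unfolding comp_op_diff ops_compose(1)[OF that] ops_compose(3)[OF that] ..
  have low: "hardy.solvable ?D (opl ?T cs ` H)"
    unfolding hardy.solvable_def
  proof (intro conjI)
    have van: "f \<in> H \<and> vanishing m f" if "f \<in> opl ?T cs ` H" for f
      using that vanishing_annihilated[OF cs(2)] hardy.opl_mem[OF bops(2)] by blast
    have inv: "vanishing m (\<lambda>x. k * f x)" if f: "vanishing m f" for k f
      unfolding vanishing_def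
    proof (intro allI impI)
      fix z :: "complex ^ 'n" assume "norm z < 1"
      then obtain C where C: "\<And>l. norm l \<le> 1 \<Longrightarrow> norm (f (join (fst_block e z) (l *s snd_block e z))) \<le> C * norm l ^ m"
        using f[unfolded vanishing_def, THEN spec, THEN mp] by blast
      show "\<exists>C. \<forall>l. norm l \<le> 1 \<longrightarrow> norm (k * f (join (fst_block e z) (l *s snd_block e z))) \<le> C * norm l ^ m"
      proof (intro exI allI impI)
        fix l :: complex assume "norm l \<le> 1"
        from mult_left_mono[OF C[OF this], of "norm k"]
        show "norm (k * f (join (fst_block e z) (l *s snd_block e z))) \<le> (norm k * C) * norm l ^ m"
          by (simp add: norm_mult mult.assoc)
      qed
    qed
    have k: "norm (1 / \<mu>) * a ^ m < 1" using m \<mu> by (simp add: norm_divide)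
    show "\<forall>f\<in>opl ?T cs ` H. ?D f = (\<lambda>x. 0) \<longrightarrow> f = (\<lambda>x. 0)"
    proof (intro ballI impI)
      fix f assume "f \<in> opl ?T cs ` H" and D: "?D f = (\<lambda>x. 0)"
      then have f: "f \<in> H" "vanishing m f" using van by blast+
      have "(\<lambda>x. ?C f x - \<mu> * f x) = ?V (\<lambda>x. 0)" unfolding VD[OF f(1), symmetric] D ..
      then have e: "?C f x - \<mu> * f x = 0" for x by (simp add: comp_op_def fun_eq_iff)
      have "f = (\<lambda>x. (1 / \<mu>) * ?C f x)"
      proof
        show "f x = (1 / \<mu>) * ?C f x" for x using e[of x] \<mu> by (simp add: field_simps)
      qed
      then have "hardy_norm f \<le> norm (1 / \<mu>) * hardy_norm (?C f)"
        using hardy_space_scale(2)[OF vanishing_decay(1)[OF f], of "1 / \<mu>"] by simp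
      also have "\<dots> \<le> norm (1 / \<mu>) * (a ^ m * hardy_norm f)" by (intro mult_left_mono vanishing_decay(2)[OF f]) simp
      finally have le: "hardy_norm f \<le> (norm (1 / \<mu>) * a ^ m) * hardy_norm f" by (simp only: mult.assoc)
      show "f = (\<lambda>x. 0)"
      proof (rule hardy_norm_eq_0[OF f(1)], rule ccontr)
        assume "\<not> hardy_norm f \<le> 0"
        then show False using mult_strict_right_mono[OF k, of "hardy_norm f"] le by linarith
      qed
    qed
    have "\<exists>g\<in>H. ?D g = f \<and> hardy_norm g \<le> (1 / (1 - norm (1 / \<mu>) * a ^ m) * norm (- 1 / \<mu>)) * hardy_norm f"
      if "f \<in> opl ?T cs ` H" for f
    proof -
      have f: "f \<in> H" "vanishing m f" using that van by blast+
      \<comment> \<open>The equation \<open>?D g = f\<close>, multiplied by \<open>V\<close> and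
        divided by \<open>- \<mu>\<close>, takes the form of a Neumann series with this right-hand
        side.\<close>
      let ?f = "\<lambda>x. (- 1 / \<mu>) * ?V f x"
      have f': "?f \<in> H \<and> vanishing m ?f" by (intro conjI hardy_space_scale(1) mem inv vanishing_comp f)
      obtain g where g: "g \<in> H" "(\<lambda>x. g x - (1 / \<mu>) * ?C g x) = ?f"
        "hardy_norm g \<le> 1 / (1 - norm (1 / \<mu>) * a ^ m) * hardy_norm ?f"
      proof -
        have "\<exists>g\<in>H. (\<lambda>z. g z - (1 / \<mu>) * comp_op \<psi> g z) = ?f \<and> hardy_norm g \<le> 1 / (1 - norm (1 / \<mu>) * a ^ m) * hardy_norm ?f"
          by (rule neumann_invariant[where P = "\<lambda>f. f \<in> H \<and> vanishing m f", OF _ _ _ psi_ball(1) _ k f'])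
            (use a vanishing_decay vanishing_comp(1) in auto)
        then show ?thesis using that by blast
      qed
      have "?V' (\<lambda>x. g x - (1 / \<mu>) * ?C g x) = (\<lambda>x. (- 1 / \<mu>) * f x)"
        unfolding g(2) comp_op_scale ops_compose(4)[OF f(1)] ..
      moreover have "?V' (?C g) = ?T g" using ops_compose(1)[OF g(1)] ops_compose(4)[OF mem(2)[OF g(1)]] by simp
      ultimately have e: "?V' g x - (1 / \<mu>) * ?T g x = (- 1 / \<mu>) * f x" for x unfolding comp_op_diff by (simp only: fun_eq_iff)
      have "?D g = f"
      proof
        show "?D g x = f x" for x using clear_denominator[OF e[of x] \<mu>] by simp
      qed
      moreover have "hardy_norm g \<le> (1 / (1 - norm (1 / \<mu>) * a ^ m) * norm (- 1 / \<mu>)) * hardy_norm f"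
      proof -
        have "hardy_norm ?f \<le> norm (- 1 / \<mu>) * hardy_norm f"
          using hardy_space_scale(2)[OF mem(3)[OF f(1)], of "- 1 / \<mu>"] isometry(1)[OF f(1)] by simp
        then have "1 / (1 - norm (1 / \<mu>) * a ^ m) * hardy_norm ?f \<le> 1 / (1 - norm (1 / \<mu>) * a ^ m) * (norm (- 1 / \<mu>) * hardy_norm f)"
          using k by (intro mult_left_mono) auto
        then show ?thesis using g(3) unfolding mult.assoc by (rule order_trans[rotated])
      qed
      ultimately show ?thesis using g(1) by blast
    qed
    then show "\<exists>K. \<forall>f\<in>opl ?T cs ` H. \<exists>g\<in>H. ?D g = f \<and> hardy_norm g \<le> K * hardy_norm f" by blast
  qed
  have "hardy.solvable ?D H"
  proof (rule hardy.solvable_chain[OF bops(2) W _ _ low])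
    show "?T (W \<mu> f) = W \<mu> (?T f)" if "f \<in> H" for f unfolding comp_op_scale ops_compose(5)[OF that] ..
    show "hardy.solvable (\<lambda>f x. W \<mu> f x - c * f x) H" if "c \<in> set cs" for c using that cs(1) c by blast
  qed
  then obtain K where K: "\<And>f. f \<in> H \<Longrightarrow> \<exists>g\<in>H. ?D g = f \<and> hardy_norm g \<le> K * hardy_norm f"
    and inj: "\<And>f. f \<in> H \<Longrightarrow> ?D f = (\<lambda>x. 0) \<Longrightarrow> f = (\<lambda>x. 0)" unfolding hardy.solvable_def by blast
  show ?thesis
  proof (rule hardy.not_in_spectrum[OF bops(1)], unfold hardy.solvable_def, intro conjI ballI impI)
    have "\<exists>g\<in>H. (\<lambda>x. ?C g x - \<mu> * g x) = f \<and> hardy_norm g \<le> K * hardy_norm f" if f: "f \<in> H" for f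
    proof -
      obtain g where g: "g \<in> H" "?D g = ?V' f" "hardy_norm g \<le> K * hardy_norm (?V' f)" using K[OF mem(4)[OF f]] by blast
      have "(\<lambda>x. ?C g x - \<mu> * g x) = f" unfolding VD[OF g(1), symmetric] g(2) by (rule ops_compose(3)[OF f])
      then show ?thesis using g(1,3) unfolding isometry(2)[OF f] by blast
    qed
    then show "\<exists>K. \<forall>f\<in>H. \<exists>g\<in>H. (\<lambda>x. ?C g x - \<mu> * g x) = f \<and> hardy_norm g \<le> K * hardy_norm f" by blast
    fix f assume f: "f \<in> H" and "(\<lambda>x. ?C f x - \<mu> * f x) = (\<lambda>x. 0)"
    then have "?V' (?V (?D f)) = ?V' (\<lambda>x. 0)" unfolding VD[OF f] by simp
    moreover have "?D f \<in> H" using hardy.diff[OF mem(2)[OF f] mem(4)[OF f]] .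
    ultimately have "?D f = (\<lambda>x. 0)" using ops_compose(4)[of "?D f"] by (simp add: comp_op_def)
    then show "f = (\<lambda>x. 0)" by (rule inj[OF f])
  qed
qed

end

section \<open>Eigenvalues\<close>

lemma is_eigenvalue_ker: "is_eigenvalue M \<mu> \<longleftrightarrow> \<not> (\<forall>v. (M - mat \<mu>) *v v = 0 \<longrightarrow> v = 0)"
proof -
  have "(mat \<mu> *v v) $ i = (\<mu> *s v) $ i" for v :: "complex ^ 'a" and i
  proof -
    have "(mat \<mu> *v v) $ i = (\<Sum>j\<in>UNIV. if j = i then \<mu> * v $ j else 0)"
      unfolding matrix_vector_mult_def mat_def vec_lambda_beta by (rule sum.cong) auto
    then show ?thesis by (simp add: sum.delta)
  qed
  then have "mat \<mu> *v v = \<mu> *s v" for v :: "complex ^ 'a" by (simp add: vec_eq_iff del: vector_smult_component)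
  then show ?thesis unfolding is_eigenvalue_def by (auto simp: matrix_vector_mult_diff_rdistrib)
qed

text \<open>A left inverse of the transpose of \<open>M - mat \<mu>\<close>, when transposed,
  inverts \<open>M - mat \<mu>\<close> itself, since one-sided inverses of square matrices are
  two-sided.\<close>

lemma is_eigenvalue_transpose:
  assumes "is_eigenvalue M \<mu>"
  shows "is_eigenvalue (transpose M) \<mu>"
proof (rule ccontr)
  assume "\<not> is_eigenvalue (transpose M) \<mu>"
  moreover have t: "transpose M - mat \<mu> = transpose (M - mat \<mu>)"
    by (simp add: transpose_def mat_def vec_eq_iff)
  ultimately obtain B where "B ** transpose (M - mat \<mu>) = mat 1"
    unfolding is_eigenvalue_ker matrix_left_invertible_ker[symmetric] t by blast
  then have "transpose (B ** transpose (M - mat \<mu>)) = transpose (mat 1)" by simp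
  then have "(M - mat \<mu>) ** transpose B = mat 1" by (simp add: matrix_transpose_mul transpose_mat)
  then have "transpose B ** (M - mat \<mu>) = mat 1" by (simp add: matrix_left_right_inverse)
  then show False using assms unfolding is_eigenvalue_ker matrix_left_invertible_ker[symmetric] by blast
qed

text \<open>Composition operators act on functionals, so eigenvectors of the transpose are what
  produces eigenfunctions; conjugating the entries fits them to \<open>hermitian\<close>, which is
  antilinear in its second argument.\<close>

lemma left_eigenvector:
  fixes M :: "complex ^ 'm ^ 'm"
  assumes "is_eigenvalue M \<mu>"
  shows "\<exists>\<eta>. \<eta> \<noteq> 0 \<and> (\<forall>w. hermitian (M *v w) \<eta> = \<mu> * hermitian w \<eta>)"
proof -
  obtain v where v: "v \<noteq> 0" "transpose M *v v = \<mu> *s v"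
    using is_eigenvalue_transpose[OF assms] by (auto simp: is_eigenvalue_def)
  define \<eta> where "\<eta> = (\<chi> i. cnj (v $ i))"
  have "adjoint_matrix M *v \<eta> = cnj \<mu> *s \<eta>"
  proof -
    have "(adjoint_matrix M *v \<eta>) $ i = cnj ((transpose M *v v) $ i)" for i
      by (simp add: matrix_vector_mult_def adjoint_matrix_def transpose_def \<eta>_def)
    then show ?thesis unfolding v(2) by (simp add: vec_eq_iff \<eta>_def)
  qed
  then have "hermitian (M *v w) \<eta> = \<mu> * hermitian w \<eta>" for w by (simp add: hermitian_adjoint)
  moreover have "\<eta> \<noteq> 0" using v(1) by (simp add: \<eta>_def vec_eq_iff)
  ultimately show ?thesis by blast
qed

lemma eigenvalue_le:
  assumes "is_eigenvalue M \<mu>" "\<And>v. norm (M *v v) \<le> c * norm v"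
  shows "norm \<mu> \<le> c"
proof -
  obtain v where v: "v \<noteq> 0" "M *v v = \<mu> *s v" using assms(1) by (auto simp: is_eigenvalue_def)
  have "norm \<mu> * norm v \<le> c * norm v" using assms(2)[of v] v(2) by simp
  then show ?thesis using v(1) by simp
qed

lemma eigenvalue_exists: "\<exists>\<mu>. is_eigenvalue (M :: complex ^ 'm ^ 'm) \<mu>"
proof -
  obtain rs where rs: "set rs \<subseteq> {\<mu>. is_eigenvalue M \<mu>}" "\<And>v. vopl M rs v = 0" using vopl_eigenvalues[of M] by blast
  have "rs \<noteq> []" using rs(2)[of "\<chi> i. 1"] by (auto simp: vec_eq_iff)
  then obtain r where "r \<in> set rs" by (cases rs) auto
  then show ?thesis using rs(1) by blast
qed

section \<open>The eigenvalue multiset and multi-indices\<close>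

lemma charpoly_eval: "poly (charpoly M) x = det (mat x - M)"
proof -
  have s: "poly (of_int k) x = of_int k" for k by (simp add: of_int_poly)
  have "poly ((\<chi> i j. (if i = j then [:0, 1:] else 0) - [:M $ i $ j:]) $ i $ j) x = (mat x - M) $ i $ j" for i j
    by (simp add: mat_def)
  then show ?thesis unfolding charpoly_def det_def poly_sum poly_mult poly_prod s by simp
qed

lemma charpoly_root: "poly (charpoly M) \<mu> = 0 \<longleftrightarrow> is_eigenvalue M \<mu>"
proof -
  have "det (mat \<mu> - M) = 0 \<longleftrightarrow> \<not> (\<forall>v. (mat \<mu> - M) *v v = 0 \<longrightarrow> v = 0)"
    unfolding matrix_left_invertible_ker[symmetric] using invertible_det_nz[of "mat \<mu> - M"]
    by (simp add: invertible_left_inverse)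
  moreover have "(mat \<mu> - M) *v v = - ((M - mat \<mu>) *v v)" for v
    by (simp add: matrix_vector_mult_diff_rdistrib)
  ultimately show ?thesis unfolding charpoly_eval is_eigenvalue_ker by simp
qed

text \<open>\<open>proots\<close> lists the roots only of a nonzero polynomial. That
  \<open>charpoly M\<close> is nonzero is seen at a number beyond the operator norm, which cannot be
  an eigenvalue, without computing the degree.\<close>

lemma set_eigenvalues_mset: "set_mset (eigenvalues_mset M) = {\<mu>. is_eigenvalue M \<mu>}"
proof -
  let ?c = "onorm (\<lambda>v. M *v v)"
  have "norm \<mu> \<le> ?c" if "is_eigenvalue M \<mu>" for \<mu>
    by (rule eigenvalue_le[OF that onorm[OF bounded_linear_matrix_vector]])
  moreover have "?c \<ge> 0" by (rule onorm_pos_le[OF bounded_linear_matrix_vector])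
  ultimately have "\<not> is_eigenvalue M (complex_of_real (?c + 1))"
    using norm_of_real[of "?c + 1", where 'a = complex] by fastforce
  then have "charpoly M \<noteq> 0" unfolding charpoly_root[symmetric] by auto
  then show ?thesis unfolding eigenvalues_mset_def by (simp add: charpoly_root)
qed

lemma multi_power_monoid: "(\<Union>\<alpha> :: 'n::finite \<Rightarrow> nat. {multi_power lam \<alpha>}) = monoid_of (range lam)"
proof (intro equalityI subsetI)
  fix x assume "x \<in> (\<Union>\<alpha> :: 'n \<Rightarrow> nat. {multi_power lam \<alpha>})"
  then obtain \<alpha> :: "'n \<Rightarrow> nat" where x: "x = (\<Prod>i\<in>UNIV. lam i ^ \<alpha> i)" by (auto simp: multi_power_def)
  have "(\<Prod>i\<in>S. lam i ^ \<alpha> i) \<in> monoid_of (range lam)" if "finite S" for S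
    using that by induction (simp_all add: monoid_of_1 monoid_of_mult monoid_of_power monoid_of_incl)
  then show "x \<in> monoid_of (range lam)" unfolding x by simp
next
  fix x assume "x \<in> monoid_of (range lam)"
  then obtain xs where xs: "set xs \<subseteq> range lam" "x = prod_list xs" by (auto simp: monoid_of_def)
  have "\<exists>\<alpha>. prod_list xs = multi_power lam \<alpha>" using xs(1)
  proof (induction xs)
    case Nil
    show ?case by (intro exI[of _ "\<lambda>i. 0"]) (simp add: multi_power_def)
  next
    case (Cons y ys)
    then obtain \<alpha> i where \<alpha>: "prod_list ys = multi_power lam \<alpha>" "y = lam i" by auto
    have "multi_power lam (\<alpha>(i := Suc (\<alpha> i))) = lam i * multi_power lam \<alpha>"
      unfolding multi_power_def by (simp add: prod.remove[of UNIV i])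
    then have "prod_list (y # ys) = multi_power lam (\<alpha>(i := Suc (\<alpha> i)))" by (simp only: \<alpha> prod_list.Cons)
    then show ?case by blast
  qed
  then show "x \<in> (\<Union>\<alpha>. {multi_power lam \<alpha>})" using xs(2) by auto
qed

section \<open>Roots of unity\<close>

lemma common_order:
  assumes "finite S" "\<And>u. u \<in> S \<Longrightarrow> root_of_unity u"
  shows "\<exists>n>0. \<forall>u\<in>S. u ^ n = 1"
  using assms
proof induction
  case (insert u S)
  obtain n where n: "n > 0" "\<And>v. v \<in> S \<Longrightarrow> v ^ n = 1" using insert.IH insert.prems by blast
  obtain k where k: "k > 0" "u ^ k = 1" using insert.prems[of u] by (auto simp: root_of_unity_def)
  have "u ^ (k * n) = 1" "\<And>v. v \<in> S \<Longrightarrow> v ^ (n * k) = 1" by (simp_all only: power_mult k(2) n(2) power_one)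
  then show ?case using n(1) k(1) by (intro exI[of _ "n * k"]) (auto simp: mult.commute)
qed auto

text \<open>A finite multiplicative monoid \<open>G\<close> of nonzero numbers is a group, and \<open>g\<^bsup>|G|\<^esup> = 1\<close> in it.\<close>

lemma monoid_of_roots_of_unity:
  assumes S: "finite S" "\<And>u. u \<in> S \<Longrightarrow> root_of_unity u"
  shows "\<exists>N>0. monoid_of S = {z. z ^ N = 1}"
proof -
  let ?G = "monoid_of S"
  obtain n where n: "n > 0" "\<And>u. u \<in> S \<Longrightarrow> u ^ n = 1" using common_order[OF S] by blast
  have "prod_list xs ^ n = 1" if "set xs \<subseteq> S" for xs
    using that by (induction xs) (auto simp: power_mult_distrib n(2))
  then have G1: "?G \<subseteq> {z. z ^ n = 1}" by (auto simp: monoid_of_def)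
  have fin: "finite ?G" using G1 finite_roots_unity[OF n(1)[unfolded Suc_le_eq[symmetric] One_nat_def[symmetric]]] by (rule finite_subset)
  have nz: "g \<noteq> 0" if "g \<in> ?G" for g using G1 that n(1) by (auto simp: power_0_left)
  have pos: "card ?G > 0" using fin monoid_of_1[of S] by (auto simp: card_gt_0_iff)
  have ord: "g ^ card ?G = 1" if g: "g \<in> ?G" for g
  proof -
    have inj: "inj_on ((*) g) ?G" using nz[OF g] by (auto intro: inj_onI)
    have im: "(*) g ` ?G = ?G"
      by (rule card_subset_eq[OF fin]) (use g monoid_of_mult card_image[OF inj] in auto)
    have "\<Prod>?G = (\<Prod>x\<in>?G. g * x)" using prod.reindex[OF inj, of "\<lambda>x. x"] im by simp
    also have "\<dots> = g ^ card ?G * \<Prod>?G" by (simp add: prod.distrib)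
    finally show ?thesis using fin nz by simp
  qed
  \<comment> \<open>There are exactly \<open>card ?G\<close> roots of unity of this order, so the
    inclusion given by \<open>ord\<close> is an equality.\<close>
  have "?G = {z. z ^ card ?G = 1}"
  proof (rule card_subset_eq)
    show "finite {z :: complex. z ^ card ?G = 1}" using finite_roots_unity[of "card ?G"] pos by simp
    show "?G \<subseteq> {z. z ^ card ?G = 1}" using ord by blast
    show "card ?G = card {z :: complex. z ^ card ?G = 1}" using card_roots_unity_eq[OF pos] by simp
  qed
  then show ?thesis using pos by blast
qed

text \<open>Density of the fractional parts of multiples of an irrational number, carried to the
  circle by the Lipschitz bound for \<open>cis\<close>. The multipliers \<open>k\<close> are
  positive, so they give natural powers of \<open>u\<close>.\<close>

lemma powers_dense_circle:
  fixes u t :: complex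
  assumes u: "norm u = 1" "\<not> root_of_unity u" and t: "norm t = 1"
  shows "\<exists>k :: nat \<Rightarrow> nat. (\<lambda>n. u ^ k n) \<longlonglongrightarrow> t"
proof -
  define \<theta> where "\<theta> = Arg u / (2 * pi)"
  define \<alpha> where "\<alpha> = Arg t / (2 * pi)"
  have u0: "u = cis (2 * pi * \<theta>)" using cis_Arg[of u] u(1) by (cases "u = 0") (auto simp: \<theta>_def sgn_div_norm)
  have t0: "t = cis (2 * pi * \<alpha>)" using cis_Arg[of t] t by (cases "t = 0") (auto simp: \<alpha>_def sgn_div_norm)
  have irr: "\<theta> \<notin> \<rat>"
  proof
    assume "\<theta> \<in> \<rat>"
    then obtain p :: int and q :: nat where pq: "q \<noteq> 0" "\<theta> = of_int p / of_nat q"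
      by (metis Rats_cases' of_int_of_nat_eq zero_less_imp_eq_int less_irrefl of_nat_0)
    have "u ^ q = cis (of_nat q * (2 * pi * \<theta>))" by (simp only: u0 Complex.DeMoivre)
    also have "of_nat q * (2 * pi * \<theta>) = 2 * pi * of_int p" using pq by (simp add: field_simps)
    also have "cis (2 * pi * of_int p) = 1" by (simp add: cis_multiple_2pi)
    finally show False using u(2) pq(1) unfolding root_of_unity_def by (metis gr0I)
  qed
  have lip: "norm (cis x - cis y) \<le> \<bar>x - y\<bar>" for x y
  proof -
    have "norm (cis x - cis y) = norm (cis (x - y) - 1)"
    proof -
      have "cis x - cis y = cis y * (cis (x - y) - 1)" by (simp add: right_diff_distrib cis_mult)
      then show ?thesis by (simp add: norm_mult)
    qed
    also have "\<dots> = 2 * \<bar>sin ((x - y) / 2)\<bar>" using dist_exp_i_1[of "x - y"] by (simp only: cis_conv_exp)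
    also have "\<dots> \<le> \<bar>x - y\<bar>" using abs_sin_x_le_abs_x[of "(x - y) / 2"] by simp
    finally show ?thesis .
  qed
  have ex: "\<exists>k. norm (u ^ k - t) < 1 / of_nat (Suc n)" for n
  proof -
    have "0 < 1 / (of_nat (Suc n) * (2 * pi))" by simp
    then obtain h k where k: "(k :: int) > 0" "\<bar>of_int k * \<theta> - of_int h - \<alpha>\<bar> < 1 / (of_nat (Suc n) * (2 * pi))"
      using sequence_of_fractional_parts_is_dense[OF irr] by metis
    have "u ^ nat k = cis (2 * pi * (of_int k * \<theta> - of_int h))"
    proof -
      have "u ^ nat k = cis (of_nat (nat k) * (2 * pi * \<theta>))" by (simp only: u0 Complex.DeMoivre)
      also have "of_nat (nat k) * (2 * pi * \<theta>) = 2 * pi * (of_int k * \<theta>)" using k(1) by (simp add: of_nat_nat)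
      also have "cis (2 * pi * (of_int k * \<theta>)) = cis (2 * pi * (of_int k * \<theta> - of_int h)) * cis (2 * pi * of_int h)"
        by (simp add: cis_mult algebra_simps)
      finally show ?thesis by (simp add: cis_multiple_2pi)
    qed
    then have "norm (u ^ nat k - t) \<le> \<bar>2 * pi * (of_int k * \<theta> - of_int h) - 2 * pi * \<alpha>\<bar>"
      using lip t0 by simp
    also have "\<dots> = 2 * pi * \<bar>of_int k * \<theta> - of_int h - \<alpha>\<bar>"
      by (simp add: abs_mult right_diff_distrib[symmetric])
    also have "\<dots> < 2 * pi * (1 / (of_nat (Suc n) * (2 * pi)))" using k(2) by (intro mult_strict_left_mono) auto
    finally show ?thesis by (intro exI[of _ "nat k"]) simp
  qed
  then obtain k where k: "\<And>n. norm (u ^ k n - t) < 1 / of_nat (Suc n)" by metis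
  have "(\<lambda>n. u ^ k n - t) \<longlonglongrightarrow> 0"
    by (rule Lim_null_comparison[OF _ lim_inverse_n'[THEN LIMSEQ_Suc]])
      (use k in \<open>auto intro!: always_eventually less_imp_le\<close>)
  then show ?thesis by (intro exI[of _ k]) (simp add: LIM_zero_iff)
qed

section \<open>Eigenfunctions\<close>

text \<open>A finite union of hyperplanes does not cover the space: a new hyperplane is left by
  moving along its normal \<open>\<nu>\<close>, and only finitely many step sizes \<open>t\<close>
  are forbidden. This keeps products of linear functionals from vanishing identically on the
  ball.\<close>

lemma common_nonzero:
  fixes F :: "(complex ^ 'n) set"
  assumes "finite F" "0 \<notin> F"
  shows "\<exists>z. norm z < 1 \<and> (\<forall>\<eta>\<in>F. hermitian z \<eta> \<noteq> 0)"
proof -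
  have "\<exists>z. \<forall>\<eta>\<in>F. hermitian z \<eta> \<noteq> 0"
    using assms
  proof induction
    case (insert \<nu> F)
    then obtain z where z: "\<And>\<eta>. \<eta> \<in> F \<Longrightarrow> hermitian z \<eta> \<noteq> 0" by auto
    have \<nu>: "hermitian \<nu> \<nu> \<noteq> 0" using insert.prems by (simp add: hermitian_self)
    let ?B = "\<lambda>\<eta>. {- hermitian z \<eta> / hermitian \<nu> \<eta>}"
    have "finite (\<Union>\<eta>\<in>insert \<nu> F. ?B \<eta>)" using insert.hyps by simp
    then obtain t where t: "t \<notin> (\<Union>\<eta>\<in>insert \<nu> F. ?B \<eta>)" using ex_new_if_finite[OF infinite_UNIV_char_0] by blast
    have "hermitian (z + t *s \<nu>) \<eta> \<noteq> 0" if \<eta>: "\<eta> \<in> insert \<nu> F" for \<eta>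
    proof (cases "hermitian \<nu> \<eta> = 0")
      case True
      then show ?thesis using z[of \<eta>] \<eta> \<nu> by auto
    next
      case False
      then have "hermitian z \<eta> + t * hermitian \<nu> \<eta> \<noteq> 0" using t \<eta> by (auto simp: field_simps add_eq_0_iff)
      then show ?thesis by simp
    qed
    then show ?case by blast
  qed simp
  then obtain z where z: "\<And>\<eta>. \<eta> \<in> F \<Longrightarrow> hermitian z \<eta> \<noteq> 0" by blast
  let ?c = "complex_of_real (1 / (norm z + 1))"
  have p: "0 < norm z + 1" by (simp add: add_nonneg_pos)
  then have c: "norm ?c = 1 / (norm z + 1)" "?c \<noteq> 0" unfolding norm_of_real of_real_eq_0_iff by simp_all
  have "norm (?c *s z) < 1" unfolding norm_smult_vec c(1) using p by simp
  moreover have "hermitian (?c *s z) \<eta> \<noteq> 0" if "\<eta> \<in> F" for \<eta>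
    unfolding hermitian_simps mult_eq_0_iff using c(2) z[OF that] by blast
  ultimately show ?thesis by blast
qed

lemma product_mem_hardy:
  fixes \<eta> :: "'b \<Rightarrow> complex ^ 'n"
  shows "(\<lambda>z. if norm z < 1 then prod_list (map (\<lambda>x. hermitian z (\<eta> x)) xs) else 0) \<in> hardy_space"
    (is "?f \<in> _")
proof -
  define f where "f = ?f"
  let ?p = "\<lambda>z. prod_list (map (\<lambda>x. hermitian z (\<eta> x)) xs)" and ?K = "prod_list (map (\<lambda>x. norm (\<eta> x)) xs)"
  have K: "?K \<ge> 0" by (induction xs) auto
  have p: "norm (?p z) \<le> ?K" if "norm z \<le> 1" for z
  proof (induction xs)
    case (Cons x xs)
    have "norm (hermitian z (\<eta> x)) \<le> norm z * norm (\<eta> x)" by (rule norm_hermitian_le)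
    also have "\<dots> \<le> 1 * norm (\<eta> x)" using that by (intro mult_right_mono) auto
    finally show ?case using Cons by (simp add: norm_mult mult_mono)
  qed simp
  have c: "cdiff ?p (*) z" for z
  proof (induction xs)
    case Nil
    show ?case by (simp add: cdiff_const)
  next
    case (Cons x xs)
    show ?case using cdiff_mult[OF cdiff_hermitian Cons.IH] by simp
  qed
  have holo: "holo_on unit_ball f"
    by (rule holo_on_transform[where f = ?p]) (auto simp: holo_on_cdiff c f_def)
  show ?thesis unfolding f_def[symmetric]
  proof (rule hardy_spaceI(1)[OF holo _ K])
    show "f z = 0" if "norm z \<ge> 1" for z using that by (simp add: f_def)
    fix r :: real assume r: "0 < r" "r < 1"
    have "hmean f r \<le> (\<integral>\<zeta>. ?K\<^sup>2 \<partial>(sigma :: (complex ^ 'n) measure))"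
      unfolding hmean_def
    proof (rule integral_mono)
      have cont: "continuous_on (sphere 0 1) (\<lambda>\<zeta>. f (r *\<^sub>R \<zeta>))"
        by (rule continuous_on_subset[OF continuous_on_dilate[OF holo_on_imp_continuous_on[OF holo] r]]) auto
      show "integrable sigma (\<lambda>\<zeta>. (norm (f (r *\<^sub>R \<zeta>)))\<^sup>2)"
        by (intro integrable_sigma_continuous continuous_on_power continuous_on_norm cont)
      show "integrable sigma (\<lambda>\<zeta> :: complex ^ 'n. ?K\<^sup>2)" by (intro integrable_sigma_continuous continuous_on_const)
      have "norm (f z) \<le> ?K" for z using p[of z] K by (auto simp: f_def)
      then show "(norm (f (r *\<^sub>R \<zeta>)))\<^sup>2 \<le> ?K\<^sup>2" for \<zeta> by (intro power_mono) auto
    qed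
    then show "hmean f r \<le> ?K\<^sup>2" by simp
  qed
qed

section \<open>Eigenfunctions and the spectrum of the normal form\<close>

context normal_map
begin

abbreviation "E \<equiv> {\<mu>. is_eigenvalue U \<mu>} \<union> {\<mu>. is_eigenvalue A \<mu>}"

lemma eigenfunctional:
  assumes "\<mu> \<in> E"
  shows "\<exists>\<eta>. \<eta> \<noteq> 0 \<and> (\<forall>w. hermitian (\<psi> w) \<eta> = \<mu> * hermitian w \<eta>)"
proof (cases "is_eigenvalue U \<mu>")
  case True
  obtain \<eta> where \<eta>: "\<eta> \<noteq> 0" "\<And>w. hermitian (U *v w) \<eta> = \<mu> * hermitian w \<eta>" using left_eigenvector[OF True] by blast
  have "norm (join \<eta> 0) \<noteq> 0" using norm_join[OF e, of \<eta> 0] \<eta>(1) by auto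
  then have "join \<eta> 0 \<noteq> 0" by (simp only: norm_eq_zero simp_thms)
  moreover have "hermitian (\<psi> w) (join \<eta> 0) = \<mu> * hermitian w (join \<eta> 0)" for w
    by (simp add: hermitian_block[OF e] \<psi>_def block_map_def block_join[OF e] \<eta>(2))
  ultimately show ?thesis by blast
next
  case False
  then have "is_eigenvalue A \<mu>" using assms by simp
  then obtain \<eta> where \<eta>: "\<eta> \<noteq> 0" "\<And>w. hermitian (A *v w) \<eta> = \<mu> * hermitian w \<eta>" using left_eigenvector by blast
  have "norm (join 0 \<eta>) \<noteq> 0" using norm_join[OF e, of 0 \<eta>] \<eta>(1) by auto
  then have "join 0 \<eta> \<noteq> 0" by (simp only: norm_eq_zero simp_thms)
  moreover have "hermitian (\<psi> w) (join 0 \<eta>) = \<mu> * hermitian w (join 0 \<eta>)" for w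
    by (simp add: hermitian_block[OF e] \<psi>_def block_map_def block_join[OF e] \<eta>(2))
  ultimately show ?thesis by blast
qed

lemma eigenfunction:
  assumes "c \<in> monoid_of E"
  shows "\<exists>f\<in>H. hardy_norm f > 0 \<and> comp_op \<psi> f = (\<lambda>x. c * f x)"
proof -
  obtain xs where xs: "set xs \<subseteq> E" "c = prod_list xs" using assms by (auto simp: monoid_of_def)
  obtain \<eta> where \<eta>: "\<And>\<mu>. \<mu> \<in> E \<Longrightarrow> \<eta> \<mu> \<noteq> 0" "\<And>\<mu> w. \<mu> \<in> E \<Longrightarrow> hermitian (\<psi> w) (\<eta> \<mu>) = \<mu> * hermitian w (\<eta> \<mu>)"
    using eigenfunctional by metis
  let ?p = "\<lambda>z. prod_list (map (\<lambda>x. hermitian z (\<eta> x)) xs)"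
  define f where "f = (\<lambda>z. if norm z < 1 then ?p z else 0)"
  have f: "f \<in> H" unfolding f_def by (rule product_mem_hardy)
  have "?p (\<psi> w) = prod_list xs * ?p w" for w
    using xs(1) by (induction xs) (auto simp: \<eta>(2))
  then have "comp_op \<psi> f = (\<lambda>x. c * f x)"
    by (simp add: f_def xs(2) comp_op_def psi_ball(1) fun_eq_iff)
  moreover have "hardy_norm f > 0"
  proof -
    have "0 \<notin> \<eta> ` set xs"
    proof
      assume "0 \<in> \<eta> ` set xs"
      then obtain x where "x \<in> set xs" "\<eta> x = 0" by (metis imageE)
      then show False using \<eta>(1)[OF subsetD[OF xs(1)]] by blast
    qed
    from common_nonzero[OF finite_imageI[OF finite_set] this]
    obtain z where z: "norm z < 1" "\<And>x. x \<in> set xs \<Longrightarrow> hermitian z (\<eta> x) \<noteq> 0" by blast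
    have "?p z \<noteq> 0" using z(2) by (induction xs) auto
    then show ?thesis by (intro hardy_norm_pos[OF f z(1)]) (simp add: f_def z(1))
  qed
  ultimately show ?thesis using f by blast
qed

text \<open>Points of the circles, and \<open>0\<close>, are in general only limits of the
  eigenvalues that come from products of functionals.\<close>

lemma spectrum_limit:
  assumes "\<And>n. c n \<in> monoid_of E" "c \<longlonglongrightarrow> \<mu>"
  shows "\<mu> \<in> op_spectrum H hardy_norm (comp_op \<psi>)"
proof -
  have "\<forall>n. \<exists>f. f \<in> H \<and> hardy_norm f > 0 \<and> comp_op \<psi> f = (\<lambda>x. c n * f x)" using eigenfunction[OF assms(1)] by blast
  then obtain f where f: "\<And>n. f n \<in> H" "\<And>n. hardy_norm (f n) > 0" "\<And>n. comp_op \<psi> (f n) = (\<lambda>x. c n * f n x)" by metis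
  show ?thesis by (rule hardy.approximate_eigenvalue[OF bops(1) f assms(2)])
qed

text \<open>Index types are nonempty, so the block \<open>A\<close> has an eigenvalue; its modulus
  is below \<open>1\<close>, and its powers lie in the spectrum and tend to
  \<open>0\<close>.\<close>

lemma spectrum_0: "0 \<in> op_spectrum H hardy_norm (comp_op \<psi>)"
proof -
  obtain \<mu> where \<mu>: "is_eigenvalue A \<mu>" using eigenvalue_exists by blast
  have "norm \<mu> < 1" using eigenvalue_le[OF \<mu> A] a by simp
  then have "(\<lambda>n. \<mu> ^ n) \<longlonglongrightarrow> 0" by (rule LIMSEQ_power_zero)
  moreover have "\<mu> ^ n \<in> monoid_of E" for n using \<mu> by (intro monoid_of_power monoid_of_incl) simp
  ultimately show ?thesis by (intro spectrum_limit)
qed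

lemma spectrum_monoid: "monoid_of E \<subseteq> op_spectrum H hardy_norm (comp_op \<psi>)"
  using spectrum_limit[OF _ tendsto_const] by blast

lemma spectrum_irrational:
  assumes u: "is_eigenvalue U u" "norm u = 1" "\<not> root_of_unity u"
  shows "op_spectrum H hardy_norm (comp_op \<psi>) = {c * t | c t. c \<in> monoid_of E \<and> norm t = 1} \<union> {0}"
proof (intro equalityI subsetI)
  fix \<mu> assume "\<mu> \<in> {c * t | c t. c \<in> monoid_of E \<and> norm t = 1} \<union> {0}"
  then consider "\<mu> = 0" | c t where "\<mu> = c * t" "c \<in> monoid_of E" "norm t = 1" by auto
  then show "\<mu> \<in> op_spectrum H hardy_norm (comp_op \<psi>)"
  proof cases
    case 1
    then show ?thesis using spectrum_0 by simp
  next
    case 2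
    obtain k where k: "(\<lambda>n. u ^ (k n :: nat)) \<longlonglongrightarrow> t" using powers_dense_circle[OF u(2,3) 2(3)] by blast
    show ?thesis unfolding 2(1)
    proof (rule spectrum_limit)
      show "(\<lambda>n. c * u ^ k n) \<longlonglongrightarrow> c * t" by (intro tendsto_mult tendsto_const k)
      show "c * u ^ k n \<in> monoid_of E" for n using u(1) by (intro monoid_of_mult 2(2) monoid_of_power monoid_of_incl) simp
    qed
  qed
next
  fix \<mu> assume \<mu>: "\<mu> \<in> op_spectrum H hardy_norm (comp_op \<psi>)"
  show "\<mu> \<in> {c * t | c t. c \<in> monoid_of E \<and> norm t = 1} \<union> {0}"
  proof (rule ccontr)
    assume n: "\<not> ?thesis"
    then have 0: "\<mu> \<noteq> 0" by simp
    have "\<mu> \<notin> op_spectrum H hardy_norm (comp_op \<psi>)"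
    proof (rule resolvent[OF 0 solvable_modulus[OF 0]])
      fix c assume "c \<in> monoid_of {\<mu>. is_eigenvalue A \<mu>}"
      then have c: "c \<in> monoid_of E" using monoid_of_mono[of "{\<mu>. is_eigenvalue A \<mu>}" E] by blast
      show "norm c \<noteq> norm \<mu>"
      proof
        assume nc: "norm c = norm \<mu>"
        then have "\<mu> = c * (\<mu> / c)" "norm (\<mu> / c) = 1" using 0 by (auto simp: norm_divide)
        then show False using n c by blast
      qed
    qed
    then show False using \<mu> by simp
  qed
qed

lemma spectrum_rational:
  assumes diag: "is_diagonal U" and u: "\<And>u. is_eigenvalue U u \<Longrightarrow> root_of_unity u"
  shows "op_spectrum H hardy_norm (comp_op \<psi>) = monoid_of E \<union> {0}"
proof (intro equalityI subsetI)
  show "\<mu> \<in> op_spectrum H hardy_norm (comp_op \<psi>)" if "\<mu> \<in> monoid_of E \<union> {0}" for \<mu>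
    using that spectrum_monoid spectrum_0 by blast
  fix \<mu> assume \<mu>: "\<mu> \<in> op_spectrum H hardy_norm (comp_op \<psi>)"
  have "finite {u. is_eigenvalue U u}" unfolding set_eigenvalues_mset[symmetric] by simp
  from monoid_of_roots_of_unity[OF this] u obtain N where N: "N > 0" "monoid_of {u. is_eigenvalue U u} = {z. z ^ N = 1}" by auto
  have Usv: "(Us *v x) $ i = cnj (U $ i $ i) * x $ i" for x i
  proof -
    have "(Us *v x) $ i = (\<Sum>j\<in>UNIV. if j = i then cnj (U $ i $ i) * x $ i else 0)"
      unfolding matrix_vector_mult_def adjoint_matrix_def vec_lambda_beta
      by (rule sum.cong) (use diag in \<open>auto simp: is_diagonal_def\<close>)
    then show ?thesis by simp
  qed
  have Uii: "(U $ i $ i) ^ N = 1" for i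
  proof -
    have "(U *v axis i 1) $ k = (U $ i $ i *s axis i 1) $ k" for k
    proof -
      have "(U *v axis i 1) $ k = (\<Sum>j\<in>UNIV. if j = i then U $ k $ i else 0)"
        unfolding matrix_vector_mult_def vec_lambda_beta by (rule sum.cong) (auto simp: axis_def)
      then show ?thesis using diag by (simp add: is_diagonal_def axis_def)
    qed
    then have "U *v axis i 1 = U $ i $ i *s axis i 1" unfolding vec_eq_iff by blast
    then have "is_eigenvalue U (U $ i $ i)" unfolding is_eigenvalue_def by (intro exI[of _ "axis i 1"]) simp
    then have "U $ i $ i \<in> monoid_of {u. is_eigenvalue U u}" by (intro monoid_of_incl) simp
    then show ?thesis unfolding N(2) by simp
  qed
  \<comment> \<open>Since \<open>U\<close> is diagonal, its adjoint multiplies each coordinate by a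
    conjugate eigenvalue, which reduces periodicity of \<open>\<psi>V\<close> to \<open>N\<close>-th
    powers of these numbers.\<close>
  have pow: "(\<psi>V ^^ j) z = join (\<chi> i. cnj (U $ i $ i) ^ j * fst_block e z $ i) (snd_block e z)" for j z
  proof (induction j)
    case 0
    have "(\<chi> i. cnj (U $ i $ i) ^ 0 * fst_block e z $ i) = fst_block e z" by (simp add: vec_eq_iff)
    then show ?case by (simp only: funpow_0 join_block[OF e])
  next
    case (Suc j)
    let ?x = "\<chi> i. cnj (U $ i $ i) ^ j * fst_block e z $ i"
    have "(\<psi>V ^^ Suc j) z = \<psi>V (join ?x (snd_block e z))" using Suc by simp
    also have "\<dots> = join (Us *v ?x) (snd_block e z)" by (simp add: \<psi>V_def block_map_join[OF e])
    also have "Us *v ?x = (\<chi> i. cnj (U $ i $ i) ^ Suc j * fst_block e z $ i)" by (simp add: vec_eq_iff Usv)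
    finally show ?case .
  qed
  have per: "(\<psi>V ^^ N) z = z" for z
  proof -
    have "cnj (U $ i $ i) ^ N = 1" for i unfolding complex_cnj_power[symmetric] Uii by simp
    then have "(\<chi> i. cnj (U $ i $ i) ^ N * fst_block e z $ i) = fst_block e z" by (simp add: vec_eq_iff)
    then show ?thesis unfolding pow by (simp only: join_block[OF e])
  qed
  show "\<mu> \<in> monoid_of E \<union> {0}"
  proof (rule ccontr)
    assume n: "\<not> ?thesis"
    then have 0: "\<mu> \<noteq> 0" by simp
    have "\<mu> \<notin> op_spectrum H hardy_norm (comp_op \<psi>)"
    proof (rule resolvent[OF 0 solvable_periodic[OF N(1) per _ 0]])
      fix c assume "c \<in> monoid_of {\<mu>. is_eigenvalue A \<mu>}"
      then have c: "c \<in> monoid_of E" using monoid_of_mono[of "{\<mu>. is_eigenvalue A \<mu>}" E] by blast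
      \<comment> \<open>Otherwise \<open>\<mu> / c\<close> is an \<open>N\<close>-th root of unity,
        hence a product of eigenvalues of \<open>U\<close>, and \<open>\<mu>\<close> itself lies in
        the monoid.\<close>
      show "\<mu> ^ N \<noteq> c ^ N"
      proof
        assume p: "\<mu> ^ N = c ^ N"
        then have c0: "c \<noteq> 0" using 0 N(1) by (auto simp: power_0_left)
        then have "(\<mu> / c) ^ N = 1" using p by (simp add: power_divide)
        then have "\<mu> / c \<in> monoid_of E" using N(2) monoid_of_mono[of "{u. is_eigenvalue U u}" E] by blast
        from monoid_of_mult[OF c this] show False using n c0 by simp
      qed
    qed
    then show False using \<mu> by simp
  qed
qed

end

section \<open>Conjugation to the normal form\<close>

text \<open>\<open>comp_op \<tau>\<close> intertwines the two operators, and it is bounded with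
  bounded inverse because both \<open>\<tau>\<close> and its inverse are automorphisms. Boundedness
  of \<open>comp_op \<phi>\<close> is inherited through this conjugation.\<close>

lemma conjugate_spectrum:
  fixes \<phi> \<psi> :: "complex ^ 'n \<Rightarrow> complex ^ 'n"
  assumes \<phi>: "\<And>z. norm z < 1 \<Longrightarrow> norm (\<phi> z) < 1" and \<psi>: "\<And>z. norm z < 1 \<Longrightarrow> norm (\<psi> z) < 1"
    and \<tau>: "ball_automorphism \<tau>" "\<And>z. norm z < 1 \<Longrightarrow> \<tau> (\<phi> z) = \<psi> (\<tau> z)"
    and T: "bounded_operator hardy_space hardy_norm (comp_op \<psi>)"
  shows "hardy_spectrum \<phi> = op_spectrum hardy_space hardy_norm (comp_op \<psi>)"
proof -
  define \<tau>' where "\<tau>' = inv_into unit_ball \<tau>"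
  have bij: "bij_betw \<tau> unit_ball unit_ball" using \<tau>(1) by (simp add: ball_automorphism_def)
  have \<tau>': "ball_automorphism \<tau>'" unfolding \<tau>'_def by (rule ball_automorphism_inverse[OF \<tau>(1)])
  have b: "norm (\<tau> z) < 1" "norm (\<tau>' z) < 1" if "norm z < 1" for z
    using bij_betwE[OF bij] bij_betwE[of \<tau>' unit_ball unit_ball] \<tau>' that by (auto simp: ball_automorphism_def)
  have i: "\<tau> (\<tau>' z) = z" "\<tau>' (\<tau> z) = z" if "norm z < 1" for z
    using that bij by (auto simp: \<tau>'_def bij_betw_inv_into_left bij_betw_inv_into_right)
  obtain K K' where K: "\<forall>f\<in>hardy_space. comp_op \<tau> f \<in> hardy_space \<and> hardy_norm (comp_op \<tau> f) \<le> K * hardy_norm f"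
    and K': "\<forall>f\<in>hardy_space. comp_op \<tau>' f \<in> hardy_space \<and> hardy_norm (comp_op \<tau>' f) \<le> K' * hardy_norm f"
    using comp_op_automorphism[OF \<tau>(1)] comp_op_automorphism[OF \<tau>'] by blast
  have J: "hardy.bop (comp_op \<tau>)" by (rule bop_comp_op[where K = K]) (use K in blast)
  have J': "hardy.bop (comp_op \<tau>')" by (rule bop_comp_op[where K = K']) (use K' in blast)
  have JJ: "comp_op \<tau> (comp_op \<tau>' f) = f" "comp_op \<tau>' (comp_op \<tau> f) = f" if f: "f \<in> hardy_space" for f
  proof -
    have "comp_op \<tau> (comp_op \<tau>' f) = comp_op (\<lambda>z. z) f" "comp_op \<tau>' (comp_op \<tau> f) = comp_op (\<lambda>z. z) f"
      by (simp_all add: comp_op_def fun_eq_iff b i)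
    then show "comp_op \<tau> (comp_op \<tau>' f) = f" "comp_op \<tau>' (comp_op \<tau> f) = f" using comp_op_id[OF f] by simp_all
  qed
  have com: "comp_op \<phi> (comp_op \<tau> f) = comp_op \<tau> (comp_op \<psi> f)" for f
    by (simp add: comp_op_def fun_eq_iff b \<phi> \<psi> \<tau>(2))
  have rep: "comp_op \<phi> f = comp_op \<tau> (comp_op \<psi> (comp_op \<tau>' f))" if "f \<in> hardy_space" for f
    using com[of "comp_op \<tau>' f"] JJ(1)[OF that] by simp
  have S: "hardy.bop (comp_op \<phi>)"
  proof -
    have "hardy.bop (\<lambda>f. comp_op \<tau> (comp_op \<psi> (comp_op \<tau>' f)))"
      by (rule hardy.bop_compose[OF J hardy.bop_compose[OF T J']])
    then obtain K where "\<forall>f\<in>hardy_space. hardy_norm (comp_op \<tau> (comp_op \<psi> (comp_op \<tau>' f))) \<le> K * hardy_norm f"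
      using hardy.bopD(5) by blast
    then show ?thesis
      using hardy.bopD(1)[OF J hardy.bopD(1)[OF T hardy.bopD(1)[OF J']]] rep by (intro bop_comp_op[where K = K]) auto
  qed
  have "op_spectrum hardy_space hardy_norm (comp_op \<phi>) \<subseteq> op_spectrum hardy_space hardy_norm (comp_op \<psi>)"
    by (rule hardy.spectrum_similar_subset[OF J J' JJ T com])
  moreover have "op_spectrum hardy_space hardy_norm (comp_op \<psi>) \<subseteq> op_spectrum hardy_space hardy_norm (comp_op \<phi>)"
  proof (rule hardy.spectrum_similar_subset[OF J' J JJ(2) JJ(1) S])
    fix f :: "complex ^ 'n \<Rightarrow> complex" assume f: "f \<in> hardy_space"
    show "comp_op \<psi> (comp_op \<tau>' f) = comp_op \<tau>' (comp_op \<phi> f)"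
      unfolding rep[OF f] by (rule JJ(2)[symmetric]) (rule hardy.bopD(1)[OF T hardy.bopD(1)[OF J' f]])
  qed
  ultimately show ?thesis unfolding hardy_spectrum_def by blast
qed

theorem theorem2p2:
  fixes \<phi> :: "complex ^ 'n \<Rightarrow> complex ^ 'n"
    and z0 :: "complex ^ 'n"
    and p :: nat
    and e :: "'p::finite + 'q::finite \<Rightarrow> 'n"
    and U :: "complex ^ 'p ^ 'p"
    and A :: "complex ^ 'q ^ 'q"
    and lam :: "'n \<Rightarrow> complex"
  assumes "\<phi> \<in> LFM"
    and "elliptic \<phi>"
    and "\<not> ball_automorphism \<phi>"
    and "z0 \<in> unit_ball" and "\<phi> z0 = z0"
    and "p = vec.dim (unitary_space \<phi> z0)"
    and "p > 0"
    and "CARD('p) = p"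
    and "normal_form \<phi> e U A"
    and "image_mset lam (mset_set UNIV) = eigenvalues_mset U + eigenvalues_mset A"
  shows "((\<exists>\<mu>. is_eigenvalue U \<mu> \<and> norm \<mu> = 1 \<and> \<not> root_of_unity \<mu>) \<longrightarrow>
            hardy_spectrum \<phi> =
              (\<Union>\<alpha> :: 'n \<Rightarrow> nat. {multi_power lam \<alpha> * t | t. norm t = 1}) \<union> {0}) \<and>
         ((\<forall>\<mu>. is_eigenvalue U \<mu> \<longrightarrow> root_of_unity \<mu>) \<longrightarrow>
            hardy_spectrum \<phi> = (\<Union>\<alpha> :: 'n \<Rightarrow> nat. {multi_power lam \<alpha>}) \<union> {0})"
proof -
  obtain \<tau> where e: "bij e" and UU: "unitary_matrix U" "is_diagonal U" and A: "onorm (\<lambda>v. A *v v) < 1"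
    and \<tau>: "ball_automorphism \<tau>" "\<And>z. z \<in> unit_ball \<Longrightarrow> \<tau> (\<phi> z) = block_map e U A (\<tau> z)"
    using assms(9) by (auto simp: normal_form_def)
  \<comment> \<open>Halfway between the norm of \<open>A\<close> and \<open>1\<close>, hence
    positive and below \<open>1\<close>.\<close>
  define a where "a = (1 + onorm (\<lambda>v. A *v v)) / 2"
  have on: "onorm (\<lambda>v. A *v v) \<ge> 0" by (rule onorm_pos_le[OF bounded_linear_matrix_vector])
  interpret normal_map e U A a
  proof
    show "norm (A *v y) \<le> a * norm y" for y
    proof (rule order_trans[OF onorm[OF bounded_linear_matrix_vector]])
      show "onorm (\<lambda>v. A *v v) * norm y \<le> a * norm y" using A by (intro mult_right_mono) (auto simp: a_def)
    qed
  qed (use e UU A on in \<open>auto simp: unitary_matrix_def a_def\<close>)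
  have "\<phi> ` unit_ball \<subseteq> unit_ball" using assms(1) unfolding LFM_def by blast
  then have \<phi>: "norm (\<phi> z) < 1" if "norm z < 1" for z using that by (auto simp: image_subset_iff)
  have spec: "hardy_spectrum \<phi> = op_spectrum hardy_space hardy_norm (comp_op \<psi>)"
  proof (rule conjugate_spectrum[OF \<phi> psi_ball(1) \<tau>(1) _ bops(1)])
    show "\<tau> (\<phi> z) = \<psi> (\<tau> z)" if "norm z < 1" for z using \<tau>(2)[of z] that by (simp add: \<psi>_def)
  qed
  \<comment> \<open>The values of \<open>lam\<close> are exactly the eigenvalues of \<open>U\<close>
    and \<open>A\<close>, so the monoid generated by \<open>E\<close> is the set of all multi-index
    products.\<close>
  have "set_mset (image_mset lam (mset_set UNIV)) = E" unfolding assms(10) by (simp add: set_eigenvalues_mset)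
  then have E: "E = range lam" by simp
  have mono: "{c * t | c t. c \<in> monoid_of (range lam) \<and> norm t = 1} = (\<Union>\<alpha> :: 'n \<Rightarrow> nat. {multi_power lam \<alpha> * t | t. norm t = 1})"
    unfolding multi_power_monoid[symmetric] by blast
  show ?thesis
  proof (intro conjI impI)
    assume "\<exists>\<mu>. is_eigenvalue U \<mu> \<and> norm \<mu> = 1 \<and> \<not> root_of_unity \<mu>"
    then obtain u where u: "is_eigenvalue U u" "norm u = 1" "\<not> root_of_unity u" by blast
    show "hardy_spectrum \<phi> = (\<Union>\<alpha> :: 'n \<Rightarrow> nat. {multi_power lam \<alpha> * t | t. norm t = 1}) \<union> {0}"
      unfolding spec mono[symmetric] E[symmetric] by (rule spectrum_irrational[OF u])
  next
    assume u: "\<forall>\<mu>. is_eigenvalue U \<mu> \<longrightarrow> root_of_unity \<mu>"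
    show "hardy_spectrum \<phi> = (\<Union>\<alpha> :: 'n \<Rightarrow> nat. {multi_power lam \<alpha>}) \<union> {0}"
      unfolding spec multi_power_monoid E[symmetric] by (rule spectrum_rational[OF UU(2)]) (use u in blast)
  qed
qed

end
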